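(* Let $\mathfrak L=L_{\boldsymbol m}(\mathfrak g,\boldsymbol\sigma,\mathfrak h)$ be a multiloop Lie algebra of nullity $n$. Then $\mathfrak L$ is support-isomorphic to some multiloop Lie $\mathbb Z^n$-torus if and only if $\mathfrak g^{\boldsymbol\sigma}\neq\{0\}$.
   Context: $k$ is an algebraically closed field of characteristic $0$; primitive roots of unity $\zeta_n\in k$ are fixed with $\zeta_{mn}^m=\zeta_n$. Let $\mathfrak g$ be a finite-dimensional simple Lie algebra over $k$, $\boldsymbol\sigma=(\sigma_1,\dots,\sigma_n)$ pairwise commuting finite-order automorphisms of $\mathfrak g$, $\boldsymbol m=(m_1,\dots,m_n)\in\mathbb Z^n_{>0}$ with $\sigma_i^{m_i}=\mathrm{id}$. For $\lambda=(l_1,\dots,l_n)\in\mathbb Z^n$, $\mathfrak g^{\bar\lambda}=\{g:\sigma_i(g)=\zeta_{m_i}^{l_i}g\ \forall i\}$ (depends on $\bar\lambda\in\bar\Lambda_{\boldsymbol m}=\mathbb Z/m_1\mathbb Z\times\dots\times\mathbb Z/m_n\mathbb Z$), $\mathfrak g^{\boldsymbol\sigma}=\mathfrak g^{\bar0}$. If $\mathfrak g^{\boldsymbol\sigma}\ne0$, $\mathfrak h$ is a Cartan subalgebra of the reductive algebra $\mathfrak g^{\boldsymbol\sigma}$, which acts diagonalizably on $\mathfrak g$ with root spaces $\mathfrak g_\alpha$ ($\alpha\in\mathfrak h^*$); $Q_{\mathfrak h}$ is the subgroup of $\mathfrak h^*$ generated by the nonzero weights, $\mathfrak g_\alpha^{\bar\lambda}=\mathfrak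 g_\alpha\cap\mathfrak g^{\bar\lambda}$, and $L_{\boldsymbol m}(\mathfrak g,\boldsymbol\sigma,\mathfrak h)=\bigoplus_{(\alpha,\lambda)\in Q_{\mathfrak h}\times\mathbb Z^n}\mathfrak g_\alpha^{\bar\lambda}\otimes t^\lambda\subseteq\mathfrak g\otimes k[t_1^{\pm1},\dots,t_n^{\pm1}]$, graded by $Q_{\mathfrak h}\times\mathbb Z^n$. If $\mathfrak g^{\boldsymbol\sigma}=0$, $\mathfrak h=0$, $Q_{\mathfrak h}=\{0\}$ and $L_{\boldsymbol m}(\mathfrak g,\boldsymbol\sigma,\mathfrak h)=\bigoplus_\lambda\mathfrak g^{\bar\lambda}\otimes t^\lambda$. $n$ is the nullity. A multiloop Lie $\mathbb Z^n$-torus is a multiloop Lie algebra $L_{\boldsymbol m}(\mathfrak g,\boldsymbol\sigma,\mathfrak h)$ of nullity $n$ satisfying: (A0) $m_i=\mathrm{ord}(\sigma_i)$ for all $i$; (A1) $\mathfrak g^{\boldsymbol\sigma}$ is simple; (A2) for every $\bar\lambda\ne\bar0$ with $\mathfrak g^{\bar\lambda}\ne0$, $\mathfrak g^{\bar\lambda}\cong U\oplus V$ as $\mathfrak g^{\boldsymbol\sigma}$-modules, where $\mathfrak g^{\boldsymbol\sigma}$ acts trivially on $U$ and either $V=0$ or $V$ is irreducible of dimension $>1$ with all $\mathfrak h$-weights in $(\Delta_0)_{\mathrm{en}}\cup\{0\}$, $\Delta_0$ being the root system of $\mathfrak g^{\boldsymbol\sigma}$ relative to $\mathfrak h$; (A3)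 the group generated by $\sigma_1,\dots,\sigma_n$ has order $\prod_i\mathrm{ord}(\sigma_i)$. For an irreducible finite root system $\Delta_0$, $(\Delta_0)_{\mathrm{en}}=\Delta_0\cup\{2\alpha:\alpha\text{ a short root}\}$ if $\Delta_0$ has type $B_l$ ($l\ge1$), and $(\Delta_0)_{\mathrm{en}}=\Delta_0$ otherwise. Support-isomorphism: for an abelian group $\Lambda$ and $\Lambda$-graded algebra $B$, $\langle\mathrm{supp}_\Lambda(B)\rangle$ is the subgroup generated by $\{\lambda:B^\lambda\ne0\}$; a $\Lambda$-graded $B$ and $\Lambda'$-graded $B'$ are support-isomorphic if there exist an algebra isomorphism $\varphi:B\to B'$ and a group isomorphism $\varphi_{\mathrm{su}}:\langle\mathrm{supp}_\Lambda(B)\rangle\to\langle\mathrm{supp}_{\Lambda'}(B')\rangle$ with $\varphi(B^\lambda)=B'^{\varphi_{\mathrm{su}}(\lambda)}$ for all $\lambda\in\langle\mathrm{supp}_\Lambda(B)\rangle$. Here the gradings are by $Q_{\mathfrak h}\times\mathbb Z^n$. *)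

theory Defs
  imports Main "HOL-Library.Function_Algebras" "HOL-Library.Product_Plus"
    "HOL-Computational_Algebra.Polynomial"
begin

definition alg_closed_field :: "'k::field itself \<Rightarrow> bool" where
  "alg_closed_field _ \<longleftrightarrow> (\<forall>p :: 'k poly. degree p \<ge> 1 \<longrightarrow> (\<exists>x. poly p x = 0))"

definition fixed_roots_of_unity :: "(nat \<Rightarrow> 'k::field) \<Rightarrow> bool" where
  "fixed_roots_of_unity \<zeta> \<longleftrightarrow>
     (\<forall>n>0. \<zeta> n ^ n = 1 \<and> (\<forall>j. 0 < j \<and> j < n \<longrightarrow> \<zeta> n ^ j \<noteq> 1)) \<and>
     (\<forall>m>0. \<forall>n>0. \<zeta> (m * n) ^ m = \<zeta> n)"

definition lie_algebra :: "('k::field \<Rightarrow> 'a::ab_group_add \<Rightarrow> 'a) \<Rightarrow> ('a \<Rightarrow> 'a \<Rightarrow> 'a) \<Rightarrow> bool" where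
  "lie_algebra s b \<longleftrightarrow> vector_space s \<and>
     (\<forall>x. Vector_Spaces.linear s s (b x)) \<and> (\<forall>y. Vector_Spaces.linear s s (\<lambda>x. b x y)) \<and>
     (\<forall>x. b x x = 0) \<and> (\<forall>x y z. b x (b y z) + b y (b z x) + b z (b x y) = 0)"

definition fin_dim :: "('k::field \<Rightarrow> 'a::ab_group_add \<Rightarrow> 'a) \<Rightarrow> bool" where
  "fin_dim s \<longleftrightarrow> (\<exists>B. finite B \<and> module.span s B = UNIV)"

definition simple_subalg :: "('k::field \<Rightarrow> 'a::ab_group_add \<Rightarrow> 'a) \<Rightarrow> ('a \<Rightarrow> 'a \<Rightarrow> 'a) \<Rightarrow> 'a set \<Rightarrow> bool" where
  "simple_subalg s b K \<longleftrightarrow> module.subspace s K \<and> (\<forall>x\<in>K. \<forall>y\<in>K. b x y \<in> K) \<and>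
     (\<exists>x\<in>K. \<exists>y\<in>K. b x y \<noteq> 0) \<and>
     (\<forall>I. I \<subseteq> K \<and> module.subspace s I \<and> (\<forall>x\<in>K. \<forall>y\<in>I. b x y \<in> I) \<longrightarrow> I = {0} \<or> I = K)"

definition lie_aut :: "('k::field \<Rightarrow> 'a::ab_group_add \<Rightarrow> 'a) \<Rightarrow> ('a \<Rightarrow> 'a \<Rightarrow> 'a) \<Rightarrow> ('a \<Rightarrow> 'a) \<Rightarrow> bool" where
  "lie_aut s b f \<longleftrightarrow> Vector_Spaces.linear s s f \<and> bij f \<and> (\<forall>x y. f (b x y) = b (f x) (f y))"

definition aut_order :: "('a \<Rightarrow> 'a) \<Rightarrow> nat" where
  "aut_order f = (LEAST m. 0 < m \<and> f ^^ m = id)"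

definition nilpotent_subalg :: "('a::zero \<Rightarrow> 'a \<Rightarrow> 'a) \<Rightarrow> 'a set \<Rightarrow> bool" where
  "nilpotent_subalg b H \<longleftrightarrow>
     (\<exists>N. \<forall>xs y. length xs = N \<and> set xs \<subseteq> H \<and> y \<in> H \<longrightarrow> foldr b xs y = 0)"

definition cartan_subalg :: "('k::field \<Rightarrow> 'a::ab_group_add \<Rightarrow> 'a) \<Rightarrow> ('a \<Rightarrow> 'a \<Rightarrow> 'a) \<Rightarrow> 'a set \<Rightarrow> 'a set \<Rightarrow> bool" where
  "cartan_subalg s b K H \<longleftrightarrow> H \<subseteq> K \<and> module.subspace s H \<and> (\<forall>x\<in>H. \<forall>y\<in>H. b x y \<in> H) \<and>
     nilpotent_subalg b H \<and> {x\<in>K. \<forall>y\<in>H. b x y \<in> H} = H"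

definition Zn :: "nat \<Rightarrow> (nat \<Rightarrow> int) set" where
  "Zn n = {l. \<forall>i\<ge>n. l i = 0}"

definition twisted :: "('k::field \<Rightarrow> 'a \<Rightarrow> 'a) \<Rightarrow> (nat \<Rightarrow> 'k) \<Rightarrow> nat \<Rightarrow> (nat \<Rightarrow> 'a \<Rightarrow> 'a) \<Rightarrow> (nat \<Rightarrow> nat) \<Rightarrow> (nat \<Rightarrow> int) \<Rightarrow> 'a set" where
  "twisted s \<zeta> n \<sigma> m l = {x. \<forall>i<n. \<sigma> i x = s (\<zeta> (m i) powi l i) x}"

definition fixed_pts :: "('k::field \<Rightarrow> 'a \<Rightarrow> 'a) \<Rightarrow> (nat \<Rightarrow> 'k) \<Rightarrow> nat \<Rightarrow> (nat \<Rightarrow> 'a \<Rightarrow> 'a) \<Rightarrow> (nat \<Rightarrow> nat) \<Rightarrow> 'a set" where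
  "fixed_pts s \<zeta> n \<sigma> m = twisted s \<zeta> n \<sigma> m (\<lambda>_. 0)"

definition hdual :: "('k::field \<Rightarrow> 'a::ab_group_add \<Rightarrow> 'a) \<Rightarrow> 'a set \<Rightarrow> ('a \<Rightarrow> 'k) set" where
  "hdual s H = {\<alpha>. (\<forall>x\<in>H. \<forall>y\<in>H. \<alpha> (x + y) = \<alpha> x + \<alpha> y) \<and> (\<forall>c. \<forall>x\<in>H. \<alpha> (s c x) = c * \<alpha> x) \<and>
                    (\<forall>x. x \<notin> H \<longrightarrow> \<alpha> x = 0)}"

definition root_space :: "('k::field \<Rightarrow> 'a \<Rightarrow> 'a) \<Rightarrow> ('a \<Rightarrow> 'a \<Rightarrow> 'a) \<Rightarrow> 'a set \<Rightarrow> ('a \<Rightarrow> 'k) \<Rightarrow> 'a set" where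
  "root_space s b H \<alpha> = {x. \<forall>y\<in>H. b y x = s (\<alpha> y) x}"

inductive_set gen_subgroup :: "'g::ab_group_add set \<Rightarrow> 'g set" for S where
  gen_zero: "0 \<in> gen_subgroup S"
| gen_base: "x \<in> S \<Longrightarrow> x \<in> gen_subgroup S"
| gen_diff: "x \<in> gen_subgroup S \<Longrightarrow> y \<in> gen_subgroup S \<Longrightarrow> x - y \<in> gen_subgroup S"

definition Qh :: "('k::field \<Rightarrow> 'a::ab_group_add \<Rightarrow> 'a) \<Rightarrow> ('a \<Rightarrow> 'a \<Rightarrow> 'a) \<Rightarrow> 'a set \<Rightarrow> ('a \<Rightarrow> 'k) set" where
  "Qh s b H = gen_subgroup {\<alpha> \<in> hdual s H. \<alpha> \<noteq> 0 \<and> root_space s b H \<alpha> \<noteq> {0}}"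

definition multiloop_datum ::
  "(nat \<Rightarrow> 'k::field) \<Rightarrow> nat \<Rightarrow> ('k \<Rightarrow> 'a::ab_group_add \<Rightarrow> 'a) \<Rightarrow> ('a \<Rightarrow> 'a \<Rightarrow> 'a) \<Rightarrow>
   (nat \<Rightarrow> 'a \<Rightarrow> 'a) \<Rightarrow> (nat \<Rightarrow> nat) \<Rightarrow> 'a set \<Rightarrow> bool" where
  "multiloop_datum \<zeta> n s b \<sigma> m H \<longleftrightarrow>
     lie_algebra s b \<and> fin_dim s \<and> simple_subalg s b UNIV \<and>
     (\<forall>i<n. lie_aut s b (\<sigma> i) \<and> 0 < m i \<and> \<sigma> i ^^ m i = id) \<and>
     (\<forall>i<n. \<forall>j<n. \<sigma> i \<circ> \<sigma> j = \<sigma> j \<circ> \<sigma> i) \<and>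
     (if fixed_pts s \<zeta> n \<sigma> m \<noteq> {0} then cartan_subalg s b (fixed_pts s \<zeta> n \<sigma> m) H else H = {0})"

text \<open>Elements of \<g> \<otimes> k[t_1^{\<pm>1},...]: finitely supported maps from exponents to \<g>.\<close>
definition loop_scale :: "('k \<Rightarrow> 'a \<Rightarrow> 'a) \<Rightarrow> 'k \<Rightarrow> ((nat \<Rightarrow> int) \<Rightarrow> 'a) \<Rightarrow> ((nat \<Rightarrow> int) \<Rightarrow> 'a)" where
  "loop_scale s c F = (\<lambda>\<nu>. s c (F \<nu>))"

definition loop_bracket :: "('a \<Rightarrow> 'a \<Rightarrow> 'a::ab_group_add) \<Rightarrow> ((nat \<Rightarrow> int) \<Rightarrow> 'a) \<Rightarrow> ((nat \<Rightarrow> int) \<Rightarrow> 'a) \<Rightarrow> ((nat \<Rightarrow> int) \<Rightarrow> 'a)" where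
  "loop_bracket b F G = (\<lambda>\<nu>. \<Sum>\<mu>\<in>{\<mu>. F \<mu> \<noteq> 0}. b (F \<mu>) (G (\<nu> - \<mu>)))"

definition ml_comp ::
  "(nat \<Rightarrow> 'k::field) \<Rightarrow> nat \<Rightarrow> ('k \<Rightarrow> 'a::ab_group_add \<Rightarrow> 'a) \<Rightarrow> ('a \<Rightarrow> 'a \<Rightarrow> 'a) \<Rightarrow>
   (nat \<Rightarrow> 'a \<Rightarrow> 'a) \<Rightarrow> (nat \<Rightarrow> nat) \<Rightarrow> 'a set \<Rightarrow> ('a \<Rightarrow> 'k) \<times> (nat \<Rightarrow> int) \<Rightarrow> ((nat \<Rightarrow> int) \<Rightarrow> 'a) set" where
  "ml_comp \<zeta> n s b \<sigma> m H \<gamma> =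
     (if fst \<gamma> \<in> Qh s b H \<and> snd \<gamma> \<in> Zn n
      then {F. F (snd \<gamma>) \<in> root_space s b H (fst \<gamma>) \<inter> twisted s \<zeta> n \<sigma> m (snd \<gamma>) \<and>
               (\<forall>\<mu>. \<mu> \<noteq> snd \<gamma> \<longrightarrow> F \<mu> = 0)}
      else {0})"

definition ml_alg ::
  "(nat \<Rightarrow> 'k::field) \<Rightarrow> nat \<Rightarrow> ('k \<Rightarrow> 'a::ab_group_add \<Rightarrow> 'a) \<Rightarrow> ('a \<Rightarrow> 'a \<Rightarrow> 'a) \<Rightarrow>
   (nat \<Rightarrow> 'a \<Rightarrow> 'a) \<Rightarrow> (nat \<Rightarrow> nat) \<Rightarrow> 'a set \<Rightarrow> ((nat \<Rightarrow> int) \<Rightarrow> 'a) set" where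
  "ml_alg \<zeta> n s b \<sigma> m H = module.span (loop_scale s) (\<Union>\<gamma>. ml_comp \<zeta> n s b \<sigma> m H \<gamma>)"

definition ml_supp ::
  "(nat \<Rightarrow> 'k::field) \<Rightarrow> nat \<Rightarrow> ('k \<Rightarrow> 'a::ab_group_add \<Rightarrow> 'a) \<Rightarrow> ('a \<Rightarrow> 'a \<Rightarrow> 'a) \<Rightarrow>
   (nat \<Rightarrow> 'a \<Rightarrow> 'a) \<Rightarrow> (nat \<Rightarrow> nat) \<Rightarrow> 'a set \<Rightarrow> (('a \<Rightarrow> 'k) \<times> (nat \<Rightarrow> int)) set" where
  "ml_supp \<zeta> n s b \<sigma> m H = {\<gamma>. ml_comp \<zeta> n s b \<sigma> m H \<gamma> \<noteq> {0}}"

definition root_sys0 ::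
  "(nat \<Rightarrow> 'k::field) \<Rightarrow> nat \<Rightarrow> ('k \<Rightarrow> 'a::ab_group_add \<Rightarrow> 'a) \<Rightarrow> ('a \<Rightarrow> 'a \<Rightarrow> 'a) \<Rightarrow>
   (nat \<Rightarrow> 'a \<Rightarrow> 'a) \<Rightarrow> (nat \<Rightarrow> nat) \<Rightarrow> 'a set \<Rightarrow> ('a \<Rightarrow> 'k) set" where
  "root_sys0 \<zeta> n s b \<sigma> m H =
     {\<alpha> \<in> hdual s H. \<alpha> \<noteq> 0 \<and> root_space s b H \<alpha> \<inter> fixed_pts s \<zeta> n \<sigma> m \<noteq> {0}}"

text \<open>\<Delta> is of type B_l (l \<ge> 1), with coordinates \<epsilon>_0,...,\<epsilon>_(l-1)
  (linearly independent): \<Delta> = {\<pm>\<epsilon>_i} \<union> {\<pm>\<epsilon>_i \<pm> \<epsilon>_j : i \<noteq> j};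
  the short roots are then \<pm>\<epsilon>_i.\<close>
definition type_B_coords :: "('a \<Rightarrow> 'k::field) set \<Rightarrow> nat \<Rightarrow> (nat \<Rightarrow> 'a \<Rightarrow> 'k) \<Rightarrow> bool" where
  "type_B_coords \<Delta> l \<epsilon> \<longleftrightarrow> 1 \<le> l \<and>
     (\<forall>c::nat \<Rightarrow> 'k. (\<forall>x. (\<Sum>i<l. c i * \<epsilon> i x) = 0) \<longrightarrow> (\<forall>i<l. c i = 0)) \<and>
     \<Delta> = {\<epsilon> i | i. i < l} \<union> {- \<epsilon> i | i. i < l} \<union>
         {\<epsilon> i + \<epsilon> j | i j. i < l \<and> j < l \<and> i \<noteq> j} \<union> {\<epsilon> i - \<epsilon> j | i j. i < l \<and> j < l \<and> i \<noteq> j} \<union>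
         {- \<epsilon> i - \<epsilon> j | i j. i < l \<and> j < l \<and> i \<noteq> j}"

definition enlarged_roots :: "('a \<Rightarrow> 'k::field) set \<Rightarrow> ('a \<Rightarrow> 'k) set" where
  "enlarged_roots \<Delta> = \<Delta> \<union>
     {\<beta>. \<exists>l \<epsilon>. type_B_coords \<Delta> l \<epsilon> \<and> (\<exists>i<l. \<beta> = 2 * \<epsilon> i \<or> \<beta> = - (2 * \<epsilon> i))}"

definition submodule :: "('k::field \<Rightarrow> 'a::ab_group_add \<Rightarrow> 'a) \<Rightarrow> ('a \<Rightarrow> 'a \<Rightarrow> 'a) \<Rightarrow> 'a set \<Rightarrow> 'a set \<Rightarrow> bool" where
  "submodule s b K W \<longleftrightarrow> module.subspace s W \<and> (\<forall>x\<in>K. \<forall>w\<in>W. b x w \<in> W)"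

definition irreducible_submodule :: "('k::field \<Rightarrow> 'a::ab_group_add \<Rightarrow> 'a) \<Rightarrow> ('a \<Rightarrow> 'a \<Rightarrow> 'a) \<Rightarrow> 'a set \<Rightarrow> 'a set \<Rightarrow> bool" where
  "irreducible_submodule s b K V \<longleftrightarrow> submodule s b K V \<and> V \<noteq> {0} \<and>
     (\<forall>W. W \<subseteq> V \<and> submodule s b K W \<longrightarrow> W = {0} \<or> W = V)"

inductive_set gen_aut_group :: "nat \<Rightarrow> (nat \<Rightarrow> 'a \<Rightarrow> 'a) \<Rightarrow> ('a \<Rightarrow> 'a) set" for n \<sigma> where
  ga_id: "id \<in> gen_aut_group n \<sigma>"
| ga_gen: "i < n \<Longrightarrow> \<sigma> i \<in> gen_aut_group n \<sigma>"
| ga_comp: "f \<in> gen_aut_group n \<sigma> \<Longrightarrow> g \<in> gen_aut_group n \<sigma> \<Longrightarrow> f \<circ> g \<in> gen_aut_group n \<sigma>"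
| ga_inv: "f \<in> gen_aut_group n \<sigma> \<Longrightarrow> inv f \<in> gen_aut_group n \<sigma>"

definition multiloop_torus ::
  "(nat \<Rightarrow> 'k::field) \<Rightarrow> nat \<Rightarrow> ('k \<Rightarrow> 'a::ab_group_add \<Rightarrow> 'a) \<Rightarrow> ('a \<Rightarrow> 'a \<Rightarrow> 'a) \<Rightarrow>
   (nat \<Rightarrow> 'a \<Rightarrow> 'a) \<Rightarrow> (nat \<Rightarrow> nat) \<Rightarrow> 'a set \<Rightarrow> bool" where
  "multiloop_torus \<zeta> n s b \<sigma> m H \<longleftrightarrow>
     multiloop_datum \<zeta> n s b \<sigma> m H \<and>
     \<comment> \<open>(A0)\<close> (\<forall>i<n. m i = aut_order (\<sigma> i)) \<and>
     \<comment> \<open>(A1)\<close> simple_subalg s b (fixed_pts s \<zeta> n \<sigma> m) \<and>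
     \<comment> \<open>(A2)\<close> (\<forall>l \<in> Zn n. (\<exists>i<n. \<not> int (m i) dvd l i) \<and> twisted s \<zeta> n \<sigma> m l \<noteq> {0} \<longrightarrow>
         (\<exists>U V. submodule s b (fixed_pts s \<zeta> n \<sigma> m) U \<and> submodule s b (fixed_pts s \<zeta> n \<sigma> m) V \<and>
            U \<inter> V = {0} \<and> {u + v | u v. u \<in> U \<and> v \<in> V} = twisted s \<zeta> n \<sigma> m l \<and>
            (\<forall>x \<in> fixed_pts s \<zeta> n \<sigma> m. \<forall>u\<in>U. b x u = 0) \<and>
            (V = {0} \<or>
             (irreducible_submodule s b (fixed_pts s \<zeta> n \<sigma> m) V \<and> vector_space.dim s V > 1 \<and>
              {\<alpha> \<in> hdual s H. root_space s b H \<alpha> \<inter> V \<noteq> {0}}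
                 \<subseteq> enlarged_roots (root_sys0 \<zeta> n s b \<sigma> m H) \<union> {0})))) \<and>
     \<comment> \<open>(A3)\<close> card (gen_aut_group n \<sigma>) = (\<Prod>i<n. aut_order (\<sigma> i))"

definition support_iso ::
  "(nat \<Rightarrow> 'k::field) \<Rightarrow> nat \<Rightarrow>
   ('k \<Rightarrow> 'a::ab_group_add \<Rightarrow> 'a) \<Rightarrow> ('a \<Rightarrow> 'a \<Rightarrow> 'a) \<Rightarrow> (nat \<Rightarrow> 'a \<Rightarrow> 'a) \<Rightarrow> (nat \<Rightarrow> nat) \<Rightarrow> 'a set \<Rightarrow>
   ('k \<Rightarrow> 'b::ab_group_add \<Rightarrow> 'b) \<Rightarrow> ('b \<Rightarrow> 'b \<Rightarrow> 'b) \<Rightarrow> (nat \<Rightarrow> 'b \<Rightarrow> 'b) \<Rightarrow> (nat \<Rightarrow> nat) \<Rightarrow> 'b set \<Rightarrow> bool" where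
  "support_iso \<zeta> n s b \<sigma> m H s' b' \<sigma>' m' H' \<longleftrightarrow>
     (\<exists>\<phi> \<phi>su.
        bij_betw \<phi> (ml_alg \<zeta> n s b \<sigma> m H) (ml_alg \<zeta> n s' b' \<sigma>' m' H') \<and>
        (\<forall>F\<in>ml_alg \<zeta> n s b \<sigma> m H. \<forall>G\<in>ml_alg \<zeta> n s b \<sigma> m H.
            \<phi> (F + G) = \<phi> F + \<phi> G \<and>
            \<phi> (loop_bracket b F G) = loop_bracket b' (\<phi> F) (\<phi> G)) \<and>
        (\<forall>c. \<forall>F\<in>ml_alg \<zeta> n s b \<sigma> m H. \<phi> (loop_scale s c F) = loop_scale s' c (\<phi> F)) \<and>
        bij_betw \<phi>su (gen_subgroup (ml_supp \<zeta> n s b \<sigma> m H)) (gen_subgroup (ml_supp \<zeta> n s' b' \<sigma>' m' H')) \<and>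
        (\<forall>x\<in>gen_subgroup (ml_supp \<zeta> n s b \<sigma> m H). \<forall>y\<in>gen_subgroup (ml_supp \<zeta> n s b \<sigma> m H).
            \<phi>su (x + y) = \<phi>su x + \<phi>su y) \<and>
        (\<forall>\<gamma>\<in>gen_subgroup (ml_supp \<zeta> n s b \<sigma> m H).
            \<phi> ` ml_comp \<zeta> n s b \<sigma> m H \<gamma> = ml_comp \<zeta> n s' b' \<sigma>' m' H' (\<phi>su \<gamma>)))"

end

theory Submission
  imports Defs "HOL-Library.FuncSet"
begin

text \<open>
  Suppose \<open>\<g>\<^sup>\<sigma> \<noteq> 0\<close>. Then \<open>\<h>\<close> is nonzero and toral, its nonzero weights form an irreducible finite,
  possibly non-reduced, root system, and the spaces \<open>\<g>\<^sub>\<alpha> \<inter> \<g>\<^sup>\<lambda>\<close> with \<open>\<alpha> \<noteq> 0\<close> have dimension at most one.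
  Choose for each simple root a degree \<open>\<lambda>\<close> in which it occurs and extend this choice additively to a
  homomorphism \<open>sh\<close> from \<open>Q\<close> to \<open>\<int>\<^sup>n\<close>. Regrading \<open>\<g>\<^sub>\<alpha> \<inter> \<g>\<^sup>\<lambda>\<close> into degree \<open>\<lambda> - sh \<alpha>\<close> moves all simple
  roots into degree \<open>0\<close>. The component \<open>W 0\<close> of the new grading is simple with Cartan subalgebra \<open>\<h>\<close>.
  Each component \<open>W \<kappa>\<close> is the sum of its invariants and an irreducible module: on the zero weight space,
  bijectivity of \<open>e f\<close> on vectors of weight \<open>2\<close> for a principal sl2 triple splits off the invariants.
  The degrees \<open>\<kappa>\<close> that occur generate a lattice \<open>M\<close> of rank \<open>n\<close>. A basis of \<open>M\<close> stacked with one of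
  \<open>m\<^sub>1 \<int> \<times> \<dots> \<times> m\<^sub>n \<int>\<close> provides the orders of new commuting automorphisms acting on \<open>W \<kappa>\<close> by the characters of
  \<open>M\<close>. They define a multiloop torus, and the regrading is the support isomorphism.

  If \<open>\<g>\<^sup>\<sigma> = 0\<close>, the component of degree \<open>0\<close> vanishes, whereas that of a torus contains the nonzero
  centre of the nilpotent algebra \<open>\<h>\<close>.
\<close>

text \<open>Only linear algebra is presupposed, so trace arguments and single sl2 triples take the
  place of Cartan's criterion, of the theory of reductive algebras and of complete reducibility. As
  \<open>'k\<close> carries no order, positivity on the root lattice is obtained through a
  rational-linear functional on \<open>'k\<close>.

  Additivity of \<open>sh\<close> keeps the regraded spaces compatible with the bracket. The root
  system may be non-reduced, but if \<open>\<alpha>\<close> occurs in degree \<open>l\<close> then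
  \<open>2 \<alpha>\<close> does not occur in degree \<open>2 l\<close>. Hence the roots that land
  in degree \<open>0\<close> form a reduced system containing the base. Every other root is the
  double of one of them; this happens only in type B, which explains the enlarged root system in
  (A2).

  Irreducibility rests on a combinatorial fact: two non-empty saturated sets of roots always meet.

  A basis adapted to both lattices presents the quotient of \<open>M\<close> as a product of the
  groups of integers modulo \<open>d i\<close>; this makes the new automorphisms independent of each
  other and yields (A0) and (A3). The algebra and \<open>H\<close> stay the same; only the
  automorphisms and their orders change.\<close>

section \<open>Linear maps and their stable subspaces\<close>

locale fdvs = finite_dimensional_vector_space scale Basis
 for scale :: "'k::field_char_0 \<Rightarrow> 'a::ab_group_add \<Rightarrow> 'a" (infixr "*s" 75) and Basis :: "'a set"
begin

abbreviation lin :: "('a \<Rightarrow> 'a) \<Rightarrow> bool" where "lin f \<equiv> Vector_Spaces.linear scale scale f"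

lemma linI:
 assumes "\<And>x y. f (x + y) = f x + f y" "\<And>c x. f (c *s x) = c *s f x"
 shows "lin f"
 unfolding Vector_Spaces.linear_iff using assms vector_space_axioms by blast

lemma lin_add: "lin f ==> f (x + y) = f x + f y"
 and lin_scale: "lin f ==> f (c *s x) = c *s f x"
 unfolding Vector_Spaces.linear_iff by blast+

lemma lin_zero: "lin f ==> f 0 = 0"
 using lin_scale[of f 0 0] by simp

lemma lin_neg: "lin f ==> f (- x) = - f x"
 using lin_scale[of f "-1" x] by simp

lemma lin_diff: "lin f ==> f (x - y) = f x - f y"
 using lin_add[of f x "-y"] lin_neg[of f y] by simp

lemma lin_sum: "lin f ==> f (\<Sum>i\<in>I. u i) = (\<Sum>i\<in>I. f (u i))"
 by (induction I rule: infinite_finite_induct) (auto simp: lin_zero lin_add)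

lemma lin_compose: "lin f ==> lin g ==> lin (\<lambda>x. f (g x))"
 by (rule linI) (simp_all add: lin_add lin_scale)

lemma lin_plus: "lin f ==> lin g ==> lin (\<lambda>x. f x + g x)"
 by (rule linI) (simp_all add: lin_add lin_scale scale_right_distrib)

lemma lin_minus: "lin f ==> lin g ==> lin (\<lambda>x. f x - g x)"
 by (rule linI) (simp_all add: lin_diff lin_add lin_scale scale_right_diff_distrib)

lemma lin_smult: "lin f ==> lin (\<lambda>x. c *s f x)"
 by (rule linI) (simp_all add: lin_add lin_scale scale_right_distrib mult.commute)

lemma lin_ident: "lin (\<lambda>x. x)"
 by (rule linI) simp_all

lemma lin_const0: "lin (\<lambda>x. 0)"
 by (rule linI) simp_all

lemma lin_setsum: "(\<And>i. i \<in> I ==> lin (f i)) ==> lin (\<lambda>x. \<Sum>i\<in>I. f i x)"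
 by (induction I rule: infinite_finite_induct) (auto intro: lin_const0 lin_plus)

lemma lin_funpow: "lin f ==> lin (f ^^ k)"
 by (induction k) (auto intro: lin_ident lin_compose simp: o_def id_def)

lemma lin_span_image:
 assumes "lin f" "\<And>x. x \<in> S ==> f x \<in> W" "subspace W" "x \<in> span S"
 shows "f x \<in> W"
 using assms(4)
proof (induction rule: span_induct_alt)
 case base then show ?case using assms by (simp add: lin_zero subspace_0)
next
 case (step c x y)
 then show ?case using assms by (simp add: lin_add lin_scale subspace_add subspace_scale)
qed

lemma lin_eq_span:
 assumes "lin f" "lin g" "\<And>x. x \<in> S ==> f x = g x" "x \<in> span S"
 shows "f x = g x"
 using assms(4)
proof (induction rule: span_induct_alt)
 case base then show ?case using assms by (simp add: lin_zero)
next
 case (step c x y)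
 then show ?case using assms by (simp add: lin_add lin_scale)
qed

lemma obtain_basis:
 assumes "subspace W"
 obtains B where "independent B" "finite B" "span B = W" "B \<subseteq> W" "card B = dim W"
proof -
 obtain B where B: "B \<subseteq> W" "independent B" "W \<subseteq> span B" "card B = dim W"
  using basis_exists by blast
 moreover have "span B = W" using B assms by (simp add: span_subspace)
 ultimately show ?thesis using that finiteI_independent by blast
qed

lemma funpow_stable: "(\<And>x. x \<in> W ==> f x \<in> W) ==> x \<in> W ==> (f ^^ k) x \<in> W"
 by (induction k) auto

lemma dim_le: "dim W \<le> card Basis"
 using dim_subset_UNIV[of W] unfolding dimension_def .

subsection \<open>Traces\<close>

definition trb :: "'a set \<Rightarrow> ('a \<Rightarrow> 'a) \<Rightarrow> 'k" where
 "trb B f = (\<Sum>v\<in>B. representation B (f v) v)"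

text \<open>The choice of basis is immaterial by \<open>tr_eq_trb\<close> when \<open>f\<close> maps
  \<open>W\<close> to itself. Traces on subspaces are needed because eigenspaces appear as sets, not
  as types.\<close>

definition tr :: "'a set \<Rightarrow> ('a \<Rightarrow> 'a) \<Rightarrow> 'k" where
 "tr W f = trb (SOME B. independent B \<and> span B = W) f"

text \<open>Both sides are the same double sum of products of matrix entries. The two bases may span
  different spaces; with \<open>f\<close> the identity and equal spans this gives independence of
  the basis.\<close>

lemma trb_comm:
 assumes B: "independent B" "finite B" and C: "independent C" "finite C"
  and f: "lin f" "\<And>x. x \<in> span C ==> f x \<in> span B"
  and g: "lin g" "\<And>x. x \<in> span B ==> g x \<in> span C"
 shows "trb B (\<lambda>x. f (g x)) = trb C (\<lambda>x. g (f x))"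
proof -
 have 1: "representation B (f (g v)) v = (\<Sum>u\<in>C. representation C (g v) u * representation B (f u) v)"
  if "v \<in> B" for v
 proof -
  have gv: "g v \<in> span C" using g(2) that by (simp add: span_base)
  have "f (g v) = f (\<Sum>u\<in>C. representation C (g v) u *s u)"
   using sum_representation_eq[OF C(1) gv C(2) subset_refl] by simp
  also have "\<dots> = (\<Sum>u\<in>C. representation C (g v) u *s f u)"
   by (simp add: lin_sum[OF f(1)] lin_scale[OF f(1)])
  finally have "representation B (f (g v)) v
    = (\<Sum>u\<in>C. representation B (representation C (g v) u *s f u) v)"
   using f(2) by (simp only: representation_sum[OF B(1)] span_base span_scale)
  also have "\<dots> = (\<Sum>u\<in>C. representation C (g v) u * representation B (f u) v)"
   using f(2) by (intro sum.cong refl) (simp add: representation_scale[OF B(1)] span_base)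
  finally show ?thesis .
 qed
 have 2: "representation C (g (f u)) u = (\<Sum>v\<in>B. representation B (f u) v * representation C (g v) u)"
  if "u \<in> C" for u
 proof -
  have fu: "f u \<in> span B" using f(2) that by (simp add: span_base)
  have "g (f u) = g (\<Sum>v\<in>B. representation B (f u) v *s v)"
   using sum_representation_eq[OF B(1) fu B(2) subset_refl] by simp
  also have "\<dots> = (\<Sum>v\<in>B. representation B (f u) v *s g v)"
   by (simp add: lin_sum[OF g(1)] lin_scale[OF g(1)])
  finally have "representation C (g (f u)) u
    = (\<Sum>v\<in>B. representation C (representation B (f u) v *s g v) u)"
   using g(2) by (simp only: representation_sum[OF C(1)] span_base span_scale)
  also have "\<dots> = (\<Sum>v\<in>B. representation B (f u) v * representation C (g v) u)"
   using g(2) by (intro sum.cong refl) (simp add: representation_scale[OF C(1)] span_base)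
  finally show ?thesis .
 qed
 have "trb B (\<lambda>x. f (g x)) = (\<Sum>v\<in>B. \<Sum>u\<in>C. representation C (g v) u * representation B (f u) v)"
  unfolding trb_def using 1 by simp
 also have "\<dots> = (\<Sum>u\<in>C. \<Sum>v\<in>B. representation B (f u) v * representation C (g v) u)"
  by (subst sum.swap) (simp add: mult.commute)
 also have "\<dots> = trb C (\<lambda>x. g (f x))"
  unfolding trb_def using 2 by simp
 finally show ?thesis .
qed

lemma tr_eq_trb:
 assumes "independent B" "span B = W" "lin f" "\<And>x. x \<in> W ==> f x \<in> W"
 shows "tr W f = trb B f"
proof -
 define C where "C = (SOME B. independent B \<and> span B = W)"
 have C: "independent C \<and> span C = W"
  unfolding C_def by (rule someI[of _ B]) (use assms in auto)
 have "trb C (\<lambda>x. f x) = trb B (\<lambda>x. f x)"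
  using trb_comm[of C B "\<lambda>x. x" f] C assms finiteI_independent lin_ident by auto
 then show ?thesis unfolding tr_def C_def[symmetric] .
qed

lemma tr_comm:
 assumes "subspace W" "lin f" "lin g" "\<And>x. x \<in> W ==> f x \<in> W" "\<And>x. x \<in> W ==> g x \<in> W"
 shows "tr W (\<lambda>x. f (g x)) = tr W (\<lambda>x. g (f x))"
proof -
 obtain B where B: "independent B" "finite B" "span B = W" using obtain_basis assms(1) by blast
 show ?thesis
  using trb_comm[of B B f g] B assms tr_eq_trb[OF B(1,3)] lin_compose by auto
qed

lemma tr_cong:
 assumes "subspace W" "lin f" "lin g" "\<And>x. x \<in> W ==> f x \<in> W" "\<And>x. x \<in> W ==> g x = f x"
 shows "tr W g = tr W f"
proof -
 obtain B where B: "independent B" "finite B" "span B = W" "B \<subseteq> W" using obtain_basis assms(1) by blast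
 have "trb B g = trb B f" unfolding trb_def using B assms by (intro sum.cong) auto
 then show ?thesis using tr_eq_trb[OF B(1,3)] assms by auto
qed

lemma tr_plus:
 assumes "subspace W" "lin f" "lin g" "\<And>x. x \<in> W ==> f x \<in> W" "\<And>x. x \<in> W ==> g x \<in> W"
 shows "tr W (\<lambda>x. f x + g x) = tr W f + tr W g"
proof -
 obtain B where B: "independent B" "finite B" "span B = W" "B \<subseteq> W" using obtain_basis assms(1) by blast
 have "trb B (\<lambda>x. f x + g x) = trb B f + trb B g"
  unfolding trb_def sum.distrib[symmetric]
  using B assms by (intro sum.cong refl) (auto simp: representation_add)
 then show ?thesis using tr_eq_trb[OF B(1,3)] assms lin_plus by (auto simp: subspace_add)
qed

lemma tr_smult:
 assumes "subspace W" "lin f" "\<And>x. x \<in> W ==> f x \<in> W"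
 shows "tr W (\<lambda>x. c *s f x) = c * tr W f"
proof -
 obtain B where B: "independent B" "finite B" "span B = W" "B \<subseteq> W" using obtain_basis assms(1) by blast
 have "trb B (\<lambda>x. c *s f x) = c * trb B f"
  unfolding trb_def sum_distrib_left
  using B assms by (intro sum.cong refl) (auto simp: representation_scale)
 then show ?thesis using tr_eq_trb[OF B(1,3)] assms lin_smult by (auto simp: subspace_scale)
qed

lemma tr_minus:
 assumes "subspace W" "lin f" "lin g" "\<And>x. x \<in> W ==> f x \<in> W" "\<And>x. x \<in> W ==> g x \<in> W"
 shows "tr W (\<lambda>x. f x - g x) = tr W f - tr W g"
proof -
 have "tr W (\<lambda>x. f x + (-1) *s g x) = tr W f + (-1) * tr W g"
  using assms tr_smult[of W g "-1"] lin_smult[of g "-1"]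
  by (subst tr_plus) (auto intro: subspace_scale simp del: scale_minus_left)
 then show ?thesis by simp
qed

lemma tr_zero: "subspace W ==> tr W (\<lambda>x. 0) = 0"
 using tr_smult[of W "\<lambda>x. 0" 0] lin_const0 by (auto simp: subspace_0)

lemma tr_setsum:
 assumes "subspace W" "finite I" "\<And>i. i \<in> I ==> lin (f i)" "\<And>i x. i \<in> I ==> x \<in> W ==> f i x \<in> W"
 shows "tr W (\<lambda>x. \<Sum>i\<in>I. f i x) = (\<Sum>i\<in>I. tr W (f i))"
 using assms(2-)
proof (induction I rule: finite_induct)
 case empty then show ?case using assms(1) by (simp add: tr_zero)
next
 case (insert j I)
 then show ?case using assms(1)
  by (simp add: tr_plus lin_setsum subspace_sum)
qed

lemma tr_ident: "subspace W ==> tr W (\<lambda>x. x) = of_nat (dim W)"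
proof -
 assume W: "subspace W"
 obtain B where B: "independent B" "finite B" "span B = W" "B \<subseteq> W" "card B = dim W"
  using obtain_basis W by blast
 have "trb B (\<lambda>x. x) = (\<Sum>v\<in>B. 1)"
  unfolding trb_def by (intro sum.cong) (auto simp: representation_basis[OF B(1)])
 then show ?thesis using tr_eq_trb[OF B(1,3) lin_ident] B by simp
qed

text \<open>Extend a basis of \<open>U\<close> to one of \<open>W\<close>: the diagonal entries at
  the added vectors vanish because \<open>f\<close> takes values in \<open>U\<close>.\<close>

lemma tr_sub:
 assumes W: "subspace W" and U: "subspace U" "U \<subseteq> W" and f: "lin f" "\<And>x. x \<in> W ==> f x \<in> U"
 shows "tr W f = tr U f"
proof -
 obtain C where C: "independent C" "finite C" "span C = U" "C \<subseteq> U" using obtain_basis U(1) by blast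
 obtain B where B: "C \<subseteq> B" "B \<subseteq> W" "independent B" "W \<subseteq> span B"
  using maximal_independent_subset_extend[of C W] C U by blast
 have sB: "span B = W" using B W by (simp add: span_subspace)
 have fB: "finite B" using B finiteI_independent by blast
 have rep: "representation B (f v) = representation C (f v)" if "v \<in> B" for v
  using representation_extend[OF B(3), of "f v" C] f(2) B(1,2) C(3) that by auto
 have "trb B f = (\<Sum>v\<in>B. representation C (f v) v)"
  unfolding trb_def using rep by simp
 also have "\<dots> = (\<Sum>v\<in>C. representation C (f v) v)"
 proof (rule sum.mono_neutral_right[OF fB B(1)], safe)
  fix v assume "v \<in> B" "v \<notin> C"
  then show "representation C (f v) v = 0" using representation_ne_zero by blast
 qed
 finally have "trb B f = trb C f" unfolding trb_def .
 then show ?thesis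
  using tr_eq_trb[OF B(3) sB f(1)] tr_eq_trb[OF C(1,3) f(1)] f(2) U by (metis subsetD)
qed

lemma subspace_lin_image:
 assumes "lin f" "subspace W" shows "subspace (f ` W)"
proof (rule subspaceI)
 show "0 \<in> f ` W" using assms lin_zero subspace_0 by (metis image_eqI)
next
 fix x y assume "x \<in> f ` W" "y \<in> f ` W"
 then show "x + y \<in> f ` W" using assms by (auto simp: lin_add[symmetric] subspace_add)
next
 fix c x assume "x \<in> f ` W"
 then show "c *s x \<in> f ` W" using assms by (auto simp: lin_scale[symmetric] subspace_scale)
qed

lemma nil_uniform:
 assumes W: "subspace W" and f: "lin f" and nil: "\<And>x. x \<in> W ==> \<exists>N. (f ^^ N) x = 0"
 shows "\<exists>N. \<forall>x\<in>W. (f ^^ N) x = 0"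
proof -
 obtain B where B: "independent B" "finite B" "span B = W" "B \<subseteq> W" using obtain_basis W by blast
 from nil B have "\<forall>x\<in>B. \<exists>N. (f ^^ N) x = 0" by auto
 then obtain N where N: "\<And>x. x \<in> B ==> (f ^^ N x) x = 0" by metis
 define M where "M = (\<Sum>x\<in>B. N x)"
 have "(f ^^ M) x = 0" if "x \<in> B" for x
 proof -
  have "N x \<le> M" unfolding M_def using B(2) that by (simp add: member_le_sum)
  then obtain d where "M = d + N x" by (metis add.commute le_Suc_ex)
  then show ?thesis using N[OF that] lin_zero[OF lin_funpow[OF f]] by (simp add: funpow_add)
 qed
 then have "(f ^^ M) x = 0" if "x \<in> W" for x
  using lin_eq_span[OF lin_funpow[OF f] lin_const0] B(3) that by blast
 then show ?thesis by blast
qed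

text \<open>By \<open>tr_sub\<close> the trace does not change on passing from \<open>W\<close> to
  its images under \<open>f\<close>, \<open>f^2\<close> and so on, and these images end at
  \<open>{0}\<close>.\<close>

lemma tr_nil:
 assumes W: "subspace W" and f: "lin f" "\<And>x. x \<in> W ==> f x \<in> W"
  and nil: "\<And>x. x \<in> W ==> \<exists>N. (f ^^ N) x = 0"
 shows "tr W f = 0"
proof -
 obtain N where N: "\<forall>x\<in>W. (f ^^ N) x = 0" using nil_uniform[OF W f(1) nil] by blast
 have sub: "subspace ((f ^^ k) ` W)" for k using subspace_lin_image[OF lin_funpow[OF f(1)] W] .
 have "tr W f = tr ((f ^^ k) ` W) f" for k
 proof (induction k)
  case (Suc k)
  have "tr ((f ^^ k) ` W) f = tr ((f ^^ Suc k) ` W) f"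
  proof (rule tr_sub[OF sub sub _ f(1)])
   show "(f ^^ Suc k) ` W \<subseteq> (f ^^ k) ` W"
    using f(2) by (auto simp: funpow_swap1)
  qed auto
  then show ?case using Suc by simp
 qed simp
 from this[of N] have "tr W f = tr {0} f"
  using N W by (metis (no_types, lifting) image_cong image_constant_conv subspace_0 empty_iff)
 also have "\<dots> = tr {0} (\<lambda>x. 0)"
  by (rule tr_cong) (auto simp: lin_const0 f(1) lin_zero)
 finally show ?thesis by (simp add: tr_zero)
qed

definition shift :: "('a \<Rightarrow> 'a) \<Rightarrow> 'k \<Rightarrow> 'a \<Rightarrow> 'a" where
 "shift f a = (\<lambda>x. f x - a *s x)"

lemma lin_shift: "lin f ==> lin (shift f a)"
 unfolding shift_def by (intro lin_minus lin_smult lin_ident)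

lemma tr_single:
 assumes W: "subspace W" and f: "lin f" "\<And>x. x \<in> W ==> f x \<in> W"
  and nil: "\<And>x. x \<in> W ==> \<exists>N. (shift f a ^^ N) x = 0"
 shows "tr W f = a * of_nat (dim W)"
proof -
 have st: "shift f a x \<in> W" if "x \<in> W" for x
  using that f W by (simp add: shift_def subspace_diff subspace_scale)
 have "tr W f = tr W (\<lambda>x. shift f a x + a *s x)"
  using W f by (intro tr_cong) (auto simp: shift_def intro: lin_plus lin_shift lin_smult lin_ident lin_minus)
 also have "\<dots> = tr W (shift f a) + tr W (\<lambda>x. a *s x)"
  using st by (rule tr_plus[OF W lin_shift[OF f(1)] lin_smult[OF lin_ident]]) (simp_all add: W subspace_scale)
 also have "\<dots> = a * of_nat (dim W)"
  using tr_nil[OF W lin_shift[OF f(1)] st nil] tr_smult[OF W lin_ident] tr_ident[OF W] by simp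
 finally show ?thesis .
qed

subsection \<open>Direct sum decompositions\<close>

text \<open>A finite internal direct sum. Spanning and independence are stated for families of
  components, so that eigenvalues, weights or pairs can serve as indices.\<close>

definition decomp :: "'i set \<Rightarrow> ('i \<Rightarrow> 'a set) \<Rightarrow> bool" where
 "decomp I W \<longleftrightarrow> finite I \<and> (\<forall>i\<in>I. subspace (W i)) \<and>
  (\<forall>x. \<exists>u. (\<forall>i\<in>I. u i \<in> W i) \<and> x = (\<Sum>i\<in>I. u i)) \<and>
  (\<forall>u. (\<forall>i\<in>I. u i \<in> W i) \<and> (\<Sum>i\<in>I. u i) = 0 \<longrightarrow> (\<forall>i\<in>I. u i = 0))"

definition pr :: "'i set \<Rightarrow> ('i \<Rightarrow> 'a set) \<Rightarrow> 'i \<Rightarrow> 'a \<Rightarrow> 'a" where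
 "pr I W i x = (SOME u. (\<forall>i\<in>I. u i \<in> W i) \<and> x = (\<Sum>i\<in>I. u i)) i"

lemma decompD:
 assumes "decomp I W"
 shows "finite I" "i \<in> I ==> subspace (W i)"
 using assms by (auto simp: decomp_def)

lemma pr_mem: "decomp I W ==> i \<in> I ==> pr I W i x \<in> W i"
 and sum_pr: "decomp I W ==> (\<Sum>i\<in>I. pr I W i x) = x"
proof -
 assume d: "decomp I W"
 then have "\<exists>u. (\<forall>i\<in>I. u i \<in> W i) \<and> x = (\<Sum>i\<in>I. u i)" by (auto simp: decomp_def)
 from someI_ex[OF this] show "i \<in> I ==> pr I W i x \<in> W i" "(\<Sum>i\<in>I. pr I W i x) = x"
  by (auto simp: pr_def)
qed

lemma decomp_unique:
 assumes "decomp I W" "\<And>i. i \<in> I ==> u i \<in> W i" "\<And>i. i \<in> I ==> v i \<in> W i"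
  "(\<Sum>i\<in>I. u i) = (\<Sum>i\<in>I. v i)" "i \<in> I"
 shows "u i = v i"
proof -
 have "(\<Sum>i\<in>I. u i - v i) = 0" using assms(4) by (simp add: sum_subtractf)
 moreover have "\<forall>i\<in>I. u i - v i \<in> W i" using assms by (auto simp: decomp_def subspace_diff)
 ultimately have "\<forall>i\<in>I. u i - v i = 0"
  using assms(1) unfolding decomp_def by (metis (no_types, lifting))
 then show ?thesis using assms(5) by simp
qed

lemma pr_eqI:
 assumes "decomp I W" "\<And>i. i \<in> I ==> u i \<in> W i" "x = (\<Sum>i\<in>I. u i)" "i \<in> I"
 shows "pr I W i x = u i"
 using decomp_unique[OF assms(1), of "\<lambda>i. pr I W i x" u i] assms pr_mem sum_pr by metis

lemma pr_same: "decomp I W ==> i \<in> I ==> x \<in> W i ==> pr I W i x = x"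
 using pr_eqI[of I W "\<lambda>j. if j = i then x else 0" x i] decompD(1)[of I W] decompD(2)[of I W]
 by (auto simp: subspace_0)

lemma pr_other: "decomp I W ==> i \<in> I ==> j \<in> I ==> x \<in> W i ==> i \<noteq> j ==> pr I W j x = 0"
 using pr_eqI[of I W "\<lambda>j. if j = i then x else 0" x j] decompD(1)[of I W] decompD(2)[of I W]
 by (auto simp: subspace_0)

lemma lin_pr: assumes d: "decomp I W" and i: "i \<in> I" shows "lin (pr I W i)"
proof (rule linI)
 fix x y show "pr I W i (x + y) = pr I W i x + pr I W i y"
  using d i by (intro pr_eqI[where u = "\<lambda>i. pr I W i x + pr I W i y"])
   (auto simp: sum.distrib sum_pr pr_mem subspace_add decompD)
next
 fix c x show "pr I W i (c *s x) = c *s pr I W i x"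
  using d i by (intro pr_eqI[where u = "\<lambda>i. c *s pr I W i x"])
   (auto simp: sum_pr pr_mem subspace_scale decompD simp flip: scale_sum_right)
qed

lemma decomp_induct:
 assumes "decomp I W" "\<And>i x. i \<in> I ==> x \<in> W i ==> P x" "\<And>x y. P x ==> P y ==> P (x + y)" "P 0"
 shows "P x"
proof -
 have "P (\<Sum>i\<in>J. pr I W i x)" if "J \<subseteq> I" for J
  using finite_subset[OF that decompD(1)[OF assms(1)]] that
 proof (induction J rule: finite_induct)
  case (insert j J)
  have "P (pr I W j x)" using assms(2)[of j] pr_mem[OF assms(1), of j] insert by auto
  then show ?case using insert assms(3) by auto
 qed (use assms in simp)
 from this[of I] show ?thesis using sum_pr[OF assms(1)] by simp
qed

text \<open>This operator serves three times: for semisimple parts of derivations, for the operator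
  in \<open>kil_nonzero\<close>, and for the automorphisms of the torus.\<close>

definition gscale :: "'i set \<Rightarrow> ('i \<Rightarrow> 'a set) \<Rightarrow> ('i \<Rightarrow> 'k) \<Rightarrow> 'a \<Rightarrow> 'a" where
 "gscale I W c x = (\<Sum>i\<in>I. c i *s pr I W i x)"

lemma lin_gscale: "decomp I W ==> lin (gscale I W c)"
 unfolding gscale_def by (intro lin_setsum lin_smult lin_pr)

lemma gscale_on: "decomp I W ==> i \<in> I ==> x \<in> W i ==> gscale I W c x = c i *s x"
proof -
 assume d: "decomp I W" and i: "i \<in> I" and x: "x \<in> W i"
 have "gscale I W c x = (\<Sum>j\<in>I. if j = i then c i *s x else 0)"
  unfolding gscale_def
  by (intro sum.cong refl) (use pr_same[OF d i x] pr_other[OF d i _ x] in auto)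
 then show ?thesis using i decompD(1)[OF d] by simp
qed

lemma tr_decomp:
 assumes d: "decomp I W" and f: "lin f" "\<And>i x. i \<in> I ==> x \<in> W i ==> f x \<in> W i"
 shows "tr UNIV f = (\<Sum>i\<in>I. tr (W i) f)"
proof -
 have "tr UNIV f = tr UNIV (\<lambda>x. \<Sum>i\<in>I. f (pr I W i x))"
  using d f by (intro tr_cong) (auto simp: lin_sum[OF f(1), symmetric] sum_pr intro!: lin_setsum lin_compose lin_pr)
 also have "\<dots> = (\<Sum>i\<in>I. tr UNIV (\<lambda>x. f (pr I W i x)))"
  using d f by (intro tr_setsum) (auto intro: lin_compose lin_pr decompD)
 also have "\<dots> = (\<Sum>i\<in>I. tr (W i) f)"
 proof (intro sum.cong refl)
  fix i assume i: "i \<in> I"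
  have l: "lin (\<lambda>x. f (pr I W i x))" using d f i by (auto intro: lin_compose lin_pr)
  have "tr UNIV (\<lambda>x. f (pr I W i x)) = tr (W i) (\<lambda>x. f (pr I W i x))"
   using d f i by (intro tr_sub l) (auto intro: decompD pr_mem)
  also have "\<dots> = tr (W i) f"
   using d f i l by (intro tr_cong) (auto intro: decompD simp: pr_same)
  finally show "tr UNIV (\<lambda>x. f (pr I W i x)) = tr (W i) f" .
 qed
 finally show ?thesis .
qed

lemma tr_gscale_comp:
 assumes d: "decomp I W" and f: "lin f" "\<And>i x. i \<in> I ==> x \<in> W i ==> f x \<in> W i"
  and nil: "\<And>i x. i \<in> I ==> x \<in> W i ==> \<exists>N. (shift f (a i) ^^ N) x = 0"
 shows "tr UNIV (\<lambda>x. gscale I W c (f x)) = (\<Sum>i\<in>I. c i * a i * of_nat (dim (W i)))"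
proof -
 have "tr UNIV (\<lambda>x. gscale I W c (f x)) = (\<Sum>i\<in>I. tr (W i) (\<lambda>x. gscale I W c (f x)))"
  by (rule tr_decomp[OF d]) (use f d in \<open>auto intro: lin_compose lin_gscale simp: gscale_on subspace_scale decompD\<close>)
 also have "\<dots> = (\<Sum>i\<in>I. c i * a i * of_nat (dim (W i)))"
 proof (intro sum.cong refl)
  fix i assume i: "i \<in> I"
  have "tr (W i) (\<lambda>x. gscale I W c (f x)) = tr (W i) (\<lambda>x. c i *s f x)"
   using d f i by (intro tr_cong) (auto intro: lin_compose lin_gscale lin_smult decompD simp: gscale_on subspace_scale decompD)
  also have "\<dots> = c i * tr (W i) f" using d f i by (intro tr_smult) (auto intro: decompD)
  also have "tr (W i) f = a i * of_nat (dim (W i))"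
   using d f i nil by (intro tr_single) (auto intro: decompD)
  finally show "tr (W i) (\<lambda>x. gscale I W c (f x)) = c i * a i * of_nat (dim (W i))" by (simp add: mult.assoc)
 qed
 finally show ?thesis .
qed

lemma span_UN_sum:
 assumes "\<And>i. i \<in> J ==> subspace (W i)" "x \<in> span (\<Union>i\<in>J. W i)"
 shows "\<exists>I u. finite I \<and> I \<subseteq> J \<and> (\<forall>i\<in>I. u i \<in> W i) \<and> x = (\<Sum>i\<in>I. u i)"
 using assms(2)
proof (induction rule: span_induct_alt)
 case base
 show ?case by (intro exI[of _ "{}"]) auto
next
 case (step c x y)
 then obtain j where j: "j \<in> J" "x \<in> W j" by auto
 from step obtain I u where I: "finite I" "I \<subseteq> J" "\<forall>i\<in>I. u i \<in> W i" "y = (\<Sum>i\<in>I. u i)" by auto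
 define v where "v = (\<lambda>i. if i = j then (if j \<in> I then u j else 0) + c *s x else u i)"
 have "c *s x + y = (\<Sum>i\<in>insert j I. v i)"
 proof (cases "j \<in> I")
  case True
  have "(\<Sum>i\<in>insert j I. v i) = v j + (\<Sum>i\<in>I - {j}. v i)"
   using I(1) True by (simp add: insert_absorb sum.remove)
  also have "(\<Sum>i\<in>I - {j}. v i) = (\<Sum>i\<in>I - {j}. u i)" by (intro sum.cong) (auto simp: v_def)
  finally show ?thesis using I True by (simp add: v_def sum.remove[of I j] algebra_simps)
 next
  case False
  then have "(\<Sum>i\<in>I. v i) = (\<Sum>i\<in>I. u i)" by (intro sum.cong) (auto simp: v_def)
  then show ?thesis using I False by (simp add: v_def)
 qed
 moreover have "\<forall>i\<in>insert j I. v i \<in> W i"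
  using assms(1) j I by (auto simp: v_def subspace_add subspace_scale subspace_0)
 ultimately show ?case using I j by (intro exI[of _ "insert j I"] exI[of _ v]) auto
qed

definition ssum :: "'i set \<Rightarrow> ('i \<Rightarrow> 'a set) \<Rightarrow> 'a set" where
 "ssum I W = {x. \<exists>u. (\<forall>i\<in>I. u i \<in> W i) \<and> x = (\<Sum>i\<in>I. u i)}"

lemma span_UN_ssum:
 assumes "\<And>i. i \<in> J ==> subspace (W i)" "x \<in> span (\<Union>i\<in>J. W i)"
 shows "\<exists>I. finite I \<and> I \<subseteq> J \<and> x \<in> ssum I W"
proof -
 have "\<exists>I u. finite I \<and> I \<subseteq> J \<and> (\<forall>i\<in>I. u i \<in> W i) \<and> x = (\<Sum>i\<in>I. u i)"
  by (rule span_UN_sum) (use assms in auto)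
 then obtain I u
  where "finite I" "I \<subseteq> J" "\<forall>i\<in>I. u i \<in> W i" "x = (\<Sum>i\<in>I. u i)" by (elim exE conjE) (rule that)
 then show ?thesis unfolding ssum_def by (intro exI[of _ I] conjI CollectI exI[of _ u])
qed

lemma ssum_mono:
 assumes "\<And>i. i \<in> K ==> subspace (W i)" "x \<in> ssum I W" "I \<subseteq> K" "finite K"
 shows "x \<in> ssum K W"
proof -
 from assms(2) obtain u where u: "\<forall>i\<in>I. u i \<in> W i" "x = (\<Sum>i\<in>I. u i)"
  unfolding ssum_def by (elim CollectE exE conjE) (rule that)
 have "x = (\<Sum>i\<in>K. if i \<in> I then u i else 0)"
  using assms u by (simp add: sum.If_cases Int_absorb1)
 moreover have "\<forall>i\<in>K. (if i \<in> I then u i else 0) \<in> W i" using u assms by (auto simp: subspace_0)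
 ultimately show ?thesis unfolding ssum_def by (intro CollectI exI conjI)
qed

lemma ssum_span: "x \<in> ssum I W ==> x \<in> span (\<Union>i\<in>I. W i)"
 unfolding ssum_def by (auto intro!: span_sum intro: span_base)

lemma decomp_iff_ssum:
 "decomp I W \<longleftrightarrow> finite I \<and> (\<forall>i\<in>I. subspace (W i)) \<and> (\<forall>x. x \<in> ssum I W) \<and>
  (\<forall>u. (\<forall>i\<in>I. u i \<in> W i) \<and> (\<Sum>i\<in>I. u i) = 0 \<longrightarrow> (\<forall>i\<in>I. u i = 0))"
 unfolding decomp_def ssum_def mem_Collect_eq ..

text \<open>Finitely many of the \<open>W j\<close> suffice to express the finite
  \<open>Basis\<close>; independence then leaves no room for a further non-zero
  \<open>W j\<close>.\<close>

lemma decomp_exists: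
 assumes sub: "\<And>i. i \<in> J ==> subspace (W i)" and span: "\<And>x. x \<in> span (\<Union>i\<in>J. W i)"
  and ind: "\<And>I u i. finite I ==> I \<subseteq> J ==> (\<And>i. i \<in> I ==> u i \<in> W i) ==> (\<Sum>i\<in>I. u i) = 0 ==> i \<in> I ==> u i = 0"
 shows "finite {i\<in>J. W i \<noteq> {0}}" "decomp {i\<in>J. W i \<noteq> {0}} W"
proof -
 have "\<forall>b\<in>Basis. \<exists>I. finite I \<and> I \<subseteq> J \<and> b \<in> ssum I W"
  using span_UN_ssum[OF sub span] by simp
 from bchoice[OF this] obtain I where I: "\<And>b. b \<in> Basis ==> finite (I b) \<and> I b \<subseteq> J \<and> b \<in> ssum (I b) W"
  by blast
 define K where "K = (\<Union>b\<in>Basis. I b)"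
 have K: "finite K" "K \<subseteq> J" using I finite_Basis by (auto simp: K_def)
 have spanK: "span (\<Union>i\<in>K. W i) = UNIV"
 proof -
  have "Basis \<subseteq> span (\<Union>i\<in>K. W i)"
  proof
   fix b assume b: "b \<in> Basis"
   have "b \<in> ssum K W" by (rule ssum_mono[of _ _ _ "I b"]) (use b I K sub in \<open>auto simp: K_def\<close>)
   then show "b \<in> span (\<Union>i\<in>K. W i)" by (rule ssum_span)
  qed
  then show ?thesis using span_Basis span_minimal subspace_span by blast
 qed
 have dec: "x \<in> ssum K W" for x
 proof -
  have "\<exists>I'. finite I' \<and> I' \<subseteq> K \<and> x \<in> ssum I' W"
   by (rule span_UN_ssum) (use sub K spanK in auto)
  then obtain I' where I': "I' \<subseteq> K" "x \<in> ssum I' W" by blast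
  show ?thesis by (rule ssum_mono[OF _ I'(2,1) K(1)]) (use sub K in auto)
 qed
 have sK: "{i\<in>J. W i \<noteq> {0}} \<subseteq> K"
 proof
  fix j assume "j \<in> {i\<in>J. W i \<noteq> {0}}"
  then have j: "j \<in> J" "W j \<noteq> {0}" by auto
  then obtain x where x: "x \<in> W j" "x \<noteq> 0" using subspace_0[OF sub[OF j(1)]] by blast
  show "j \<in> K"
  proof (rule ccontr)
   assume nj: "j \<notin> K"
   from dec[of x] obtain u where u: "\<forall>i\<in>K. u i \<in> W i" "x = (\<Sum>i\<in>K. u i)"
    unfolding ssum_def by (elim CollectE exE conjE) (rule that)
   define v where "v = (\<lambda>i. if i = j then - x else u i)"
   have "(\<Sum>i\<in>K. v i) = (\<Sum>i\<in>K. u i)" using nj by (intro sum.cong) (auto simp: v_def)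
   then have "(\<Sum>i\<in>insert j K. v i) = 0" using nj K u(2) by (simp add: v_def)
   moreover have "v i \<in> W i" if "i \<in> insert j K" for i
    using that u(1) x(1) sub[OF j(1)] by (auto simp: v_def subspace_neg)
   ultimately have "v j = 0" using ind[of "insert j K" v j] K j by auto
   then show False using x by (simp add: v_def)
  qed
 qed
 show f: "finite {i\<in>J. W i \<noteq> {0}}" using sK K finite_subset by blast
 have "x \<in> ssum {i\<in>J. W i \<noteq> {0}} W" for x
 proof -
  from dec[of x] obtain u where u: "\<forall>i\<in>K. u i \<in> W i" "x = (\<Sum>i\<in>K. u i)"
   unfolding ssum_def by (elim CollectE exE conjE) (rule that)
  have "(\<Sum>i\<in>K. u i) = (\<Sum>i\<in>{i\<in>J. W i \<noteq> {0}}. u i)"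
   by (rule sum.mono_neutral_right) (use K sK u(1) in auto)
  then have "x = (\<Sum>i\<in>{i\<in>J. W i \<noteq> {0}}. u i)" using u(2) by simp
  moreover have "\<forall>i\<in>{i\<in>J. W i \<noteq> {0}}. u i \<in> W i" using u(1) sK by blast
  ultimately show ?thesis unfolding ssum_def by (intro CollectI exI conjI)
 qed
 then show "decomp {i\<in>J. W i \<noteq> {0}} W"
  unfolding decomp_iff_ssum
  by (intro conjI allI impI ballI f) (use sub ind[OF f] in auto)
qed

end

context fdvs begin

subsection \<open>Generalized eigenspaces\<close>

definition geig :: "('a \<Rightarrow> 'a) \<Rightarrow> 'k \<Rightarrow> 'a set" where
 "geig f a = {x. \<exists>N. (shift f a ^^ N) x = 0}"

lemma funpow_zero_mono:
 assumes "lin g" "(g ^^ N) x = 0" "N \<le> M" shows "(g ^^ M) x = 0"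
proof -
 obtain d where "M = d + N" using assms(3) by (metis add.commute le_Suc_ex)
 then show ?thesis using assms lin_zero[OF lin_funpow[OF assms(1)]] by (simp add: funpow_add)
qed

lemma subspace_geig: assumes "lin f" shows "subspace (geig f a)"
proof (rule subspaceI)
 show "0 \<in> geig f a" unfolding geig_def by (auto intro!: exI[of _ 0])
next
 fix x y assume "x \<in> geig f a" "y \<in> geig f a"
 then obtain N M where N: "(shift f a ^^ N) x = 0" "(shift f a ^^ M) y = 0" by (auto simp: geig_def)
 have "(shift f a ^^ max N M) (x + y) = 0"
  using funpow_zero_mono[OF lin_shift[OF assms] N(1), of "max N M"]
   funpow_zero_mono[OF lin_shift[OF assms] N(2), of "max N M"]
  by (simp add: lin_add[OF lin_funpow[OF lin_shift[OF assms]]])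
 then show "x + y \<in> geig f a" by (auto simp: geig_def)
next
 fix c x assume "x \<in> geig f a"
 then show "c *s x \<in> geig f a"
  by (auto simp: geig_def lin_scale[OF lin_funpow[OF lin_shift[OF assms]]] intro: exI)
qed

lemma shift_comm: "lin g ==> (\<And>x. f (g x) = g (f x)) ==> (shift f a ^^ N) (g x) = g ((shift f a ^^ N) x)"
 by (induction N) (simp_all add: shift_def lin_diff lin_scale)

lemma geig_stable:
 assumes "lin g" "\<And>x. f (g x) = g (f x)" "x \<in> geig f a" shows "g x \<in> geig f a"
proof -
 obtain N where N: "(shift f a ^^ N) x = 0" using assms(3) by (auto simp: geig_def)
 have "(shift f a ^^ N) (g x) = g ((shift f a ^^ N) x)"
  by (rule shift_comm[of g f]) (rule assms)+
 then have "(shift f a ^^ N) (g x) = 0" using N lin_zero[OF assms(1)] by simp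
 then show ?thesis by (auto simp: geig_def)
qed

lemma geig_stable_self: "lin f ==> x \<in> geig f a ==> f x \<in> geig f a"
 by (rule geig_stable[of f f]) auto

lemma eig_geig: "f x = a *s x ==> x \<in> geig f a"
 unfolding geig_def by (auto intro!: exI[of _ 1] simp: shift_def)

lemma shift_stable: "subspace W ==> (\<And>x. x \<in> W ==> f x \<in> W) ==> x \<in> W ==> shift f a x \<in> W"
 by (simp add: shift_def subspace_diff subspace_scale)

text \<open>Modulo the stable subspace \<open>W\<close>, \<open>f - b\<close> is injective on
  \<open>geig f a\<close>, since it differs from the non-zero scalar \<open>a - b\<close> by the
  locally nilpotent \<open>f - a\<close>.\<close>

lemma geig_sep:
 assumes f: "lin f" and W: "subspace W" "\<And>x. x \<in> W ==> f x \<in> W" and ne: "a \<noteq> b"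
  and y: "y \<in> geig f a" "shift f b y \<in> W"
 shows "y \<in> W"
proof -
 obtain N where "(shift f a ^^ N) y = 0" using y(1) by (auto simp: geig_def)
 then show ?thesis using y(2)
 proof (induction N arbitrary: y)
  case 0 then show ?case using W by (simp add: subspace_0)
 next
  case (Suc N)
  define z where "z = shift f a y"
  have "(shift f a ^^ N) z = 0" using Suc.prems(1) by (simp add: z_def funpow_swap1)
  moreover have "shift f b z = shift f a (shift f b y)"
   by (simp add: z_def shift_def lin_diff[OF f] lin_scale[OF f] algebra_simps)
  then have "shift f b z \<in> W" using shift_stable[OF W] Suc.prems(2) by simp
  ultimately have z: "z \<in> W" by (rule Suc.IH)
  have "shift f b y = z + (a - b) *s y" by (simp add: z_def shift_def algebra_simps)
  then have "(a - b) *s y = shift f b y - z" by simp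
  then have "(a - b) *s y \<in> W" using Suc.prems(2) z W by (simp add: subspace_diff)
  then have "inverse (a - b) *s ((a - b) *s y) \<in> W" using W subspace_scale by blast
  then show ?case using ne by simp
 qed
qed

lemma geig_sep_pow:
 assumes f: "lin f" and W: "subspace W" "\<And>x. x \<in> W ==> f x \<in> W" and ne: "a \<noteq> b"
 shows "y \<in> geig f a ==> (shift f b ^^ N) y \<in> W ==> y \<in> W"
proof (induction N arbitrary: y)
 case (Suc N)
 have "shift f b y \<in> geig f a"
  using Suc.prems(1) f by (intro shift_stable subspace_geig geig_stable_self)
 moreover have "(shift f b ^^ N) (shift f b y) \<in> W" using Suc.prems(2) by (simp add: funpow_swap1)
 ultimately have "shift f b y \<in> W" by (rule Suc.IH)
 then show ?case using geig_sep[OF f W ne Suc.prems(1)] by simp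
qed simp

text \<open>A power of \<open>f - b\<close> kills the term at \<open>b\<close> and shortens the sum;
  \<open>geig_sep_pow\<close> then recovers the remaining terms. The case \<open>W = {0}\<close> is
  the independence of the generalized eigenspaces.\<close>

lemma geig_comp:
 assumes f: "lin f" and W: "subspace W" "\<And>x. x \<in> W ==> f x \<in> W"
 shows "finite A ==> (\<And>a. a \<in> A ==> u a \<in> geig f a) ==> (\<Sum>a\<in>A. u a) \<in> W ==> a \<in> A ==> u a \<in> W"
proof (induction A arbitrary: u a rule: finite_induct)
 case (insert b A)
 have "u b \<in> geig f b" using insert.prems by simp
 then obtain N where N: "(shift f b ^^ N) (u b) = 0" by (auto simp: geig_def)
 let ?S = "shift f b ^^ N"
 have lS: "lin ?S" by (intro lin_funpow lin_shift f)
 have "?S (\<Sum>a\<in>insert b A. u a) \<in> W"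
  by (rule funpow_stable[OF shift_stable[OF W] insert.prems(2)])
 then have "(\<Sum>a\<in>A. ?S (u a)) \<in> W" using insert.hyps N by (simp add: lin_add[OF lS] lin_sum[OF lS])
 then have "?S (u c) \<in> W" if "c \<in> A" for c
  using that insert.prems(1) f
  by (intro insert.IH[of "\<lambda>a. ?S (u a)"] funpow_stable shift_stable subspace_geig geig_stable_self) auto
 then have A: "u c \<in> W" if "c \<in> A" for c
  using geig_sep_pow[OF f W _ insert.prems(1)[of c], where b = b and N = N] that insert.hyps by auto
 then have "(\<Sum>a\<in>insert b A. u a) - (\<Sum>a\<in>A. u a) \<in> W"
  by (rule subspace_diff[OF W(1) insert.prems(2) subspace_sum[OF W(1)]])
 then have "u b \<in> W" using insert.hyps by simp
 then show ?case using A insert.prems by auto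
qed simp

text \<open>On \<open>geig f c\<close> the map \<open>f - a\<close> is a non-zero scalar plus a
  nilpotent map, hence onto; the induction is on the exponent that kills \<open>y\<close>.\<close>

lemma geig_solve:
 assumes f: "lin f" and ne: "a \<noteq> c" and y: "y \<in> geig f c"
 shows "\<exists>z\<in>geig f c. shift f a z = y"
proof -
 obtain N where "(shift f c ^^ N) y = 0" using y by (auto simp: geig_def)
 then show ?thesis using y
 proof (induction N arbitrary: y)
  case 0 then show ?case by (auto intro!: bexI[of _ 0] simp: lin_zero[OF lin_shift[OF f]] subspace_0[OF subspace_geig[OF f]])
 next
  case (Suc N)
  have m: "shift f c y \<in> geig f c" using Suc.prems(2) f by (intro shift_stable subspace_geig geig_stable_self)
  obtain z where z: "z \<in> geig f c" "shift f a z = shift f c y"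
   using Suc.IH[OF _ m] Suc.prems(1) by (auto simp: funpow_swap1)
  have "shift f a (y - z) = (c - a) *s y"
   using z(2) by (simp add: lin_diff[OF lin_shift[OF f]]) (simp add: shift_def algebra_simps)
  then have "shift f a (inverse (c - a) *s (y - z)) = y"
   using ne by (simp add: lin_scale[OF lin_shift[OF f]])
  moreover have "inverse (c - a) *s (y - z) \<in> geig f c"
   using Suc.prems(2) z subspace_geig[OF f] by (intro subspace_scale subspace_diff)
  ultimately show ?case by blast
 qed
qed

text \<open>Horner's scheme for the vector \<open>p(f) x\<close>.\<close>

definition pev :: "'k poly \<Rightarrow> ('a \<Rightarrow> 'a) \<Rightarrow> 'a \<Rightarrow> 'a" where
 "pev p f x = fold_coeffs (\<lambda>c y. c *s x + f y) p 0"

lemma pev_0: "pev 0 f x = 0" by (simp add: pev_def)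

lemma pev_pCons: "lin f ==> pev (pCons c p) f x = c *s x + f (pev p f x)"
 by (cases "p = 0 \<and> c = 0") (auto simp: pev_def lin_zero)

lemma pev_add: "lin f ==> pev (p + q) f x = pev p f x + pev q f x"
 by (induction p q rule: poly_induct2) (simp_all add: pev_0 pev_pCons lin_add algebra_simps)

lemma pev_smult: "lin f ==> pev (smult c p) f x = c *s pev p f x"
 by (induction p) (simp_all add: pev_0 pev_pCons lin_scale algebra_simps)

lemma pev_linear: "lin f ==> pev ([:- a, 1:] * q) f x = shift f a (pev q f x)"
proof -
 assume f: "lin f"
 have "[:- a, 1:] * q = smult (- a) q + pCons 0 q" by simp
 then show ?thesis by (simp only: pev_add[OF f] pev_smult[OF f] pev_pCons[OF f]) (simp add: shift_def)
qed

lemma pev_shift: "lin f ==> pev q f (shift f a x) = shift f a (pev q f x)"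
proof (induction q)
 case 0 then show ?case by (simp add: pev_0 lin_zero lin_shift)
next
 case (pCons c q)
 have "f (shift f a y) = shift f a (f y)" for y
  using pCons.prems by (simp add: shift_def lin_diff lin_scale)
 then show ?case using pCons
  by (simp add: pev_pCons lin_add[OF lin_shift] lin_scale[OF lin_shift])
qed

lemma pev_monom: assumes f: "lin f" shows "pev (monom 1 k) f x = (f ^^ k) x"
proof (induction k)
 case 0
 show ?case unfolding monom_0 pev_pCons[OF f] pev_0 lin_zero[OF f] by simp
next
 case (Suc k)
 show ?case unfolding monom_Suc pev_pCons[OF f] Suc.IH by simp
qed

text \<open>In finite dimension some iterate \<open>f^k x\<close> depends linearly on the lower
  ones.\<close>

lemma annihilating_poly:
 assumes f: "lin f" shows "\<exists>p. p \<noteq> 0 \<and> pev p f x = 0"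
proof -
 have "\<exists>k. (f ^^ k) x \<in> span ((\<lambda>i. (f ^^ i) x) ` {..<k})"
 proof (rule ccontr)
  assume n: "\<nexists>k. (f ^^ k) x \<in> span ((\<lambda>i. (f ^^ i) x) ` {..<k})"
  have "independent ((\<lambda>i. (f ^^ i) x) ` {..<k}) \<and> card ((\<lambda>i. (f ^^ i) x) ` {..<k}) = k" for k
  proof (induction k)
   case (Suc k)
   let ?S = "(\<lambda>i. (f ^^ i) x) ` {..<k}"
   have ns: "(f ^^ k) x \<notin> span ?S" using n by simp
   then have nn: "(f ^^ k) x \<notin> ?S" using span_base by metis
   have "(\<lambda>i. (f ^^ i) x) ` {..<Suc k} = insert ((f ^^ k) x) ?S" unfolding lessThan_Suc by (rule image_insert)
   moreover have "independent (insert ((f ^^ k) x) ?S)" using Suc ns by (intro independent_insertI) auto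
   moreover have "card (insert ((f ^^ k) x) ?S) = Suc k" using Suc nn by (subst card_insert_disjoint) auto
   ultimately show ?case by (simp only: simp_thms)
  qed (simp add: independent_empty)
  from this[of "Suc (card Basis)"] show False
   using independent_card_le_dim[of "(\<lambda>i. (f ^^ i) x) ` {..<Suc (card Basis)}" UNIV] by simp
 qed
 then obtain k where k: "(f ^^ k) x \<in> span ((\<lambda>i. (f ^^ i) x) ` {..<k})" by blast
 \<comment> \<open>The condition \<open>coeff q k = 0\<close> ensures that
   \<open>monom 1 k - q\<close> is non-zero: its coefficient at \<open>k\<close> is
   \<open>1\<close>.\<close>
 let ?R = "{pev q f x | q. coeff q k = 0 \<and> degree q \<le> k}"
 have "span ((\<lambda>i. (f ^^ i) x) ` {..<k}) \<subseteq> ?R"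
 proof (rule span_minimal)
  show "(\<lambda>i. (f ^^ i) x) ` {..<k} \<subseteq> ?R"
  proof
   fix y assume "y \<in> (\<lambda>i. (f ^^ i) x) ` {..<k}"
   then obtain i where i: "i < k" "y = (f ^^ i) x" by auto
   then show "y \<in> ?R" using pev_monom[OF f]
    by (auto intro!: exI[of _ "monom 1 i"] simp: degree_monom_eq)
  qed
  show "subspace ?R"
  proof (rule subspaceI)
   show "0 \<in> ?R" by (auto intro!: exI[of _ 0] simp: pev_0)
  next
   fix x1 y1 assume "x1 \<in> ?R" "y1 \<in> ?R"
   then obtain p q where "x1 = pev p f x" "y1 = pev q f x" "coeff p k = 0" "coeff q k = 0" "degree p \<le> k" "degree q \<le> k" by auto
   then show "x1 + y1 \<in> ?R" by (auto intro!: exI[of _ "p + q"] simp: pev_add[OF f] degree_add_le)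
  next
   fix c x1 assume "x1 \<in> ?R"
   then obtain p where "x1 = pev p f x" "coeff p k = 0" "degree p \<le> k" by auto
   then show "c *s x1 \<in> ?R" by (auto intro!: exI[of _ "smult c p"] simp: pev_smult[OF f])
  qed
 qed
 then obtain q where q: "(f ^^ k) x = pev q f x" "coeff q k = 0" using k by auto
 have "pev (monom 1 k + smult (-1) q) f x = 0"
  using q by (simp add: pev_add[OF f] pev_smult[OF f] pev_monom[OF f] del: smult_minus_left)
 moreover have "coeff (monom 1 k + smult (-1) q) k = 1" using q by simp
 then have "monom 1 k + smult (-1) q \<noteq> 0" by (metis coeff_0 zero_neq_one)
 ultimately show ?thesis by blast
qed

text \<open>Induct on the degree of an annihilating polynomial. For a root \<open>a\<close> of it,
  \<open>(f - a) x\<close> lies in the span \<open>?E\<close> by induction; \<open>split\<close>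
  writes it as \<open>(f - a) z + w\<close> with \<open>w\<close> in \<open>geig f a\<close>, so
  \<open>x - z\<close> is a generalized eigenvector.\<close>

lemma geig_span:
 assumes ac: "alg_closed_field TYPE('k)" and f: "lin f"
 shows "x \<in> span (\<Union>a. geig f a)"
proof -
 let ?E = "span (\<Union>a. geig f a)"
 have split: "\<exists>z\<in>?E. \<exists>w\<in>geig f a. y = shift f a z + w" if "y \<in> ?E" for a y
  using that
 proof (induction rule: span_induct_alt)
  case base
  show ?case using lin_zero[OF lin_shift[OF f]] span_zero subspace_0[OF subspace_geig[OF f]]
   by (intro bexI[of _ 0]) auto
 next
  case (step c x y)
  then obtain b where b: "x \<in> geig f b" by auto
  obtain z w where zw: "z \<in> ?E" "w \<in> geig f a" "y = shift f a z + w" using step by auto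
  show ?case
  proof (cases "b = a")
   case True
   then show ?thesis using b zw subspace_geig[OF f]
    by (intro bexI[of _ z] bexI[of _ "c *s x + w"]) (auto simp: subspace_add subspace_scale)
  next
   case False
   then obtain t where t: "t \<in> geig f b" "shift f a t = x" using geig_solve[OF f _ b] by metis
   have "t \<in> ?E" using t by (auto intro: span_base)
   then show ?thesis using zw t
    by (intro bexI[of _ "c *s t + z"] bexI[of _ w])
     (auto simp: lin_add[OF lin_shift[OF f]] lin_scale[OF lin_shift[OF f]] span_add span_scale)
  qed
 qed
 have "p \<noteq> 0 ==> pev p f x = 0 ==> x \<in> ?E" for p x
 proof (induction "degree p" arbitrary: p x)
  case 0
  then obtain c where "p = [:c:]" by (metis degree_eq_zeroE)
  then show ?case using 0 by (auto simp: pev_pCons[OF f] pev_0 lin_zero[OF f] span_zero)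
 next
  case (Suc d)
  then obtain a where "poly p a = 0" using ac unfolding alg_closed_field_def by (metis le_add1 plus_1_eq_Suc)
  then obtain q where q: "p = [:- a, 1:] * q" using poly_eq_0_iff_dvd by (metis dvdE)
  have q0: "q \<noteq> 0" using q Suc.prems by auto
  have "degree p = degree [:- a, 1:] + degree q" unfolding q by (rule degree_mult_eq) (use q0 in auto)
  then have dq: "d = degree q" using Suc.hyps(2) by simp
  have "pev q f (shift f a x) = 0" using Suc.prems q by (simp add: pev_shift[OF f] pev_linear[OF f] del: mult_pCons_left)
  then have "shift f a x \<in> ?E" using Suc.hyps(1)[OF dq q0] by simp
  then obtain z w where zw: "z \<in> ?E" "w \<in> geig f a" "shift f a x = shift f a z + w" using split by blast
  then have "shift f a (x - z) \<in> geig f a" by (simp add: lin_diff[OF lin_shift[OF f]])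
  then obtain N where "(shift f a ^^ N) (shift f a (x - z)) = 0" by (auto simp: geig_def)
  then have "(shift f a ^^ Suc N) (x - z) = 0" by (simp add: funpow_swap1)
  then have "x - z \<in> geig f a" unfolding geig_def by blast
  then have "x - z \<in> ?E" by (auto intro: span_base)
  then have "(x - z) + z \<in> ?E" using zw(1) span_add by blast
  then show ?case by simp
 qed
 then show ?thesis using annihilating_poly[OF f] by blast
qed

lemma geig_decomp:
 assumes ac: "alg_closed_field TYPE('k)" and f: "lin f"
 shows "finite {a. geig f a \<noteq> {0}}" "decomp {a. geig f a \<noteq> {0}} (geig f)"
proof -
 have i: "u i = 0" if "finite I" "\<And>i. i \<in> I ==> u i \<in> geig f i" "(\<Sum>i\<in>I. u i) = 0" "i \<in> I" for I u i
 proof -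
  have "u i \<in> {0}"
   by (rule geig_comp[OF f subspace_single_0 _ that(1), of u]) (use that(2-4) lin_zero[OF f] in auto)
  then show ?thesis by simp
 qed
 have "finite {a \<in> UNIV. geig f a \<noteq> {0}}" "decomp {a \<in> UNIV. geig f a \<noteq> {0}} (geig f)"
  by (rule decomp_exists, rule subspace_geig[OF f], rule geig_span[OF ac f], rule i; assumption)+
 then show "finite {a. geig f a \<noteq> {0}}" "decomp {a. geig f a \<noteq> {0}} (geig f)" by simp_all
qed

subsection \<open>Simultaneous eigenspaces\<close>

definition jeig :: "'t set \<Rightarrow> ('t \<Rightarrow> 'a \<Rightarrow> 'a) \<Rightarrow> ('t \<Rightarrow> 'k) \<Rightarrow> 'a set" where
 "jeig T f \<chi> = {x. \<forall>t\<in>T. f t x = \<chi> t *s x}"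

lemma subspace_jeig: "(\<And>t. t \<in> T ==> lin (f t)) ==> subspace (jeig T f \<chi>)"
 by (rule subspaceI) (auto simp: jeig_def lin_zero lin_add lin_scale scale_right_distrib mult.commute)

text \<open>An operator that separates \<open>\<chi>\<close> from \<open>b\<close> can be shifted to
  kill the term at \<open>b\<close> and to multiply the term at \<open>\<chi>\<close> by a non-zero
  scalar. Indices are kept apart from the characters \<open>c\<close> so that pairs of a weight and
  a degree may serve as indices.\<close>

lemma jeig_comp:
 assumes f: "\<And>t. t \<in> T ==> lin (f t)" and W: "subspace W" "\<And>t x. t \<in> T ==> x \<in> W ==> f t x \<in> W"
 shows "finite X ==> (\<And>\<chi> \<psi>. \<chi> \<in> X ==> \<psi> \<in> X ==> \<chi> \<noteq> \<psi> ==> \<exists>t\<in>T. c \<chi> t \<noteq> c \<psi> t) ==>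
  (\<And>\<chi>. \<chi> \<in> X ==> u \<chi> \<in> jeig T f (c \<chi>)) ==> (\<Sum>\<chi>\<in>X. u \<chi>) \<in> W ==> \<chi> \<in> X ==> u \<chi> \<in> W"
proof (induction X arbitrary: u \<chi> rule: finite_induct)
 case (insert b X)
 have A: "u \<chi> \<in> W" if \<chi>: "\<chi> \<in> X" for \<chi>
 proof -
  have "\<chi> \<noteq> b" using \<chi> insert.hyps by auto
  then obtain t where t: "t \<in> T" "c \<chi> t \<noteq> c b t" using insert.prems(1)[of \<chi> b] \<chi> by auto
  let ?S = "shift (f t) (c b t)"
  have lS: "lin ?S" using f t by (intro lin_shift) auto
  have S: "?S (u \<psi>) = (c \<psi> t - c b t) *s u \<psi>" if "\<psi> \<in> insert b X" for \<psi>
   using insert.prems(2)[OF that] t(1) by (simp add: jeig_def shift_def scale_left_diff_distrib)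
  have "?S (\<Sum>\<psi>\<in>insert b X. u \<psi>) \<in> W"
   using W t by (intro shift_stable insert.prems(3)) auto
  moreover have "?S (\<Sum>\<psi>\<in>insert b X. u \<psi>) = (\<Sum>\<psi>\<in>X. (c \<psi> t - c b t) *s u \<psi>)"
   using insert.hyps S by (simp add: lin_add[OF lS] lin_sum[OF lS])
  ultimately have "(\<Sum>\<psi>\<in>X. (c \<psi> t - c b t) *s u \<psi>) \<in> W" by simp
  then have "(c \<chi> t - c b t) *s u \<chi> \<in> W"
   using insert.prems(1,2) \<chi> f
   by (intro insert.IH[of "\<lambda>\<psi>. (c \<psi> t - c b t) *s u \<psi>"] subspace_scale subspace_jeig) auto
  then have "inverse (c \<chi> t - c b t) *s ((c \<chi> t - c b t) *s u \<chi>) \<in> W" using W(1) subspace_scale by blast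
  then show ?thesis using t by simp
 qed
 then have "(\<Sum>a\<in>insert b X. u a) - (\<Sum>a\<in>X. u a) \<in> W"
  by (rule subspace_diff[OF W(1) insert.prems(3) subspace_sum[OF W(1)]])
 then have "u b \<in> W" using insert.hyps by simp
 then show ?case using A insert.prems by auto
qed simp

definition diagble :: "('a \<Rightarrow> 'a) \<Rightarrow> bool" where
 "diagble f \<longleftrightarrow> (\<forall>x. x \<in> span (\<Union>a. {x. f x = a *s x}))"

lemma diagble_gscale: assumes d: "decomp I W" shows "diagble (gscale I W c)"
 unfolding diagble_def
proof
 fix x
 have "pr I W i x \<in> (\<Union>a. {x. gscale I W c x = a *s x})" if "i \<in> I" for i
  using gscale_on[OF d that pr_mem[OF d that]] by blast
 then have "(\<Sum>i\<in>I. pr I W i x) \<in> span (\<Union>a. {x. gscale I W c x = a *s x})"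
  by (intro span_sum span_base)
 then show "x \<in> span (\<Union>a. {x. gscale I W c x = a *s x})" using sum_pr[OF d] by simp
qed

lemma subspace_eig: "lin f ==> subspace {x. f x = a *s x}"
 by (rule subspaceI) (auto simp: lin_zero lin_add lin_scale scale_right_distrib mult.commute)

text \<open>The joint eigenspaces of \<open>T\<close> inside \<open>W\<close> are stable under a
  further commuting operator, and \<open>geig_comp\<close> splits their vectors into eigenvectors of
  it.\<close>

lemma jeig_span:
 assumes "finite T" "\<And>t. t \<in> T ==> lin (f t)" "\<And>t. t \<in> T ==> diagble (f t)"
  "\<And>t s x. t \<in> T ==> s \<in> T ==> f t (f s x) = f s (f t x)"
  and W: "subspace W" "\<And>t x. t \<in> T ==> x \<in> W ==> f t x \<in> W" and "x \<in> W"
 shows "x \<in> span (\<Union>\<chi>. jeig T f \<chi> \<inter> W)"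
 using assms
proof (induction T arbitrary: x rule: finite_induct)
 case empty
 then show ?case by (intro span_base) (auto simp: jeig_def)
next
 case (insert t T)
 have "x \<in> span (\<Union>\<chi>. jeig T f \<chi> \<inter> W)"
  by (rule insert.IH) (rule insert.prems; simp)+
 moreover have "(\<Union>\<chi>. jeig T f \<chi> \<inter> W) \<subseteq> span (\<Union>\<chi>. jeig (insert t T) f \<chi> \<inter> W)"
 proof
  fix y assume "y \<in> (\<Union>\<chi>. jeig T f \<chi> \<inter> W)"
  then obtain \<chi> where y: "y \<in> jeig T f \<chi>" "y \<in> W" by auto
  have lt: "lin (f t)" by (rule insert.prems) simp
  have sub: "subspace (jeig T f \<chi> \<inter> W)"
   by (intro subspace_inter subspace_jeig insert.prems(4)) (rule insert.prems(1), simp)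
  have st: "f t z \<in> jeig T f \<chi> \<inter> W" if "z \<in> jeig T f \<chi> \<inter> W" for z
  proof -
   have "f s (f t z) = \<chi> s *s f t z" if "s \<in> T" for s
   proof -
    have "f s (f t z) = f t (f s z)" using that by (intro insert.prems(3)) auto
    then show ?thesis using that \<open>z \<in> _\<close> lin_scale[OF lt] by (auto simp: jeig_def)
   qed
   then show ?thesis using that insert.prems(5) by (auto simp: jeig_def)
  qed
  have "\<exists>A. finite A \<and> A \<subseteq> UNIV \<and> y \<in> ssum A (\<lambda>a. {x. f t x = a *s x})"
   by (rule span_UN_ssum[OF subspace_eig[OF lt]]) (use insert.prems(2) in \<open>auto simp: diagble_def\<close>)
  then obtain A where A0: "finite A" "y \<in> ssum A (\<lambda>a. {x. f t x = a *s x})" by blast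
  from A0(2) obtain u where "\<forall>a\<in>A. u a \<in> {x. f t x = a *s x}" "y = (\<Sum>a\<in>A. u a)"
   unfolding ssum_def by (elim CollectE exE conjE) (rule that)
  then have A: "finite A" "\<And>a. a \<in> A ==> f t (u a) = a *s u a" "y = (\<Sum>a\<in>A. u a)"
   using A0 by auto
  have u: "u a \<in> jeig (insert t T) f (\<chi>(t := a)) \<inter> W" if a: "a \<in> A" for a
  proof -
   have uW: "u a \<in> jeig T f \<chi> \<inter> W"
   proof (rule geig_comp[OF lt sub st A(1), of u])
    show "sum u A \<in> jeig T f \<chi> \<inter> W" using y A(3) by simp
    show "u a \<in> geig (f t) a" if "a \<in> A" for a using A(2)[OF that] by (rule eig_geig)
   qed (assumption | rule a)+
   have "f s (u a) = (\<chi>(t := a)) s *s u a" if "s \<in> insert t T" for s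
   proof (cases "s = t")
    case True then show ?thesis using A(2)[OF a] by simp
   next
    case False
    then have "s \<in> T" using that by simp
    then have "f s (u a) = \<chi> s *s u a" using uW unfolding jeig_def by blast
    then show ?thesis using False by simp
   qed
   then show ?thesis using uW unfolding jeig_def by blast
  qed
  have "(\<Sum>a\<in>A. u a) \<in> span (\<Union>\<chi>. jeig (insert t T) f \<chi> \<inter> W)"
  proof (rule span_sum)
   fix a assume "a \<in> A"
   show "u a \<in> span (\<Union>\<chi>. jeig (insert t T) f \<chi> \<inter> W)"
    by (rule span_base, rule UN_I[OF UNIV_I], rule u[OF \<open>a \<in> A\<close>])
  qed
  then show "y \<in> span (\<Union>\<chi>. jeig (insert t T) f \<chi> \<inter> W)" using A(3) by simp
 qed
 ultimately show ?case using span_minimal[OF _ subspace_span] by (meson subsetD)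
qed

end

text \<open>A rational-linear retraction of \<open>'k\<close> onto the rationals, found by extending
  \<open>1\<close> to a basis. It carries sums of squares out of the unordered field, both in
  \<open>kil_nonzero\<close> and in the form \<open>R\<close>.\<close>

lemma rational_functional:
 "\<exists>\<phi> :: 'k::field_char_0 \<Rightarrow> rat. (\<forall>x y. \<phi> (x + y) = \<phi> x + \<phi> y) \<and> (\<forall>r x. \<phi> (of_rat r * x) = r * \<phi> x) \<and> \<phi> 1 = 1"
proof -
 interpret A: vector_space "\<lambda>(r::rat) (x::'k). of_rat r * x"
  by unfold_locales (simp_all add: algebra_simps of_rat_add of_rat_mult)
 interpret B: vector_space "(*) :: rat \<Rightarrow> rat \<Rightarrow> rat"
  by unfold_locales (simp_all add: algebra_simps)
 interpret P: vector_space_pair "\<lambda>(r::rat) (x::'k). of_rat r * x" "(*) :: rat \<Rightarrow> rat \<Rightarrow> rat" ..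
 have "A.independent {1 :: 'k}" by simp
 from P.linear_independent_extend[OF this, of "\<lambda>_. 1"]
 obtain g where "Vector_Spaces.linear (\<lambda>(r::rat) (x::'k). of_rat r * x) (*) g" "g 1 = 1" by auto
 then show ?thesis unfolding Vector_Spaces.linear_iff by blast
qed

section \<open>Lie algebras and Engel's theorem\<close>

locale flie = fdvs scale Basis
 for scale :: "'k::field_char_0 \<Rightarrow> 'a::ab_group_add \<Rightarrow> 'a" (infixr "*s" 75) and Basis :: "'a set" +
 fixes br :: "'a \<Rightarrow> 'a \<Rightarrow> 'a"
 assumes ac: "alg_closed_field TYPE('k)"
  and lin_br: "\<And>x. Vector_Spaces.linear scale scale (br x)"
  and lin_br2: "\<And>y. Vector_Spaces.linear scale scale (\<lambda>x. br x y)"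
  and br_self: "\<And>x. br x x = 0"
  and jacobi0: "\<And>x y z. br x (br y z) + br y (br z x) + br z (br x y) = 0"
begin

lemma br_add_right: "br x (y + z) = br x y + br x z" by (rule lin_add[OF lin_br])
lemma br_add_left: "br (x + y) z = br x z + br y z" by (rule lin_add[OF lin_br2])
lemma br_scale_right: "br x (c *s y) = c *s br x y" by (rule lin_scale[OF lin_br])
lemma br_scale_left: "br (c *s x) y = c *s br x y" by (rule lin_scale[OF lin_br2])
lemma br_zero_right[simp]: "br x 0 = 0" by (rule lin_zero[OF lin_br])
lemma br_zero_left[simp]: "br 0 x = 0" by (rule lin_zero[OF lin_br2])
lemma br_neg_right: "br x (- y) = - br x y" by (rule lin_neg[OF lin_br])
lemma br_neg_left: "br (- x) y = - br x y" by (rule lin_neg[OF lin_br2])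
lemma br_diff_right: "br x (y - z) = br x y - br x z" by (rule lin_diff[OF lin_br])
lemma br_diff_left: "br (x - y) z = br x z - br y z" by (rule lin_diff[OF lin_br2])
lemma br_sum_right: "br x (\<Sum>i\<in>I. u i) = (\<Sum>i\<in>I. br x (u i))" by (rule lin_sum[OF lin_br])
lemma br_sum_left: "br (\<Sum>i\<in>I. u i) y = (\<Sum>i\<in>I. br (u i) y)" by (rule lin_sum[OF lin_br2])

lemmas br_lin = br_add_right br_add_left br_scale_right br_scale_left br_neg_right br_neg_left
 br_diff_right br_diff_left

lemma br_anti: "br x y = - br y x"
proof -
 have "br x x + br x y + (br y x + br y y) = 0"
  using br_self[of "x + y"] by (simp only: br_add_left br_add_right) (simp add: add_ac)
 then have "br x y + br y x = 0" by (simp add: br_self)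
 then show ?thesis by (simp add: eq_neg_iff_add_eq_0)
qed

lemma br_anti_zero: "br x y = 0 ==> br y x = 0"
 using br_anti[of y x] by simp

lemma jacobi: "br x (br y z) = br (br x y) z + br y (br x z)"
proof -
 have "br x (br y z) + br y (br z x) + br z (br x y) = 0" by (rule jacobi0)
 moreover have "br y (br z x) = - br y (br x z)" using br_anti[of z x] by (simp add: br_neg_right)
 moreover have "br z (br x y) = - br (br x y) z" by (rule br_anti)
 ultimately show ?thesis by (simp add: algebra_simps)
qed

lemma br_br_left: "br (br x y) z = br x (br y z) - br y (br x z)"
 using jacobi[of x y z] by simp

definition subalg :: "'a set \<Rightarrow> bool" where
 "subalg K \<longleftrightarrow> subspace K \<and> (\<forall>x\<in>K. \<forall>y\<in>K. br x y \<in> K)"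

lemma last_nonmember:
 assumes "(g ^^ N) w \<in> U" "w \<notin> U"
 shows "\<exists>k. (g ^^ k) w \<notin> U \<and> g ((g ^^ k) w) \<in> U"
 using assms
proof (induction N)
 case (Suc N)
 then show ?case by (cases "(g ^^ N) w \<in> U") auto
qed simp

text \<open>Engel's theorem for a section \<open>W/U\<close> of the adjoint representation; formulating it for sections
 avoids quotient spaces.\<close>

lemma engel_section:
 assumes "subalg K" "subspace U" "subspace W" "U \<subseteq> W" "w0 \<in> W" "w0 \<notin> U"
  "\<And>x w. x \<in> K ==> w \<in> W ==> br x w \<in> W" "\<And>x w. x \<in> K ==> w \<in> U ==> br x w \<in> U"
  "\<And>x w. x \<in> K ==> w \<in> W ==> \<exists>N. (br x ^^ N) w \<in> U"
  "\<And>x y. x \<in> K ==> y \<in> K ==> \<exists>N. (br x ^^ N) y = 0"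
 shows "\<exists>w\<in>W. w \<notin> U \<and> (\<forall>x\<in>K. br x w \<in> U)"
 using assms
proof (induction "dim K" arbitrary: K U W w0 rule: less_induct)
 case less
 note K = less.prems(1) and U = less.prems(2) and W = less.prems(3)
 have sK: "subspace K" and cK: "\<And>x y. x \<in> K ==> y \<in> K ==> br x y \<in> K" using K by (auto simp: subalg_def)
 show ?case
 proof (cases "K = {0}")
  case True
  then show ?thesis using less.prems(5,6) subspace_0[OF U] by auto
 next
  case False
  \<comment> \<open>A proper subalgebra \<open>M\<close> of maximal dimension is taken. Induction
    for \<open>M\<close> acting on \<open>K/M\<close> gives a \<open>z\<close> outside
    \<open>M\<close> that normalizes \<open>M\<close>, and maximality makes \<open>K\<close> the sum
    of \<open>M\<close> and the line of \<open>z\<close>.\<close>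
  define P where "P = (\<lambda>M. subalg M \<and> M \<subseteq> K \<and> M \<noteq> K)"
  have "P {0}" using False subspace_0[OF sK] by (auto simp: P_def subalg_def)
  then have "\<exists>M. P M \<and> (\<forall>M'. P M' \<longrightarrow> dim M' \<le> dim M)"
   using dim_le by (intro ex_has_greatest_nat[where b = "Suc (card Basis)"]) (auto simp: less_Suc_eq_le)
  then obtain M where M: "P M" and max: "\<And>M'. P M' ==> dim M' \<le> dim M" by blast
  have sM: "subspace M" and cM: "\<And>x y. x \<in> M ==> y \<in> M ==> br x y \<in> M" and MK: "M \<subseteq> K" "M \<noteq> K"
   using M by (auto simp: P_def subalg_def)
  have dM: "dim M < dim K"
   using MK sM sK dim_psubset[of M K] by (metis psubsetI span_eq_iff)
  obtain k0 where k0: "k0 \<in> K" "k0 \<notin> M" using MK by auto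
  have "\<exists>w\<in>K. w \<notin> M \<and> (\<forall>x\<in>M. br x w \<in> M)"
  proof (rule less.hyps[OF dM _ sM sK MK(1) k0])
   show "subalg M" using M by (simp add: P_def)
   show "\<exists>N. (br x ^^ N) w \<in> M" if "x \<in> M" "w \<in> K" for x w
   proof -
    obtain N where "(br x ^^ N) w = 0" using less.prems(10)[of x w] \<open>x \<in> M\<close> \<open>w \<in> K\<close> MK by blast
    then show ?thesis using subspace_0[OF sM] by (intro exI[of _ N]) simp
   qed
   show "\<exists>N. (br x ^^ N) y = 0" if "x \<in> M" "y \<in> M" for x y
    using less.prems(10)[of x y] that MK by auto
  qed (use MK cK cM in auto)
  then obtain z where z: "z \<in> K" "z \<notin> M" "\<And>x. x \<in> M ==> br x z \<in> M" by blast
  have spM: "x \<in> span (insert z M) \<longleftrightarrow> (\<exists>c. x - c *s z \<in> M)" for x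
   using span_breakdown_eq[of x z M] sM by (metis span_eq_iff)
  have "subalg (span (insert z M))"
   unfolding subalg_def
  proof (intro conjI ballI)
   fix x y assume "x \<in> span (insert z M)" "y \<in> span (insert z M)"
   then obtain c d where cd: "x - c *s z \<in> M" "y - d *s z \<in> M" using spM by blast
   let ?m = "x - c *s z" and ?n = "y - d *s z"
   have "br x y = br (?m + c *s z) (?n + d *s z)" by simp
   also have "\<dots> = br ?m ?n + d *s br ?m z - c *s br ?n z"
    using br_anti[of z ?n] by (simp only: br_add_left br_add_right br_scale_left br_scale_right br_self) simp
   also have "\<dots> \<in> M" using cd z(3) cM sM by (intro subspace_diff subspace_add subspace_scale) auto
   finally show "br x y \<in> span (insert z M)" using span_base[of "br x y" "insert z M"] by blast
  qed simp
  moreover have "span (insert z M) \<subseteq> K" using z MK sK by (intro span_minimal) auto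
  moreover have "dim (span (insert z M)) > dim M"
   using dim_insert[of z M] z(2) sM by (simp add: span_eq_iff[THEN iffD2])
  ultimately have Ksp: "span (insert z M) = K" using max[of "span (insert z M)"] by (auto simp: P_def)
  have "\<exists>w\<in>W. w \<notin> U \<and> (\<forall>x\<in>M. br x w \<in> U)"
  proof (rule less.hyps[OF dM _ U W less.prems(4-6)])
   show "subalg M" using M by (simp add: P_def)
  qed (use less.prems(7-10) MK in blast)+
  then obtain w1 where w1: "w1 \<in> W" "w1 \<notin> U" "\<And>x. x \<in> M ==> br x w1 \<in> U" by blast
  \<comment> \<open>The vectors killed by \<open>M\<close> modulo \<open>U\<close>. They are stable
    under \<open>z\<close> because \<open>z\<close> normalizes \<open>M\<close>, so the last iterate
    under \<open>z\<close> that is non-zero modulo \<open>U\<close> is killed by all of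
    \<open>K\<close>.\<close>
  define U' where "U' = {w\<in>W. \<forall>m\<in>M. br m w \<in> U}"
  have zU': "br z w \<in> U'" if "w \<in> U'" for w
  proof -
   have "br m (br z w) \<in> U" if m: "m \<in> M" for m
   proof -
    have "br m (br z w) = br (br m z) w + br z (br m w)" by (rule jacobi)
    moreover have "br (br m z) w \<in> U" using \<open>w \<in> U'\<close> z(3)[OF m] by (auto simp: U'_def)
    moreover have "br z (br m w) \<in> U" using \<open>w \<in> U'\<close> m z(1) less.prems(8) by (auto simp: U'_def)
    ultimately show ?thesis using subspace_add[OF U] by simp
   qed
   moreover have "br z w \<in> W" using that z(1) less.prems(7) by (auto simp: U'_def)
   ultimately show ?thesis by (auto simp: U'_def)
  qed
  obtain N where "(br z ^^ N) w1 \<in> U" using less.prems(9)[OF z(1) w1(1)] by blast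
  then obtain k where k: "(br z ^^ k) w1 \<notin> U" "br z ((br z ^^ k) w1) \<in> U"
   using last_nonmember w1(2) by metis
  have w1': "(br z ^^ k) w1 \<in> U'" using zU' w1 by (intro funpow_stable) (auto simp: U'_def)
  have "br x ((br z ^^ k) w1) \<in> U" if x: "x \<in> K" for x
  proof -
   obtain c where c: "x - c *s z \<in> M" using x Ksp spM by blast
   have "br x ((br z ^^ k) w1) = br (x - c *s z) ((br z ^^ k) w1) + c *s br z ((br z ^^ k) w1)"
    by (simp add: br_diff_left br_scale_left)
   then show ?thesis using c w1' k(2) U by (auto simp: U'_def subspace_add subspace_scale)
  qed
  then show ?thesis using w1' k(1) by (auto simp: U'_def)
 qed
qed

subsection \<open>The Killing form\<close>

definition kil :: "'a \<Rightarrow> 'a \<Rightarrow> 'k" where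
 "kil x y = tr UNIV (\<lambda>v. br x (br y v))"

lemma lin_br_br: "lin (\<lambda>v. br x (br y v))"
 by (rule lin_compose[OF lin_br lin_br])

lemma kil_sym: "kil x y = kil y x"
 unfolding kil_def by (rule tr_comm) (simp_all add: lin_br)

lemma kil_add_right: "kil x (y + z) = kil x y + kil x z"
 unfolding kil_def using tr_plus[of UNIV "\<lambda>v. br x (br y v)" "\<lambda>v. br x (br z v)"]
 by (simp add: lin_br_br br_add_left br_add_right)

lemma kil_scale_right: "kil x (c *s y) = c * kil x y"
 unfolding kil_def using tr_smult[of UNIV "\<lambda>v. br x (br y v)" c]
 by (simp add: lin_br_br br_scale_left br_scale_right)

lemma kil_add_left: "kil (x + y) z = kil x z + kil y z"
 using kil_add_right kil_sym by metis

lemma kil_scale_left: "kil (c *s x) y = c * kil x y"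
 using kil_scale_right kil_sym by metis

lemma kil_zero_right[simp]: "kil x 0 = 0" using kil_scale_right[of x 0 0] by simp
lemma kil_zero_left[simp]: "kil 0 x = 0" using kil_sym kil_zero_right by metis
lemma kil_neg_right: "kil x (- y) = - kil x y" using kil_scale_right[of x "-1" y] by simp
lemma kil_neg_left: "kil (- x) y = - kil x y" using kil_neg_right kil_sym by metis
lemma kil_diff_right: "kil x (y - z) = kil x y - kil x z" using kil_add_right[of x y "-z"] by (simp add: kil_neg_right)
lemma kil_diff_left: "kil (x - y) z = kil x z - kil y z" using kil_diff_right kil_sym by metis
lemma kil_sum_left: "kil (\<Sum>i\<in>I. u i) y = (\<Sum>i\<in>I. kil (u i) y)"
 by (induction I rule: infinite_finite_induct) (auto simp: kil_add_left)

text \<open>\<open>ad [y, z]\<close> is a commutator; cyclicity of the trace turns the left side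
  into the trace of \<open>[D, ad y] ad z\<close>, and \<open>[D, ad y] = ad (D y)\<close> for a
  derivation. The case \<open>D = ad x\<close> is the invariance of the Killing form.\<close>

lemma tr_derivation:
 assumes D: "lin D" "\<And>x y. D (br x y) = br (D x) y + br x (D y)"
 shows "tr UNIV (\<lambda>v. D (br (br y z) v)) = kil (D y) z"
proof -
 have l: "lin (\<lambda>v. D (br y (br z v)))" "lin (\<lambda>v. D (br z (br y v)))" "lin (\<lambda>v. br y (D (br z v)))"
  by (intro lin_compose[OF D(1)] lin_br_br lin_compose[OF lin_br] lin_br lin_compose[OF D(1) lin_br])+
 have "tr UNIV (\<lambda>v. D (br (br y z) v)) = tr UNIV (\<lambda>v. D (br y (br z v)) - D (br z (br y v)))"
  by (simp add: br_br_left lin_diff[OF D(1)])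
 also have "\<dots> = tr UNIV (\<lambda>v. D (br y (br z v))) - tr UNIV (\<lambda>v. D (br z (br y v)))"
  by (intro tr_minus l) simp_all
 also have "tr UNIV (\<lambda>v. D (br z (br y v))) = tr UNIV (\<lambda>v. br y (D (br z v)))"
  using tr_comm[of UNIV "\<lambda>v. D (br z v)" "br y"] lin_compose[OF D(1) lin_br] lin_br by simp
 also have "tr UNIV (\<lambda>v. D (br y (br z v))) - tr UNIV (\<lambda>v. br y (D (br z v)))
   = tr UNIV (\<lambda>v. D (br y (br z v)) - br y (D (br z v)))"
  by (intro tr_minus[symmetric] l) simp_all
 also have "\<dots> = kil (D y) z" unfolding kil_def by (simp add: D(2))
 finally show ?thesis .
qed

lemma kil_invariant: "kil (br x y) z = kil x (br y z)"
proof -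
 have "kil (br x y) z = tr UNIV (\<lambda>v. br x (br (br y z) v))"
  by (rule tr_derivation[OF lin_br jacobi, symmetric])
 then show ?thesis by (simp add: kil_def)
qed

lemma kil_invariant2: "kil (br x y) z = - kil y (br x z)"
 using kil_invariant[of y x z] br_anti[of x y] by (simp add: kil_neg_left)

text \<open>\<open>ad (f x)\<close> is the conjugate of \<open>ad x\<close> by
  \<open>f\<close>.\<close>

lemma kil_aut:
 assumes f: "lin f" "bij f" "\<And>x y. f (br x y) = br (f x) (f y)"
 shows "kil (f x) (f y) = kil x y"
proof -
 let ?g = "inv f"
 have fg: "f (?g v) = v" "?g (f v) = v" for v using f(2) by (auto simp: bij_is_surj surj_f_inv_f bij_is_inj)
 have g: "lin ?g"
 proof (rule linI)
  fix x y show "?g (x + y) = ?g x + ?g y" using lin_add[OF f(1), of "?g x" "?g y"] fg by metis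
 next
  fix c x show "?g (c *s x) = c *s ?g x" using lin_scale[OF f(1), of c "?g x"] fg by metis
 qed
 have "kil (f x) (f y) = tr UNIV (\<lambda>v. f (br x (br y (?g v))))"
  unfolding kil_def by (simp add: f(3) fg)
 also have "\<dots> = tr UNIV (\<lambda>v. br x (br y (?g (f v))))"
  by (rule tr_comm[of UNIV f "\<lambda>v. br x (br y (?g v))"]) (simp_all add: f lin_compose[OF lin_br_br g])
 finally show ?thesis by (simp add: fg kil_def)
qed

text \<open>\<open>ad n\<close> and \<open>ad x\<close> commute, so a power of their product
  contains a power of the nilpotent \<open>ad n\<close>.\<close>

lemma kil_nil_commuting:
 assumes "br n x = 0" and nil: "\<And>v. \<exists>N. (br n ^^ N) v = 0"
 shows "kil n x = 0"
proof -
 have c: "br n (br x v) = br x (br n v)" for v using jacobi[of n x v] assms(1) by simp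
 have "((\<lambda>v. br n (br x v)) ^^ N) v = (br x ^^ N) ((br n ^^ N) v)" for N v
 proof (induction N arbitrary: v)
  case (Suc N)
  have cc: "(br n ^^ N) (br x v) = br x ((br n ^^ N) v)" for N v
   by (induction N) (simp_all add: c)
  have "((\<lambda>v. br n (br x v)) ^^ Suc N) v = ((\<lambda>v. br n (br x v)) ^^ N) (br n (br x v))"
   by (simp only: funpow_Suc_right o_apply)
  also have "\<dots> = (br x ^^ N) ((br n ^^ N) (br n (br x v)))" by (rule Suc)
  also have "\<dots> = (br x ^^ N) ((br n ^^ N) (br x (br n v)))" by (simp only: c)
  also have "\<dots> = (br x ^^ Suc N) ((br n ^^ Suc N) v)" by (simp add: cc funpow_swap1)
  finally show ?case .
 qed simp
 moreover have "(br x ^^ N) 0 = 0" for N by (rule lin_zero[OF lin_funpow[OF lin_br]])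
 ultimately have "\<exists>N. ((\<lambda>v. br n (br x v)) ^^ N) v = 0" for v using nil[of v] by metis
 then show ?thesis unfolding kil_def by (intro tr_nil) (simp_all add: lin_br_br)
qed

lemma geig_shiftI: "shift f a x \<in> geig f a ==> x \<in> geig f a"
proof -
 assume "shift f a x \<in> geig f a"
 then obtain N where "(shift f a ^^ N) (shift f a x) = 0" by (auto simp: geig_def)
 then have "(shift f a ^^ Suc N) x = 0" by (simp only: funpow_Suc_right o_apply)
 then show ?thesis unfolding geig_def by blast
qed

text \<open>By the Leibniz rule \<open>shift D (a + c)\<close> acts on the bracket as
  \<open>shift D a\<close> on the first factor plus \<open>shift D c\<close> on the second; induct
  on the sum of the two exponents.\<close>

lemma geig_br:
 assumes D: "lin D" "\<And>x y. D (br x y) = br (D x) y + br x (D y)"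
  and x: "x \<in> geig D a" and y: "y \<in> geig D c"
 shows "br x y \<in> geig D (a + c)"
proof -
 obtain N M where NM: "(shift D a ^^ N) x = 0" "(shift D c ^^ M) y = 0" using x y by (auto simp: geig_def)
 then show ?thesis
 proof (induction "N + M" arbitrary: N M x y rule: less_induct)
  case less
  have z: "0 \<in> geig D (a + c)" by (rule subspace_0[OF subspace_geig[OF D(1)]])
  show ?case
  proof (cases "N = 0 \<or> M = 0")
   case True
   then show ?thesis using less.prems z by auto
  next
   case False
   then obtain N' M' where NM: "N = Suc N'" "M = Suc M'" by (metis not0_implies_Suc)
   have "br (shift D a x) y \<in> geig D (a + c)"
    using less.hyps[of N' M "shift D a x" y] less.prems NM by (simp add: funpow_swap1)
   moreover have "br x (shift D c y) \<in> geig D (a + c)"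
    using less.hyps[of N M' x "shift D c y"] less.prems NM by (simp add: funpow_swap1)
   moreover have "shift D (a + c) (br x y) = br (shift D a x) y + br x (shift D c y)"
    by (simp add: shift_def D(2) br_lin algebra_simps)
   ultimately have "shift D (a + c) (br x y) \<in> geig D (a + c)"
    using subspace_add[OF subspace_geig[OF D(1)]] by simp
   then show ?thesis by (rule geig_shiftI)
  qed
 qed
qed

abbreviation gei :: "('a \<Rightarrow> 'a) \<Rightarrow> ('k \<Rightarrow> 'k) \<Rightarrow> 'a \<Rightarrow> 'a" where
 "gei f c \<equiv> gscale {a. geig f a \<noteq> {0}} (geig f) c"

lemma gei_on: "lin f ==> x \<in> geig f a ==> gei f c x = c a *s x"
proof -
 assume f: "lin f" and x: "x \<in> geig f a"
 show ?thesis
 proof (cases "geig f a = {0}")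
  case True
  then show ?thesis using x lin_zero[OF lin_gscale[OF geig_decomp(2)[OF ac f]]] by auto
 next
  case False
  then show ?thesis using gscale_on[OF geig_decomp(2)[OF ac f], of a x c] x by auto
 qed
qed

lemma lin_gei: "lin f ==> lin (gei f c)"
 by (rule lin_gscale[OF geig_decomp(2)[OF ac]])

lemma geig_induct:
 assumes "lin f" "\<And>a x. x \<in> geig f a ==> P x" "\<And>x y. P x ==> P y ==> P (x + y)"
 shows "P x"
proof (rule decomp_induct[OF geig_decomp(2)[OF ac assms(1)]])
 show "P 0" using assms(2) subspace_0[OF subspace_geig[OF assms(1)]] by blast
qed (use assms in auto)

text \<open>Eigenvalues add under the bracket, so additivity of \<open>c\<close> is what the Leibniz
  rule asks for. The identity gives the semisimple part of \<open>D\<close>, a rational functional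
  gives the operator of \<open>kil_nonzero\<close>.\<close>

lemma gei_derivation:
 assumes D: "lin D" "\<And>x y. D (br x y) = br (D x) y + br x (D y)" and c: "\<And>x y. c (x + y) = c x + c y"
 shows "gei D c (br x y) = br (gei D c x) y + br x (gei D c y)"
proof -
 let ?E = "gei D c"
 note l = lin_gei[OF D(1), of c]
 show ?thesis
 proof (rule geig_induct[OF D(1), of "\<lambda>x. ?E (br x y) = br (?E x) y + br x (?E y)"])
  fix a x assume x: "x \<in> geig D a"
  show "?E (br x y) = br (?E x) y + br x (?E y)"
  proof (rule geig_induct[OF D(1), of "\<lambda>y. ?E (br x y) = br (?E x) y + br x (?E y)"])
   fix a' y assume y: "y \<in> geig D a'"
   show "?E (br x y) = br (?E x) y + br x (?E y)"
    using gei_on[OF D(1) geig_br[OF D x y], of c] gei_on[OF D(1) x, of c] gei_on[OF D(1) y, of c]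
    by (simp add: br_lin c scale_left_distrib)
  qed (simp add: br_lin lin_add[OF l] algebra_simps)
 qed (simp add: br_lin lin_add[OF l] algebra_simps)
qed

text \<open>Riesz representation: the map \<open>?T\<close> that sends \<open>x\<close> to the
  vector with coordinates \<open>kil x v\<close> is injective on \<open>W\<close> by nondegeneracy,
  hence onto, and so reaches the vector with coordinates \<open>L v\<close>.\<close>

lemma kil_functional:
 assumes W: "subspace W" and nd: "\<And>x. x \<in> W ==> (\<And>y. y \<in> W ==> kil x y = 0) ==> x = 0"
  and L: "\<And>x y. x \<in> W ==> y \<in> W ==> L (x + y) = L x + L y" "\<And>c x. x \<in> W ==> L (c *s x) = c * L x"
 shows "\<exists>d\<in>W. \<forall>w\<in>W. kil d w = L w"
proof -
 obtain B where B: "independent B" "finite B" "span B = W" "B \<subseteq> W" "card B = dim W" using obtain_basis W by blast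
 let ?T = "\<lambda>x. \<Sum>v\<in>B. kil x v *s v"
 have lT: "lin ?T"
  by (rule linI) (simp_all add: kil_add_left kil_scale_left scale_left_distrib sum.distrib scale_sum_right)
 have TW: "?T x \<in> W" for x using B W by (auto intro!: subspace_sum subspace_scale)
 have L0: "L 0 = 0" using L(2)[of 0 0] subspace_0[OF W] by simp
 have ext: "kil d w = L w" if "\<And>v. v \<in> B ==> kil d v = L v" "w \<in> W" for d w
 proof -
  have "w \<in> span B" using that B by simp
  then have "w \<in> W \<and> kil d w = L w"
  proof (induction rule: span_induct_alt)
   case base then show ?case using L0 subspace_0[OF W] by simp
  next
   case (step c x y)
   then show ?case using that(1)[of x] B(4) W
    by (auto simp: kil_add_right kil_scale_right L subspace_add subspace_scale)
  qed
  then show ?thesis by simp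
 qed
 have coef: "kil x v = L v" if "?T x = (\<Sum>v\<in>B. L v *s v)" "v \<in> B" for x v
 proof -
  have "(\<Sum>v\<in>B. (kil x v - L v) *s v) = 0" using that(1) by (simp add: scale_left_diff_distrib sum_subtractf)
  then have "kil x v - L v = 0" by (rule independentD[OF B(1,2) subset_refl _ that(2)])
  then show ?thesis by simp
 qed
 have inj: "inj_on ?T W"
 proof (rule inj_onI)
  fix x y assume xy: "x \<in> W" "y \<in> W" "?T x = ?T y"
  have "?T (x - y) = 0" using xy(3) lin_diff[OF lT] by simp
  then have z: "kil (x - y) v = 0" if "v \<in> B" for v
   using independentD[OF B(1,2) subset_refl _ that] by blast
  have "kil (x - y) w = 0" if "w \<in> W" for w
  proof -
   have "w \<in> span B" using that B by simp
   then show ?thesis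
    by (induction rule: span_induct_alt) (simp_all add: kil_add_right kil_scale_right z)
  qed
  then have "x - y = 0" using nd[of "x - y"] xy W by (simp add: subspace_diff)
  then show "x = y" by simp
 qed
 interpret fdp: finite_dimensional_vector_space_pair_1 scale Basis scale ..
 have "dim (?T ` W) = dim W"
  using fdp.dim_image_eq[OF lT, of W] inj W by (simp add: span_eq_iff[THEN iffD2])
 then have "?T ` W = W"
  using TW subspace_lin_image[OF lT W] W by (intro subspace_dim_equal) auto
 moreover have "(\<Sum>v\<in>B. L v *s v) \<in> W" using B W by (auto intro!: subspace_sum subspace_scale)
 ultimately have "(\<Sum>v\<in>B. L v *s v) \<in> ?T ` W" by (simp only:)
 then obtain d where d: "(\<Sum>v\<in>B. L v *s v) = ?T d" "d \<in> W" by (rule imageE)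
 show ?thesis
  by (intro bexI[OF _ d(2)] ballI ext[OF coef[OF d(1)[symmetric]]])
qed

end

section \<open>Simple Lie algebras: nondegenerate Killing form and inner derivations\<close>

locale simple_lie = flie scale Basis br
 for scale :: "'k::field_char_0 \<Rightarrow> 'a::ab_group_add \<Rightarrow> 'a" (infixr "*s" 75) and Basis :: "'a set"
  and br :: "'a \<Rightarrow> 'a \<Rightarrow> 'a" +
 assumes nonab: "\<exists>x y. br x y \<noteq> 0"
  and ideals: "\<And>I. subspace I ==> (\<And>x y. y \<in> I ==> br x y \<in> I) ==> I = {0} \<or> I = UNIV"
begin

lemma center_zero: assumes "\<And>y. br x y = 0" shows "x = 0"
proof -
 let ?Z = "{x. \<forall>y. br x y = 0}"
 have "?Z = {0} \<or> ?Z = UNIV"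
 proof (rule ideals)
  show "subspace ?Z" by (rule subspaceI) (auto simp: br_lin)
 next
  fix x y assume "y \<in> ?Z"
  then have "br x y = 0" using br_anti_zero by blast
  then show "br x y \<in> ?Z" by simp
 qed
 then show ?thesis using assms nonab by auto
qed

lemma perfect: "span {br x y | x y. True} = UNIV"
proof -
 let ?D = "span {br x y | x y. True}"
 have "?D = {0} \<or> ?D = UNIV"
  by (rule ideals) (auto intro: span_base)
 then show ?thesis using nonab span_base[of _ "{br x y | x y. True}"] by blast
qed

text \<open>Otherwise Engel's theorem for the adjoint action on the whole algebra produces a
  non-zero central element.\<close>

lemma not_ad_nilpotent: "\<exists>x v. \<forall>N. (br x ^^ N) v \<noteq> 0"
proof (rule ccontr)
 assume "\<not> ?thesis"
 then have nil: "\<exists>N. (br x ^^ N) v = 0" for x v by blast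
 obtain w0 :: 'a where "w0 \<noteq> 0" using nonab br_zero_left by metis
 then have "\<exists>w\<in>UNIV. w \<notin> {0} \<and> (\<forall>x\<in>UNIV. br x w \<in> {0})"
  using nil by (intro engel_section[of UNIV "{0}" UNIV w0]) (auto simp: subalg_def)
 then obtain w where w: "w \<noteq> 0" "\<And>x. br x w = 0" by auto
 have "w = 0" by (rule center_zero) (rule br_anti_zero[OF w(2)])
 then show False using w by simp
qed

text \<open>If the Killing form vanished, let \<open>D\<close> act on the generalized eigenspaces of a non-nilpotent
 \<open>ad x\<close> by \<open>f a\<close>, \<open>f\<close> a rational functional. Then \<open>tr (D \<circ> ad y) = 0\<close> for all \<open>y\<close>, and applying
 \<open>f\<close> to the case \<open>y = x\<close> makes a sum of squares vanish.\<close>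

lemma kil_nonzero: "\<exists>x y. kil x y \<noteq> 0"
proof (rule ccontr)
 assume "\<not> ?thesis"
 then have k0: "kil x y = 0" for x y by blast
 obtain x v where xv: "\<And>N. (br x ^^ N) v \<noteq> 0" using not_ad_nilpotent by blast
 define J where "J = {a. geig (br x) a \<noteq> {0}}"
 have dJ: "finite J" "decomp J (geig (br x))" unfolding J_def by (rule geig_decomp[OF ac lin_br])+
 have "\<exists>a\<in>J. a \<noteq> 0"
 proof (rule ccontr)
  assume "\<not> (\<exists>a\<in>J. a \<noteq> 0)"
  then have J0: "a = 0" if "a \<in> J" for a using that by blast
  have "v \<in> geig (br x) 0"
  proof (rule decomp_induct[OF dJ(2), of "\<lambda>v. v \<in> geig (br x) 0"])
   show "0 \<in> geig (br x) 0" by (rule subspace_0[OF subspace_geig[OF lin_br]])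
   show "w \<in> geig (br x) 0" if "a \<in> J" "w \<in> geig (br x) a" for a w
    using that(2) unfolding J0[OF that(1)] .
  qed (rule subspace_add[OF subspace_geig[OF lin_br]])
  moreover have "shift (br x) 0 = br x" by (simp add: shift_def)
  ultimately show False using xv by (auto simp: geig_def)
 qed
 then obtain a0 where a0: "a0 \<in> J" "a0 \<noteq> 0" by blast
 obtain \<phi> :: "'k \<Rightarrow> rat" where \<phi>: "\<And>x y. \<phi> (x + y) = \<phi> x + \<phi> y" "\<And>r x. \<phi> (of_rat r * x) = r * \<phi> x" "\<phi> 1 = 1"
  using rational_functional by blast
 \<comment> \<open>Normalized so that \<open>f a0 = 1\<close>: one summand of the final sum of
   squares is then the dimension of \<open>geig (br x) a0\<close>.\<close>
 define f where "f = (\<lambda>a. \<phi> (a / a0))"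
 have f: "f (a + b) = f a + f b" "f (of_rat r * a) = r * f a" "f a0 = 1" for a b r
  using \<phi>(1)[of "a / a0" "b / a0"] \<phi>(2)[of r "a / a0"] \<phi>(3) a0 by (simp_all add: f_def add_divide_distrib)
 have f0: "f 0 = 0" using f(2)[of 0 0] by simp
 define c :: "'k \<Rightarrow> 'k" where "c = (\<lambda>a. of_rat (f a))"
 define D where "D = gei (br x) c"
 have D: "lin D" "\<And>u w. D (br u w) = br (D u) w + br u (D w)"
  unfolding D_def by (rule lin_gei[OF lin_br], rule gei_derivation[OF lin_br jacobi]) (simp add: c_def f(1) of_rat_add)
 \<comment> \<open>Every \<open>y\<close> is a linear combination of commutators, and for a
   commutator \<open>tr_derivation\<close> turns the trace into a value of the vanishing Killing
   form.\<close>
 have tr0: "tr UNIV (\<lambda>v. D (br y v)) = 0" for y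
 proof -
  have "y \<in> span {br x y | x y. True}" using perfect by simp
  then show ?thesis
  proof (induction rule: span_induct_alt)
   case base then show ?case by (simp add: lin_zero[OF D(1)] tr_zero)
  next
   case (step c u w)
   then obtain p q where u: "u = br p q" by auto
   have "tr UNIV (\<lambda>v. D (br (c *s u + w) v)) = tr UNIV (\<lambda>v. c *s D (br u v) + D (br w v))"
    by (simp add: br_lin lin_add[OF D(1)] lin_scale[OF D(1)])
   also have "\<dots> = c * tr UNIV (\<lambda>v. D (br u v)) + tr UNIV (\<lambda>v. D (br w v))"
    by (subst tr_plus) (simp_all add: tr_smult lin_smult lin_compose[OF D(1) lin_br])
   also have "\<dots> = 0" using step u tr_derivation[OF D] k0 by simp
   finally show ?case .
  qed
 qed
 have "0 = tr UNIV (\<lambda>v. D (br x v))" using tr0 by simp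
 also have "\<dots> = (\<Sum>a\<in>J. c a * a * of_nat (dim (geig (br x) a)))"
  unfolding D_def J_def[symmetric]
  by (rule tr_gscale_comp[OF dJ(2) lin_br], erule geig_stable_self[OF lin_br], simp add: geig_def)
 finally have "0 = f (\<Sum>a\<in>J. c a * a * of_nat (dim (geig (br x) a)))" using f0 by simp
 also have "\<dots> = (\<Sum>a\<in>J. f (of_rat (f a * of_nat (dim (geig (br x) a))) * a))"
 proof -
  have "f (\<Sum>a\<in>J. h a) = (\<Sum>a\<in>J. f (h a))" for h :: "'k \<Rightarrow> 'k"
   using dJ(1) by (induction rule: finite_induct) (simp_all add: f f0)
  then show ?thesis by (simp add: c_def of_rat_mult mult_ac)
 qed
 also have "\<dots> = (\<Sum>a\<in>J. (f a)\<^sup>2 * of_nat (dim (geig (br x) a)))"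
  by (simp only: f(2)) (simp add: power2_eq_square mult_ac)
 finally have "(\<Sum>a\<in>J. (f a)\<^sup>2 * of_nat (dim (geig (br x) a))) = 0" by simp
 then have "(f a0)\<^sup>2 * of_nat (dim (geig (br x) a0)) = 0"
  using sum_nonneg_eq_0_iff[OF dJ(1), of "\<lambda>a. (f a)\<^sup>2 * of_nat (dim (geig (br x) a))"] a0 by auto
 then have "geig (br x) a0 \<subseteq> {0}" using f(3) by simp
 then show False using a0 subspace_0[OF subspace_geig[OF lin_br]] by (auto simp: J_def)
qed

lemma kil_nondeg: assumes "\<And>y. kil x y = 0" shows "x = 0"
proof -
 let ?R = "{x. \<forall>y. kil x y = 0}"
 have "?R = {0} \<or> ?R = UNIV"
 proof (rule ideals)
  show "subspace ?R" by (rule subspaceI) (auto simp: kil_add_left kil_scale_left)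
 next
  fix x y assume "y \<in> ?R"
  then show "br x y \<in> ?R" using kil_invariant2[of x y] by simp
 qed
 then show ?thesis using assms kil_nonzero by auto
qed

text \<open>Let \<open>d\<close> represent the functional sending \<open>y\<close> to the trace of
  \<open>D ad y\<close>. Then \<open>E = D - ad d\<close> has trace \<open>0\<close> against every
  \<open>ad y\<close>, and \<open>tr_derivation\<close> turns this into orthogonality of
  \<open>E x\<close> to everything.\<close>

lemma derivation_inner:
 assumes D: "lin D" "\<And>x y. D (br x y) = br (D x) y + br x (D y)"
 shows "\<exists>d. \<forall>x. D x = br d x"
proof -
 let ?L = "\<lambda>y. tr UNIV (\<lambda>v. D (br y v))"
 have l: "lin (\<lambda>v. D (br y v))" for y by (rule lin_compose[OF D(1) lin_br])
 have "\<exists>d\<in>UNIV. \<forall>w\<in>UNIV. kil d w = ?L w"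
 proof (rule kil_functional)
  show "?L (x + y) = ?L x + ?L y" for x y
   using tr_plus[OF subspace_UNIV l l, of x y] by (simp add: br_lin lin_add[OF D(1)])
  show "?L (c *s x) = c * ?L x" for c x
   using tr_smult[OF subspace_UNIV l, of x c] by (simp add: br_lin lin_scale[OF D(1)])
 qed (use kil_nondeg in auto)
 then obtain d where d: "\<And>w. kil d w = ?L w" by auto
 define E where "E = (\<lambda>x. D x - br d x)"
 have lE: "lin E" unfolding E_def by (rule lin_minus[OF D(1) lin_br])
 have E: "E (br x y) = br (E x) y + br x (E y)" for x y
  unfolding E_def using jacobi[of d x y] by (simp add: D(2) br_lin algebra_simps)
 have tE: "tr UNIV (\<lambda>v. E (br y v)) = 0" for y
  unfolding E_def using tr_minus[OF subspace_UNIV l lin_br_br, of y d y] d[of y] by (simp add: kil_def)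
 have "E x = 0" for x
  by (rule kil_nondeg) (use tr_derivation[OF lE E] tE in metis)
 then show ?thesis unfolding E_def by (metis eq_iff_diff_eq_0)
qed

end

section \<open>Roots of unity and operators of finite order\<close>

text \<open>A further root \<open>c\<close> would give the polynomial \<open>X^m - 1\<close> more
  than \<open>m\<close> roots.\<close>

lemma root_of_unity_power:
 fixes z c :: "'k::field"
 assumes m: "0 < m" and z: "z ^ m = 1" "\<And>j. 0 < j ==> j < m ==> z ^ j \<noteq> 1" and c: "c ^ m = 1"
 shows "\<exists>j<m. c = z ^ j"
proof (rule ccontr)
 assume n: "\<not> ?thesis"
 have z0: "z \<noteq> 0" using z(1) m by (auto simp: power_0_left)
 have inj: "inj_on (\<lambda>j. z ^ j) {..<m}"
 proof (rule linorder_inj_onI)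
  fix i j assume ij: "i < j" "i \<in> {..<m}" "j \<in> {..<m}"
  show "z ^ i \<noteq> z ^ j"
  proof
   assume "z ^ i = z ^ j"
   moreover have "z ^ i * z ^ (j - i) = z ^ j" using ij by (simp flip: power_add)
   ultimately have "z ^ i * z ^ (j - i) = z ^ i * 1" by simp
   then have "z ^ (j - i) = 1" using z0 by simp
   then show False using z(2)[of "j - i"] ij by (simp add: less_imp_diff_less)
  qed
 qed auto
 let ?R = "insert c ((\<lambda>j. z ^ j) ` {..<m})"
 have "card ?R = Suc m" using n card_image[OF inj] by (subst card_insert_disjoint) auto
 moreover let ?p = "monom 1 m - 1 :: 'k poly"
 have "coeff ?p m = 1" using m by simp
 then have p0: "?p \<noteq> 0" by (metis coeff_0 zero_neq_one)
 have zj: "(z ^ j) ^ m = 1" for j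
 proof -
  have "(z ^ j) ^ m = (z ^ m) ^ j" by (simp only: power_mult[symmetric] mult.commute)
  then show ?thesis using z(1) by simp
 qed
 have "?R \<subseteq> {x. poly ?p x = 0}"
  using c zj by (auto simp: poly_monom)
 then have "card ?R \<le> degree ?p"
  using poly_roots_finite[OF p0] card_poly_roots_bound[OF p0] card_mono le_trans by blast
 moreover have "degree ?p \<le> m" by (intro degree_diff_le degree_monom_le) simp
 ultimately show False by simp
qed

lemma powi_dvd:
 fixes z :: "'k::field"
 assumes m: "0 < m" and z: "z ^ m = 1" "\<And>j. 0 < j ==> j < m ==> z ^ j \<noteq> 1"
 shows "z powi a = 1 \<longleftrightarrow> int m dvd a"
proof -
 have z0: "z \<noteq> 0" using z(1) m by (auto simp: power_0_left)
 have "z powi a = z powi (int m * (a div int m) + a mod int m)" by simp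
 also have "\<dots> = (z powi int m) powi (a div int m) * z powi (a mod int m)"
  using z0 by (simp only: power_int_add power_int_mult simp_thms)
 also have "\<dots> = z ^ nat (a mod int m)" using z(1) m by (simp add: power_int_def)
 finally have e: "z powi a = z ^ nat (a mod int m)" .
 have lt: "nat (a mod int m) < m" using m by (simp add: nat_less_iff)
 have "z ^ nat (a mod int m) = 1 \<longleftrightarrow> nat (a mod int m) = 0"
  using z(2)[OF _ lt] by (cases "nat (a mod int m)") auto
 also have "\<dots> \<longleftrightarrow> a mod int m = 0" using pos_mod_sign[of "int m" a] m by linarith
 also have "\<dots> \<longleftrightarrow> int m dvd a" by (simp only: dvd_eq_mod_eq_0)
 finally show ?thesis using e by simp
qed

context fdvs begin

lemma diagble_finite_order:
 fixes z :: 'k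
 assumes f: "lin f" "f ^^ m = id" and m: "0 < m"
  and z: "z ^ m = 1" "\<And>j. 0 < j ==> j < m ==> z ^ j \<noteq> 1"
 shows "diagble f"
 unfolding diagble_def
proof
 fix x
 have z0: "z \<noteq> 0" using z(1) m by (auto simp: power_0_left)
 let ?w = "inverse z"
 have w: "?w ^ m = 1" using z(1) by (simp add: power_inverse)
 \<comment> \<open>A discrete Fourier transform of the orbit of \<open>x\<close>: \<open>p j\<close>
   is \<open>m\<close> times the component of \<open>x\<close> in the eigenspace of
   \<open>z ^ j\<close>. Summing over \<open>j\<close> leaves only the term \<open>r = 0\<close>,
   which is \<open>m\<close> times \<open>x\<close>.\<close>
 define p where "p = (\<lambda>j. \<Sum>r<m. (?w ^ j) ^ r *s (f ^^ r) x)"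
 have ev: "f (p j) = z ^ j *s p j" for j
 proof -
  have "f (p j) = (\<Sum>r<m. (?w ^ j) ^ r *s (f ^^ Suc r) x)"
   by (simp add: p_def lin_sum[OF f(1)] lin_scale[OF f(1)])
  also have "\<dots> = z ^ j *s (\<Sum>r<m. (?w ^ j) ^ Suc r *s (f ^^ Suc r) x)"
   unfolding scale_sum_right scale_scale
   using z0 by (intro sum.cong refl arg_cong2[of _ _ _ _ scale]) (simp add: field_simps power_inverse)
  also have "(\<Sum>r<m. (?w ^ j) ^ Suc r *s (f ^^ Suc r) x) = p j"
  proof -
   have "(\<Sum>r<m. (?w ^ j) ^ Suc r *s (f ^^ Suc r) x) + (?w ^ j) ^ 0 *s (f ^^ 0) x
     = (\<Sum>r<Suc m. (?w ^ j) ^ r *s (f ^^ r) x)"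
    by (subst sum.lessThan_Suc_shift) simp
   also have "\<dots> = p j + x"
   proof -
    have "(?w ^ j) ^ m = (?w ^ m) ^ j" by (simp only: power_mult[symmetric] mult.commute)
    then show ?thesis using w f(2) by (simp add: p_def)
   qed
   finally show ?thesis by simp
  qed
  finally show ?thesis .
 qed
 have "(\<Sum>j<m. p j) = (\<Sum>r<m. (\<Sum>j<m. (?w ^ r) ^ j) *s (f ^^ r) x)"
  unfolding p_def by (subst sum.swap) (simp add: scale_sum_left mult.commute flip: power_mult)
 also have "\<dots> = (\<Sum>r<m. (if r = 0 then of_nat m *s x else 0))"
 proof (intro sum.cong refl)
  fix r assume r: "r \<in> {..<m}"
  show "(\<Sum>j<m. (?w ^ r) ^ j) *s (f ^^ r) x = (if r = 0 then of_nat m *s x else 0)"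
  proof (cases "r = 0")
   case False
   then have "z ^ r \<noteq> 1" using z(2) r by simp
   then have ne: "?w ^ r \<noteq> 1" by (simp add: power_inverse)
   have "(?w ^ r) ^ m = (?w ^ m) ^ r" by (simp only: power_mult[symmetric] mult.commute)
   then have "(?w ^ r) ^ m = 1" using w by simp
   then have "(\<Sum>j<m. (?w ^ r) ^ j) = 0" using geometric_sum[OF ne, of m] by simp
   then show ?thesis using False by simp
  qed simp
 qed
 also have "\<dots> = of_nat m *s x" using m by simp
 finally have "x = inverse (of_nat m) *s (\<Sum>j<m. p j)" using m by simp
 also have "\<dots> \<in> span (\<Union>a. {x. f x = a *s x})"
  using ev by (intro span_scale span_sum span_base) auto
 finally show "x \<in> span (\<Union>a. {x. f x = a *s x})" .
qed

end

context simple_lie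
begin

text \<open>A commutator has trace \<open>0\<close> on each eigenspace of an operator commuting with both factors.\<close>

lemma diagble_commutator_zero:
 assumes d: "diagble (br (br y x))" and com: "br (br y x) x = 0" "br (br y x) y = 0"
 shows "br y x = 0"
proof -
 let ?c = "br y x"
 have comm: "br ?c (br h v) = br h (br ?c v)" if "h = x \<or> h = y" for h v
  using jacobi[of ?c h v] com that by auto
 have z: "a = 0" if a: "geig (br ?c) a \<noteq> {0}" for a
 proof -
  let ?W = "geig (br ?c) a"
  have sW: "subspace ?W" by (rule subspace_geig[OF lin_br])
  have st: "br h v \<in> ?W" if "h = x \<or> h = y" "v \<in> ?W" for h v
   by (rule geig_stable[OF lin_br comm[OF that(1)] that(2)])
  have stx: "\<And>v. v \<in> ?W ==> br x v \<in> ?W" and sty: "\<And>v. v \<in> ?W ==> br y v \<in> ?W"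
   using st[of x] st[of y] by simp_all
  have "a * of_nat (dim ?W) = tr ?W (br ?c)"
   by (rule tr_single[OF sW lin_br, symmetric], erule geig_stable_self[OF lin_br], simp add: geig_def)
  also have "\<dots> = tr ?W (\<lambda>v. br y (br x v) - br x (br y v))"
   by (simp add: br_br_left[symmetric])
  also have "\<dots> = tr ?W (\<lambda>v. br y (br x v)) - tr ?W (\<lambda>v. br x (br y v))"
   by (intro tr_minus sW lin_br_br stx sty)
  also have "\<dots> = 0" using tr_comm[OF sW lin_br lin_br stx sty] by simp
  finally have "a = 0 \<or> dim ?W = 0" by simp
  moreover have "dim ?W \<noteq> 0" using a subspace_0[OF sW] by auto
  ultimately show ?thesis by simp
 qed
 show ?thesis
 proof (rule center_zero)
  fix v
  have "v \<in> span (\<Union>a. {x. br ?c x = a *s x})" using d by (simp add: diagble_def)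
  then show "br ?c v = 0"
  proof (induction rule: span_induct_alt)
   case (step k u w)
   then obtain a where u: "br ?c u = a *s u" by auto
   have "br ?c u = 0"
   proof (cases "u = 0")
    case False
    have "u \<in> geig (br ?c) a" using u by (intro eig_geig)
    then have "a = 0" using z[of a] False by auto
    then show ?thesis using u by simp
   qed simp
   then show ?case using step by (simp add: br_lin)
  qed simp
 qed
qed

end

section \<open>The Cartan subalgebra of the fixed points is toral\<close>

locale mloop = simple_lie scale Basis br
 for scale :: "'k::field_char_0 \<Rightarrow> 'a::ab_group_add \<Rightarrow> 'a" (infixr "*s" 75) and Basis :: "'a set"
  and br :: "'a \<Rightarrow> 'a \<Rightarrow> 'a" +
 fixes \<zeta> :: "nat \<Rightarrow> 'k" and n :: nat and \<sigma> :: "nat \<Rightarrow> 'a \<Rightarrow> 'a" and m :: "nat \<Rightarrow> nat" and H :: "'a set"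
 assumes zeta: "fixed_roots_of_unity \<zeta>"
  and sig_lin: "\<And>i. i < n ==> Vector_Spaces.linear scale scale (\<sigma> i)"
  and sig_bij: "\<And>i. i < n ==> bij (\<sigma> i)"
  and sig_br: "\<And>i x y. i < n ==> \<sigma> i (br x y) = br (\<sigma> i x) (\<sigma> i y)"
  and sig_m: "\<And>i. i < n ==> \<sigma> i ^^ m i = id"
  and m_pos: "\<And>i. i < n ==> 0 < m i"
  and sig_comm: "\<And>i j x. i < n ==> j < n ==> \<sigma> i (\<sigma> j x) = \<sigma> j (\<sigma> i x)"
  and cartan: "cartan_subalg scale br (fixed_pts scale \<zeta> n \<sigma> m) H"
begin

abbreviation K :: "'a set" where "K \<equiv> fixed_pts scale \<zeta> n \<sigma> m"
abbreviation tw :: "(nat \<Rightarrow> int) \<Rightarrow> 'a set" where "tw l \<equiv> twisted scale \<zeta> n \<sigma> m l"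
abbreviation rt :: "('a \<Rightarrow> 'k) \<Rightarrow> 'a set" where "rt \<alpha> \<equiv> root_space scale br H \<alpha>"
abbreviation hd' :: "('a \<Rightarrow> 'k) set" where "hd' \<equiv> hdual scale H"

lemma zeta_pow: "0 < q ==> \<zeta> q ^ q = 1" "0 < j ==> j < q ==> \<zeta> q ^ j \<noteq> 1"
 using zeta unfolding fixed_roots_of_unity_def by auto

lemma zeta_nz: "0 < q ==> \<zeta> q \<noteq> 0"
 using zeta_pow(1)[of q] by (auto simp: power_0_left)

lemma zeta_powi_1: "0 < q ==> \<zeta> q powi a = 1 \<longleftrightarrow> int q dvd a"
 by (rule powi_dvd) (use zeta_pow in auto)

lemma K_iff: "x \<in> K \<longleftrightarrow> (\<forall>i<n. \<sigma> i x = x)"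
 by (simp add: fixed_pts_def twisted_def)

lemma sig_diagble: "i < n ==> diagble (\<sigma> i)"
 by (rule diagble_finite_order[OF sig_lin sig_m m_pos zeta_pow(1) zeta_pow(2)]) (auto simp: m_pos)

lemma kil_sig: "i < n ==> kil (\<sigma> i x) (\<sigma> i y) = kil x y"
 by (rule kil_aut) (auto simp: sig_lin sig_bij sig_br)

lemma subspace_K: "subspace K"
 by (rule subspaceI) (auto simp: K_iff lin_zero lin_add lin_scale sig_lin)

lemma K_br: "x \<in> K ==> y \<in> K ==> br x y \<in> K"
 by (simp add: K_iff sig_br)

text \<open>Joint eigenvectors of the \<open>\<sigma> i\<close> with a non-trivial character are
  orthogonal to \<open>K\<close>, as the Killing form is invariant. Nondegeneracy on the whole
  algebra therefore passes to \<open>K\<close>.\<close>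

lemma K_nondeg:
 assumes x: "x \<in> K" and xK: "\<And>y. y \<in> K ==> kil x y = 0" shows "x = 0"
proof (rule kil_nondeg)
 fix y
 have "y \<in> span (\<Union>\<chi>. jeig {..<n} \<sigma> \<chi> \<inter> UNIV)"
  by (rule jeig_span) (use sig_lin sig_diagble sig_comm in auto)
 then show "kil x y = 0"
 proof (induction rule: span_induct_alt)
  case (step c v w)
  then obtain \<chi> where v: "v \<in> jeig {..<n} \<sigma> \<chi>" by auto
  have "kil x v = 0"
  proof (cases "\<forall>i<n. \<chi> i = 1")
   case True
   then have "v \<in> K" using v by (simp add: K_iff jeig_def)
   then show ?thesis by (rule xK)
  next
   case False
   then obtain i where i: "i < n" "\<chi> i \<noteq> 1" by auto
   have "kil x v = kil (\<sigma> i x) (\<sigma> i v)" using kil_sig i by simp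
   also have "\<dots> = \<chi> i * kil x v" using x v i by (simp add: K_iff jeig_def kil_scale_right)
   finally show ?thesis using i by simp
  qed
  then show ?case using step by (simp add: kil_add_right kil_scale_right)
 qed simp
qed

lemma H_K: "x \<in> H ==> x \<in> K" and subspace_H: "subspace H"
 and H_br: "x \<in> H ==> y \<in> H ==> br x y \<in> H"
 and H_norm: "x \<in> K ==> (\<And>y. y \<in> H ==> br x y \<in> H) ==> x \<in> H"
 and H_nilp: "nilpotent_subalg br H"
 using cartan unfolding cartan_subalg_def by blast+

lemma H_nil: "\<exists>N. \<forall>x\<in>H. \<forall>y\<in>H. (br x ^^ N) y = 0"
proof -
 obtain N where N: "\<forall>xs y. length xs = N \<and> set xs \<subseteq> H \<and> y \<in> H \<longrightarrow> foldr br xs y = 0"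
  using H_nilp unfolding nilpotent_subalg_def by blast
 have f: "foldr br (replicate k x) y = (br x ^^ k) y" for k x y
  by (induction k) simp_all
 have "(br x ^^ N) y = 0" if "x \<in> H" "y \<in> H" for x y
  using N[rule_format, of "replicate N x" y] that f[of N x y] by (auto simp: set_replicate_conv_if)
 then show ?thesis by blast
qed

lemma subalg_H: "subalg H"
 unfolding subalg_def using subspace_H H_br by blast

lemma H_norm': "x \<in> K ==> (\<And>y. y \<in> H ==> br y x \<in> H) ==> x \<in> H"
 using H_norm br_anti subspace_neg[OF subspace_H] by metis

definition nil_ad :: "'a \<Rightarrow> bool" where "nil_ad x \<longleftrightarrow> (\<forall>v. \<exists>N. (br x ^^ N) v = 0)"

text \<open>The semisimple part of \<open>ad h\<close> is a derivation, hence inner.\<close>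

lemma jordan_part:
 assumes h: "h \<in> H"
 shows "\<exists>s\<in>H. (\<forall>y\<in>H. br y s = 0) \<and> diagble (br s) \<and> nil_ad (h - s)"
proof -
 define D where "D = gei (br h) (\<lambda>a. a)"
 have D: "lin D" "D (br x y) = br (D x) y + br x (D y)" for x y
  unfolding D_def by (rule lin_gei[OF lin_br], rule gei_derivation[OF lin_br jacobi refl])
 have Dg: "D w = a *s w" if "w \<in> geig (br h) a" for w a
  unfolding D_def using gei_on[OF lin_br that] .
 obtain s where s: "\<And>x. D x = br s x" using derivation_inner[OF D] by blast
 \<comment> \<open>As \<open>h\<close> is fixed, each \<open>\<sigma> i\<close> preserves the
   generalized eigenspaces of \<open>ad h\<close> and commutes with \<open>D\<close>; since the
   centre is zero, \<open>s\<close> is fixed as well.\<close>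
 have sK: "s \<in> K"
  unfolding K_iff
 proof (intro allI impI)
  fix i assume i: "i < n"
  have Ds: "D (\<sigma> i w) = \<sigma> i (D w)" for w
  proof (rule geig_induct[OF lin_br, of h "\<lambda>w. D (\<sigma> i w) = \<sigma> i (D w)"])
   fix a x assume x: "x \<in> geig (br h) a"
   have "\<sigma> i x \<in> geig (br h) a"
    by (rule geig_stable[OF sig_lin[OF i] _ x]) (use sig_br[OF i] H_K[OF h] i in \<open>simp add: K_iff\<close>)
   then show "D (\<sigma> i x) = \<sigma> i (D x)" using Dg[OF x] Dg by (simp add: lin_scale[OF sig_lin[OF i]])
  qed (simp add: lin_add D sig_lin[OF i])
  have "br (\<sigma> i s - s) v = 0" for v
  proof -
   obtain w where w: "v = \<sigma> i w" using sig_bij[OF i] by (metis bij_pointE)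
   have "br (\<sigma> i s) v = br s v" using Ds[of w] unfolding w s by (simp add: sig_br[OF i])
   then show ?thesis by (simp add: br_diff_left)
  qed
  then show "\<sigma> i s = s" using center_zero[of "\<sigma> i s - s"] by simp
 qed
 obtain N where N: "\<forall>x\<in>H. \<forall>y\<in>H. (br x ^^ N) y = 0" using H_nil by blast
 have sh0: "shift (br x) 0 = br x" for x by (simp add: shift_def)
 \<comment> \<open>By nilpotency of \<open>H\<close>, \<open>y\<close> lies in the generalized
   eigenspace of \<open>ad h\<close> for \<open>0\<close>. So \<open>ad y\<close> preserves every
   generalized eigenspace and commutes with \<open>D = ad s\<close>.\<close>
 have sc: "br y s = 0" if y: "y \<in> H" for y
 proof (rule center_zero)
  fix w
  have y0: "y \<in> geig (br h) 0" using N h y by (auto simp: geig_def sh0)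
  have "br y (D w) = D (br y w)"
  proof (rule geig_induct[OF lin_br, of h "\<lambda>w. br y (D w) = D (br y w)"])
   fix a x assume x: "x \<in> geig (br h) a"
   show "br y (D x) = D (br y x)"
    using Dg[OF x] Dg[of "br y x" a] geig_br[OF lin_br jacobi y0 x] by (simp add: br_lin)
  qed (simp add: lin_add[OF D(1)] br_lin)
  then show "br (br y s) w = 0" by (simp add: br_br_left s)
 qed
 have sH: "s \<in> H" by (rule H_norm'[OF sK]) (simp add: sc subspace_0[OF subspace_H])
 have "br s = gscale {a. geig (br h) a \<noteq> {0}} (geig (br h)) (\<lambda>a. a)"
  using s unfolding D_def by (intro ext) simp
 then have "diagble (br s)" using diagble_gscale[OF geig_decomp(2)[OF ac lin_br]] by simp
 moreover have "nil_ad (h - s)"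
  unfolding nil_ad_def
 proof
  fix v
  have "v \<in> geig (br (h - s)) 0"
  proof (rule geig_induct[OF lin_br, of h "\<lambda>v. v \<in> geig (br (h - s)) 0"])
   fix a x assume x: "x \<in> geig (br h) a"
   then obtain M where M: "(shift (br h) a ^^ M) x = 0" by (auto simp: geig_def)
   have "(br (h - s) ^^ k) x = (shift (br h) a ^^ k) x \<and> (shift (br h) a ^^ k) x \<in> geig (br h) a" for k
   proof (induction k)
    case (Suc k)
    let ?y = "(shift (br h) a ^^ k) x"
    have y: "?y \<in> geig (br h) a" using Suc by simp
    have "br (h - s) ?y = shift (br h) a ?y"
     using Dg[OF y] by (simp add: br_diff_left shift_def s)
    moreover have "shift (br h) a ?y \<in> geig (br h) a"
     by (rule shift_stable[OF subspace_geig[OF lin_br] geig_stable_self[OF lin_br] y])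
    ultimately show ?case using Suc by simp
   qed (simp add: x)
   then show "x \<in> geig (br (h - s)) 0" unfolding geig_def sh0 using M by auto
  qed (rule subspace_add[OF subspace_geig[OF lin_br]])
  then show "\<exists>N. (br (h - s) ^^ N) v = 0" by (auto simp: geig_def sh0)
 qed
 ultimately show ?thesis using sH sc by blast
qed

text \<open>The ad-diagonalizable part of the centre of \<open>H\<close>; \<open>H_SS\<close> shows
  that it exhausts \<open>H\<close>.\<close>

definition SS :: "'a set" where
 "SS = {s\<in>H. (\<forall>y\<in>H. br y s = 0) \<and> diagble (br s)}"

text \<open>On the centralizer \<open>C\<close> of \<open>SS\<close> in \<open>K\<close>, an element
  of \<open>H\<close> acts as its nilpotent Jordan part. If \<open>C\<close> exceeded
  \<open>H\<close>, Engel's theorem for \<open>C/H\<close> would give an element outside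
  \<open>H\<close> that normalizes \<open>H\<close>.\<close>

lemma SS_centralizer:
 assumes "x \<in> K" "\<And>s. s \<in> SS ==> br s x = 0" shows "x \<in> H"
proof (rule ccontr)
 assume xH: "x \<notin> H"
 define C where "C = {x\<in>K. \<forall>s\<in>SS. br s x = 0}"
 have HC: "H \<subseteq> C" using H_K br_anti_zero by (auto simp: C_def SS_def)
 have sC: "subspace C" using subspace_K by (auto intro!: subspaceI simp: C_def br_lin subspace_0 subspace_add subspace_scale)
 have st: "br h w \<in> C" if "h \<in> H" "w \<in> C" for h w
 proof -
  have "br s (br h w) = 0" if s: "s \<in> SS" for s
  proof -
   have "br s h = 0" using s \<open>h \<in> H\<close> br_anti_zero by (auto simp: SS_def)
   moreover have "br s w = 0" using s \<open>w \<in> C\<close> by (auto simp: C_def)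
   ultimately show ?thesis using jacobi[of s h w] by simp
  qed
  then show ?thesis using that H_K K_br by (auto simp: C_def)
 qed
 have nil: "\<exists>N. (br h ^^ N) w \<in> H" if h: "h \<in> H" and w: "w \<in> C" for h w
 proof -
  obtain s where s: "s \<in> H" "\<forall>y\<in>H. br y s = 0" "diagble (br s)" "nil_ad (h - s)" using jordan_part[OF h] by blast
  then have "s \<in> SS" by (auto simp: SS_def)
  then have e: "br h v = br (h - s) v" if "v \<in> C" for v
   using that by (simp add: C_def br_diff_left)
  have "(br h ^^ k) w = (br (h - s) ^^ k) w \<and> (br h ^^ k) w \<in> C" for k
  proof (induction k)
   case (Suc k)
   then have "(br h ^^ k) w \<in> C" by blast
   then show ?case using e[of "(br h ^^ k) w"] st[OF h, of "(br h ^^ k) w"] Suc by simp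
  qed (simp add: w)
  then show ?thesis using s(4) subspace_0[OF subspace_H] unfolding nil_ad_def by metis
 qed
 obtain N where N: "\<forall>x\<in>H. \<forall>y\<in>H. (br x ^^ N) y = 0" using H_nil by blast
 have "\<exists>w\<in>C. w \<notin> H \<and> (\<forall>x\<in>H. br x w \<in> H)"
 proof (rule engel_section[OF subalg_H subspace_H sC HC _ xH])
  show "x \<in> C" using assms by (auto simp: C_def)
 qed (use st nil H_br N in blast)+
 then obtain w where "w \<in> C" "w \<notin> H" "\<And>x. x \<in> H ==> br x w \<in> H" by blast
 then show False using H_norm'[of w] by (auto simp: C_def)
qed

text \<open>\<open>z\<close> is orthogonal to all of \<open>K\<close>: to the non-zero weight spaces
  of \<open>SS\<close> by invariance, and to the zero weight space, which lies in \<open>H\<close>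
  by \<open>SS_centralizer\<close>, because \<open>z\<close> commutes with it and is
  ad-nilpotent.\<close>

lemma central_nil_zero:
 assumes n: "z \<in> H" "\<And>y. y \<in> H ==> br y z = 0" "nil_ad z" shows "z = 0"
proof (rule K_nondeg[OF H_K[OF n(1)]])
 fix x assume xK: "x \<in> K"
 obtain T where T: "T \<subseteq> SS" "independent T" "SS \<subseteq> span T"
  using maximal_independent_subset by blast
 have fT: "finite T" using T finiteI_independent by blast
 have "x \<in> span (\<Union>\<chi>. jeig T br \<chi> \<inter> K)"
 proof (rule jeig_span[OF fT lin_br _ _ subspace_K _ xK])
  show "diagble (br t)" if "t \<in> T" for t using T that by (auto simp: SS_def)
  show "br t (br s x) = br s (br t x)" if "t \<in> T" "s \<in> T" for t s x
   using jacobi[of t s x] T that by (auto simp: SS_def subset_iff)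
  show "br t x \<in> K" if "t \<in> T" "x \<in> K" for t x
   using that T H_K K_br by (auto simp: SS_def subset_iff)
 qed
 then show "kil z x = 0"
 proof (induction rule: span_induct_alt)
  case (step c v w)
  then obtain \<chi> where v: "v \<in> jeig T br \<chi>" "v \<in> K" by auto
  have "kil z v = 0"
  proof (cases "\<forall>t\<in>T. \<chi> t = 0")
   case True
   have "br s v = 0" if "s \<in> SS" for s
   proof -
    have "s \<in> span T" using that T by auto
    then show ?thesis
     by (induction rule: span_induct_alt) (use v True in \<open>auto simp: jeig_def br_lin\<close>)
   qed
   then have "v \<in> H" by (rule SS_centralizer[OF v(2)])
   then show ?thesis using n br_anti_zero by (intro kil_nil_commuting) (auto simp: nil_ad_def)
  next
   case False
   then obtain t where t: "t \<in> T" "\<chi> t \<noteq> 0" by auto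
   have "\<chi> t * kil z v = kil z (br t v)" using v t by (simp add: jeig_def kil_scale_right)
   also have "\<dots> = - kil (br t z) v" using kil_invariant2[of t z v] by simp
   also have "\<dots> = 0" using n T t by (auto simp: SS_def subset_iff)
   finally show ?thesis using t by simp
  qed
  then show ?case using step by (simp add: kil_add_right kil_scale_right)
 qed simp
qed

lemma central_SS: assumes z: "z \<in> H" "\<And>y. y \<in> H ==> br y z = 0" shows "z \<in> SS"
proof -
 obtain s where s: "s \<in> H" "\<forall>y\<in>H. br y s = 0" "diagble (br s)" "nil_ad (z - s)" using jordan_part[OF z(1)] by blast
 have "z - s = 0" by (rule central_nil_zero) (use s z in \<open>auto simp: br_lin subspace_diff[OF subspace_H]\<close>)
 then show ?thesis using s z by (auto simp: SS_def)
qed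

lemma SS_commutator:
 assumes c: "br y x \<in> SS" and xy: "x \<in> H" "y \<in> H" shows "br y x = 0"
proof (rule diagble_commutator_zero)
 show "diagble (br (br y x))" using c by (simp add: SS_def)
 show "br (br y x) x = 0" "br (br y x) y = 0"
  by (rule br_anti_zero, use c xy in \<open>simp add: SS_def\<close>)+
qed

text \<open>By \<open>central_SS\<close>, \<open>SS\<close> is the centre of \<open>H\<close>. If it
  were smaller than \<open>H\<close>, Engel's theorem for \<open>H/SS\<close> would give
  \<open>w\<close> outside \<open>SS\<close> with \<open>[H, w]\<close> inside \<open>SS\<close>;
  such commutators vanish by \<open>SS_commutator\<close>, so \<open>w\<close> would be
  central.\<close>

lemma H_SS: "H = SS"
proof (rule ccontr)
 assume "H \<noteq> SS"
 then obtain x0 where x0: "x0 \<in> H" "x0 \<notin> SS" by (auto simp: SS_def)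
 have eq: "SS = {z\<in>H. \<forall>y\<in>H. br y z = 0}" using central_SS by (auto simp: SS_def)
 have sS: "subspace SS" unfolding eq using subspace_H
  by (auto intro!: subspaceI simp: br_lin subspace_0 subspace_add subspace_scale)
 obtain N where N: "\<forall>x\<in>H. \<forall>y\<in>H. (br x ^^ N) y = 0" using H_nil by blast
 have "\<exists>w\<in>H. w \<notin> SS \<and> (\<forall>x\<in>H. br x w \<in> SS)"
 proof (rule engel_section[OF subalg_H sS subspace_H _ x0])
  show "SS \<subseteq> H" by (auto simp: SS_def)
  show "br x w \<in> SS" if "x \<in> H" "w \<in> SS" for x w
   using that subspace_0[OF sS] by (auto simp: SS_def)
  show "\<exists>N. (br x ^^ N) w \<in> SS" if "x \<in> H" "w \<in> H" for x w
   using that N subspace_0[OF sS] by metis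
 qed (use N H_br in blast)+
 then obtain w where w: "w \<in> H" "w \<notin> SS" "\<And>x. x \<in> H ==> br x w \<in> SS" by blast
 then have "br x w = 0" if "x \<in> H" for x using SS_commutator that by blast
 then show False using w central_SS by blast
qed

lemma H_abelian: "x \<in> H ==> y \<in> H ==> br x y = 0"
 and H_diagble: "x \<in> H ==> diagble (br x)"
 using H_SS by (auto simp: SS_def)

end

text \<open>Weights and degrees are functions into commutative rings, so their integer multiples are
  products with the constant functions \<open>of_nat j\<close> and \<open>of_int z\<close>. One ring
  identity serves for both.\<close>

lemma add_of_nat_Suc: "(a::'r::comm_ring_1) + (c + of_nat j * a) = c + of_nat (Suc j) * a"
 by (simp add: algebra_simps)

lemma cancel_string:
 "0 \<le> z ==> (c::'r::comm_ring_1) + of_nat j * a + of_nat (j + nat z) * (- a) = c - of_int z * a"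
 by (simp add: algebra_simps flip: of_int_of_nat_eq[of "nat z"])

context flie begin

lemma eig_geig_br: "br h w = a *s w ==> w \<in> geig (br h) a"
 by (rule eig_geig)

subsection \<open>Triples for sl2\<close>

definition sl2 :: "'a \<Rightarrow> 'a \<Rightarrow> 'a \<Rightarrow> bool" where
 "sl2 e f h \<longleftrightarrow> br h e = 2 *s e \<and> br h f = (-2) *s f \<and> br e f = h"

lemma sl2_swap: "sl2 e f h ==> sl2 f e (- h)"
 using br_anti[of f e] by (auto simp: sl2_def br_neg_left)

lemma sl2_weight_e: "sl2 e f h ==> br h w = c *s w ==> br h (br e w) = (c + 2) *s br e w"
 using jacobi[of h e w] by (simp add: sl2_def br_scale_left br_scale_right scale_left_distrib add.commute)

lemma sl2_weight_f: "sl2 e f h ==> br h w = c *s w ==> br h (br f w) = (c - 2) *s br f w"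
 using jacobi[of h f w]
 by (simp add: sl2_def br_scale_left br_neg_left br_scale_right scale_left_diff_distrib)

lemma sl2_weight_e_pow: "sl2 e f h ==> br h w = c *s w ==> br h ((br e ^^ j) w) = (c + 2 * of_nat j) *s (br e ^^ j) w"
proof (induction j)
 case (Suc j)
 have "c + 2 * of_nat (Suc j) = (c + 2 * of_nat j) + 2" by (simp add: algebra_simps)
 then show ?case using sl2_weight_e[OF Suc.prems(1) Suc.IH[OF Suc.prems]] by simp
qed simp

lemma sl2_weight_f_pow: "sl2 e f h ==> br h w = c *s w ==> br h ((br f ^^ j) w) = (c - 2 * of_nat j) *s (br f ^^ j) w"
proof (induction j)
 case (Suc j)
 have "c - 2 * of_nat (Suc j) = (c - 2 * of_nat j) - 2" by (simp add: algebra_simps)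
 then show ?case using sl2_weight_f[OF Suc.prems(1) Suc.IH[OF Suc.prems]] by simp
qed simp

text \<open>The vectors \<open>e^j w\<close> have pairwise distinct weights \<open>c + 2 j\<close>,
  and \<open>ad h\<close> has only finitely many eigenvalues.\<close>

lemma sl2_top:
 assumes s: "sl2 e f h" and w: "br h w = c *s w" "w \<noteq> 0"
 shows "\<exists>j. (br e ^^ j) w \<noteq> 0 \<and> br e ((br e ^^ j) w) = 0"
proof -
 have "\<exists>j. (br e ^^ j) w = 0"
 proof (rule ccontr)
  assume n: "\<not> ?thesis"
  have "(\<lambda>j::nat. c + 2 * of_nat j) ` UNIV \<subseteq> {a. geig (br h) a \<noteq> {0}}"
  proof clarsimp
   fix j assume "geig (br h) (c + 2 * of_nat j) = {0}"
   then show False using eig_geig_br[OF sl2_weight_e_pow[OF s w(1), of j]] n by auto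
  qed
  then have "finite ((\<lambda>j::nat. c + 2 * of_nat j) ` UNIV)" using geig_decomp(1)[OF ac lin_br] finite_subset by blast
  moreover have "inj (\<lambda>j::nat. c + 2 * of_nat j)" by (auto simp: inj_def)
  ultimately show False using finite_imageD infinite_UNIV_nat by blast
 qed
 then obtain N where "(br e ^^ N) w \<in> {0}" by auto
 then show ?thesis using last_nonmember[of N "br e" w "{0}"] w(2) by simp
qed

lemma sl2_ef_pow:
 assumes s: "sl2 e f h" and u: "br h u = c *s u" "br e u = 0"
 shows "br e ((br f ^^ Suc i) u) = (of_nat (Suc i) * (c - of_nat i)) *s (br f ^^ i) u"
proof (induction i)
 case 0
 show ?case using jacobi[of e f u] u s by (simp add: sl2_def)
next
 case (Suc i)
 let ?v = "(br f ^^ Suc i) u"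
 have "br e (br f ?v) = br h ?v + br f (br e ?v)" using jacobi[of e f ?v] s by (simp only: sl2_def)
 also have "br f (br e ?v) = (of_nat (Suc i) * (c - of_nat i)) *s ?v"
  unfolding Suc by (simp add: br_scale_right)
 also have "br h ?v = (c - 2 * of_nat (Suc i)) *s ?v" by (rule sl2_weight_f_pow[OF s u(1)])
 also have "(c - 2 * of_nat (Suc i)) *s ?v + (of_nat (Suc i) * (c - of_nat i)) *s ?v
   = (of_nat (Suc (Suc i)) * (c - of_nat (Suc i))) *s ?v"
  unfolding scale_left_distrib[symmetric] by (rule arg_cong2[where f = scale]) (simp_all add: algebra_simps)
 finally show ?case by simp
qed

text \<open>At the last non-zero \<open>f^k u\<close> the coefficient \<open>(k + 1) (c - k)\<close>
  of \<open>sl2_ef_pow\<close> must vanish, and in characteristic zero this leaves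
  \<open>c = k\<close>.\<close>

lemma sl2_highest:
 assumes s: "sl2 e f h" and u: "br h u = c *s u" "br e u = 0" "u \<noteq> 0"
 shows "\<exists>p. c = of_nat p \<and> (\<forall>i\<le>p. (br f ^^ i) u \<noteq> 0) \<and> br f ((br f ^^ p) u) = 0"
proof -
 have "br (- h) u = (- c) *s u" using u(1) by (simp add: br_neg_left)
 from sl2_top[OF sl2_swap[OF s] this u(3)] obtain k
  where k: "(br f ^^ k) u \<noteq> 0" "br f ((br f ^^ k) u) = 0" by blast
 have "(of_nat (Suc k) * (c - of_nat k)) *s (br f ^^ k) u = 0"
  using sl2_ef_pow[OF s u(1,2), of k] k(2) by simp
 then have "c = of_nat k" using k(1) by (auto simp del: of_nat_Suc)
 moreover have "(br f ^^ i) u \<noteq> 0" if i: "i \<le> k" for i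
 proof
  assume "(br f ^^ i) u = 0"
  then have "(br f ^^ k) u = 0" using funpow_zero_mono[OF lin_br _ i] by blast
  then show False using k(1) by simp
 qed
 ultimately show ?thesis using k(2) by blast
qed

lemma sl2_reach:
 assumes s: "sl2 e f h" and w: "br h w = c *s w" "w \<noteq> 0"
 shows "\<exists>j p. c + 2 * of_nat j = of_nat p \<and> (br e ^^ j) w \<noteq> 0 \<and> br e ((br e ^^ j) w) = 0 \<and>
  (\<forall>i\<le>p. (br f ^^ i) ((br e ^^ j) w) \<noteq> 0)"
proof -
 obtain j where j: "(br e ^^ j) w \<noteq> 0" "br e ((br e ^^ j) w) = 0" using sl2_top[OF s w] by blast
 then show ?thesis using sl2_highest[OF s sl2_weight_e_pow[OF s w(1)] j(2,1)] by blast
qed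

lemma sl2_integer:
 assumes s: "sl2 e f h" and w: "br h w = c *s w" "w \<noteq> 0"
 shows "\<exists>z. c = of_int z"
proof -
 obtain j p where "c + 2 * of_nat j = of_nat p" using sl2_reach[OF assms] by blast
 then have "c = of_int (int p - 2 * int j)" by (simp add: algebra_simps)
 then show ?thesis by blast
qed

text \<open>Raise \<open>w\<close> to a highest weight vector, of weight \<open>p = z + 2 j\<close>,
  and descend. The descending string is non-zero for \<open>p\<close> steps, and the
  \<open>j + z\<close> steps that lead to weight \<open>- z\<close> are among them.\<close>

lemma sl2_reflect:
 assumes s: "sl2 e f h" and w: "br h w = of_int z *s w" "w \<noteq> 0" "0 \<le> z"
 shows "\<exists>j. (br f ^^ (j + nat z)) ((br e ^^ j) w) \<noteq> 0"
proof -
 obtain j p where jp: "of_int z + 2 * of_nat j = (of_nat p :: 'k)"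
  "\<forall>i\<le>p. (br f ^^ i) ((br e ^^ j) w) \<noteq> 0" using sl2_reach[OF s w(1,2)] by blast
 have "of_int (z + 2 * int j) = (of_int (int p) :: 'k)" using jp(1) by simp
 then have "z + 2 * int j = int p" by (rule of_int_eq_iff[THEN iffD1])
 then have "j + nat z \<le> p" using w(3) by linarith
 then show ?thesis using jp(2) by blast
qed

lemma sl2_f_inj:
 assumes s: "sl2 e f h" and w: "br h w = of_int z *s w" "br f w = 0" "0 < z"
 shows "w = 0"
proof (rule ccontr)
 assume "w \<noteq> 0"
 have "br (- h) w = (- of_int z) *s w" using w(1) by (simp add: br_neg_left)
 then obtain p where "- of_int z = (of_nat p :: 'k)"
  using sl2_highest[OF sl2_swap[OF s] _ w(2) \<open>w \<noteq> 0\<close>] by blast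
 then have "of_int (- z) = (of_int (int p) :: 'k)" by simp
 then have "- z = int p" by (rule of_int_eq_iff[THEN iffD1])
 then show False using w(3) by simp
qed

text \<open>On vectors of weight \<open>c\<close> the Casimir operator acts, up to normalization, as
 \<open>w \<mapsto> 4 f e w + (c\<^sup>2 + 2 c) w\<close>.\<close>

lemma sl2_casimir_e:
 assumes s: "sl2 e f h" and w: "br h w = c *s w"
 shows "br e (4 *s br f (br e w) + (c\<^sup>2 + 2 * c) *s w)
  = 4 *s br f (br e (br e w)) + ((c + 2)\<^sup>2 + 2 * (c + 2)) *s br e w"
proof -
 have "br e (br f (br e w)) = (c + 2) *s br e w + br f (br e (br e w))"
  using jacobi[of e f "br e w"] sl2_weight_e[OF s w] s by (simp only: sl2_def)
 then have "br e (4 *s br f (br e w) + (c\<^sup>2 + 2 * c) *s w)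
  = 4 *s ((c + 2) *s br e w + br f (br e (br e w))) + (c\<^sup>2 + 2 * c) *s br e w"
  by (simp only: br_add_right br_scale_right)
 also have "\<dots> = 4 *s br f (br e (br e w)) + (4 * (c + 2) + (c\<^sup>2 + 2 * c)) *s br e w"
  unfolding scale_left_distrib[of "4 * (c + 2)"] scale_right_distrib scale_scale by (simp only: add_ac)
 also have "4 * (c + 2) + (c\<^sup>2 + 2 * c) = (c + 2)\<^sup>2 + 2 * (c + 2)" by (simp add: power2_eq_square algebra_simps)
 finally show ?thesis .
qed

lemma sl2_casimir_f:
 assumes s: "sl2 e f h" and w: "br h w = c *s w"
 shows "br f (4 *s br f (br e w) + (c\<^sup>2 + 2 * c) *s w)
  = 4 *s br f (br e (br f w)) + ((c - 2)\<^sup>2 + 2 * (c - 2)) *s br f w"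
proof -
 have "br e (br f w) = c *s w + br f (br e w)" using jacobi[of e f w] w s by (simp only: sl2_def)
 then have "4 *s br f (br e (br f w)) + ((c - 2)\<^sup>2 + 2 * (c - 2)) *s br f w
  = 4 *s br f (br f (br e w)) + (4 * c + ((c - 2)\<^sup>2 + 2 * (c - 2))) *s br f w"
  by (simp only: br_add_right br_scale_right scale_right_distrib scale_scale scale_left_distrib add_ac)
 also have "4 * c + ((c - 2)\<^sup>2 + 2 * (c - 2)) = c\<^sup>2 + 2 * c" by (simp add: power2_eq_square algebra_simps)
 finally show ?thesis by (simp only: br_add_right br_scale_right)
qed

text \<open>If \<open>e f w = 0\<close>, the Casimir operator acts on \<open>w\<close> by
  \<open>z^2 - 2 z\<close>: the error term \<open>x\<close> is killed by \<open>f\<close> and has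
  positive weight, so it vanishes by \<open>sl2_f_inj\<close>. On a highest weight vector
  \<open>e^j w\<close> of weight \<open>p \<ge> z\<close> the same operator acts by
  \<open>p^2 + 2 p\<close>, which is larger.\<close>

lemma sl2_ef_inj:
 assumes s: "sl2 e f h" and w: "br h w = of_int z *s w" "0 < z" "br e (br f w) = 0"
 shows "w = 0"
proof (rule ccontr)
 assume w0: "w \<noteq> 0"
 let ?c = "of_int z :: 'k"
 define Q where "Q = (\<lambda>(c::'k) w. 4 *s br f (br e w) + (c\<^sup>2 + 2 * c) *s w)"
 define x where "x = Q ?c w - (?c\<^sup>2 - 2 * ?c) *s w"
 have "br f (Q ?c w) = ((?c - 2)\<^sup>2 + 2 * (?c - 2)) *s br f w"
  unfolding Q_def sl2_casimir_f[OF s w(1)] by (simp add: w(3))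
 also have "(?c - 2)\<^sup>2 + 2 * (?c - 2) = ?c\<^sup>2 - 2 * ?c" by (simp add: power2_eq_square algebra_simps)
 finally have fx: "br f x = 0" unfolding x_def by (simp only: br_diff_right br_scale_right diff_self)
 have "br h (br f (br e w)) = ?c *s br f (br e w)"
  using sl2_weight_f[OF s sl2_weight_e[OF s w(1)]] by simp
 then have "br h x = ?c *s x"
  unfolding x_def Q_def using w(1)
  by (simp add: br_diff_right br_add_right br_scale_right scale_right_diff_distrib scale_right_distrib mult.commute)
 then have "x = 0" using sl2_f_inj[OF s _ fx w(2)] by blast
 then have Q: "Q ?c w = (?c\<^sup>2 - 2 * ?c) *s w" by (simp add: x_def)
 obtain j p where jp: "?c + 2 * of_nat j = of_nat p" "(br e ^^ j) w \<noteq> 0" "br e ((br e ^^ j) w) = 0"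
  using sl2_reach[OF s w(1) w0] by blast
 have "Q (?c + 2 * of_nat j) ((br e ^^ j) w) = (?c\<^sup>2 - 2 * ?c) *s (br e ^^ j) w" for j
 proof (induction j)
  case (Suc j)
  have "Q (?c + 2 * of_nat (Suc j)) ((br e ^^ Suc j) w) = br e (Q (?c + 2 * of_nat j) ((br e ^^ j) w))"
   unfolding Q_def sl2_casimir_e[OF s sl2_weight_e_pow[OF s w(1)]] by (simp add: algebra_simps)
  then show ?case unfolding Suc by (simp add: br_scale_right)
 qed (simp add: Q)
 from this[of j] have "(of_nat p ^ 2 + 2 * of_nat p) *s (br e ^^ j) w = (?c\<^sup>2 - 2 * ?c) *s (br e ^^ j) w"
  unfolding Q_def jp(1) by (simp add: jp(3))
 then have "of_nat p ^ 2 + 2 * of_nat p = ?c\<^sup>2 - 2 * ?c" using jp(2) scale_right_imp_eq by blast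
 then have "of_int (int p ^ 2 + 2 * int p) = (of_int (z\<^sup>2 - 2 * z) :: 'k)" by simp
 then have e: "int p ^ 2 + 2 * int p = z\<^sup>2 - 2 * z" by (rule of_int_eq_iff[THEN iffD1])
 have "of_int (z + 2 * int j) = (of_int (int p) :: 'k)" using jp(1) by simp
 then have "z + 2 * int j = int p" by (rule of_int_eq_iff[THEN iffD1])
 then have "z \<le> int p" by simp
 then have "z\<^sup>2 \<le> (int p)\<^sup>2" using w(2) by (intro power_mono) auto
 then show False using e w(2) by linarith
qed

end

section \<open>Joint spaces of a weight and a degree\<close>

context mloop begin

text \<open>Degrees are integer vectors although only their residues modulo the \<open>m i\<close>
  matter, by \<open>G_cong\<close>; thus degrees can be added and shifted without reduction.\<close>

definition G :: "('a \<Rightarrow> 'k) \<Rightarrow> (nat \<Rightarrow> int) \<Rightarrow> 'a set" where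
 "G \<alpha> l = rt \<alpha> \<inter> tw l"

lemma rt_iff: "x \<in> rt \<alpha> \<longleftrightarrow> (\<forall>h\<in>H. br h x = \<alpha> h *s x)"
 by (simp add: root_space_def)

lemma tw_iff: "x \<in> tw l \<longleftrightarrow> (\<forall>i<n. \<sigma> i x = \<zeta> (m i) powi l i *s x)"
 by (simp add: twisted_def)

lemma subspace_rt: "subspace (rt \<alpha>)"
 by (rule subspaceI) (auto simp: rt_iff br_add_right br_scale_right scale_right_distrib mult.commute)

lemma subspace_tw: "subspace (tw l)"
 by (rule subspaceI) (auto simp: tw_iff lin_zero lin_add lin_scale sig_lin scale_right_distrib mult.commute)

lemma subspace_G: "subspace (G \<alpha> l)"
 unfolding G_def by (intro subspace_inter subspace_rt subspace_tw)

lemma rt_br: "x \<in> rt \<alpha> ==> y \<in> rt \<beta> ==> br x y \<in> rt (\<alpha> + \<beta>)"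
 unfolding rt_iff
proof
 fix h assume "\<forall>h\<in>H. br h x = \<alpha> h *s x" "\<forall>h\<in>H. br h y = \<beta> h *s y" "h \<in> H"
 then show "br h (br x y) = (\<alpha> + \<beta>) h *s br x y"
  using jacobi[of h x y] by (simp add: br_scale_left br_scale_right scale_left_distrib)
qed

lemma tw_br: "x \<in> tw l ==> y \<in> tw l' ==> br x y \<in> tw (l + l')"
 by (auto simp: tw_iff sig_br br_scale_left br_scale_right power_int_add zeta_nz m_pos)

lemma G_br: "x \<in> G \<alpha> l ==> y \<in> G \<beta> l' ==> br x y \<in> G (\<alpha> + \<beta>) (l + l')"
 unfolding G_def using rt_br tw_br by blast

lemma tw_cong: assumes "\<And>i. i < n ==> int (m i) dvd l i - l' i" shows "tw l = tw l'"
proof -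
 have "\<zeta> (m i) powi l i = \<zeta> (m i) powi l' i" if i: "i < n" for i
 proof -
  have "\<zeta> (m i) powi l i = \<zeta> (m i) powi l' i * \<zeta> (m i) powi (l i - l' i)"
   using zeta_nz[OF m_pos[OF i]] by (simp flip: power_int_add)
  also have "\<zeta> (m i) powi (l i - l' i) = 1" using zeta_powi_1[OF m_pos[OF i]] assms[OF i] by simp
  finally show ?thesis by simp
 qed
 then show ?thesis by (auto simp: tw_iff)
qed

lemma G_cong: "(\<And>i. i < n ==> int (m i) dvd l i - l' i) ==> G \<alpha> l = G \<alpha> l'"
 unfolding G_def using tw_cong[of l l'] by simp

lemma hd_add: "\<alpha> \<in> hd' ==> \<beta> \<in> hd' ==> \<alpha> + \<beta> \<in> hd'"
 by (auto simp: hdual_def algebra_simps)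
lemma hd_zero: "0 \<in> hd'" by (auto simp: hdual_def)
lemma hd_diff: "\<alpha> \<in> hd' ==> \<beta> \<in> hd' ==> \<alpha> - \<beta> \<in> hd'"
 by (auto simp: hdual_def algebra_simps)
lemma hd_neg: "\<alpha> \<in> hd' ==> - \<alpha> \<in> hd'"
 by (auto simp: hdual_def algebra_simps)
lemma hd_eqI: "\<alpha> \<in> hd' ==> \<beta> \<in> hd' ==> (\<And>h. h \<in> H ==> \<alpha> h = \<beta> h) ==> \<alpha> = \<beta>"
 by (rule ext) (auto simp: hdual_def, metis)
lemma hd_lin: "\<alpha> \<in> hd' ==> x \<in> H ==> y \<in> H ==> \<alpha> (x + y) = \<alpha> x + \<alpha> y"
 "\<alpha> \<in> hd' ==> x \<in> H ==> \<alpha> (c *s x) = c * \<alpha> x"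
 by (auto simp: hdual_def)

lemma rt_eq: "x \<in> rt \<alpha> ==> x \<in> rt \<beta> ==> x \<noteq> 0 ==> \<alpha> \<in> hd' ==> \<beta> \<in> hd' ==> \<alpha> = \<beta>"
 by (rule hd_eqI) (auto simp: rt_iff)

text \<open>A basis of \<open>H\<close> and the \<open>\<sigma> i\<close> are finitely many
  commuting diagonalizable operators. A joint eigenvector defines a functional on \<open>H\<close>
  and, since \<open>\<sigma> i ^^ m i = id\<close>, exponents of the roots of unity
  \<open>\<zeta> (m i)\<close>.\<close>

lemma G_span: "x \<in> span (\<Union>p\<in>hd' \<times> Zn n. G (fst p) (snd p))"
proof -
 obtain B where B: "independent B" "finite B" "span B = H" "B \<subseteq> H" using obtain_basis[OF subspace_H] by blast
 define T where "T = Inl ` B \<union> Inr ` {..<n}"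
 define opr where "opr = case_sum br \<sigma>"
 have fT: "finite T" using B(2) by (simp add: T_def)
 have sbr: "\<sigma> i (br h v) = br h (\<sigma> i v)" if "i < n" "h \<in> H" for i h v
  using H_K[OF that(2)] that(1) by (simp add: sig_br K_iff)
 have "x \<in> span (\<Union>\<chi>. jeig T opr \<chi> \<inter> UNIV)"
 proof (rule jeig_span[OF fT])
  show "lin (opr t)" if "t \<in> T" for t using that lin_br sig_lin by (auto simp: T_def opr_def)
  show "diagble (opr t)" if "t \<in> T" for t using that H_diagble B(4) sig_diagble by (auto simp: T_def opr_def)
  show "opr t (opr s v) = opr s (opr t v)" if ts: "t \<in> T" "s \<in> T" for t s v
  proof -
   have "br h (br k v) = br k (br h v)" if "h \<in> B" "k \<in> B" for h k
   proof -
    have "h \<in> H" "k \<in> H" using that B(4) by auto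
    then show ?thesis using jacobi[of h k v] H_abelian[of h k] by simp
   qed
   then show ?thesis using ts sbr sig_comm B(4) by (auto simp: T_def opr_def subset_iff)
  qed
 qed auto
 moreover have "(\<Union>\<chi>. jeig T opr \<chi> \<inter> UNIV) \<subseteq> (\<Union>p\<in>hd' \<times> Zn n. G (fst p) (snd p))"
 proof
  fix v assume "v \<in> (\<Union>\<chi>. jeig T opr \<chi> \<inter> UNIV)"
  then obtain \<chi> where v: "v \<in> jeig T opr \<chi>" by auto
  have z: "(\<lambda>_. 0) \<in> Zn n" by (simp add: Zn_def)
  show "v \<in> (\<Union>p\<in>hd' \<times> Zn n. G (fst p) (snd p))"
  proof (cases "v = 0")
   case True
   then show ?thesis using subspace_0[OF subspace_G] z hd_zero by (intro UN_I[of "(0, \<lambda>_. 0)"]) auto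
  next
   case False
   have ev: "\<exists>a. br h v = a *s v" if "h \<in> H" for h
   proof -
    have "h \<in> span B" using that B by simp
    then show ?thesis
    proof (induction rule: span_induct_alt)
     case base show ?case by (intro exI[of _ 0]) simp
    next
     case (step c x y)
     then obtain a where "br y v = a *s v" by auto
     moreover have "br x v = \<chi> (Inl x) *s v"
     proof -
      have "Inl x \<in> T" using step by (simp add: T_def)
      then have "opr (Inl x) v = \<chi> (Inl x) *s v" using v unfolding jeig_def by blast
      then show ?thesis by (simp add: opr_def)
     qed
     ultimately show ?case
      by (intro exI[of _ "c * \<chi> (Inl x) + a"]) (simp add: br_add_left br_scale_left scale_left_distrib)
    qed
   qed
   define \<alpha> where "\<alpha> = (\<lambda>h. if h \<in> H then SOME a. br h v = a *s v else 0)"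
   have al: "br h v = \<alpha> h *s v" if "h \<in> H" for h
    using someI_ex[OF ev[OF that]] that by (simp add: \<alpha>_def)
   have u: "\<alpha> h = a" if "h \<in> H" "br h v = a *s v" for h a
    using al[OF that(1)] that(2) False by simp
   have "\<alpha> \<in> hd'"
    unfolding hdual_def
   proof (intro CollectI conjI ballI allI impI)
    show "\<alpha> (x + y) = \<alpha> x + \<alpha> y" if "x \<in> H" "y \<in> H" for x y
     by (rule u) (use that al subspace_add[OF subspace_H] in \<open>auto simp: br_add_left scale_left_distrib\<close>)
    show "\<alpha> (c *s x) = c * \<alpha> x" if "x \<in> H" for c x
     by (rule u) (use that al subspace_scale[OF subspace_H] in \<open>auto simp: br_scale_left\<close>)
   qed (simp add: \<alpha>_def)
   moreover have "v \<in> rt \<alpha>" using al by (simp add: rt_iff)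
   moreover have "\<exists>j. \<sigma> i v = \<zeta> (m i) powi int j *s v" if i: "i < n" for i
   proof -
    have e: "\<sigma> i v = \<chi> (Inr i) *s v"
    proof -
     have "Inr i \<in> T" using i by (simp add: T_def)
     then have "opr (Inr i) v = \<chi> (Inr i) *s v" using v unfolding jeig_def by blast
     then show ?thesis by (simp add: opr_def)
    qed
    have "(\<sigma> i ^^ k) v = \<chi> (Inr i) ^ k *s v" for k
     by (induction k) (auto simp: e lin_scale[OF sig_lin[OF i]] mult.commute)
    from this[of "m i"] have "v = \<chi> (Inr i) ^ m i *s v" using sig_m[OF i] by simp
    then have "\<chi> (Inr i) ^ m i = 1" using False by (metis scale_one scale_right_imp_eq)
    then obtain j where "\<chi> (Inr i) = \<zeta> (m i) ^ j"
     using root_of_unity_power[OF m_pos[OF i] zeta_pow(1)[OF m_pos[OF i]] zeta_pow(2)] by blast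
    then show ?thesis using e by (intro exI[of _ j]) simp
   qed
   then obtain j where j: "\<And>i. i < n ==> \<sigma> i v = \<zeta> (m i) powi int (j i) *s v" by metis
   define l where "l = (\<lambda>i. if i < n then int (j i) else 0)"
   have "v \<in> tw l" "l \<in> Zn n" using j by (auto simp: tw_iff l_def Zn_def)
   ultimately show ?thesis by (intro UN_I[of "(\<alpha>, l)"]) (auto simp: G_def)
  qed
 qed
 ultimately show ?thesis using span_mono by blast
qed

lemma G_induct:
 assumes "\<And>\<alpha> l x. \<alpha> \<in> hd' ==> l \<in> Zn n ==> x \<in> G \<alpha> l ==> P x"
  "\<And>x y. P x ==> P y ==> P (x + y)"
 shows "P x"
proof -
 have z: "(\<lambda>_. 0) \<in> Zn n" by (simp add: Zn_def)
 from G_span[of x] show ?thesis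
 proof (induction rule: span_induct_alt)
  case base then show ?case using assms(1)[OF hd_zero z subspace_0[OF subspace_G]] .
 next
  case (step c x y)
  then obtain \<alpha> l where "\<alpha> \<in> hd'" "l \<in> Zn n" "x \<in> G \<alpha> l" by auto
  then have "P (c *s x)" using assms(1) subspace_scale[OF subspace_G] by blast
  then show ?case using step assms(2) by blast
 qed
qed

lemma G_kil:
 assumes "x \<in> G \<alpha> l" "y \<in> G \<beta> l'" "kil x y \<noteq> 0"
 shows "h \<in> H ==> \<alpha> h + \<beta> h = 0" "i < n ==> int (m i) dvd l i + l' i"
proof -
 assume h: "h \<in> H"
 have "\<alpha> h * kil x y = kil (br h x) y" using assms h by (simp add: G_def rt_iff kil_scale_left)
 also have "\<dots> = - (\<beta> h * kil x y)" using assms h kil_invariant2[of h x y] by (simp add: G_def rt_iff kil_scale_right)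
 finally have "(\<alpha> h + \<beta> h) * kil x y = 0" by (simp add: distrib_right)
 then show "\<alpha> h + \<beta> h = 0" using assms by simp
next
 assume i: "i < n"
 have "kil x y = kil (\<sigma> i x) (\<sigma> i y)" using kil_sig i by simp
 also have "\<dots> = \<zeta> (m i) powi (l i + l' i) * kil x y"
  using assms i zeta_nz[OF m_pos[OF i]] by (simp add: G_def tw_iff kil_scale_left kil_scale_right power_int_add)
 finally have "\<zeta> (m i) powi (l i + l' i) = 1" using assms by simp
 then show "int (m i) dvd l i + l' i" using zeta_powi_1[OF m_pos[OF i]] by simp
qed

text \<open>By \<open>G_kil\<close> a vector of \<open>G \<alpha> l\<close> is orthogonal to all
  joint spaces except the one of opposite weight and degree.\<close>

lemma G_nondeg:
 assumes x: "x \<in> G \<alpha> l" "x \<noteq> 0" "\<alpha> \<in> hd'"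
 shows "\<exists>y\<in>G (- \<alpha>) (- l). kil x y \<noteq> 0"
proof (rule ccontr)
 assume n: "\<not> ?thesis"
 have "x = 0"
 proof (rule kil_nondeg)
  fix y show "kil x y = 0"
  proof (rule G_induct[of "\<lambda>y. kil x y = 0"])
   fix \<beta> l' y assume b: "\<beta> \<in> hd'" "y \<in> G \<beta> l'"
   show "kil x y = 0"
   proof (rule ccontr)
    assume k: "kil x y \<noteq> 0"
    have "\<beta> = - \<alpha>"
     using G_kil(1)[OF x(1) b(2) k] by (intro hd_eqI b hd_neg x) (simp add: eq_neg_iff_add_eq_0 add.commute)
    moreover have "G \<beta> l' = G \<beta> (- l)"
     using G_kil(2)[OF x(1) b(2) k] by (intro G_cong) (simp add: add.commute)
    ultimately show False using n b k by auto
   qed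
  qed (simp add: kil_add_right)
 qed
 then show False using x by simp
qed

lemma tw_0: "tw 0 = K"
 by (simp add: fixed_pts_def zero_fun_def)

lemma G_0: "G 0 0 = H"
proof
 show "G 0 0 \<subseteq> H"
  using H_norm' subspace_0[OF subspace_H] by (auto simp: G_def rt_iff tw_0)
 show "H \<subseteq> G 0 0" using H_K H_abelian by (auto simp: G_def rt_iff tw_0)
qed

lemma H_nondeg:
 assumes "x \<in> H" "\<And>y. y \<in> H ==> kil x y = 0" shows "x = 0"
 using G_nondeg[of x 0 0] assms hd_zero by (auto simp: G_0)

definition tt :: "('a \<Rightarrow> 'k) \<Rightarrow> 'a" where
 "tt \<alpha> = (SOME t. t \<in> H \<and> (\<forall>h\<in>H. kil t h = \<alpha> h))"

lemma tt: assumes "\<alpha> \<in> hd'" shows "tt \<alpha> \<in> H" "h \<in> H ==> kil (tt \<alpha>) h = \<alpha> h"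
proof -
 have "\<exists>d\<in>H. \<forall>w\<in>H. kil d w = \<alpha> w"
  by (rule kil_functional[OF subspace_H H_nondeg]) (use hd_lin[OF assms] in auto)
 then have "\<exists>t. t \<in> H \<and> (\<forall>h\<in>H. kil t h = \<alpha> h)" by blast
 from someI_ex[OF this] show "tt \<alpha> \<in> H" "h \<in> H ==> kil (tt \<alpha>) h = \<alpha> h" by (auto simp: tt_def)
qed

text \<open>Both sides lie in \<open>G 0 0 = H\<close> and, by invariance, have the same Killing
  products with \<open>H\<close>.\<close>

lemma br_opposite:
 assumes "x \<in> G \<alpha> l" "y \<in> G (- \<alpha>) (- l)" "\<alpha> \<in> hd'"
 shows "br x y = kil x y *s tt \<alpha>"
proof -
 have "br x y \<in> G (\<alpha> + - \<alpha>) (l + - l)" by (rule G_br[OF assms(1,2)])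
 then have H1: "br x y \<in> H" by (simp add: G_0)
 have "br x y - kil x y *s tt \<alpha> = 0"
 proof (rule H_nondeg)
  show "br x y - kil x y *s tt \<alpha> \<in> H"
   using H1 tt(1)[OF assms(3)] by (intro subspace_diff subspace_scale subspace_H)
  fix h assume h: "h \<in> H"
  have "kil (br x y) h = kil x (br y h)" by (rule kil_invariant)
  also have "br y h = \<alpha> h *s y" using br_anti[of y h] assms(2) h by (simp add: G_def rt_iff)
  finally show "kil (br x y - kil x y *s tt \<alpha>) h = 0"
   by (simp add: kil_diff_left kil_scale_left kil_scale_right tt(2)[OF assms(3) h])
 qed
 then show ?thesis by simp
qed

text \<open>If \<open>\<alpha> (tt \<alpha>) = 0\<close>, the commutator of \<open>x\<close> with a
  dual vector \<open>y\<close> is an ad-diagonalizable multiple of \<open>tt \<alpha>\<close> that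
  commutes with both factors. It vanishes by \<open>diagble_commutator_zero\<close>, and with it
  \<open>\<alpha>\<close>.\<close>

lemma norm_nonzero:
 assumes "x \<in> G \<alpha> l" "x \<noteq> 0" "\<alpha> \<in> hd'" "\<alpha> \<noteq> 0" shows "\<alpha> (tt \<alpha>) \<noteq> 0"
proof
 assume z: "\<alpha> (tt \<alpha>) = 0"
 obtain y where y: "y \<in> G (- \<alpha>) (- l)" "kil x y \<noteq> 0" using G_nondeg assms by blast
 let ?t = "br x y"
 have t: "?t = kil x y *s tt \<alpha>" by (rule br_opposite[OF assms(1) y(1) assms(3)])
 have tH: "tt \<alpha> \<in> H" by (rule tt[OF assms(3)])
 have "?t = 0"
 proof (rule diagble_commutator_zero)
  show "diagble (br ?t)" unfolding t using tH subspace_scale[OF subspace_H] by (intro H_diagble)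
  show "br ?t x = 0" "br ?t y = 0"
   unfolding t using assms(1) y(1) tH z by (auto simp: br_scale_left G_def rt_iff)
 qed
 then have "tt \<alpha> = 0" using t y by simp
 then have "\<alpha> h = 0" if "h \<in> H" for h using tt(2)[OF assms(3) that] by simp
 then have "\<alpha> = 0" by (intro hd_eqI assms hd_zero) simp
 then show False using assms by simp
qed

text \<open>The coroot of \<open>\<alpha>\<close>.\<close>

definition hh :: "('a \<Rightarrow> 'k) \<Rightarrow> 'a" where
 "hh \<alpha> = (2 / \<alpha> (tt \<alpha>)) *s tt \<alpha>"

definition supp :: "('a \<Rightarrow> 'k) \<Rightarrow> (nat \<Rightarrow> int) \<Rightarrow> bool" where
 "supp \<alpha> l \<longleftrightarrow> \<alpha> \<in> hd' \<and> G \<alpha> l \<noteq> {0}"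

lemma suppI: "\<alpha> \<in> hd' ==> x \<in> G \<alpha> l ==> x \<noteq> 0 ==> supp \<alpha> l"
 by (auto simp: supp_def)

lemma suppE: assumes "supp \<alpha> l" obtains x where "\<alpha> \<in> hd'" "x \<in> G \<alpha> l" "x \<noteq> 0"
 using assms subspace_0[OF subspace_G] by (auto simp: supp_def)

lemma hh_H: "\<alpha> \<in> hd' ==> hh \<alpha> \<in> H"
 unfolding hh_def using tt subspace_scale[OF subspace_H] by blast

lemma supp_norm: "supp \<alpha> l ==> \<alpha> \<noteq> 0 ==> \<alpha> (tt \<alpha>) \<noteq> 0"
 by (metis suppE norm_nonzero)

lemma supp_hh: "supp \<alpha> l ==> \<alpha> \<noteq> 0 ==> \<alpha> (hh \<alpha>) = 2"
 using supp_norm[of \<alpha> l] tt(1)[of \<alpha>] by (auto simp: hh_def hd_lin supp_def)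

lemma sl2_exists:
 assumes x: "x \<in> G \<alpha> l" "x \<noteq> 0" "\<alpha> \<in> hd'" "\<alpha> \<noteq> 0"
 shows "\<exists>y\<in>G (- \<alpha>) (- l). y \<noteq> 0 \<and> sl2 x y (hh \<alpha>)"
proof -
 obtain y where y: "y \<in> G (- \<alpha>) (- l)" "kil x y \<noteq> 0" using G_nondeg x by blast
 define f where "f = (2 / (\<alpha> (tt \<alpha>) * kil x y)) *s y"
 have N: "\<alpha> (tt \<alpha>) \<noteq> 0" by (rule norm_nonzero[OF x])
 have f: "f \<in> G (- \<alpha>) (- l)" unfolding f_def using y(1) subspace_scale[OF subspace_G] by blast
 have "br x f = hh \<alpha>"
  using N y br_opposite[OF x(1) y(1) x(3)] by (simp add: f_def hh_def br_scale_right)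
 moreover have "br (hh \<alpha>) x = 2 *s x" "br (hh \<alpha>) f = (-2) *s f"
  using x(1) f hh_H[OF x(3)] supp_hh[OF suppI[OF x(3,1,2)] x(4)] by (simp_all add: G_def rt_iff)
 moreover have "f \<noteq> 0" using N y by (auto simp: f_def)
 ultimately show ?thesis using f unfolding sl2_def by blast
qed

lemma supp_sl2:
 assumes "supp \<alpha> l" "\<alpha> \<noteq> 0"
 obtains e f where "e \<in> G \<alpha> l" "f \<in> G (- \<alpha>) (- l)" "e \<noteq> 0" "f \<noteq> 0" "sl2 e f (hh \<alpha>)" "\<alpha> \<in> hd'"
 using assms sl2_exists by (metis suppE)

lemma supp_neg: "supp \<alpha> l ==> \<alpha> \<noteq> 0 ==> supp (- \<alpha>) (- l)"
 by (metis supp_sl2 suppI hd_neg)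

lemma G_weight: "x \<in> G \<beta> \<mu> ==> \<alpha> \<in> hd' ==> br (hh \<alpha>) x = \<beta> (hh \<alpha>) *s x"
 using hh_H by (simp add: G_def rt_iff)

lemma supp_integer:
 assumes "supp \<alpha> l" "\<alpha> \<noteq> 0" "supp \<beta> \<mu>" shows "\<exists>z. \<beta> (hh \<alpha>) = of_int z"
proof -
 obtain e f where ef: "sl2 e f (hh \<alpha>)" "\<alpha> \<in> hd'" using supp_sl2[OF assms(1,2)] .
 obtain x where x: "x \<in> G \<beta> \<mu>" "x \<noteq> 0" using suppE[OF assms(3)] .
 show ?thesis using sl2_integer[OF ef(1) G_weight[OF x(1) ef(2)] x(2)] .
qed

text \<open>Subtracting a multiple of \<open>x\<close> makes \<open>w\<close> orthogonal to
  \<open>y\<close>, hence killed by \<open>y\<close> according to \<open>br_opposite\<close>; but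
  the lowering element of a triple kills no non-zero vector of weight \<open>2\<close>.\<close>

lemma G_one_dim:
 assumes "x \<in> G \<alpha> l" "x \<noteq> 0" "\<alpha> \<in> hd'" "\<alpha> \<noteq> 0" "w \<in> G \<alpha> l"
 shows "\<exists>c. w = c *s x"
proof -
 obtain y where y: "y \<in> G (- \<alpha>) (- l)" "y \<noteq> 0" "sl2 x y (hh \<alpha>)" using sl2_exists[OF assms(1-4)] by blast
 have kxy: "kil x y \<noteq> 0"
 proof
  assume "kil x y = 0"
  then have "hh \<alpha> = 0" using y(3) br_opposite[OF assms(1) y(1) assms(3)] by (simp add: sl2_def)
  then have "2 *s x = 0" using y(3) by (simp add: sl2_def)
  then show False using assms by simp
 qed
 define v where "v = w - (kil w y / kil x y) *s x"
 have v: "v \<in> G \<alpha> l" unfolding v_def using assms by (intro subspace_diff subspace_scale subspace_G)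
 have "kil v y = 0" using kxy by (simp add: v_def kil_diff_left kil_scale_left)
 then have "br v y = 0" using br_opposite[OF v y(1) assms(3)] by simp
 then have "br y v = 0" by (rule br_anti_zero)
 moreover have "br (hh \<alpha>) v = of_int 2 *s v"
  using G_weight[OF v assms(3)] supp_hh[OF suppI[OF assms(3,1,2)] assms(4)] by simp
 ultimately have "v = 0" using sl2_f_inj[OF y(3), of v 2] by simp
 then show ?thesis by (auto simp: v_def)
qed

text \<open>\<open>f w\<close> would lie on the line of \<open>e\<close>, giving
  \<open>e f w = 0\<close> at weight \<open>4\<close>, against \<open>sl2_ef_inj\<close>. The
  statement fixes the degree: \<open>\<alpha> + \<alpha>\<close> may still be a weight in other
  degrees.\<close>

lemma G_double:
 assumes "supp \<alpha> l" "\<alpha> \<noteq> 0" shows "\<not> supp (\<alpha> + \<alpha>) (l + l)"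
proof
 assume "supp (\<alpha> + \<alpha>) (l + l)"
 then obtain w where w: "w \<in> G (\<alpha> + \<alpha>) (l + l)" "w \<noteq> 0" using suppE by blast
 obtain e f where ef: "e \<in> G \<alpha> l" "f \<in> G (- \<alpha>) (- l)" "e \<noteq> 0" "sl2 e f (hh \<alpha>)" "\<alpha> \<in> hd'"
  using supp_sl2[OF assms] .
 have "br f w \<in> G (- \<alpha> + (\<alpha> + \<alpha>)) (- l + (l + l))" by (rule G_br[OF ef(2) w(1)])
 then have "br f w \<in> G \<alpha> l" by simp
 then obtain c where "br f w = c *s e" using G_one_dim[OF ef(1,3,5) assms(2)] by blast
 then have "br e (br f w) = 0" by (simp add: br_scale_right br_self)
 moreover have "br (hh \<alpha>) w = of_int 4 *s w"
  using G_weight[OF w(1) ef(5)] supp_hh[OF assms] by simp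
 ultimately show False using sl2_ef_inj[OF ef(4), of w 4] w(2) by simp
qed

lemma G_pow:
 assumes "e \<in> G \<alpha> l" "w \<in> G \<beta> \<mu>"
 shows "(br e ^^ j) w \<in> G (\<beta> + of_nat j * \<alpha>) (\<mu> + of_nat j * l)"
proof (induction j)
 case (Suc j)
 have "br e ((br e ^^ j) w) \<in> G (\<alpha> + (\<beta> + of_nat j * \<alpha>)) (l + (\<mu> + of_nat j * l))"
  by (rule G_br[OF assms(1) Suc])
 then show ?case by (simp only: add_of_nat_Suc funpow.simps o_apply)
qed (simp add: assms)

lemma hd_of_nat: "\<alpha> \<in> hd' ==> of_nat j * \<alpha> \<in> hd'"
 by (induction j) (auto simp: hd_zero hd_add distrib_right)

lemma hd_of_int: "\<alpha> \<in> hd' ==> of_int j * \<alpha> \<in> hd'"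
 by (cases j rule: int_cases2) (auto simp: hd_of_nat hd_neg)

text \<open>The set \<open>M\<close> records that the reflected vector arises from \<open>x\<close>
  by applying \<open>e\<close> and \<open>f\<close> only; in \<open>VV_irreducible\<close> it is a
  submodule.\<close>

lemma G_reflect:
 assumes e: "e \<in> G \<alpha> l" and f: "f \<in> G (- \<alpha>) (- l)" and s: "sl2 e f (hh \<alpha>)" "\<alpha> \<in> hd'"
  and x: "x \<in> G \<beta> \<mu>" "x \<noteq> 0" "\<beta> (hh \<alpha>) = of_int z"
  and M: "\<And>v. v \<in> M ==> br e v \<in> M" "\<And>v. v \<in> M ==> br f v \<in> M" "x \<in> M"
 shows "\<exists>y\<in>G (\<beta> - of_int z * \<alpha>) (\<mu> - of_int z * l) \<inter> M. y \<noteq> 0"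
proof -
 have w: "br (hh \<alpha>) x = of_int z *s x" using G_weight[OF x(1) s(2)] x(3) by simp
 show ?thesis
 proof (cases "0 \<le> z")
  case True
  obtain j where j: "(br f ^^ (j + nat z)) ((br e ^^ j) x) \<noteq> 0" using sl2_reflect[OF s(1) w x(2) True] by blast
  have "(br f ^^ (j + nat z)) ((br e ^^ j) x)
    \<in> G (\<beta> + of_nat j * \<alpha> + of_nat (j + nat z) * (- \<alpha>)) (\<mu> + of_nat j * l + of_nat (j + nat z) * (- l))"
   by (rule G_pow[OF f G_pow[OF e x(1)]])
  moreover have "\<beta> + of_nat j * \<alpha> + of_nat (j + nat z) * (- \<alpha>) = \<beta> - of_int z * \<alpha>"
   "\<mu> + of_nat j * l + of_nat (j + nat z) * (- l) = \<mu> - of_int z * l"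
   by (rule cancel_string[OF True])+
  ultimately have "(br f ^^ (j + nat z)) ((br e ^^ j) x) \<in> G (\<beta> - of_int z * \<alpha>) (\<mu> - of_int z * l)" by (simp only:)
  moreover have "(br f ^^ (j + nat z)) ((br e ^^ j) x) \<in> M" by (intro funpow_stable M)
  ultimately show ?thesis using j by blast
 next
  case False
  have w': "br (- hh \<alpha>) x = of_int (- z) *s x" using w by (simp add: br_neg_left)
  obtain j where j: "(br e ^^ (j + nat (- z))) ((br f ^^ j) x) \<noteq> 0"
   using sl2_reflect[OF sl2_swap[OF s(1)] w' x(2)] False by auto
  have "(br e ^^ (j + nat (- z))) ((br f ^^ j) x)
    \<in> G (\<beta> + of_nat j * (- \<alpha>) + of_nat (j + nat (- z)) * \<alpha>) (\<mu> + of_nat j * (- l) + of_nat (j + nat (- z)) * l)"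
   by (rule G_pow[OF e G_pow[OF f x(1)]])
  moreover have "\<beta> + of_nat j * (- \<alpha>) + of_nat (j + nat (- z)) * \<alpha> = \<beta> - of_int z * \<alpha>"
   "\<mu> + of_nat j * (- l) + of_nat (j + nat (- z)) * l = \<mu> - of_int z * l"
   using cancel_string[of "- z" \<beta> j "- \<alpha>"] cancel_string[of "- z" \<mu> j "- l"] False by simp_all
  ultimately have "(br e ^^ (j + nat (- z))) ((br f ^^ j) x) \<in> G (\<beta> - of_int z * \<alpha>) (\<mu> - of_int z * l)" by (simp only:)
  moreover have "(br e ^^ (j + nat (- z))) ((br f ^^ j) x) \<in> M" by (intro funpow_stable M)
  ultimately show ?thesis using j by blast
 qed
qed

lemma supp_reflect:
 assumes "supp \<alpha> l" "\<alpha> \<noteq> 0" "supp \<beta> \<mu>" "\<beta> (hh \<alpha>) = of_int z"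
 shows "supp (\<beta> - of_int z * \<alpha>) (\<mu> - of_int z * l)"
proof -
 obtain e f where ef: "e \<in> G \<alpha> l" "f \<in> G (- \<alpha>) (- l)" "sl2 e f (hh \<alpha>)" "\<alpha> \<in> hd'" using supp_sl2[OF assms(1,2)] .
 obtain x where x: "x \<in> G \<beta> \<mu>" "x \<noteq> 0" "\<beta> \<in> hd'" using suppE[OF assms(3)] .
 obtain y where y: "y \<in> G (\<beta> - of_int z * \<alpha>) (\<mu> - of_int z * l)" "y \<noteq> 0"
  using G_reflect[OF ef x(1,2) assms(4), of UNIV] by blast
 show ?thesis by (rule suppI[OF hd_diff[OF x(3) hd_of_int[OF ef(4)]] y])
qed

lemma supp_string:
 assumes "supp \<alpha> l" "\<alpha> \<noteq> 0" "supp \<beta> \<mu>" "\<beta> (hh \<alpha>) = of_int z" "0 < z"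
 shows "supp (\<beta> - \<alpha>) (\<mu> - l)"
proof -
 obtain e f where ef: "e \<in> G \<alpha> l" "f \<in> G (- \<alpha>) (- l)" "sl2 e f (hh \<alpha>)" "\<alpha> \<in> hd'" using supp_sl2[OF assms(1,2)] .
 obtain x where x: "x \<in> G \<beta> \<mu>" "x \<noteq> 0" "\<beta> \<in> hd'" using suppE[OF assms(3)] .
 have w: "br (hh \<alpha>) x = of_int z *s x" using G_weight[OF x(1) ef(4)] assms(4) by simp
 have "br f x \<noteq> 0" using sl2_f_inj[OF ef(3) w _ assms(5)] x(2) by blast
 moreover have "br f x \<in> G (\<beta> - \<alpha>) (\<mu> - l)" using G_br[OF ef(2) x(1)] by (simp add: algebra_simps)
 ultimately show ?thesis using x ef by (intro suppI[of _ "br f x"] hd_diff)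
qed

end

subsection \<open>Root systems\<close>

lemma gen_subgroup_neg: "x \<in> gen_subgroup S ==> - x \<in> gen_subgroup S"
 using gen_diff[OF gen_zero, of x] by simp

lemma gen_subgroup_add: "x \<in> gen_subgroup S ==> y \<in> gen_subgroup S ==> x + y \<in> gen_subgroup S"
 using gen_diff[OF _ gen_subgroup_neg, of x S y] by simp

lemma gen_subgroup_sum: "(\<And>i. i \<in> I ==> f i \<in> gen_subgroup S) ==> sum f I \<in> gen_subgroup S"
 by (induction I rule: infinite_finite_induct) (auto intro: gen_zero gen_subgroup_add)

lemma gen_subgroup_of_nat: "(x::'v::comm_ring_1) \<in> gen_subgroup S ==> of_nat k * x \<in> gen_subgroup S"
 by (induction k) (auto intro: gen_zero gen_subgroup_add simp: distrib_right)

lemma gen_subgroup_of_int: "(x::'v::comm_ring_1) \<in> gen_subgroup S ==> of_int k * x \<in> gen_subgroup S"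
 by (cases k rule: int_cases2) (auto intro: gen_subgroup_of_nat gen_subgroup_neg)

text \<open>Irreducible, possibly non-reduced root systems without an ambient Euclidean space: the
  roots live in a ring of functions, and the rational form \<open>R\<close> has to be positive only
  on the lattice generated by the roots. \<open>a \<beta> \<alpha>\<close> is the Cartan integer of
  \<open>\<beta>\<close> along \<open>\<alpha>\<close>.\<close>

locale rootsys =
 fixes \<Delta> :: "'v::comm_ring_1 set" and R :: "'v \<Rightarrow> 'v \<Rightarrow> rat" and a :: "'v \<Rightarrow> 'v \<Rightarrow> int"
 assumes fin: "finite \<Delta>" and nz: "0 \<notin> \<Delta>"
  and R_add: "\<And>x y z. R (x + y) z = R x z + R y z" and R_sym: "\<And>x y. R x y = R y x"
  and R_pos: "\<And>x. x \<in> gen_subgroup \<Delta> ==> x \<noteq> 0 ==> 0 < R x x"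
  and a_R: "\<And>\<alpha> \<beta>. \<alpha> \<in> \<Delta> ==> \<beta> \<in> \<Delta> ==> of_int (a \<beta> \<alpha>) * R \<alpha> \<alpha> = 2 * R \<beta> \<alpha>"
  and refl_closed: "\<And>\<alpha> \<beta>. \<alpha> \<in> \<Delta> ==> \<beta> \<in> \<Delta> ==> \<beta> - of_int (a \<beta> \<alpha>) * \<alpha> \<in> \<Delta>"
  and string: "\<And>\<alpha> \<beta>. \<alpha> \<in> \<Delta> ==> \<beta> \<in> \<Delta> ==> 0 < R \<beta> \<alpha> ==> \<beta> = \<alpha> \<or> \<beta> - \<alpha> \<in> \<Delta>"
  and irreducible: "\<And>A. A \<subseteq> \<Delta> ==> A \<noteq> {} ==> (\<And>x y. x \<in> A ==> y \<in> \<Delta> - A ==> R x y = 0) ==> A = \<Delta>"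
begin

abbreviation Q :: "'v set" where "Q \<equiv> gen_subgroup \<Delta>"

lemma R_add2: "R x (y + z) = R x y + R x z" by (metis R_add R_sym)
lemma R_zero: "R 0 y = 0" using R_add[of 0 0 y] by simp
lemma R_zero2: "R y 0 = 0" by (metis R_zero R_sym)
lemma R_neg: "R (- x) y = - R x y" using R_add[of x "- x" y] by (simp add: R_zero)
lemma R_neg2: "R x (- y) = - R x y" by (metis R_neg R_sym)
lemma R_diff: "R (x - y) z = R x z - R y z" using R_add[of x "- y" z] by (simp add: R_neg)
lemma R_diff2: "R x (y - z) = R x y - R x z" by (metis R_diff R_sym)
lemma R_of_nat: "R (of_nat k * x) y = of_nat k * R x y"
 by (induction k) (simp_all add: R_zero distrib_right R_add)
lemma R_of_int: "R (of_int k * x) y = of_int k * R x y"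
 by (cases k rule: int_cases2) (simp_all add: R_of_nat R_neg)
lemma R_of_int2: "R x (of_int k * y) = of_int k * R x y" by (metis R_of_int R_sym)
lemma R_sum: "R (sum f I) y = (\<Sum>i\<in>I. R (f i) y)"
 by (induction I rule: infinite_finite_induct) (simp_all add: R_zero R_add)
lemma R_sum2: "R y (sum f I) = (\<Sum>i\<in>I. R y (f i))"
 by (induction I rule: infinite_finite_induct) (simp_all add: R_zero2 R_add2)

lemma R_two [simp]: "R (2 * x) y = 2 * R x y" using R_of_int[of 2 x y] by simp
lemma R_two2 [simp]: "R x (2 * y) = 2 * R x y" using R_of_int2[of x 2 y] by simp

lemmas R_lin = R_add R_add2 R_neg R_neg2 R_diff R_diff2 R_of_int R_of_int2

lemma D_Q: "\<alpha> \<in> \<Delta> ==> \<alpha> \<in> Q" by (rule gen_base)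

lemma D_pos: "\<alpha> \<in> \<Delta> ==> 0 < R \<alpha> \<alpha>"
 using R_pos D_Q nz by metis

lemma R_eq0: "x \<in> Q ==> R x x \<le> 0 ==> x = 0"
 using R_pos by force

abbreviation s :: "'v \<Rightarrow> 'v \<Rightarrow> 'v" where "s \<alpha> \<beta> \<equiv> \<beta> - of_int (a \<beta> \<alpha>) * \<alpha>"

lemma a_eqI: "\<alpha> \<in> \<Delta> ==> \<beta> \<in> \<Delta> ==> of_int z * R \<alpha> \<alpha> = 2 * R \<beta> \<alpha> ==> a \<beta> \<alpha> = z"
 using a_R[of \<alpha> \<beta>] D_pos[of \<alpha>] by (metis mult_cancel_right of_int_eq_iff less_irrefl)

lemma a_self: "\<alpha> \<in> \<Delta> ==> a \<alpha> \<alpha> = 2"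
 by (rule a_eqI) auto

lemma a_pos: "\<alpha> \<in> \<Delta> ==> \<beta> \<in> \<Delta> ==> 0 < R \<beta> \<alpha> ==> 0 < a \<beta> \<alpha>"
 using a_R[of \<alpha> \<beta>] D_pos[of \<alpha>] by (metis mult_pos_pos of_int_0_less_iff zero_less_mult_pos2 zero_less_numeral)

lemma a_zero: "\<alpha> \<in> \<Delta> ==> \<beta> \<in> \<Delta> ==> R \<beta> \<alpha> = 0 ==> a \<beta> \<alpha> = 0"
 by (rule a_eqI) auto

lemma a_nonzero: "\<alpha> \<in> \<Delta> ==> \<beta> \<in> \<Delta> ==> R \<beta> \<alpha> \<noteq> 0 ==> a \<beta> \<alpha> \<noteq> 0"
 using a_R[of \<alpha> \<beta>] by auto

lemma D_neg: "\<alpha> \<in> \<Delta> ==> - \<alpha> \<in> \<Delta>"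
 using refl_closed[of \<alpha> \<alpha>] a_self[of \<alpha>] by (simp add: algebra_simps)

lemma s_R: "\<alpha> \<in> \<Delta> ==> \<beta> \<in> \<Delta> ==> R (s \<alpha> \<beta>) (s \<alpha> \<beta>) = R \<beta> \<beta>"
proof -
 assume ab: "\<alpha> \<in> \<Delta>" "\<beta> \<in> \<Delta>"
 let ?c = "of_int (a \<beta> \<alpha>) :: rat"
 have "R (s \<alpha> \<beta>) (s \<alpha> \<beta>) = R \<beta> \<beta> - 2 * ?c * R \<beta> \<alpha> + ?c * (?c * R \<alpha> \<alpha>)"
  by (simp add: R_lin R_sym[of \<alpha> \<beta>] ring_distribs)
 then show ?thesis unfolding a_R[OF ab] by simp
qed

lemma s_s: "\<alpha> \<in> \<Delta> ==> \<beta> \<in> \<Delta> ==> s \<alpha> (s \<alpha> \<beta>) = \<beta>"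
proof -
 assume ab: "\<alpha> \<in> \<Delta>" "\<beta> \<in> \<Delta>"
 have "a (s \<alpha> \<beta>) \<alpha> = - a \<beta> \<alpha>"
 proof (rule a_eqI[OF ab(1) refl_closed[OF ab]])
  have "2 * R (s \<alpha> \<beta>) \<alpha> = 2 * R \<beta> \<alpha> - 2 * (of_int (a \<beta> \<alpha>) * R \<alpha> \<alpha>)" by (simp add: R_lin)
  then show "of_int (- a \<beta> \<alpha>) * R \<alpha> \<alpha> = 2 * R (s \<alpha> \<beta>) \<alpha>" using a_R[OF ab] by simp
 qed
 then show ?thesis by simp
qed

lemma torsion_free: "x \<in> Q ==> k \<noteq> 0 ==> of_int k * x = 0 ==> x = 0"
 using R_of_int[of k x x] by (intro R_eq0) (auto simp: R_zero)

text \<open>If \<open>\<alpha>\<close> is orthogonal to \<open>v\<close>, replace \<open>v\<close>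
  by \<open>N v + \<alpha>\<close>, where \<open>N\<close> avoids the finitely many ratios at which
  a product with another member of \<open>F\<close> would vanish.\<close>

lemma regular_vector: "F \<subseteq> \<Delta> ==> \<exists>v\<in>Q. \<forall>\<alpha>\<in>F. R \<alpha> v \<noteq> 0"
proof -
 assume F: "F \<subseteq> \<Delta>"
 then have "finite F" using fin finite_subset by blast
 then show ?thesis using F
 proof (induction F rule: finite_induct)
  case empty then show ?case using gen_zero by blast
 next
  case (insert \<alpha> F)
  then obtain v where v: "v \<in> Q" "\<forall>\<beta>\<in>F. R \<beta> v \<noteq> 0" by auto
  show ?case
  proof (cases "R \<alpha> v = 0")
   case False then show ?thesis using v by auto
  next
   case True
   let ?bad = "(\<lambda>\<beta>. - R \<beta> \<alpha> / R \<beta> v) ` F"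
   have "infinite (range (of_nat :: nat \<Rightarrow> rat))" by (simp add: infinite_UNIV_char_0 range_inj_infinite inj_on_def)
   then have "\<not> range (of_nat :: nat \<Rightarrow> rat) \<subseteq> ?bad" using insert.hyps(1) finite_subset by blast
   then obtain N :: nat where N: "of_nat N \<notin> ?bad" by auto
   have "R \<beta> (of_int (int N) * v + \<alpha>) \<noteq> 0" if "\<beta> \<in> insert \<alpha> F" for \<beta>
   proof (cases "\<beta> = \<alpha>")
    case True
    then show ?thesis using \<open>R \<alpha> v = 0\<close> D_pos[of \<alpha>] insert.prems unfolding R_add2 R_of_int2 by auto
   next
    case False
    then have b: "\<beta> \<in> F" using that by simp
    show ?thesis
    proof
     assume "R \<beta> (of_int (int N) * v + \<alpha>) = 0"
     then have "of_nat N * R \<beta> v = - R \<beta> \<alpha>" unfolding R_add2 R_of_int2 by simp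
     then have "of_nat N = - R \<beta> \<alpha> / R \<beta> v" using v(2) b by (intro eq_divide_imp) auto
     then show False using N b by blast
    qed
   qed
   moreover have "of_int (int N) * v + \<alpha> \<in> Q"
    using v insert.prems by (intro gen_subgroup_add gen_subgroup_of_int) (auto intro: D_Q)
   ultimately show ?thesis by blast
  qed
 qed
qed

definition v0 :: 'v where "v0 = (SOME v. v \<in> Q \<and> (\<forall>\<alpha>\<in>\<Delta>. R \<alpha> v \<noteq> 0))"
definition \<rho> :: "'v \<Rightarrow> rat" where "\<rho> x = R x v0"
definition pos :: "'v set" where "pos = {\<alpha>\<in>\<Delta>. 0 < \<rho> \<alpha>}"
definition base :: "'v set" where "base = {\<alpha>\<in>pos. \<forall>\<beta>\<in>pos. \<forall>\<gamma>\<in>pos. \<alpha> \<noteq> \<beta> + \<gamma>}"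

lemma rho_nz: "\<alpha> \<in> \<Delta> ==> \<rho> \<alpha> \<noteq> 0"
proof -
 have "\<exists>v. v \<in> Q \<and> (\<forall>\<alpha>\<in>\<Delta>. R \<alpha> v \<noteq> 0)" using regular_vector[of \<Delta>] by blast
 from someI_ex[OF this] show "\<alpha> \<in> \<Delta> ==> \<rho> \<alpha> \<noteq> 0" unfolding \<rho>_def v0_def by blast
qed

lemma rho_lin: "\<rho> (x + y) = \<rho> x + \<rho> y" "\<rho> (- x) = - \<rho> x" "\<rho> (x - y) = \<rho> x - \<rho> y" "\<rho> (of_int k * x) = of_int k * \<rho> x"
 by (simp_all add: \<rho>_def R_lin)

lemma pos_or_neg: "\<alpha> \<in> \<Delta> ==> \<alpha> \<in> pos \<or> - \<alpha> \<in> pos"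
 using rho_nz[of \<alpha>] D_neg[of \<alpha>] by (auto simp: pos_def rho_lin)

lemma pos_D: "\<alpha> \<in> pos ==> \<alpha> \<in> \<Delta>" and Pi_pos: "\<alpha> \<in> base ==> \<alpha> \<in> pos" and Pi_D: "\<alpha> \<in> base ==> \<alpha> \<in> \<Delta>"
 by (auto simp: pos_def base_def)

lemma fin_Pi: "finite base"
 by (rule finite_subset[OF _ fin]) (use Pi_D in blast)

text \<open>\<open>\<rho>\<close> has rational values, so well-foundedness comes from counting the
  finitely many positive roots below \<open>\<beta>\<close>.\<close>

lemma pos_induct [consumes 1, case_names step]:
 assumes "\<beta> \<in> pos" "\<And>\<beta>. \<beta> \<in> pos ==> (\<And>\<gamma>. \<gamma> \<in> pos ==> \<rho> \<gamma> < \<rho> \<beta> ==> P \<gamma>) ==> P \<beta>"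
 shows "P \<beta>"
 using assms(1)
proof (induction "card {\<gamma>\<in>pos. \<rho> \<gamma> < \<rho> \<beta>}" arbitrary: \<beta> rule: less_induct)
 case less
 show ?case
 proof (rule assms(2)[OF less.prems])
  fix \<gamma> assume g: "\<gamma> \<in> pos" "\<rho> \<gamma> < \<rho> \<beta>"
  have "finite {\<gamma>\<in>pos. \<rho> \<gamma> < \<rho> \<beta>}" using fin by (simp add: pos_def)
  moreover have "{\<delta>\<in>pos. \<rho> \<delta> < \<rho> \<gamma>} \<subset> {\<delta>\<in>pos. \<rho> \<delta> < \<rho> \<beta>}" using g by auto
  ultimately show "P \<gamma>" using less.hyps[OF _ g(1)] psubset_card_mono by blast
 qed
qed

lemma pos_coords: "\<beta> \<in> pos ==> \<exists>c. \<beta> = (\<Sum>\<alpha>\<in>base. of_int (c \<alpha>) * \<alpha>) \<and> (\<forall>\<alpha>. 0 \<le> c \<alpha>)"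
proof (induction \<beta> rule: pos_induct)
 case (step \<beta>)
 show ?case
 proof (cases "\<beta> \<in> base")
  case True
  have "(\<Sum>\<alpha>\<in>base. of_int (if \<alpha> = \<beta> then 1 else 0) * \<alpha>) = (\<Sum>\<alpha>\<in>base. if \<alpha> = \<beta> then \<alpha> else 0)"
   by (intro sum.cong) auto
  then show ?thesis using True fin_Pi by (intro exI[of _ "\<lambda>\<alpha>. if \<alpha> = \<beta> then 1 else 0"]) simp
 next
  case False
  then obtain \<gamma> \<delta> where g: "\<gamma> \<in> pos" "\<delta> \<in> pos" "\<beta> = \<gamma> + \<delta>" using step by (auto simp: base_def)
  then have "\<rho> \<gamma> < \<rho> \<beta>" "\<rho> \<delta> < \<rho> \<beta>" by (auto simp: rho_lin pos_def)
  then obtain c d where "\<gamma> = (\<Sum>\<alpha>\<in>base. of_int (c \<alpha>) * \<alpha>)" "\<forall>\<alpha>. 0 \<le> c \<alpha>"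
   "\<delta> = (\<Sum>\<alpha>\<in>base. of_int (d \<alpha>) * \<alpha>)" "\<forall>\<alpha>. 0 \<le> d \<alpha>" using step(2) g by meson
  then show ?thesis using g(3)
   by (intro exI[of _ "\<lambda>\<alpha>. c \<alpha> + d \<alpha>"]) (simp add: sum.distrib distrib_right)
 qed
qed

lemma Pi_obtuse: "\<alpha> \<in> base ==> \<beta> \<in> base ==> \<alpha> \<noteq> \<beta> ==> R \<alpha> \<beta> \<le> 0"
proof (rule ccontr)
 assume ab: "\<alpha> \<in> base" "\<beta> \<in> base" "\<alpha> \<noteq> \<beta>" "\<not> R \<alpha> \<beta> \<le> 0"
 then have "\<alpha> - \<beta> \<in> \<Delta>" using string[of \<beta> \<alpha>] Pi_D by auto
 then have "\<alpha> - \<beta> \<in> pos \<or> \<beta> - \<alpha> \<in> pos" using pos_or_neg by fastforce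
 moreover have "\<alpha> = (\<alpha> - \<beta>) + \<beta>" "\<beta> = (\<beta> - \<alpha>) + \<alpha>" by simp_all
 ultimately show False using ab(1,2) unfolding base_def by blast
qed

lemma Pi_diff: "\<alpha> \<in> base ==> \<beta> \<in> base ==> \<alpha> - \<beta> \<notin> \<Delta>"
proof
 assume ab: "\<alpha> \<in> base" "\<beta> \<in> base" "\<alpha> - \<beta> \<in> \<Delta>"
 then have "\<alpha> - \<beta> \<in> pos \<or> \<beta> - \<alpha> \<in> pos" using pos_or_neg by fastforce
 moreover have "\<alpha> = (\<alpha> - \<beta>) + \<beta>" "\<beta> = (\<beta> - \<alpha>) + \<alpha>" by simp_all
 ultimately show False using ab(1,2) unfolding base_def by blast
qed

text \<open>Separate the relation into two equal sums with non-negative coefficients. Obtuseness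
  makes their product non-positive, so both are zero; since \<open>\<rho>\<close> is positive on the
  base, all coefficients vanish.\<close>

lemma Pi_independent:
 assumes z: "(\<Sum>\<alpha>\<in>base. of_int (c \<alpha>) * \<alpha>) = 0" and al: "\<alpha> \<in> base" shows "c \<alpha> = 0"
proof -
 define p where "p = (\<lambda>\<alpha>. max (c \<alpha>) 0)"
 define q where "q = (\<lambda>\<alpha>. max (- c \<alpha>) 0)"
 let ?x = "\<Sum>\<alpha>\<in>base. of_int (p \<alpha>) * \<alpha>" and ?y = "\<Sum>\<alpha>\<in>base. of_int (q \<alpha>) * \<alpha>"
 have "c \<alpha> = p \<alpha> - q \<alpha>" for \<alpha> by (auto simp: p_def q_def)
 then have "?x - ?y = 0" using z by (simp add: sum_subtractf[symmetric] left_diff_distrib)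
 then have xy: "?y = ?x" by simp
 have "R ?x ?x = R ?x ?y" using xy by simp
 also have "\<dots> = (\<Sum>\<alpha>\<in>base. \<Sum>\<beta>\<in>base. of_int (p \<alpha>) * (of_int (q \<beta>) * R \<alpha> \<beta>))"
  unfolding R_sum by (simp add: R_sum2 R_of_int R_of_int2 sum_distrib_left mult.left_commute)
 also have "\<dots> \<le> 0"
 proof (intro sum_nonpos)
  fix \<alpha> \<beta> assume ab: "\<alpha> \<in> base" "\<beta> \<in> base"
  show "of_int (p \<alpha>) * (of_int (q \<beta>) * R \<alpha> \<beta>) \<le> 0"
  proof (cases "\<alpha> = \<beta>")
   case True
   then have "p \<alpha> = 0 \<or> q \<beta> = 0" by (auto simp: p_def q_def)
   then show ?thesis by auto
  next
   case False
   have "0 \<le> of_int (p \<alpha>) * (of_int (q \<beta>) :: rat)" by (simp add: p_def q_def)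
   then show ?thesis using Pi_obtuse[OF ab False] by (simp add: mult.assoc[symmetric] mult_nonneg_nonpos)
  qed
 qed
 finally have x0: "?x = 0"
  by (intro R_eq0 gen_subgroup_sum gen_subgroup_of_int D_Q Pi_D)
 have rsum: "(\<Sum>\<alpha>\<in>base. of_int (r \<alpha>) * \<rho> \<alpha>) = 0" if "(\<Sum>\<alpha>\<in>base. of_int (r \<alpha>) * \<alpha>) = 0" for r
  using that by (simp add: \<rho>_def R_sum[symmetric] R_of_int[symmetric] R_zero)
 have "r \<alpha> = 0" if r: "(\<Sum>\<alpha>\<in>base. of_int (r \<alpha>) * \<alpha>) = 0" "\<And>\<alpha>. 0 \<le> r \<alpha>" for r
 proof -
  have nn: "0 \<le> of_int (r x) * \<rho> x" if "x \<in> base" for x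
   using r(2)[of x] Pi_pos[OF that] by (simp add: pos_def)
  have "\<forall>\<alpha>\<in>base. of_int (r \<alpha>) * \<rho> \<alpha> = 0"
   using rsum[OF r(1)] sum_nonneg_eq_0_iff[OF fin_Pi nn] by simp
  then show ?thesis using al rho_nz[OF Pi_D[OF al]] by auto
 qed
 from this[of p] this[of q] x0 xy have "p \<alpha> = 0" "q \<alpha> = 0" by (auto simp: p_def q_def)
 then show ?thesis by (auto simp: p_def q_def max_def split: if_splits)
qed

lemma Q_coords: "q \<in> Q ==> \<exists>c. q = (\<Sum>\<alpha>\<in>base. of_int (c \<alpha>) * \<alpha>)"
proof (induction rule: gen_subgroup.induct)
 case gen_zero
 show ?case by (intro exI[of _ "\<lambda>_. 0"]) simp
next
 case (gen_base x)
 show ?case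
 proof (cases "x \<in> pos")
  case True then show ?thesis using pos_coords by blast
 next
  case False
  then have "- x \<in> pos" using pos_or_neg gen_base by blast
  then obtain c where "- x = (\<Sum>\<alpha>\<in>base. of_int (c \<alpha>) * \<alpha>)" using pos_coords by blast
  then have "x = - (\<Sum>\<alpha>\<in>base. of_int (c \<alpha>) * \<alpha>)" by (metis minus_minus)
  then have "x = (\<Sum>\<alpha>\<in>base. of_int (- c \<alpha>) * \<alpha>)" by (simp add: sum_negf)
  then show ?thesis by (rule exI[of _ "\<lambda>\<alpha>. - c \<alpha>"])
 qed
next
 case (gen_diff x y)
 then obtain c d where "x = (\<Sum>\<alpha>\<in>base. of_int (c \<alpha>) * \<alpha>)" "y = (\<Sum>\<alpha>\<in>base. of_int (d \<alpha>) * \<alpha>)" by blast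
 then show ?case by (intro exI[of _ "\<lambda>\<alpha>. c \<alpha> - d \<alpha>"]) (simp add: sum_subtractf left_diff_distrib)
qed

definition coord :: "'v \<Rightarrow> 'v \<Rightarrow> int" where
 "coord q = (SOME c. q = (\<Sum>\<alpha>\<in>base. of_int (c \<alpha>) * \<alpha>))"

lemma coord: "q \<in> Q ==> q = (\<Sum>\<alpha>\<in>base. of_int (coord q \<alpha>) * \<alpha>)"
 unfolding coord_def by (rule someI_ex[OF Q_coords])

lemma coord_eqI: "q = (\<Sum>\<alpha>\<in>base. of_int (c \<alpha>) * \<alpha>) ==> \<alpha> \<in> base ==> coord q \<alpha> = c \<alpha>"
proof -
 assume q: "q = (\<Sum>\<alpha>\<in>base. of_int (c \<alpha>) * \<alpha>)" and al: "\<alpha> \<in> base"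
 have "q \<in> Q" unfolding q by (intro gen_subgroup_sum gen_subgroup_of_int D_Q Pi_D)
 then have "(\<Sum>\<alpha>\<in>base. of_int (coord q \<alpha>) * \<alpha>) = (\<Sum>\<alpha>\<in>base. of_int (c \<alpha>) * \<alpha>)" using coord[of q] q by (simp only:)
 then have "(\<Sum>\<alpha>\<in>base. of_int (coord q \<alpha> - c \<alpha>) * \<alpha>) = 0" by (simp add: left_diff_distrib sum_subtractf)
 then show ?thesis using Pi_independent[of "\<lambda>\<alpha>. coord q \<alpha> - c \<alpha>", OF _ al] by simp
qed

lemma coord_diff: "x \<in> Q ==> y \<in> Q ==> \<alpha> \<in> base ==> coord (x - y) \<alpha> = coord x \<alpha> - coord y \<alpha>"
 by (rule coord_eqI[where c = "\<lambda>\<alpha>. coord x \<alpha> - coord y \<alpha>"])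
  (simp_all add: left_diff_distrib sum_subtractf coord[symmetric])

lemma coord_Pi: "\<beta> \<in> base ==> \<alpha> \<in> base ==> coord \<beta> \<alpha> = (if \<alpha> = \<beta> then 1 else 0)"
proof (rule coord_eqI)
 assume "\<beta> \<in> base"
 have "(\<Sum>\<alpha>\<in>base. of_int (if \<alpha> = \<beta> then 1 else 0) * \<alpha>) = (\<Sum>\<alpha>\<in>base. if \<alpha> = \<beta> then \<alpha> else 0)"
  by (intro sum.cong) auto
 then show "\<beta> = (\<Sum>\<alpha>\<in>base. of_int (if \<alpha> = \<beta> then 1 else 0) * \<alpha>)" using \<open>\<beta> \<in> base\<close> fin_Pi by simp
qed

lemma pos_coord: "\<beta> \<in> pos ==> \<alpha> \<in> base ==> 0 \<le> coord \<beta> \<alpha>"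
 using pos_coords[of \<beta>] coord_eqI by metis

text \<open>Some simple \<open>\<alpha>\<close> pairs positively with \<open>\<beta>\<close> because
  \<open>R \<beta> \<beta>\<close> is positive. The reflection in \<open>\<alpha>\<close> changes
  only the coordinate at \<open>\<alpha>\<close>, so it can make \<open>\<beta>\<close> negative
  only if \<open>\<beta> = c \<alpha>\<close>; then \<open>a \<alpha> \<beta> * c = 2\<close>, and
  \<open>c\<close> is \<open>1\<close> or \<open>2\<close>.\<close>

lemma pos_descent:
 assumes b: "\<beta> \<in> pos"
 shows "\<exists>\<alpha>\<in>base. 0 < R \<beta> \<alpha> \<and> (\<beta> = \<alpha> \<or> \<beta> = \<alpha> + \<alpha> \<or> (s \<alpha> \<beta> \<in> pos \<and> \<rho> (s \<alpha> \<beta>) < \<rho> \<beta>))"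
proof -
 have bD: "\<beta> \<in> \<Delta>" using b pos_D by blast
 have "\<exists>\<alpha>\<in>base. 0 < R \<beta> \<alpha>"
 proof (rule ccontr)
  assume "\<not> ?thesis"
  then have n: "R \<beta> \<alpha> \<le> 0" if "\<alpha> \<in> base" for \<alpha> using that by force
  have "R \<beta> \<beta> = R \<beta> (\<Sum>\<alpha>\<in>base. of_int (coord \<beta> \<alpha>) * \<alpha>)" using coord[OF D_Q[OF bD]] by simp
  also have "\<dots> = (\<Sum>\<alpha>\<in>base. of_int (coord \<beta> \<alpha>) * R \<beta> \<alpha>)" by (simp add: R_sum2 R_of_int2)
  also have "\<dots> \<le> 0" using pos_coord[OF b] n by (intro sum_nonpos) (simp add: mult_nonneg_nonpos)
  finally show False using D_pos[OF bD] by simp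
 qed
 then obtain \<alpha> where al: "\<alpha> \<in> base" "0 < R \<beta> \<alpha>" by blast
 note aD = Pi_D[OF al(1)]
 have ap: "0 < a \<beta> \<alpha>" using a_pos[OF aD bD] al by simp
 have sD: "s \<alpha> \<beta> \<in> \<Delta>" by (rule refl_closed[OF aD bD])
 have lt: "\<rho> (s \<alpha> \<beta>) < \<rho> \<beta>" using ap Pi_pos[OF al(1)] by (simp add: rho_lin pos_def)
 have "\<beta> = \<alpha> \<or> \<beta> = \<alpha> + \<alpha>" if neg: "s \<alpha> \<beta> \<notin> pos"
 proof -
  have np: "- s \<alpha> \<beta> \<in> pos" using pos_or_neg[OF sD] neg by blast
  have zero: "coord \<beta> \<delta> = 0" if d: "\<delta> \<in> base" "\<delta> \<noteq> \<alpha>" for \<delta>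
  proof -
   have "coord (\<beta> - s \<alpha> \<beta>) \<delta> = (if \<delta> = \<alpha> then a \<beta> \<alpha> else 0)"
   proof (rule coord_eqI[OF _ d(1)])
    have "(\<Sum>\<delta>\<in>base. of_int (if \<delta> = \<alpha> then a \<beta> \<alpha> else 0) * \<delta>) = (\<Sum>\<delta>\<in>base. if \<delta> = \<alpha> then of_int (a \<beta> \<alpha>) * \<delta> else 0)"
     by (intro sum.cong) auto
    then show "\<beta> - s \<alpha> \<beta> = (\<Sum>\<delta>\<in>base. of_int (if \<delta> = \<alpha> then a \<beta> \<alpha> else 0) * \<delta>)" using al(1) fin_Pi by simp
   qed
   then have "coord \<beta> \<delta> - coord (s \<alpha> \<beta>) \<delta> = 0" using coord_diff[OF D_Q[OF bD] D_Q[OF sD] d(1)] d by simp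
   moreover have "coord (0 - s \<alpha> \<beta>) \<delta> = coord 0 \<delta> - coord (s \<alpha> \<beta>) \<delta>" by (rule coord_diff[OF gen_zero D_Q[OF sD] d(1)])
   moreover have "coord 0 \<delta> = 0" by (rule coord_eqI[OF _ d(1), of 0 "\<lambda>_. 0"]) simp
   ultimately show ?thesis using pos_coord[OF b d(1)] pos_coord[OF np d(1)] by simp
  qed
  let ?c = "coord \<beta> \<alpha>"
  have "(\<Sum>\<delta>\<in>base. of_int (coord \<beta> \<delta>) * \<delta>) = (\<Sum>\<delta>\<in>base. if \<delta> = \<alpha> then of_int ?c * \<alpha> else 0)"
   using zero by (intro sum.cong) auto
  then have bc: "\<beta> = of_int ?c * \<alpha>" using coord[OF D_Q[OF bD]] al(1) fin_Pi by simp
  have c0: "0 \<le> ?c" "?c \<noteq> 0" using pos_coord[OF b al(1)] bc bD nz by auto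
  have e1: "R \<beta> \<beta> = of_int ?c * R \<alpha> \<beta>" using arg_cong[OF bc, of "\<lambda>x. R x \<beta>"] by (simp only: R_of_int)
  have "of_int (a \<alpha> \<beta>) * R \<beta> \<beta> = 2 * R \<alpha> \<beta>" by (rule a_R[OF bD aD])
  then have "(of_int (a \<alpha> \<beta> * ?c)) * R \<alpha> \<beta> = 2 * R \<alpha> \<beta>" using e1 by simp
  then have "of_int (a \<alpha> \<beta> * ?c) = (of_int 2 :: rat)" using al(2) R_sym[of \<alpha> \<beta>] by simp
  then have "a \<alpha> \<beta> * ?c = 2" by (rule of_int_eq_iff[THEN iffD1])
  then have "?c dvd 2" by (metis dvd_triv_right)
  then have "?c \<le> 2" using zdvd_imp_le by simp
  then have "?c = 1 \<or> ?c = 2" using c0 by linarith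
  then show ?thesis
  proof
   assume "?c = 1" then show ?thesis using bc by simp
  next
   assume c2: "?c = 2"
   have "of_int ?c * \<alpha> = \<alpha> + \<alpha>" unfolding c2 by simp
   then show ?thesis using bc by simp
  qed
 qed
 then show ?thesis using al lt by blast
qed

end

section \<open>A reduced subsystem containing the base\<close>

locale subrootsys = rootsys \<Delta> R a
 for \<Delta> :: "'v::comm_ring_1 set" and R :: "'v \<Rightarrow> 'v \<Rightarrow> rat" and a :: "'v \<Rightarrow> 'v \<Rightarrow> int" +
 fixes D0 :: "'v set"
 assumes D0_sub: "D0 \<subseteq> \<Delta>" and Pi_D0: "base \<subseteq> D0"
  and D0_refl: "\<And>\<alpha> \<beta>. \<alpha> \<in> D0 ==> \<beta> \<in> D0 ==> s \<alpha> \<beta> \<in> D0"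
  and D0_double: "\<And>\<alpha>. \<alpha> \<in> D0 ==> \<alpha> + \<alpha> \<notin> D0"
begin

lemma D0_D: "\<alpha> \<in> D0 ==> \<alpha> \<in> \<Delta>" using D0_sub by blast

lemma D0_neg: "\<alpha> \<in> D0 ==> - \<alpha> \<in> D0"
 using D0_refl[of \<alpha> \<alpha>] a_self[OF D0_D, of \<alpha>] by (simp add: algebra_simps)

lemma s_double: "\<alpha> \<in> \<Delta> ==> \<gamma> \<in> \<Delta> ==> \<gamma> + \<gamma> \<in> \<Delta> ==> s \<alpha> (\<gamma> + \<gamma>) = s \<alpha> \<gamma> + s \<alpha> \<gamma>"
proof -
 assume ag: "\<alpha> \<in> \<Delta>" "\<gamma> \<in> \<Delta>" "\<gamma> + \<gamma> \<in> \<Delta>"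
 have "a (\<gamma> + \<gamma>) \<alpha> = a \<gamma> \<alpha> + a \<gamma> \<alpha>"
 proof (rule a_eqI[OF ag(1,3)])
  show "of_int (a \<gamma> \<alpha> + a \<gamma> \<alpha>) * R \<alpha> \<alpha> = 2 * R (\<gamma> + \<gamma>) \<alpha>"
   using a_R[OF ag(1,2)] by (simp only: R_add of_int_add distrib_right distrib_left)
 qed
 then show ?thesis by (simp add: algebra_simps)
qed

text \<open>Simple reflections lower a positive root until it is a simple root or the double of one.
  Reflecting back preserves both \<open>D0\<close> and the set of doubles of its elements.\<close>

lemma D_cases: assumes "\<beta> \<in> \<Delta>" shows "\<beta> \<in> D0 \<or> (\<exists>\<alpha>\<in>D0. \<beta> = \<alpha> + \<alpha>)"
proof -
 have P: "\<beta> \<in> D0 \<or> (\<exists>\<alpha>\<in>D0. \<beta> = \<alpha> + \<alpha>)" if "\<beta> \<in> pos" for \<beta>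
  using that
 proof (induction \<beta> rule: pos_induct)
  case (step \<beta>)
  obtain \<alpha> where al: "\<alpha> \<in> base" "0 < R \<beta> \<alpha>" "\<beta> = \<alpha> \<or> \<beta> = \<alpha> + \<alpha> \<or> (s \<alpha> \<beta> \<in> pos \<and> \<rho> (s \<alpha> \<beta>) < \<rho> \<beta>)"
   using pos_descent[OF step(1)] by blast
  have a0: "\<alpha> \<in> D0" using al Pi_D0 by blast
  from al(3) show ?case
  proof (elim disjE)
   assume st: "s \<alpha> \<beta> \<in> pos \<and> \<rho> (s \<alpha> \<beta>) < \<rho> \<beta>"
   have ss: "s \<alpha> (s \<alpha> \<beta>) = \<beta>" using s_s[OF D0_D[OF a0] pos_D[OF step(1)]] .
   from step(2)[of "s \<alpha> \<beta>"] st have "s \<alpha> \<beta> \<in> D0 \<or> (\<exists>\<gamma>\<in>D0. s \<alpha> \<beta> = \<gamma> + \<gamma>)" by blast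
   then show ?case
   proof
    assume "s \<alpha> \<beta> \<in> D0"
    then have "s \<alpha> (s \<alpha> \<beta>) \<in> D0" by (rule D0_refl[OF a0])
    then show ?case unfolding ss by simp
   next
    assume "\<exists>\<gamma>\<in>D0. s \<alpha> \<beta> = \<gamma> + \<gamma>"
    then obtain \<gamma> where g: "\<gamma> \<in> D0" "s \<alpha> \<beta> = \<gamma> + \<gamma>" by blast
    have "\<gamma> + \<gamma> \<in> \<Delta>" using refl_closed[OF D0_D[OF a0] pos_D[OF step(1)]] g by simp
    then have "s \<alpha> (\<gamma> + \<gamma>) = s \<alpha> \<gamma> + s \<alpha> \<gamma>" by (rule s_double[OF D0_D[OF a0] D0_D[OF g(1)]])
    then have "\<beta> = s \<alpha> \<gamma> + s \<alpha> \<gamma>" using ss unfolding g(2) by simp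
    then show ?case using D0_refl[OF a0 g(1)] by blast
   qed
  qed (use a0 in auto)
 qed
 from pos_or_neg[OF assms] show ?thesis
 proof
  assume "- \<beta> \<in> pos"
  then have "- \<beta> \<in> D0 \<or> (\<exists>\<alpha>\<in>D0. - \<beta> = \<alpha> + \<alpha>)" by (rule P)
  then show ?thesis
  proof
   assume "- \<beta> \<in> D0" then show ?thesis using D0_neg[of "- \<beta>"] by simp
  next
   assume "\<exists>\<alpha>\<in>D0. - \<beta> = \<alpha> + \<alpha>"
   then obtain \<alpha> where al: "\<alpha> \<in> D0" "- \<beta> = \<alpha> + \<alpha>" by blast
   then have "\<beta> = - (\<alpha> + \<alpha>)" by (metis minus_minus)
   then have "\<beta> = - \<alpha> + - \<alpha>" by simp
   then show ?thesis using D0_neg[OF al(1)] by blast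
  qed
 qed (rule P)
qed

lemma D0_irreducible:
 assumes A: "A \<subseteq> D0" "A \<noteq> {}" "\<And>x y. x \<in> A ==> y \<in> D0 - A ==> R x y = 0" shows "A = D0"
proof -
 let ?A = "{\<beta>\<in>\<Delta>. \<beta> \<in> A \<or> (\<exists>\<alpha>\<in>A. \<beta> = \<alpha> + \<alpha>)}"
 have "?A = \<Delta>"
 proof (rule irreducible)
  show "?A \<noteq> {}" using A D0_sub by blast
  fix x y assume x: "x \<in> ?A" and y: "y \<in> \<Delta> - ?A"
  obtain x' where x': "x' \<in> A" "x = x' \<or> x = x' + x'" using x by blast
  obtain y' where y': "y' \<in> D0 - A" "y = y' \<or> y = y' + y'" using y D_cases[of y] by blast
  have "R x' y' = 0" by (rule A(3)[OF x'(1) y'(1)])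
  then show "R x y = 0" using x'(2) y'(2) by (auto simp: R_add R_add2)
 qed auto
 then have "D0 \<subseteq> ?A" using D0_sub by simp
 then have "D0 \<subseteq> A" using D0_double A(1) by blast
 then show ?thesis using A(1) by blast
qed

text \<open>As \<open>C\<close> is stable under reflections in \<open>D0\<close>, the roots of
  \<open>D0\<close> that are not orthogonal to \<open>C\<close> are orthogonal to the remaining
  ones; irreducibility makes them all of \<open>D0\<close>.\<close>

lemma nonorthogonal:
 assumes C: "C \<subseteq> D0" "C \<noteq> {}" "\<And>\<alpha> \<gamma>. \<alpha> \<in> D0 ==> \<gamma> \<in> C ==> s \<alpha> \<gamma> \<in> C" and b: "\<beta> \<in> D0"
 shows "\<exists>\<gamma>\<in>C. R \<beta> \<gamma> \<noteq> 0"
proof -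
 let ?A = "{\<alpha>\<in>D0. \<exists>\<gamma>\<in>C. R \<alpha> \<gamma> \<noteq> 0}"
 have "?A = D0"
 proof (rule D0_irreducible)
  obtain \<gamma> where "\<gamma> \<in> C" using C(2) by blast
  then have "\<gamma> \<in> ?A" using C(1) D_pos[of \<gamma>] D0_D by force
  then show "?A \<noteq> {}" by blast
  fix x y assume x: "x \<in> ?A" and y: "y \<in> D0 - ?A"
  obtain \<gamma> where g: "\<gamma> \<in> C" "R x \<gamma> \<noteq> 0" using x by blast
  have xD: "x \<in> \<Delta>" "\<gamma> \<in> \<Delta>" using x g C(1) D0_sub by auto
  have y0: "R y \<delta> = 0" if "\<delta> \<in> C" for \<delta> using y that by blast
  have "R y (s x \<gamma>) = 0" using C(3)[of x \<gamma>] x g y0 by blast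
  then have "of_int (a \<gamma> x) * R y x = 0" using y0[OF g(1)] by (simp add: R_lin)
  then have "R y x = 0" using a_nonzero[OF xD(1,2)] g(2) R_sym by auto
  then show "R x y = 0" by (simp add: R_sym)
 qed auto
 then show ?thesis using b by blast
qed

text \<open>Meant for the weights of a submodule and the weights that it misses. The elements
  \<open>mn P\<close> of minimal length lie in \<open>D0\<close>, and their Cartan integer is
  \<open>1\<close> along any other root of \<open>D0\<close> with which they pair positively. Choose
  minimal \<open>\<mu>\<close> in \<open>P\<close> and \<open>\<nu>\<close> in \<open>P'\<close>
  with positive product. If they differ, reflections put \<open>\<mu> - \<nu>\<close> in
  \<open>P\<close> and \<open>\<nu> - \<mu>\<close> in \<open>P'\<close>, and reflecting the former
  in itself puts \<open>\<nu> - \<mu>\<close> in both.\<close>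

lemma saturated_meet:
 assumes P: "P \<subseteq> \<Delta>" "P \<noteq> {}" "\<And>\<alpha> \<mu>. \<alpha> \<in> D0 ==> \<mu> \<in> P ==> s \<alpha> \<mu> \<in> P"
   "\<And>\<alpha> \<mu>. \<alpha> \<in> D0 ==> \<mu> \<in> P ==> 0 < R \<mu> \<alpha> ==> \<mu> = \<alpha> \<or> \<mu> - \<alpha> \<in> P"
  and P': "P' \<subseteq> \<Delta>" "P' \<noteq> {}" "\<And>\<alpha> \<mu>. \<alpha> \<in> D0 ==> \<mu> \<in> P' ==> s \<alpha> \<mu> \<in> P'"
   "\<And>\<alpha> \<mu>. \<alpha> \<in> D0 ==> \<mu> \<in> P' ==> 0 < R \<mu> \<alpha> ==> \<mu> = \<alpha> \<or> \<mu> - \<alpha> \<in> P'"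
 shows "P \<inter> P' \<noteq> {}"
proof -
 define mn where "mn = (\<lambda>P. {\<mu>\<in>P. \<forall>\<nu>\<in>P. R \<mu> \<mu> \<le> R \<nu> \<nu>})"
 define gd where "gd = (\<lambda>P. mn P \<noteq> {} \<and> mn P \<subseteq> D0 \<and> (\<forall>\<alpha>\<in>D0. \<forall>\<mu>\<in>mn P. s \<alpha> \<mu> \<in> mn P) \<and>
   (\<forall>\<mu>\<in>mn P. \<forall>\<alpha>\<in>D0. 0 < R \<mu> \<alpha> \<longrightarrow> \<mu> = \<alpha> \<or> a \<mu> \<alpha> = 1))"
 have main: "gd P" if P: "P \<subseteq> \<Delta>" "P \<noteq> {}" "\<And>\<alpha> \<mu>. \<alpha> \<in> D0 ==> \<mu> \<in> P ==> s \<alpha> \<mu> \<in> P"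
   "\<And>\<alpha> \<mu>. \<alpha> \<in> D0 ==> \<mu> \<in> P ==> 0 < R \<mu> \<alpha> ==> \<mu> = \<alpha> \<or> \<mu> - \<alpha> \<in> P" for P
 proof -
  have fP: "finite P" using P(1) fin finite_subset by blast
  have "Min ((\<lambda>\<mu>. R \<mu> \<mu>) ` P) \<in> (\<lambda>\<mu>. R \<mu> \<mu>) ` P" using fP P(2) by (intro Min_in) auto
  then obtain \<mu> where "\<mu> \<in> P" "Min ((\<lambda>\<mu>. R \<mu> \<mu>) ` P) = R \<mu> \<mu>" by blast
  then have "\<mu> \<in> mn P" unfolding mn_def using Min_le[of "(\<lambda>\<mu>. R \<mu> \<mu>) ` P"] fP by fastforce
  then have ne: "mn P \<noteq> {}" by blast
  have le1: "a \<mu> \<alpha> \<le> 1" if m: "\<mu> \<in> mn P" "\<alpha> \<in> D0" "0 < R \<mu> \<alpha>" "\<mu> \<noteq> \<alpha>" for \<mu> \<alpha>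
  proof -
   have mP: "\<mu> \<in> P" using m by (simp add: mn_def)
   have "\<mu> - \<alpha> \<in> P" using P(4)[OF m(2) mP m(3)] m(4) by blast
   then have "R \<mu> \<mu> \<le> R (\<mu> - \<alpha>) (\<mu> - \<alpha>)" using m(1) by (simp add: mn_def)
   then have "2 * R \<mu> \<alpha> \<le> R \<alpha> \<alpha>" by (simp add: R_lin R_sym[of \<alpha> \<mu>])
   then have "of_int (a \<mu> \<alpha>) * R \<alpha> \<alpha> \<le> 1 * R \<alpha> \<alpha>" using a_R[OF D0_D[OF m(2)], of \<mu>] mP P(1) by auto
   then have "of_int (a \<mu> \<alpha>) \<le> (of_int 1 :: rat)" using D_pos[OF D0_D[OF m(2)]] by (simp add: mult_le_cancel_right)
   then show ?thesis by simp
  qed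
  have D: "\<mu> \<in> D0" if m: "\<mu> \<in> mn P" for \<mu>
  proof (rule ccontr)
   assume n: "\<mu> \<notin> D0"
   have mD: "\<mu> \<in> \<Delta>" using m P(1) by (auto simp: mn_def)
   then obtain \<alpha> where al: "\<alpha> \<in> D0" "\<mu> = \<alpha> + \<alpha>" using D_cases n by blast
   have p: "0 < R \<alpha> \<alpha>" by (rule D_pos[OF D0_D[OF al(1)]])
   have "a \<mu> \<alpha> = 4" by (rule a_eqI[OF D0_D[OF al(1)] mD]) (simp add: al(2) R_add)
   moreover have "a \<mu> \<alpha> \<le> 1" using le1[OF m al(1)] p n al by (metis R_add add_pos_pos)
   ultimately show False by simp
  qed
  have "s \<alpha> \<mu> \<in> mn P" if "\<alpha> \<in> D0" "\<mu> \<in> mn P" for \<alpha> \<mu>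
   using that P(3)[of \<alpha> \<mu>] s_R[OF D0_D, of \<alpha> \<mu>] P(1) by (auto simp: mn_def)
  moreover have "\<mu> = \<alpha> \<or> a \<mu> \<alpha> = 1" if "\<mu> \<in> mn P" "\<alpha> \<in> D0" "0 < R \<mu> \<alpha>" for \<mu> \<alpha>
   using le1[OF that] a_pos[OF D0_D[OF that(2)] D0_D[OF D[OF that(1)]] that(3)] by linarith
  ultimately show ?thesis using ne D unfolding gd_def by blast
 qed
 have "gd P" by (rule main) (use P in auto)
 note mP = this[unfolded gd_def]
 have "gd P'" by (rule main) (use P' in auto)
 note mP' = this[unfolded gd_def]
 obtain \<mu>' where m': "\<mu>' \<in> mn P'" using mP' by blast
 have "\<exists>\<gamma>\<in>mn P. R \<mu>' \<gamma> \<noteq> 0" by (rule nonorthogonal) (use mP mP' m' in auto)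
 then obtain \<mu> where m: "\<mu> \<in> mn P" "R \<mu> \<mu>' \<noteq> 0" using R_sym by metis
 have m'D: "\<mu>' \<in> D0" using mP' m' by blast
 have negP': "- \<mu>' \<in> mn P'"
 proof -
  have "s \<mu>' \<mu>' \<in> mn P'" using mP' m' m'D by blast
  then show ?thesis using a_self[OF D0_D[OF m'D]] by (simp add: algebra_simps)
 qed
 have "\<exists>\<nu>\<in>mn P'. 0 < R \<mu> \<nu>"
 proof (cases "0 < R \<mu> \<mu>'")
  case False then show ?thesis using m(2) negP' by (intro bexI[of _ "- \<mu>'"]) (auto simp: R_neg2)
 qed (use m' in blast)
 then obtain \<nu> where nu: "\<nu> \<in> mn P'" "0 < R \<mu> \<nu>" by blast
 have mD: "\<mu> \<in> D0" and nD: "\<nu> \<in> D0" using mP mP' m nu by blast+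
 show ?thesis
 proof (cases "\<mu> = \<nu>")
  case True then show ?thesis using m nu by (auto simp: mn_def)
 next
  case False
  have "a \<mu> \<nu> = 1" using mP m(1) nD nu False by blast
  moreover have "a \<nu> \<mu> = 1" using mP' nu mD R_sym[of \<mu> \<nu>] False by metis
  moreover have "s \<nu> \<mu> \<in> P" "s \<mu> \<nu> \<in> P'" using P(3) P'(3) m(1) nu(1) mD nD by (auto simp: mn_def)
  moreover have "s \<nu> \<mu> \<in> D0" by (rule D0_refl[OF nD mD])
  ultimately have e: "\<mu> - \<nu> \<in> P" "\<nu> - \<mu> \<in> P'" "\<mu> - \<nu> \<in> D0" by simp_all
  have "s (\<mu> - \<nu>) (\<mu> - \<nu>) \<in> P" using P(3) e by blast
  then have "\<nu> - \<mu> \<in> P" using a_self[OF D0_D[OF e(3)]] by (simp add: algebra_simps)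
  then show ?thesis using e by blast
 qed
qed

subsection \<open>Type B\<close>

definition Dbl :: "'v set" where "Dbl = {\<gamma>\<in>D0. \<gamma> + \<gamma> \<in> \<Delta>}"

lemma Dbl_D0: "\<gamma> \<in> Dbl ==> \<gamma> \<in> D0" and Dbl_D: "\<gamma> \<in> Dbl ==> \<gamma> \<in> \<Delta>" and Dbl2: "\<gamma> \<in> Dbl ==> \<gamma> + \<gamma> \<in> \<Delta>"
 by (auto simp: Dbl_def D0_D)

lemma Dbl_refl: "\<alpha> \<in> D0 ==> \<gamma> \<in> Dbl ==> s \<alpha> \<gamma> \<in> Dbl"
proof -
 assume al: "\<alpha> \<in> D0" and g: "\<gamma> \<in> Dbl"
 have "s \<alpha> (\<gamma> + \<gamma>) \<in> \<Delta>" by (rule refl_closed[OF D0_D[OF al] Dbl2[OF g]])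
 then have "s \<alpha> \<gamma> + s \<alpha> \<gamma> \<in> \<Delta>" unfolding s_double[OF D0_D[OF al] Dbl_D[OF g] Dbl2[OF g]] .
 then show ?thesis using D0_refl[OF al Dbl_D0[OF g]] unfolding Dbl_def by blast
qed

lemma Dbl_neg: "\<gamma> \<in> Dbl ==> - \<gamma> \<in> Dbl"
 using D0_neg[of \<gamma>] D_neg[of "\<gamma> + \<gamma>"] by (auto simp: Dbl_def)

lemma Dbl_even: "\<gamma> \<in> Dbl ==> \<beta> \<in> \<Delta> ==> even (a \<beta> \<gamma>)"
proof -
 assume g: "\<gamma> \<in> Dbl" and b: "\<beta> \<in> \<Delta>"
 have "of_int (a \<beta> (\<gamma> + \<gamma>)) * R (\<gamma> + \<gamma>) (\<gamma> + \<gamma>) = 2 * R \<beta> (\<gamma> + \<gamma>)" by (rule a_R[OF Dbl2[OF g] b])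
 then have "of_int (2 * a \<beta> (\<gamma> + \<gamma>)) * R \<gamma> \<gamma> = 2 * R \<beta> \<gamma>" by (simp only: R_add R_add2) simp
 then have "a \<beta> \<gamma> = 2 * a \<beta> (\<gamma> + \<gamma>)" by (rule a_eqI[OF Dbl_D[OF g] b])
 then show ?thesis by simp
qed

text \<open>By \<open>Dbl_even\<close> both Cartan integers are at least \<open>2\<close>, which
  makes the square length of \<open>\<delta> - \<gamma>\<close> non-positive.\<close>

lemma Dbl_orth_aux:
 assumes g: "\<gamma> \<in> Dbl" "\<delta> \<in> Dbl" "0 < R \<delta> \<gamma>" shows "\<delta> = \<gamma>"
proof -
 have ge: "R \<gamma> \<gamma> \<le> R \<delta> \<gamma>" if "\<gamma> \<in> Dbl" "\<delta> \<in> Dbl" "0 < R \<delta> \<gamma>" for \<gamma> \<delta>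
 proof -
  have "2 \<le> a \<delta> \<gamma>" using Dbl_even[OF that(1) Dbl_D[OF that(2)]] a_pos[OF Dbl_D[OF that(1)] Dbl_D[OF that(2)] that(3)]
   by (auto elim!: evenE)
  then have "2 * R \<gamma> \<gamma> \<le> of_int (a \<delta> \<gamma>) * R \<gamma> \<gamma>" using D_pos[OF Dbl_D[OF that(1)]] by (intro mult_right_mono) auto
  then show ?thesis using a_R[OF Dbl_D[OF that(1)] Dbl_D[OF that(2)]] by simp
 qed
 have "R (\<delta> - \<gamma>) (\<delta> - \<gamma>) \<le> 0"
  using ge[OF g] ge[OF g(2,1)] g(3) by (simp add: R_lin R_sym[of \<gamma> \<delta>])
 then have "\<delta> - \<gamma> = 0" using g D_Q Dbl_D by (intro R_eq0 gen_diff) auto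
 then show ?thesis by simp
qed

lemma Dbl_orth:
 assumes "\<gamma> \<in> Dbl" "\<delta> \<in> Dbl" "\<delta> \<noteq> \<gamma>" "\<delta> \<noteq> - \<gamma>" shows "R \<delta> \<gamma> = 0"
proof (rule ccontr)
 assume "R \<delta> \<gamma> \<noteq> 0"
 then have "0 < R \<delta> \<gamma> \<or> 0 < R \<delta> (- \<gamma>)" by (auto simp: R_neg2)
 then show False using Dbl_orth_aux[OF assms(1,2)] Dbl_orth_aux[OF Dbl_neg[OF assms(1)] assms(2)] assms by blast
qed

text \<open>\<open>s \<beta> \<gamma>\<close> is again in \<open>Dbl\<close> and differs from
  \<open>\<gamma>\<close>, so by \<open>Dbl_orth\<close> it is \<open>- \<gamma>\<close> or
  orthogonal to \<open>\<gamma>\<close>. In the first case \<open>\<beta>\<close> is proportional to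
  \<open>\<gamma>\<close>; in the second the Cartan integer is \<open>1\<close> or \<open>-1\<close>
  and \<open>\<beta>\<close> is a difference of two orthogonal members of
  \<open>Dbl\<close>.\<close>

lemma Dbl_trich:
 assumes g: "\<gamma> \<in> Dbl" and b: "\<beta> \<in> D0" and ne: "R \<beta> \<gamma> \<noteq> 0"
 shows "(s \<beta> \<gamma> = - \<gamma> \<and> (\<beta> = \<gamma> \<or> \<beta> = - \<gamma>)) \<or> (R \<gamma> (s \<beta> \<gamma>) = 0 \<and> (\<beta> = \<gamma> - s \<beta> \<gamma> \<or> \<beta> = s \<beta> \<gamma> - \<gamma>))"
proof -
 let ?c = "a \<gamma> \<beta>" and ?g = "s \<beta> \<gamma>"
 note gD = Dbl_D[OF g] and bD = D0_D[OF b]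
 have g': "?g \<in> Dbl" by (rule Dbl_refl[OF b g])
 have c0: "?c \<noteq> 0" using a_nonzero[OF bD gD] ne R_sym by metis
 have "?g \<noteq> \<gamma>"
 proof
  assume "?g = \<gamma>"
  then have "of_int ?c * \<beta> = 0" by simp
  then have "\<beta> = 0" by (rule torsion_free[OF D_Q[OF bD] c0])
  then show False using bD nz by simp
 qed
 show ?thesis
 proof (cases "?g = - \<gamma>")
  case True
  have cb: "of_int ?c * \<beta> = \<gamma> + \<gamma>" using True by (simp add: algebra_simps eq_neg_iff_add_eq_0)
  have cR: "of_int ?c * R \<beta> \<gamma> = 2 * R \<gamma> \<gamma>" using arg_cong[OF cb, of "\<lambda>x. R x \<gamma>"] by (simp add: R_of_int R_add)
  have "of_int (a \<beta> \<gamma> * ?c) * R \<gamma> \<gamma> = of_int ?c * (of_int (a \<beta> \<gamma>) * R \<gamma> \<gamma>)" by simp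
  also have "\<dots> = of_int ?c * (2 * R \<beta> \<gamma>)" by (simp only: a_R[OF gD bD])
  also have "\<dots> = 2 * (of_int ?c * R \<beta> \<gamma>)" by simp
  also have "\<dots> = 4 * R \<gamma> \<gamma>" by (simp add: cR)
  finally have "of_int (a \<beta> \<gamma> * ?c) * R \<gamma> \<gamma> = 4 * R \<gamma> \<gamma>" .
  then have "of_int (a \<beta> \<gamma> * ?c) = (of_int 4 :: rat)" using D_pos[OF gD] by simp
  then have "a \<beta> \<gamma> * ?c = 4" by (rule of_int_eq_iff[THEN iffD1])
  \<comment> \<open>The values \<open>1\<close>, \<open>-1\<close>, \<open>4\<close> and
    \<open>-4\<close> would make \<open>\<beta>\<close> or \<open>\<gamma>\<close>, up to sign, the
    double of an element of \<open>D0\<close>; only \<open>2\<close> and \<open>-2\<close>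
    survive.\<close>
  then have dv: "?c dvd 4" by (metis dvd_triv_right)
  have "\<bar>?c\<bar> \<le> 4" using dvd_imp_le_int[OF _ dv] by simp
  then have "?c \<in> {-4,-3,-2,-1,1,2,3,4}" using c0 by auto
  moreover have "?c \<noteq> 3" "?c \<noteq> -3" using dv by auto
  ultimately have "?c = 1 \<or> ?c = -1 \<or> ?c = 2 \<or> ?c = -2 \<or> ?c = 4 \<or> ?c = -4" by auto
  moreover have "?c \<noteq> 1" using cb D0_double[OF Dbl_D0[OF g]] b by auto
  moreover have "?c \<noteq> -1"
  proof
   assume "?c = -1"
   then have "- \<beta> = \<gamma> + \<gamma>" using cb by simp
   then show False using D0_double[OF Dbl_D0[OF g]] D0_neg[OF b] by simp
  qed
  moreover have half: "\<gamma> = of_int k * \<beta>" if "?c = 2 * k" for k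
  proof -
   have "of_int (2 * k) * \<beta> = \<gamma> + \<gamma>" using cb unfolding that .
   then have z: "of_int 2 * (of_int k * \<beta> - \<gamma>) = 0" by (simp add: right_diff_distrib mult.assoc)
   have "of_int k * \<beta> - \<gamma> \<in> Q" by (rule gen_diff[OF gen_subgroup_of_int[OF D_Q[OF bD]] D_Q[OF gD]])
   from torsion_free[OF this _ z] have "of_int k * \<beta> - \<gamma> = 0" by simp
   then show ?thesis by simp
  qed
  have "?c \<noteq> 4"
  proof
   assume "?c = 4"
   then have "\<gamma> = \<beta> + \<beta>" using half[of 2] by simp
   then show False using D0_double[OF b] Dbl_D0[OF g] by simp
  qed
  moreover have "?c \<noteq> -4"
  proof
   assume "?c = -4"
   then have "- \<gamma> = \<beta> + \<beta>" using half[of "-2"] by simp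
   then show False using D0_double[OF b] D0_neg[OF Dbl_D0[OF g]] by simp
  qed
  ultimately have "?c = 2 \<or> ?c = -2" by blast
  then have "\<beta> = \<gamma> \<or> \<beta> = - \<gamma>" using half[of 1] half[of "-1"] by auto
  then show ?thesis using True by blast
 next
  case False
  have o: "R \<gamma> ?g = 0" using Dbl_orth[OF g' g] False \<open>?g \<noteq> \<gamma>\<close> by (metis minus_minus)
  then have e: "R \<gamma> \<gamma> = of_int ?c * R \<gamma> \<beta>" by (simp add: R_lin)
  obtain k where k: "a \<beta> \<gamma> = 2 * k" using Dbl_even[OF g bD] by (auto elim: evenE)
  have "of_int (a \<beta> \<gamma>) * R \<gamma> \<gamma> = 2 * R \<beta> \<gamma>" by (rule a_R[OF gD bD])
  then have "of_int (k * ?c) * R \<gamma> \<beta> = 1 * R \<gamma> \<beta>" using k e R_sym[of \<beta> \<gamma>] by simp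
  then have "of_int (k * ?c) = (of_int 1 :: rat)" using ne R_sym[of \<beta> \<gamma>] by simp
  then have "k * ?c = 1" by (rule of_int_eq_iff[THEN iffD1])
  then have "?c = 1 \<or> ?c = -1" using zmult_eq_1_iff by auto
  then have "\<beta> = \<gamma> - ?g \<or> \<beta> = ?g - \<gamma>" by auto
  then show ?thesis using o by blast
 qed
qed

text \<open>The set \<open>C\<close> of members of \<open>Dbl\<close> that are
  \<open>\<delta>\<close> or \<open>- \<delta>\<close> or joined to \<open>\<delta>\<close> by a
  difference in \<open>D0\<close> is stable under reflections. By \<open>nonorthogonal\<close> it
  has a member not orthogonal to \<open>\<gamma>\<close>, and this member equals
  \<open>\<gamma>\<close> up to sign.\<close>

lemma Dbl_connected:
 assumes g: "\<gamma> \<in> Dbl" "\<delta> \<in> Dbl" "\<delta> \<noteq> \<gamma>" "\<delta> \<noteq> - \<gamma>" shows "\<gamma> - \<delta> \<in> D0"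
proof -
 define C where "C = {\<epsilon>\<in>Dbl. \<epsilon> = \<delta> \<or> \<epsilon> = - \<delta> \<or> \<epsilon> - \<delta> \<in> D0}"
 have flip: "- \<epsilon> - \<delta> \<in> D0" if e: "\<epsilon> \<in> Dbl" "\<epsilon> - \<delta> \<in> D0" "\<epsilon> \<noteq> \<delta>" "\<epsilon> \<noteq> - \<delta>" for \<epsilon>
 proof -
  have "R \<epsilon> \<delta> = 0" by (rule Dbl_orth[OF g(2) e(1,3,4)])
  then have "a (\<epsilon> - \<delta>) \<epsilon> = 2"
   by (intro a_eqI) (use e D0_D Dbl_D in \<open>auto simp: R_lin R_sym[of \<delta> \<epsilon>]\<close>)
  then have "s \<epsilon> (\<epsilon> - \<delta>) = (\<epsilon> - \<delta>) - of_int 2 * \<epsilon>" by (simp only:)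
  then have "s \<epsilon> (\<epsilon> - \<delta>) = - \<epsilon> - \<delta>" by (simp add: algebra_simps)
  moreover have "s \<epsilon> (\<epsilon> - \<delta>) \<in> D0" by (rule D0_refl[OF Dbl_D0[OF e(1)] e(2)])
  ultimately show ?thesis by (simp only:)
 qed
 have Cneg: "- \<epsilon> \<in> C" if "\<epsilon> \<in> C" for \<epsilon>
  using that flip[of \<epsilon>] Dbl_neg[of \<epsilon>] by (cases "\<epsilon> = \<delta> \<or> \<epsilon> = - \<delta>") (auto simp: C_def)
 have Cs: "s \<beta> \<epsilon> \<in> C" if b: "\<beta> \<in> D0" and e: "\<epsilon> \<in> C" for \<beta> \<epsilon>
 proof (cases "R \<beta> \<epsilon> = 0")
  case True
  have "\<epsilon> \<in> Dbl" using e by (simp add: C_def)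
  then show ?thesis using e a_zero[OF D0_D[OF b] Dbl_D] True R_sym[of \<beta> \<epsilon>] by simp
 next
  case False
  have eO: "\<epsilon> \<in> Dbl" using e by (simp add: C_def)
  let ?e = "s \<beta> \<epsilon>"
  have e': "?e \<in> Dbl" by (rule Dbl_refl[OF b eO])
  have key: "E \<in> C" if E: "E \<in> Dbl" "R \<epsilon> E = 0" "\<beta> = \<epsilon> - E \<or> \<beta> = E - \<epsilon>" "s \<beta> \<epsilon> = E" for E
  proof (cases "E = \<delta> \<or> E = - \<delta>")
   case True then show ?thesis using E(1) by (auto simp: C_def)
  next
   case ne: False
   have bb: "\<epsilon> - E \<in> D0" "E - \<epsilon> \<in> D0" using E(3) b D0_neg[OF b] by auto
   consider "\<epsilon> = \<delta>" | "\<epsilon> = - \<delta>" | "\<epsilon> \<noteq> \<delta>" "\<epsilon> \<noteq> - \<delta>" "\<epsilon> - \<delta> \<in> D0" using e by (auto simp: C_def)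
   then show ?thesis
   proof cases
    case 1 then show ?thesis using bb E(1) by (simp add: C_def)
   next
    case 2
    then have "E + \<delta> \<in> D0" using bb by simp
    then have "- (E + \<delta>) \<in> D0" by (rule D0_neg)
    then have "- E \<in> C" using Dbl_neg[OF E(1)] by (simp add: C_def)
    then show ?thesis using Cneg by fastforce
   next
    case 3
    have "R \<delta> \<epsilon> = 0" using Dbl_orth[OF g(2) eO] 3 R_sym[of \<delta> \<epsilon>] by simp
    moreover have "R \<delta> E = 0" using Dbl_orth[OF g(2) E(1)] ne R_sym[of \<delta> E] by simp
    ultimately have "R \<delta> \<beta> = 0" using E(3) by (auto simp: R_diff2)
    then have "a (\<epsilon> - \<delta>) \<beta> = a \<epsilon> \<beta>"
     using a_R[OF D0_D[OF b] Dbl_D[OF eO]] by (intro a_eqI D0_D b 3) (simp add: R_diff)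
    then have "s \<beta> (\<epsilon> - \<delta>) = s \<beta> \<epsilon> - \<delta>" by simp
    then have "s \<beta> (\<epsilon> - \<delta>) = E - \<delta>" by (simp only: E(4))
    then have "E - \<delta> \<in> D0" using D0_refl[OF b 3(3)] by (simp only:)
    then show ?thesis using E(1) by (simp add: C_def)
   qed
  qed
  from Dbl_trich[OF eO b False] show ?thesis
  proof (elim disjE conjE)
   assume "?e = - \<epsilon>" then show ?thesis using Cneg[OF e] by (simp only:)
  next
   assume "?e = - \<epsilon>" then show ?thesis using Cneg[OF e] by (simp only:)
  next
   assume "R \<epsilon> ?e = 0" "\<beta> = \<epsilon> - ?e"
   then show ?thesis by (intro key[OF e'] disjI1 refl)
  next
   assume "R \<epsilon> ?e = 0" "\<beta> = ?e - \<epsilon>"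
   then show ?thesis by (intro key[OF e'] disjI2 refl)
  qed
 qed
 have "\<exists>\<epsilon>\<in>C. R \<gamma> \<epsilon> \<noteq> 0"
  by (rule nonorthogonal[OF _ _ Cs Dbl_D0[OF g(1)]]) (use g Dbl_D0 in \<open>auto simp: C_def\<close>)
 then obtain \<epsilon> where e: "\<epsilon> \<in> C" "R \<gamma> \<epsilon> \<noteq> 0" by blast
 then have "\<gamma> = \<epsilon> \<or> \<gamma> = - \<epsilon>" using Dbl_orth[of \<epsilon> \<gamma>] g by (auto simp: C_def)
 then have "\<gamma> \<in> C" using e Cneg by blast
 then show ?thesis using g by (auto simp: C_def)
qed

text \<open>One coordinate for each pair \<open>\<gamma>\<close>, \<open>- \<gamma>\<close> in
  \<open>Dbl\<close>, namely its positive member. \<open>Dbl_trich\<close> shows that every element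
  of \<open>D0\<close> has one of the listed forms, \<open>Dbl_connected\<close> that all of these
  forms occur.\<close>

lemma type_B:
 assumes al: "\<alpha> \<in> Dbl"
 shows "\<exists>(l::nat) \<epsilon>. 1 \<le> l \<and> (\<forall>i<l. \<epsilon> i \<in> \<Delta>) \<and> (\<forall>i<l. \<forall>j<l. i \<noteq> j \<longrightarrow> R (\<epsilon> i) (\<epsilon> j) = 0) \<and>
  D0 = {\<epsilon> i | i. i < l} \<union> {- \<epsilon> i | i. i < l} \<union>
    {\<epsilon> i + \<epsilon> j | i j. i < l \<and> j < l \<and> i \<noteq> j} \<union> {\<epsilon> i - \<epsilon> j | i j. i < l \<and> j < l \<and> i \<noteq> j} \<union>
    {- \<epsilon> i - \<epsilon> j | i j. i < l \<and> j < l \<and> i \<noteq> j} \<and>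
  (\<exists>i<l. \<alpha> = \<epsilon> i \<or> \<alpha> = - \<epsilon> i)"
proof -
 let ?P = "Dbl \<inter> pos"
 have fP: "finite ?P" by (rule finite_subset[OF _ fin]) (auto simp: Dbl_D)
 obtain \<epsilon> where bij: "bij_betw \<epsilon> {..<card ?P} ?P"
  using ex_bij_betw_nat_finite[OF fP] by (auto simp: atLeast0LessThan)
 define l where "l = card ?P"
 have im: "\<epsilon> ` {..<l} = ?P" and inj: "inj_on \<epsilon> {..<l}" using bij by (auto simp: l_def bij_betw_def)
 have ePO: "\<epsilon> i \<in> Dbl" "\<epsilon> i \<in> pos" if "i < l" for i using im that by auto
 have cov: "\<exists>i<l. \<gamma> = \<epsilon> i \<or> \<gamma> = - \<epsilon> i" if "\<gamma> \<in> Dbl" for \<gamma>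
 proof -
  from pos_or_neg[OF Dbl_D[OF that]] show ?thesis
  proof
   assume "\<gamma> \<in> pos"
   then have "\<gamma> \<in> \<epsilon> ` {..<l}" using that im by blast
   then show ?thesis by blast
  next
   assume "- \<gamma> \<in> pos"
   then have "- \<gamma> \<in> \<epsilon> ` {..<l}" using Dbl_neg[OF that] im by blast
   then show ?thesis by (metis imageE lessThan_iff minus_minus)
  qed
 qed
 have dist: "\<epsilon> i \<noteq> \<epsilon> j \<and> \<epsilon> i \<noteq> - \<epsilon> j" if "i < l" "j < l" "i \<noteq> j" for i j
 proof
  show "\<epsilon> i \<noteq> \<epsilon> j" using inj that by (auto simp: inj_on_def)
  show "\<epsilon> i \<noteq> - \<epsilon> j"
  proof
   assume "\<epsilon> i = - \<epsilon> j"
   then have "\<rho> (\<epsilon> i) = - \<rho> (\<epsilon> j)" by (simp add: rho_lin)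
   then show False using ePO(2)[OF that(1)] ePO(2)[OF that(2)] by (simp add: pos_def)
  qed
 qed
 have orth: "R (\<epsilon> i) (\<epsilon> j) = 0" if "i < l" "j < l" "i \<noteq> j" for i j
  using Dbl_orth[OF ePO(1)[OF that(2)] ePO(1)[OF that(1)]] dist[OF that] by blast
 have diffD: "\<gamma> - \<delta> \<in> D0" if "\<gamma> \<in> Dbl" "\<delta> \<in> Dbl" "\<delta> \<noteq> \<gamma>" "\<delta> \<noteq> - \<gamma>" for \<gamma> \<delta>
  using Dbl_connected that .
 let ?S = "{\<epsilon> i | i. i < l} \<union> {- \<epsilon> i | i. i < l} \<union>
    {\<epsilon> i + \<epsilon> j | i j. i < l \<and> j < l \<and> i \<noteq> j} \<union> {\<epsilon> i - \<epsilon> j | i j. i < l \<and> j < l \<and> i \<noteq> j} \<union>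
    {- \<epsilon> i - \<epsilon> j | i j. i < l \<and> j < l \<and> i \<noteq> j}"
 have S1: "\<epsilon> i \<in> ?S" "- \<epsilon> i \<in> ?S" if "i < l" for i using that by blast+
 have S2: "\<epsilon> i + \<epsilon> j \<in> ?S" "\<epsilon> i - \<epsilon> j \<in> ?S" "- \<epsilon> i - \<epsilon> j \<in> ?S" if "i < l" "j < l" "i \<noteq> j" for i j
  using that by blast+
 have "D0 \<subseteq> ?S"
 proof
  fix \<beta> assume b: "\<beta> \<in> D0"
  have "\<exists>\<gamma>\<in>Dbl. R \<beta> \<gamma> \<noteq> 0" by (rule nonorthogonal[OF _ _ Dbl_refl b]) (use al Dbl_D0 in auto)
  then obtain \<gamma> where g: "\<gamma> \<in> Dbl" "R \<beta> \<gamma> \<noteq> 0" by blast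
  have g': "s \<beta> \<gamma> \<in> Dbl" by (rule Dbl_refl[OF b g(1)])
  obtain i where i: "i < l" "\<gamma> = \<epsilon> i \<or> \<gamma> = - \<epsilon> i" using cov[OF g(1)] by blast
  have main: "\<mu> - \<nu> \<in> ?S" if mn: "\<mu> \<in> Dbl" "\<nu> \<in> Dbl" "R \<mu> \<nu> = 0" for \<mu> \<nu>
  proof -
   obtain i j where ij: "i < l" "j < l" "\<mu> = \<epsilon> i \<or> \<mu> = - \<epsilon> i" "\<nu> = \<epsilon> j \<or> \<nu> = - \<epsilon> j"
    using cov[OF mn(1)] cov[OF mn(2)] by blast
   have ne: "i \<noteq> j" using ij(3,4) mn(3) D_pos[OF Dbl_D[OF ePO(1)[OF ij(1)]]] by (auto simp: R_neg R_neg2)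
   show ?thesis using ij(3,4) S2[OF ij(1,2) ne] S2(2)[OF ij(2,1)] ne by (elim disjE) auto
  qed
  from Dbl_trich[OF g(1) b g(2)] show "\<beta> \<in> ?S"
  proof (elim disjE conjE)
   assume "\<beta> = \<gamma>" then show ?thesis using i S1[OF i(1)] by (elim disjE) (simp_all only:)
  next
   assume "\<beta> = - \<gamma>" then show ?thesis using i S1[OF i(1)] by (elim disjE) (simp_all only: minus_minus)
  next
   assume "R \<gamma> (s \<beta> \<gamma>) = 0" "\<beta> = \<gamma> - s \<beta> \<gamma>"
   then show ?thesis using main[OF g(1) g'] by metis
  next
   assume "R \<gamma> (s \<beta> \<gamma>) = 0" "\<beta> = s \<beta> \<gamma> - \<gamma>"
   then show ?thesis using main[OF g' g(1)] R_sym by metis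
  qed
 qed
 moreover have "?S \<subseteq> D0"
 proof -
  have e: "\<epsilon> i \<in> D0" "- \<epsilon> i \<in> D0" if "i < l" for i using ePO[OF that] Dbl_D0 D0_neg by auto
  have e2: "\<epsilon> i - \<epsilon> j \<in> D0" "\<epsilon> i + \<epsilon> j \<in> D0" "- \<epsilon> i - \<epsilon> j \<in> D0" if ij: "i < l" "j < l" "i \<noteq> j" for i j
  proof -
   note d = dist[OF ij] dist[OF ij(2,1)] ij(3)
   show "\<epsilon> i - \<epsilon> j \<in> D0" by (rule diffD) (use ePO ij d in auto)
   have "\<epsilon> i - (- \<epsilon> j) \<in> D0" by (rule diffD) (use ePO ij d Dbl_neg in \<open>auto simp: minus_equation_iff\<close>)
   then show p: "\<epsilon> i + \<epsilon> j \<in> D0" by simp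
   show "- \<epsilon> i - \<epsilon> j \<in> D0" using D0_neg[OF p] by simp
  qed
  show ?thesis using e e2 by blast
 qed
 ultimately have D0S: "D0 = ?S" by (rule equalityI)
 have l1: "1 \<le> l" using cov[OF al] by auto
 have eD: "\<forall>i<l. \<epsilon> i \<in> \<Delta>" using ePO(1) Dbl_D by blast
 have or: "\<forall>i<l. \<forall>j<l. i \<noteq> j \<longrightarrow> R (\<epsilon> i) (\<epsilon> j) = 0" using orth by blast
 show ?thesis
  by (rule exI, rule exI, rule conjI[OF l1], rule conjI[OF eD], rule conjI[OF or],
   rule conjI[OF D0S], rule cov[OF al])
qed

end

lemma of_int_fun_apply: "(of_int k :: 'x \<Rightarrow> 'y::comm_ring_1) x = of_int k"
 by (cases k rule: int_cases2) (simp_all add: of_nat_fun_apply)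

context mloop begin

subsection \<open>The root system of a multiloop datum\<close>

definition roots :: "('a \<Rightarrow> 'k) set" where
 "roots = {\<alpha>\<in>hd'. \<alpha> \<noteq> 0 \<and> rt \<alpha> \<noteq> {0}}"

lemma Qh_roots: "Qh scale br H = gen_subgroup roots"
 by (simp add: Qh_def roots_def)

lemma rt_independent:
 assumes "finite X" "X \<subseteq> hd'" "\<And>\<alpha>. \<alpha> \<in> X ==> u \<alpha> \<in> rt \<alpha>" "subspace W" "\<And>h x. h \<in> H ==> x \<in> W ==> br h x \<in> W"
  "(\<Sum>\<alpha>\<in>X. u \<alpha>) \<in> W" "\<alpha> \<in> X"
 shows "u \<alpha> \<in> W"
proof (rule jeig_comp[of H br W X "\<lambda>\<alpha>. \<alpha>" u \<alpha>])
 show "\<exists>t\<in>H. \<chi> t \<noteq> \<psi> t" if "\<chi> \<in> X" "\<psi> \<in> X" "\<chi> \<noteq> \<psi>" for \<chi> \<psi>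
  using hd_eqI[of \<chi> \<psi>] that assms(2) by blast
 show "u \<chi> \<in> jeig H br \<chi>" if "\<chi> \<in> X" for \<chi>
  using assms(3)[OF that] by (simp add: jeig_def rt_iff)
qed (use assms lin_br in auto)

lemma rt_decomp: "finite {\<alpha>\<in>hd'. rt \<alpha> \<noteq> {0}}" "decomp {\<alpha>\<in>hd'. rt \<alpha> \<noteq> {0}} rt"
proof -
 have sp: "x \<in> span (\<Union>\<alpha>\<in>hd'. rt \<alpha>)" for x
 proof -
  have "(\<Union>p\<in>hd' \<times> Zn n. G (fst p) (snd p)) \<subseteq> (\<Union>\<alpha>\<in>hd'. rt \<alpha>)" by (auto simp: G_def)
  then show ?thesis using G_span[of x] span_mono by blast
 qed
 have ind: "u i = 0" if I: "finite I" "I \<subseteq> hd'" "\<And>i. i \<in> I ==> u i \<in> rt i" "(\<Sum>i\<in>I. u i) = 0" "i \<in> I" for I u i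
 proof -
  have "u i \<in> {0}" by (rule rt_independent[OF I(1-3) subspace_single_0]) (use I in auto)
  then show ?thesis by simp
 qed
 show "finite {\<alpha>\<in>hd'. rt \<alpha> \<noteq> {0}}" "decomp {\<alpha>\<in>hd'. rt \<alpha> \<noteq> {0}} rt"
  by (rule decomp_exists, rule subspace_rt, rule sp, rule ind; assumption)+
qed

lemma finite_roots: "finite roots"
 by (rule finite_subset[OF _ rt_decomp(1)]) (auto simp: roots_def)

lemma Zn_zero: "0 \<in> Zn n" and Zn_neg: "l \<in> Zn n ==> - l \<in> Zn n" and
 Zn_add: "l \<in> Zn n ==> l' \<in> Zn n ==> l + l' \<in> Zn n" and
 Zn_diff: "l \<in> Zn n ==> l' \<in> Zn n ==> l - l' \<in> Zn n"
 by (auto simp: Zn_def)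

lemma Zn_of_int: "l \<in> Zn n ==> of_int k * l \<in> Zn n"
 by (auto simp: Zn_def)

lemma Zn_sum: "(\<And>i. i \<in> I ==> f i \<in> Zn n) ==> sum f I \<in> Zn n"
 by (induction I rule: infinite_finite_induct) (auto intro: Zn_zero Zn_add)

lemma supp_root: "supp \<alpha> l ==> \<alpha> \<noteq> 0 ==> \<alpha> \<in> roots"
 using suppE[of \<alpha> l] unfolding roots_def G_def by (metis (mono_tags, lifting) IntD1 mem_Collect_eq singletonD)

lemma root_hd: "\<alpha> \<in> roots ==> \<alpha> \<in> hd'" and root_nz: "\<alpha> \<in> roots ==> \<alpha> \<noteq> 0"
 by (auto simp: roots_def)

text \<open>By nondegeneracy some homogeneous vector has a non-zero Killing product with
  \<open>x\<close>, and its weight must be opposite to \<open>\<alpha>\<close>.\<close>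

lemma rt_G: assumes x: "x \<in> rt \<alpha>" "x \<noteq> 0" "\<alpha> \<in> hd'" shows "\<exists>l\<in>Zn n. supp (- \<alpha>) l"
proof (rule ccontr)
 assume n: "\<not> ?thesis"
 have "x = 0"
 proof (rule kil_nondeg)
  fix y show "kil x y = 0"
  proof (rule G_induct[of "\<lambda>y. kil x y = 0"])
   fix \<beta> l y assume b: "\<beta> \<in> hd'" "l \<in> Zn n" "y \<in> G \<beta> l"
   show "kil x y = 0"
   proof (rule ccontr)
    assume k: "kil x y \<noteq> 0"
    have "\<beta> = - \<alpha>"
    proof (intro hd_eqI b hd_neg x)
     fix h assume h: "h \<in> H"
     have "\<alpha> h * kil x y = kil (br h x) y" using x h by (simp add: rt_iff kil_scale_left)
     also have "\<dots> = - (\<beta> h * kil x y)" using b h kil_invariant2[of h x y] by (simp add: G_def rt_iff kil_scale_right)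
     finally have "(\<alpha> h + \<beta> h) * kil x y = 0" by (simp add: distrib_right)
     then show "\<beta> h = (- \<alpha>) h" using k by (simp add: eq_neg_iff_add_eq_0 add.commute)
    qed
    moreover have "y \<noteq> 0" using k by auto
    ultimately have "supp (- \<alpha>) l" using suppI[OF b(1,3)] by simp
    then show False using n b by blast
   qed
  qed (simp add: kil_add_right)
 qed
 then show False using x by simp
qed

lemma root_supp: assumes "\<alpha> \<in> roots" shows "\<exists>l\<in>Zn n. supp \<alpha> l"
proof -
 obtain x where x: "x \<in> rt \<alpha>" "x \<noteq> 0" using assms subspace_0[OF subspace_rt] by (auto simp: roots_def)
 obtain l where l: "l \<in> Zn n" "supp (- \<alpha>) l" using rt_G[OF x root_hd[OF assms]] by blast
 have "supp (- (- \<alpha>)) (- l)" by (rule supp_neg[OF l(2)]) (use root_nz[OF assms] in simp)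
 then show ?thesis using Zn_neg[OF l(1)] by (intro bexI[of _ "- l"]) simp_all
qed

lemma roots_center: assumes h: "h \<in> H" "\<And>\<alpha>. \<alpha> \<in> roots ==> \<alpha> h = 0" shows "h = 0"
proof (rule center_zero)
 fix y show "br h y = 0"
 proof (rule G_induct[of "\<lambda>y. br h y = 0"])
  fix \<beta> l y assume b: "\<beta> \<in> hd'" "y \<in> G \<beta> l"
  show "br h y = 0"
  proof (cases "y = 0 \<or> \<beta> = 0")
   case False
   then have "\<beta> \<in> roots" using b supp_root[OF suppI] by blast
   then show ?thesis using h b by (simp add: G_def rt_iff)
  qed (use h b in \<open>auto simp: G_def rt_iff\<close>)
 qed (simp add: br_add_right)
qed

definition BH :: "'a set" where "BH = (SOME B. independent B \<and> finite B \<and> span B = H \<and> B \<subseteq> H)"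

lemma BH: "independent BH" "finite BH" "span BH = H" "BH \<subseteq> H"
proof -
 have "\<exists>B. independent B \<and> finite B \<and> span B = H \<and> B \<subseteq> H" using obtain_basis[OF subspace_H] by metis
 from someI_ex[OF this] show "independent BH" "finite BH" "span BH = H" "BH \<subseteq> H" unfolding BH_def by blast+
qed

text \<open>Additive on all functions, not only on \<open>hd'\<close>; only the values on a basis of \<open>H\<close> are used.\<close>

definition tv :: "('a \<Rightarrow> 'k) \<Rightarrow> 'a" where
 "tv \<alpha> = (SOME t. t \<in> H \<and> (\<forall>v\<in>BH. kil t v = \<alpha> v))"

lemma tv: "tv \<alpha> \<in> H" "v \<in> BH ==> kil (tv \<alpha>) v = \<alpha> v"
proof -
 define L where "L = (\<lambda>h. \<Sum>v\<in>BH. representation BH h v * \<alpha> v)"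
 have "\<exists>d\<in>H. \<forall>w\<in>H. kil d w = L w"
  by (rule kil_functional[OF subspace_H H_nondeg])
   (use BH in \<open>auto simp: L_def representation_add representation_scale distrib_right sum.distrib sum_distrib_left mult.assoc\<close>)
 then obtain d where d: "d \<in> H" "\<And>w. w \<in> H ==> kil d w = L w" by blast
 have "L v = \<alpha> v" if "v \<in> BH" for v
 proof -
  have "L v = (\<Sum>w\<in>BH. if w = v then \<alpha> w else 0)"
   unfolding L_def by (intro sum.cong refl) (simp add: representation_basis[OF BH(1) that])
  then show ?thesis using BH(2) that by simp
 qed
 then have "d \<in> H \<and> (\<forall>v\<in>BH. kil d v = \<alpha> v)" using d BH(4) by auto
 from someI[of "\<lambda>t. t \<in> H \<and> (\<forall>v\<in>BH. kil t v = \<alpha> v)", OF this]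
 show "tv \<alpha> \<in> H" "v \<in> BH ==> kil (tv \<alpha>) v = \<alpha> v" unfolding tv_def by auto
qed

lemma tv_eqI: assumes "t \<in> H" "\<And>v. v \<in> BH ==> kil t v = \<alpha> v" shows "tv \<alpha> = t"
proof -
 have "tv \<alpha> - t = 0"
 proof (rule H_nondeg)
  show "tv \<alpha> - t \<in> H" using tv assms subspace_diff[OF subspace_H] by blast
  fix y assume "y \<in> H"
  then have "y \<in> span BH" using BH by simp
  then show "kil (tv \<alpha> - t) y = 0"
   by (induction rule: span_induct_alt) (simp_all add: kil_add_right kil_scale_right kil_diff_left tv assms)
 qed
 then show ?thesis by simp
qed

lemma tv_add: "tv (\<alpha> + \<beta>) = tv \<alpha> + tv \<beta>"
 by (rule tv_eqI) (auto simp: tv subspace_add[OF subspace_H] kil_add_left)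

lemma tv_diff: "tv (\<alpha> - \<beta>) = tv \<alpha> - tv \<beta>"
 using tv_add[of "\<alpha> - \<beta>" \<beta>] by simp

lemma tv_tt: "\<alpha> \<in> hd' ==> tv \<alpha> = tt \<alpha>"
 by (rule tv_eqI) (use tt BH(4) in auto)

definition \<phi> :: "'k \<Rightarrow> rat" where
 "\<phi> = (SOME \<phi>. (\<forall>x y. \<phi> (x + y) = \<phi> x + \<phi> y) \<and> (\<forall>r x. \<phi> (of_rat r * x) = r * \<phi> x) \<and> \<phi> 1 = 1)"

lemma phi: "\<phi> (x + y) = \<phi> x + \<phi> y" "\<phi> (of_rat r * x) = r * \<phi> x" "\<phi> 1 = 1"
 using someI_ex[OF rational_functional[where 'k = 'k]] unfolding \<phi>_def[symmetric] by auto

lemma phi_rat: "\<phi> (of_rat r) = r" using phi(2)[of r 1] phi(3) by simp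

text \<open>Killing products of the \<open>tt \<alpha>\<close> for roots are already rational, see
  \<open>kil_R\<close>; there \<open>\<phi>\<close> only transports them to the type
  \<open>rat\<close>. Elsewhere it keeps the form total and additive.\<close>

definition R :: "('a \<Rightarrow> 'k) \<Rightarrow> ('a \<Rightarrow> 'k) \<Rightarrow> rat" where
 "R \<alpha> \<beta> = \<phi> (kil (tv \<alpha>) (tv \<beta>))"

definition ai :: "('a \<Rightarrow> 'k) \<Rightarrow> ('a \<Rightarrow> 'k) \<Rightarrow> int" where
 "ai \<beta> \<alpha> = (SOME z. \<beta> (hh \<alpha>) = of_int z)"

lemma ai: "\<alpha> \<in> roots ==> \<beta> \<in> roots ==> \<beta> (hh \<alpha>) = of_int (ai \<beta> \<alpha>)"
proof -
 assume "\<alpha> \<in> roots" "\<beta> \<in> roots"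
 then have "\<exists>z. \<beta> (hh \<alpha>) = of_int z" using root_supp supp_integer root_nz by metis
 from someI_ex[OF this] show ?thesis by (simp add: ai_def)
qed

lemma kil_H:
 assumes "x \<in> H" "y \<in> H"
 shows "kil x y = (\<Sum>\<alpha>\<in>roots. of_nat (dim (rt \<alpha>)) * (\<alpha> x * \<alpha> y))"
proof -
 let ?I = "{\<alpha>\<in>hd'. rt \<alpha> \<noteq> {0}}"
 have "kil x y = (\<Sum>\<alpha>\<in>?I. tr (rt \<alpha>) (\<lambda>v. br x (br y v)))"
  unfolding kil_def
  by (rule tr_decomp[OF rt_decomp(2) lin_br_br]) (use assms subspace_scale[OF subspace_rt] in \<open>auto simp: rt_iff br_scale_right\<close>)
 also have "\<dots> = (\<Sum>\<alpha>\<in>?I. of_nat (dim (rt \<alpha>)) * (\<alpha> x * \<alpha> y))"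
 proof (intro sum.cong refl)
  fix \<alpha>
  have "tr (rt \<alpha>) (\<lambda>v. br x (br y v)) = tr (rt \<alpha>) (\<lambda>v. (\<alpha> x * \<alpha> y) *s v)"
   by (rule tr_cong[OF subspace_rt lin_smult[OF lin_ident] lin_br_br])
    (use assms subspace_scale[OF subspace_rt] in \<open>auto simp: rt_iff br_scale_right mult.commute\<close>)
  then show "tr (rt \<alpha>) (\<lambda>v. br x (br y v)) = of_nat (dim (rt \<alpha>)) * (\<alpha> x * \<alpha> y)"
   using tr_smult[OF subspace_rt lin_ident, of \<alpha> "\<alpha> x * \<alpha> y"] tr_ident[OF subspace_rt, of \<alpha>] by (simp add: mult.commute)
 qed
 also have "\<dots> = (\<Sum>\<alpha>\<in>roots. of_nat (dim (rt \<alpha>)) * (\<alpha> x * \<alpha> y))"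
  by (rule sum.mono_neutral_right[OF rt_decomp(1)]) (auto simp: roots_def)
 finally show ?thesis .
qed

lemma root_norm: "\<alpha> \<in> roots ==> \<alpha> (tt \<alpha>) \<noteq> 0" and root_hh: "\<alpha> \<in> roots ==> \<alpha> (hh \<alpha>) = 2"
 using root_supp supp_norm supp_hh root_nz by metis+

text \<open>\<open>kil (hh \<alpha>) (hh \<alpha>)\<close> is an integer by \<open>kil_H\<close>,
  since roots take integer values on coroots, and it also equals
  \<open>4 / \<alpha> (tt \<alpha>)\<close>.\<close>

lemma norm_rational: assumes a: "\<alpha> \<in> roots" shows "\<exists>r. \<alpha> (tt \<alpha>) = of_rat r"
proof -
 let ?N = "\<Sum>\<beta>\<in>roots. int (dim (rt \<beta>)) * (ai \<beta> \<alpha> * ai \<beta> \<alpha>)"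
 have hH: "hh \<alpha> \<in> H" "tt \<alpha> \<in> H" using hh_H tt root_hd[OF a] by blast+
 have "kil (hh \<alpha>) (hh \<alpha>) = of_int ?N"
  using kil_H[OF hH(1) hH(1)] ai[OF a] by simp
 moreover have "kil (hh \<alpha>) (hh \<alpha>) = 4 / \<alpha> (tt \<alpha>)"
  using root_norm[OF a] tt(2)[OF root_hd[OF a] hH(2)]
  by (simp add: hh_def kil_scale_left kil_scale_right)
 ultimately have "\<alpha> (tt \<alpha>) * of_int ?N = 4" using root_norm[OF a] by (metis nonzero_mult_div_cancel_left times_divide_eq_right)
 moreover from this have "(of_int ?N :: 'k) \<noteq> 0" by (metis mult_zero_right zero_neq_numeral)
 ultimately have "\<alpha> (tt \<alpha>) = 4 / of_int ?N" by (intro eq_divide_imp)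
 also have "\<dots> = of_rat (4 / of_int ?N)" by (simp only: of_rat_divide of_rat_numeral_eq of_rat_of_int_eq)
 finally show ?thesis by blast
qed

lemma root_tt_rational: assumes "\<alpha> \<in> roots" "\<beta> \<in> roots" shows "\<exists>r. \<beta> (tt \<alpha>) = of_rat r"
proof -
 obtain r where r: "\<alpha> (tt \<alpha>) = of_rat r" using norm_rational[OF assms(1)] by blast
 have "of_int (ai \<beta> \<alpha>) = (2 / \<alpha> (tt \<alpha>)) * \<beta> (tt \<alpha>)"
  using ai[OF assms] hd_lin(2)[OF root_hd[OF assms(2)] tt(1)[OF root_hd[OF assms(1)]]] by (simp add: hh_def)
 then have "\<beta> (tt \<alpha>) = of_int (ai \<beta> \<alpha>) * \<alpha> (tt \<alpha>) / 2" using root_norm[OF assms(1)] by (simp add: field_simps)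
 also have "\<dots> = of_rat (of_int (ai \<beta> \<alpha>) * r / 2)" by (simp add: r of_rat_divide of_rat_mult)
 finally show ?thesis by blast
qed

lemma Q_hd: "x \<in> gen_subgroup roots ==> x \<in> hd'"
 by (induction rule: gen_subgroup.induct) (blast intro: hd_zero root_hd hd_diff)+

lemma Q_rational: "x \<in> gen_subgroup roots ==> \<beta> \<in> roots ==> \<exists>r. \<beta> (tv x) = of_rat r"
proof (induction rule: gen_subgroup.induct)
 case gen_zero
 have "tv 0 = 0" using tv_diff[of 0 0] by simp
 moreover have "\<beta> 0 = 0" using hd_lin(2)[OF root_hd[OF gen_zero] subspace_0[OF subspace_H], of 0] by simp
 ultimately have "\<beta> (tv 0) = of_rat 0" by (simp only: of_rat_0)
 then show ?case by (rule exI)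
next
 case (gen_base x)
 then show ?case using root_tt_rational tv_tt[OF root_hd] by simp
next
 case (gen_diff x y)
 then obtain r q where rq: "\<beta> (tv x) = of_rat r" "\<beta> (tv y) = of_rat q" by blast
 have "\<beta> (tv x) = \<beta> (tv (x - y)) + \<beta> (tv y)"
  using hd_lin(1)[OF root_hd[OF gen_diff.prems] tv(1) tv(1), of "x - y" y] tv_add[of "x - y" y] by simp
 then have "\<beta> (tv (x - y)) = of_rat (r - q)" using rq by (simp add: of_rat_diff)
 then show ?case by blast
qed

lemma R_add': "R (x + y) z = R x z + R y z"
 by (simp add: R_def tv_add kil_add_left phi)

text \<open>By \<open>kil_H\<close> the value is a sum of rational squares weighted by dimensions.
  It vanishes only if all roots vanish on \<open>tv x\<close>, and then \<open>tv x\<close> is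
  central.\<close>

lemma R_pos':
 assumes x: "x \<in> gen_subgroup roots" "x \<noteq> 0" shows "0 < R x x"
proof -
 obtain r where r: "\<And>\<beta>. \<beta> \<in> roots ==> \<beta> (tv x) = of_rat (r \<beta>)" using Q_rational[OF x(1)] by metis
 have "kil (tv x) (tv x) = of_rat (\<Sum>\<beta>\<in>roots. of_nat (dim (rt \<beta>)) * (r \<beta> * r \<beta>))"
  by (simp add: kil_H tv r of_rat_sum of_rat_mult)
 then have Re: "R x x = (\<Sum>\<beta>\<in>roots. of_nat (dim (rt \<beta>)) * (r \<beta> * r \<beta>))" unfolding R_def by (simp only: phi_rat)
 have ge: "0 \<le> R x x" unfolding Re by (intro sum_nonneg) simp
 have "R x x \<noteq> 0"
 proof
  assume "R x x = 0"
  then have "\<forall>\<beta>\<in>roots. of_nat (dim (rt \<beta>)) * (r \<beta> * r \<beta>) = 0"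
   unfolding Re by (subst (asm) sum_nonneg_eq_0_iff[OF finite_roots]) simp_all
  moreover have "dim (rt \<beta>) \<noteq> 0" if "\<beta> \<in> roots" for \<beta>
   using that subspace_0[OF subspace_rt] by (auto simp: roots_def)
  ultimately have "\<beta> (tv x) = 0" if "\<beta> \<in> roots" for \<beta> using r[OF that] that by auto
  then have "tv x = 0" using roots_center tv(1) by blast
  then have "x h = 0" if "h \<in> H" for h using tt(2)[OF Q_hd[OF x(1)] that] tv_tt[OF Q_hd[OF x(1)]] by simp
  then have "x = 0" by (intro hd_eqI Q_hd x hd_zero) simp
  then show False using x by simp
 qed
 then show ?thesis using ge by simp
qed

lemma a_R': assumes "\<alpha> \<in> roots" "\<beta> \<in> roots" shows "of_int (ai \<beta> \<alpha>) * R \<alpha> \<alpha> = 2 * R \<beta> \<alpha>"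
proof -
 note a = root_hd[OF assms(1)] and b = root_hd[OF assms(2)]
 have "of_int (ai \<beta> \<alpha>) = (2 / \<alpha> (tt \<alpha>)) * \<beta> (tt \<alpha>)"
  using ai[OF assms] hd_lin(2)[OF b tt(1)[OF a]] by (simp add: hh_def)
 then have "of_int (ai \<beta> \<alpha>) * \<alpha> (tt \<alpha>) = 2 * \<beta> (tt \<alpha>)" using root_norm[OF assms(1)] by simp
 then have "of_rat (of_int (ai \<beta> \<alpha>)) * kil (tv \<alpha>) (tv \<alpha>) = of_rat 2 * kil (tv \<beta>) (tv \<alpha>)"
  using tt a b by (simp add: tv_tt)
 then have "\<phi> (of_rat (of_int (ai \<beta> \<alpha>)) * kil (tv \<alpha>) (tv \<alpha>)) = \<phi> (of_rat 2 * kil (tv \<beta>) (tv \<alpha>))" by simp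
 then show ?thesis unfolding phi R_def .
qed

lemma refl_closed': assumes "\<alpha> \<in> roots" "\<beta> \<in> roots" shows "\<beta> - of_int (ai \<beta> \<alpha>) * \<alpha> \<in> roots"
proof -
 obtain l \<mu> where l: "supp \<alpha> l" "supp \<beta> \<mu>" using root_supp assms by metis
 have "supp (\<beta> - of_int (ai \<beta> \<alpha>) * \<alpha>) (\<mu> - of_int (ai \<beta> \<alpha>) * l)"
  by (rule supp_reflect[OF l(1) root_nz[OF assms(1)] l(2) ai[OF assms]])
 moreover have "\<beta> - of_int (ai \<beta> \<alpha>) * \<alpha> \<noteq> 0"
 proof
  assume z: "\<beta> - of_int (ai \<beta> \<alpha>) * \<alpha> = 0"
  then have "(\<beta> - of_int (ai \<beta> \<alpha>) * \<alpha>) (hh \<alpha>) = 0" by simp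
  then have "of_int (ai \<beta> \<alpha>) * (1 :: 'k) = 0" using ai[OF assms] root_hh[OF assms(1)] by (simp add: of_int_fun_apply)
  then have "ai \<beta> \<alpha> = 0" by simp
  then show False using z root_nz[OF assms(2)] by simp
 qed
 ultimately show ?thesis by (rule supp_root)
qed

lemma string': assumes "\<alpha> \<in> roots" "\<beta> \<in> roots" "0 < R \<beta> \<alpha>" shows "\<beta> = \<alpha> \<or> \<beta> - \<alpha> \<in> roots"
proof -
 obtain l \<mu> where l: "supp \<alpha> l" "supp \<beta> \<mu>" using root_supp assms by metis
 have "0 < R \<alpha> \<alpha>" using R_pos' gen_base assms root_nz by metis
 then have "0 < ai \<beta> \<alpha>" using a_R'[OF assms(1,2)] assms(3)
  by (metis of_int_0_less_iff zero_less_mult_pos2 mult_pos_pos zero_less_numeral)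
 then have "supp (\<beta> - \<alpha>) (\<mu> - l)"
  by (rule supp_string[OF l(1) root_nz[OF assms(1)] l(2) ai[OF assms(1,2)]])
 then show ?thesis using supp_root by (cases "\<beta> - \<alpha> = 0") auto
qed

lemma rt_zero_or_root: "x \<in> rt \<alpha> ==> \<alpha> \<in> hd' ==> x = 0 \<or> \<alpha> = 0 \<or> \<alpha> \<in> roots"
 by (auto simp: roots_def)

lemma rt_induct:
 assumes "\<And>\<alpha> x. \<alpha> \<in> hd' ==> x \<in> rt \<alpha> ==> P x" "\<And>x y. P x ==> P y ==> P (x + y)"
 shows "P x"
 by (rule G_induct[of P]) (use assms in \<open>auto simp: G_def\<close>)

text \<open>Orthogonal parts of the root system generate commuting ideals of \<open>\<g>\<close>.\<close>

lemma irreducible':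
 assumes A: "A \<subseteq> roots" "A \<noteq> {}" and orth: "\<And>x y. x \<in> A ==> y \<in> roots - A ==> R x y = 0"
 shows "A = roots"
proof (rule ccontr)
 assume "A \<noteq> roots"
 then obtain \<gamma>0 where g0: "\<gamma>0 \<in> roots - A" using A by blast
 have Rsym: "R x y = R y x" for x y by (simp add: R_def kil_sym)
 have Rp: "0 < R x x" if "x \<in> roots" for x using R_pos' gen_base that root_nz by metis
 have sumA: "\<beta> + \<beta>' \<in> A" if b: "\<beta> \<in> A" "\<beta>' \<in> A" "\<beta> + \<beta>' \<in> roots" for \<beta> \<beta>'
 proof (rule ccontr)
  assume n: "\<beta> + \<beta>' \<notin> A"
  have "R \<beta> (\<beta> + \<beta>') = 0" "R \<beta>' (\<beta> + \<beta>') = 0" using orth b n by blast+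
  then have "R (\<beta> + \<beta>') (\<beta> + \<beta>') = 0" by (simp add: R_add')
  then show False using Rp[OF b(3)] by simp
 qed
 \<comment> \<open>For orthogonal \<open>\<beta>\<close> and \<open>\<gamma>\<close> the sum pairs
   positively with both, so as a root it could belong neither to \<open>A\<close> nor to its
   complement.\<close>
 have mixed: "\<gamma> + \<beta> \<notin> roots \<and> \<gamma> + \<beta> \<noteq> 0" if b: "\<beta> \<in> A" "\<gamma> \<in> roots - A" for \<beta> \<gamma>
 proof -
  have o: "R \<beta> \<gamma> = 0" "R \<gamma> \<beta> = 0" using orth b Rsym by metis+
  have p: "0 < R (\<gamma> + \<beta>) \<beta>" "0 < R (\<gamma> + \<beta>) \<gamma>" using o Rp b A by (auto simp: R_add')
  have z: "R 0 \<beta> = 0" using R_add'[of 0 0 \<beta>] by simp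
  have "\<gamma> + \<beta> \<notin> roots"
  proof
   assume r: "\<gamma> + \<beta> \<in> roots"
   show False
   proof (cases "\<gamma> + \<beta> \<in> A")
    case True then show False using orth[of "\<gamma> + \<beta>" \<gamma>] b p by simp
   next
    case False then show False using orth[of \<beta> "\<gamma> + \<beta>"] r b p Rsym[of \<beta> "\<gamma> + \<beta>"] by simp
   qed
  qed
  moreover have "\<gamma> + \<beta> \<noteq> 0" using p z by auto
  ultimately show ?thesis by blast
 qed
 define S1 where "S1 = (\<Union>\<beta>\<in>A. rt \<beta>)"
 define S2 where "S2 = {br x y | x y. x \<in> S1 \<and> y \<in> S1}"
 let ?I = "span (S1 \<union> S2)"
 have I1: "x \<in> ?I" if "x \<in> S1" for x using that by (simp add: span_base)
 have I2: "br x y \<in> ?I" if "x \<in> S1" "y \<in> S1" for x y using that by (intro span_base) (auto simp: S2_def)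
 have mix0: "br z x = 0" if z: "z \<in> rt \<gamma>" "\<gamma> \<in> roots - A" and x: "x \<in> S1" for z x \<gamma>
 proof -
  obtain \<beta> where b: "\<beta> \<in> A" "x \<in> rt \<beta>" using x by (auto simp: S1_def)
  have "\<gamma> + \<beta> \<in> hd'" using b z A root_hd hd_add by blast
  then show ?thesis using rt_zero_or_root[OF rt_br[OF z(1) b(2)]] mixed[OF b(1) z(2)] by blast
 qed
 have AA: "br z x \<in> S1 \<or> (\<exists>w. br z x = w \<and> w \<in> rt 0)" if z: "z \<in> S1" and x: "x \<in> S1" for z x
 proof -
  obtain \<beta> \<gamma> where b: "\<beta> \<in> A" "x \<in> rt \<beta>" "\<gamma> \<in> A" "z \<in> rt \<gamma>" using x z by (auto simp: S1_def)
  have m: "br z x \<in> rt (\<gamma> + \<beta>)" using rt_br b by blast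
  have "\<gamma> + \<beta> \<in> hd'" using b A root_hd hd_add by blast
  from rt_zero_or_root[OF m this] show ?thesis
   using m sumA[OF b(3,1)] subspace_0[OF subspace_rt, of 0] by (auto simp: S1_def)
 qed
 have zero_S1: "br w x \<in> S1" if "w \<in> rt 0" "x \<in> S1" for w x
  using that rt_br[of w 0] by (auto simp: S1_def)
 have cl: "br z x \<in> ?I" if x: "x \<in> S1 \<union> S2" for z x
 proof (rule rt_induct[of "\<lambda>z. br z x \<in> ?I"])
  fix \<gamma> z assume g: "\<gamma> \<in> hd'" "z \<in> rt \<gamma>"
  have AI: "br (br p q) r \<in> ?I" if "p \<in> S1" "q \<in> S1" "r \<in> S1" for p q r
   using AA[OF that(1,2)] I2 that I1 zero_S1 by blast
  consider "z = 0" | "\<gamma> = 0" | "\<gamma> \<in> A" | "\<gamma> \<in> roots - A" using rt_zero_or_root[OF g(2,1)] by blast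
  then show "br z x \<in> ?I"
  proof cases
   case 1 then show ?thesis by (simp add: span_zero)
  next
   case 2
   from x show ?thesis
   proof
    assume "x \<in> S1" then show ?thesis using I1 zero_S1 g 2 by blast
   next
    assume "x \<in> S2"
    then obtain p q where pq: "x = br p q" "p \<in> S1" "q \<in> S1" by (auto simp: S2_def)
    show ?thesis unfolding pq(1) jacobi[of z p q]
     using zero_S1[of z p] zero_S1[of z q] g 2 pq I2 by (intro span_add) auto
   qed
  next
   case 3
   then have zS: "z \<in> S1" using g by (auto simp: S1_def)
   from x show ?thesis
   proof
    assume "x \<in> S1" then show ?thesis using I2 zS by blast
   next
    assume "x \<in> S2"
    then obtain p q where pq: "x = br p q" "p \<in> S1" "q \<in> S1" by (auto simp: S2_def)
    have "br p (br z q) = - br (br z q) p" by (rule br_anti)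
    then show ?thesis unfolding pq(1) jacobi[of z p q]
     using AI[OF zS pq(2,3)] AI[OF zS pq(3,2)] by (simp add: span_diff)
   qed
  next
   case 4
   from x show ?thesis
   proof
    assume "x \<in> S1" then show ?thesis using mix0[OF g(2) 4] by (simp add: span_zero)
   next
    assume "x \<in> S2"
    then obtain p q where pq: "x = br p q" "p \<in> S1" "q \<in> S1" by (auto simp: S2_def)
    show ?thesis unfolding pq(1) jacobi[of z p q]
     using mix0[OF g(2) 4 pq(2)] mix0[OF g(2) 4 pq(3)] by (simp add: span_zero)
   qed
  qed
 qed (simp add: br_add_left span_add)
 have "?I = {0} \<or> ?I = UNIV"
 proof (rule ideals)
  fix x y assume "y \<in> ?I"
  then show "br x y \<in> ?I" using lin_span_image[OF lin_br cl subspace_span] by blast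
 qed simp
 moreover have "?I \<noteq> {0}"
 proof -
  obtain \<beta> where "\<beta> \<in> A" using A by blast
  then obtain x where "x \<in> S1" "x \<noteq> 0"
   using A(1) subspace_0[OF subspace_rt] unfolding S1_def roots_def by blast
  then show ?thesis using I1 by blast
 qed
 ultimately have I: "?I = UNIV" by blast
 obtain w where w: "w \<in> rt \<gamma>0" "w \<noteq> 0" using g0 subspace_0[OF subspace_rt] by (auto simp: roots_def)
 have "w = 0"
 proof (rule center_zero)
  fix y
  have "br w x \<in> {0}" if "x \<in> S1 \<union> S2" for x
   using that
  proof
   assume "x \<in> S2"
   then obtain p q where pq: "x = br p q" "p \<in> S1" "q \<in> S1" by (auto simp: S2_def)
   show ?thesis unfolding pq(1) jacobi[of w p q]
    using mix0[OF w(1) g0 pq(2)] mix0[OF w(1) g0 pq(3)] by simp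
  qed (use mix0[OF w(1) g0] in simp)
  moreover have "y \<in> ?I" unfolding I by (rule UNIV_I)
  ultimately have "br w y \<in> {0}" by (rule lin_span_image[OF lin_br _ subspace_single_0])
  then show "br w y = 0" by simp
 qed
 then show False using w by simp
qed

sublocale rs: rootsys roots R ai
proof
 show "finite roots" by (rule finite_roots)
 show "0 \<notin> roots" by (simp add: roots_def)
 show "R x y = R y x" for x y by (simp add: R_def kil_sym)
qed (fact R_add' R_pos' a_R' refl_closed' string' irreducible')+

abbreviation Pi where "Pi \<equiv> rs.base"

definition lam :: "('a \<Rightarrow> 'k) \<Rightarrow> nat \<Rightarrow> int" where
 "lam \<alpha> = (SOME l. l \<in> Zn n \<and> supp \<alpha> l)"

lemma lam: "\<alpha> \<in> roots ==> lam \<alpha> \<in> Zn n" "\<alpha> \<in> roots ==> supp \<alpha> (lam \<alpha>)"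
proof -
 assume "\<alpha> \<in> roots"
 then have "\<exists>l. l \<in> Zn n \<and> supp \<alpha> l" using root_supp by blast
 from someI_ex[OF this] show "lam \<alpha> \<in> Zn n" "supp \<alpha> (lam \<alpha>)" unfolding lam_def by blast+
qed

definition sh :: "('a \<Rightarrow> 'k) \<Rightarrow> nat \<Rightarrow> int" where
 "sh q = (\<Sum>\<alpha>\<in>Pi. of_int (rs.coord q \<alpha>) * lam \<alpha>)"

lemma sh_Zn: "sh q \<in> Zn n"
 unfolding sh_def by (intro Zn_sum Zn_of_int lam rs.Pi_D)

lemma sh_diff: "x \<in> rs.Q ==> y \<in> rs.Q ==> sh (x - y) = sh x - sh y"
proof -
 assume xy: "x \<in> rs.Q" "y \<in> rs.Q"
 have "sh (x - y) = (\<Sum>\<alpha>\<in>Pi. of_int (rs.coord x \<alpha>) * lam \<alpha> - of_int (rs.coord y \<alpha>) * lam \<alpha>)"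
  unfolding sh_def by (intro sum.cong refl) (simp only: rs.coord_diff[OF xy] of_int_diff left_diff_distrib)
 then show ?thesis by (simp only: sum_subtractf sh_def)
qed

lemma sh_zero: "sh 0 = 0"
 using sh_diff[OF gen_zero gen_zero] by simp

lemma sh_neg: "x \<in> rs.Q ==> sh (- x) = - sh x"
 using sh_diff[OF gen_zero, of x] sh_zero by simp

lemma sh_add: "x \<in> rs.Q ==> y \<in> rs.Q ==> sh (x + y) = sh x + sh y"
 using sh_diff[OF _ gen_subgroup_neg, of x y] sh_neg[of y] by simp

lemma sh_of_int: "x \<in> rs.Q ==> sh (of_int k * x) = of_int k * sh x"
proof -
 assume x: "x \<in> rs.Q"
 have n: "sh (of_nat j * x) = of_nat j * sh x" for j
 proof (induction j)
  case (Suc j)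
  have "sh (of_nat (Suc j) * x) = sh (x + of_nat j * x)" by (simp only: of_nat_Suc distrib_right mult_1_left)
  also have "\<dots> = sh x + of_nat j * sh x" by (simp only: sh_add[OF x gen_subgroup_of_nat[OF x]] Suc)
  also have "\<dots> = of_nat (Suc j) * sh x" by (simp only: of_nat_Suc distrib_right mult_1_left)
  finally show ?case .
 qed (simp only: sh_zero of_nat_0 mult_zero_left)
 show ?thesis
  by (cases k rule: int_cases2) (use n sh_neg[OF gen_subgroup_of_nat[OF x]] in simp_all)
qed

lemma sh_Pi: "\<alpha> \<in> Pi ==> sh \<alpha> = lam \<alpha>"
proof -
 assume a: "\<alpha> \<in> Pi"
 have "sh \<alpha> = (\<Sum>\<beta>\<in>Pi. if \<beta> = \<alpha> then lam \<alpha> else 0)"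
  unfolding sh_def by (intro sum.cong refl) (simp add: rs.coord_Pi[OF a])
 then show ?thesis using a rs.fin_Pi by simp
qed

definition D0 :: "('a \<Rightarrow> 'k) set" where "D0 = {\<alpha>\<in>roots. supp \<alpha> (sh \<alpha>)}"

sublocale sr: subrootsys roots R ai D0
proof
 show "D0 \<subseteq> roots" by (auto simp: D0_def)
 show "Pi \<subseteq> D0" using rs.Pi_D lam sh_Pi by (auto simp: D0_def)
 show "\<beta> - of_int (ai \<beta> \<alpha>) * \<alpha> \<in> D0" if "\<alpha> \<in> D0" "\<beta> \<in> D0" for \<alpha> \<beta>
 proof -
  have r: "\<alpha> \<in> roots" "\<beta> \<in> roots" "supp \<alpha> (sh \<alpha>)" "supp \<beta> (sh \<beta>)" using that by (auto simp: D0_def)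
  have "supp (\<beta> - of_int (ai \<beta> \<alpha>) * \<alpha>) (sh \<beta> - of_int (ai \<beta> \<alpha>) * sh \<alpha>)"
   by (rule supp_reflect[OF r(3) root_nz[OF r(1)] r(4) ai[OF r(1,2)]])
  also have "sh \<beta> - of_int (ai \<beta> \<alpha>) * sh \<alpha> = sh (\<beta> - of_int (ai \<beta> \<alpha>) * \<alpha>)"
   using r by (simp add: sh_diff sh_of_int gen_base gen_subgroup_of_int)
  finally show ?thesis using rs.refl_closed[OF r(1,2)] unfolding D0_def by blast
 qed
 \<comment> \<open>Since \<open>sh\<close> is additive, \<open>\<alpha> + \<alpha>\<close> would
   occur in exactly twice the degree of \<open>\<alpha>\<close>, which \<open>G_double\<close>
   forbids.\<close>
 show "\<alpha> + \<alpha> \<notin> D0" if "\<alpha> \<in> D0" for \<alpha>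
  using that G_double[of \<alpha> "sh \<alpha>"] root_nz sh_add[OF gen_base gen_base, of \<alpha> \<alpha>] by (auto simp: D0_def)
qed

end

context mloop begin

subsection \<open>The twisted grading\<close>

text \<open>\<open>\<kappa>\<close> is the new degree and \<open>\<kappa> + sh \<mu>\<close> the old
  one.\<close>

definition Wt :: "(nat \<Rightarrow> int) \<Rightarrow> ('a \<Rightarrow> 'k) \<Rightarrow> 'a set" where
 "Wt \<kappa> \<mu> = G \<mu> (\<kappa> + sh \<mu>)"

definition W :: "(nat \<Rightarrow> int) \<Rightarrow> 'a set" where
 "W \<kappa> = span (\<Union>\<mu>\<in>insert 0 roots. Wt \<kappa> \<mu>)"

abbreviation wts :: "('a \<Rightarrow> 'k) set" where "wts \<equiv> insert 0 roots"

lemma fin_wts: "finite wts" using finite_roots by simp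

lemma wts_Q: "\<mu> \<in> wts ==> \<mu> \<in> rs.Q" by (metis gen_base gen_zero insertE)
lemma wts_hd: "\<mu> \<in> wts ==> \<mu> \<in> hd'" using Q_hd wts_Q by blast
lemma D0_roots: "\<alpha> \<in> D0 ==> \<alpha> \<in> roots" by (simp add: D0_def)
lemma roots_wts: "\<alpha> \<in> roots ==> \<alpha> \<in> wts" by simp
lemma root_Q: "\<alpha> \<in> roots ==> \<alpha> \<in> rs.Q" by (rule gen_base)

lemma subspace_Wt: "subspace (Wt \<kappa> \<mu>)" unfolding Wt_def by (rule subspace_G)

lemma Wt_rt: "x \<in> Wt \<kappa> \<mu> ==> x \<in> rt \<mu>" by (simp add: Wt_def G_def)

lemma Wt_W: "x \<in> Wt \<kappa> \<mu> ==> \<mu> \<in> wts ==> x \<in> W \<kappa>"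
 unfolding W_def by (rule span_base) blast

lemma subspace_W: "subspace (W \<kappa>)" by (simp add: W_def)

lemma Wt_br: "x \<in> Wt \<kappa> \<alpha> ==> y \<in> Wt \<kappa>' \<beta> ==> \<alpha> \<in> rs.Q ==> \<beta> \<in> rs.Q ==> br x y \<in> Wt (\<kappa> + \<kappa>') (\<alpha> + \<beta>)"
proof -
 assume a: "x \<in> Wt \<kappa> \<alpha>" "y \<in> Wt \<kappa>' \<beta>" "\<alpha> \<in> rs.Q" "\<beta> \<in> rs.Q"
 have "br x y \<in> G (\<alpha> + \<beta>) ((\<kappa> + sh \<alpha>) + (\<kappa>' + sh \<beta>))" using G_br a unfolding Wt_def by blast
 also have "(\<kappa> + sh \<alpha>) + (\<kappa>' + sh \<beta>) = (\<kappa> + \<kappa>') + sh (\<alpha> + \<beta>)" by (simp only: sh_add[OF a(3,4)] add_ac)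
 finally show ?thesis unfolding Wt_def .
qed

lemma Wt_zero: "x \<in> Wt \<kappa> \<mu> ==> \<mu> \<in> rs.Q ==> \<mu> \<notin> wts ==> x = 0"
 using rt_zero_or_root[OF Wt_rt] Q_hd by blast

lemma Wt_br_W: "x \<in> Wt \<kappa> \<alpha> ==> y \<in> Wt \<kappa>' \<beta> ==> \<alpha> \<in> rs.Q ==> \<beta> \<in> rs.Q ==> br x y \<in> W (\<kappa> + \<kappa>')"
proof -
 assume a: "x \<in> Wt \<kappa> \<alpha>" "y \<in> Wt \<kappa>' \<beta>" "\<alpha> \<in> rs.Q" "\<beta> \<in> rs.Q"
 have m: "br x y \<in> Wt (\<kappa> + \<kappa>') (\<alpha> + \<beta>)" by (rule Wt_br[OF a])
 show ?thesis
 proof (cases "\<alpha> + \<beta> \<in> wts")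
  case True then show ?thesis using Wt_W m by blast
 next
  case False
  then have "br x y = 0" using Wt_zero[OF m gen_subgroup_add] a by blast
  then show ?thesis by (simp add: subspace_0[OF subspace_W])
 qed
qed

lemma W_br: assumes "x \<in> W \<kappa>" "y \<in> W \<kappa>'" shows "br x y \<in> W (\<kappa> + \<kappa>')"
 using assms(1) unfolding W_def[of \<kappa>]
proof (induction rule: span_induct_alt)
 case base then show ?case by (simp add: subspace_0[OF subspace_W])
next
 case (step c u v)
 then obtain \<mu> where u: "\<mu> \<in> wts" "u \<in> Wt \<kappa> \<mu>" by blast
 have "br u y \<in> W (\<kappa> + \<kappa>')"
  by (rule lin_span_image[OF lin_br _ subspace_W assms(2)[unfolded W_def]])
   (use Wt_br_W u wts_Q in blast)
 then show ?case unfolding br_add_left br_scale_left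
  by (intro subspace_add[OF subspace_W] subspace_scale[OF subspace_W] step.IH)
qed

lemma W_cases:
 assumes "x \<in> W \<kappa>"
 obtains u where "\<And>\<mu>. \<mu> \<in> wts ==> u \<mu> \<in> Wt \<kappa> \<mu>" "x = (\<Sum>\<mu>\<in>wts. u \<mu>)"
proof -
 have "\<exists>I. finite I \<and> I \<subseteq> wts \<and> x \<in> ssum I (Wt \<kappa>)"
  by (rule span_UN_ssum) (use assms subspace_Wt in \<open>auto simp: W_def\<close>)
 then obtain I where I: "I \<subseteq> wts" "x \<in> ssum I (Wt \<kappa>)" by blast
 have "x \<in> ssum wts (Wt \<kappa>)" by (rule ssum_mono[OF subspace_Wt I(2,1) fin_wts])
 then show ?thesis unfolding ssum_def using that by blast
qed

lemma wt_comp: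
 assumes M: "subspace M" "\<And>h v. h \<in> H ==> v \<in> M ==> br h v \<in> M"
  and u: "\<And>\<mu>. \<mu> \<in> wts ==> u \<mu> \<in> rt \<mu>" "(\<Sum>\<mu>\<in>wts. u \<mu>) \<in> M" "\<mu> \<in> wts"
 shows "u \<mu> \<in> M"
 by (rule rt_independent[OF fin_wts _ u(1) M u(2,3)]) (use wts_hd in auto)

lemma Wt_0_0: "Wt 0 0 = H" by (simp add: Wt_def sh_zero G_0)

lemma Wt_lambda_0: "Wt \<kappa> 0 = G 0 \<kappa>" by (simp add: Wt_def sh_zero)

lemma H_W0: "h \<in> H ==> h \<in> W 0" using Wt_W[of h 0 0] Wt_0_0 by simp

text \<open>Chosen as a pair, because the two root vectors must satisfy the sl2 relations with each
  other.\<close>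

definition ef :: "('a \<Rightarrow> 'k) \<Rightarrow> 'a \<times> 'a" where
 "ef \<alpha> = (SOME p. fst p \<in> G \<alpha> (sh \<alpha>) \<and> snd p \<in> G (- \<alpha>) (- sh \<alpha>) \<and> sl2 (fst p) (snd p) (hh \<alpha>))"
definition e :: "('a \<Rightarrow> 'k) \<Rightarrow> 'a" where "e \<alpha> = fst (ef \<alpha>)"
definition f :: "('a \<Rightarrow> 'k) \<Rightarrow> 'a" where "f \<alpha> = snd (ef \<alpha>)"

lemma ef: assumes "\<alpha> \<in> D0"
 shows "e \<alpha> \<in> G \<alpha> (sh \<alpha>)" "f \<alpha> \<in> G (- \<alpha>) (- sh \<alpha>)" "sl2 (e \<alpha>) (f \<alpha>) (hh \<alpha>)"
proof -
 have "supp \<alpha> (sh \<alpha>)" "\<alpha> \<noteq> 0" using assms root_nz by (auto simp: D0_def)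
 then obtain x y where "x \<in> G \<alpha> (sh \<alpha>)" "y \<in> G (- \<alpha>) (- sh \<alpha>)" "sl2 x y (hh \<alpha>)" using supp_sl2 by metis
 then have "\<exists>p. fst p \<in> G \<alpha> (sh \<alpha>) \<and> snd p \<in> G (- \<alpha>) (- sh \<alpha>) \<and> sl2 (fst p) (snd p) (hh \<alpha>)"
  by (intro exI[of _ "(x, y)"]) simp
 from someI_ex[OF this] show "e \<alpha> \<in> G \<alpha> (sh \<alpha>)" "f \<alpha> \<in> G (- \<alpha>) (- sh \<alpha>)" "sl2 (e \<alpha>) (f \<alpha>) (hh \<alpha>)"
  unfolding e_def f_def ef_def by blast+
qed

lemma hh_nz: "\<alpha> \<in> roots ==> hh \<alpha> \<noteq> 0"
proof
 assume a: "\<alpha> \<in> roots" "hh \<alpha> = 0"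
 have "\<alpha> (0 *s 0) = 0 * \<alpha> 0" by (rule hd_lin(2)[OF root_hd[OF a(1)] subspace_0[OF subspace_H]])
 then show False using root_hh[OF a(1)] a(2) by simp
qed

lemma ef_nz: "\<alpha> \<in> D0 ==> e \<alpha> \<noteq> 0" "\<alpha> \<in> D0 ==> f \<alpha> \<noteq> 0"
 using ef(3)[of \<alpha>] hh_nz[OF D0_roots, of \<alpha>] by (auto simp: sl2_def)

lemma e_Wt: "\<alpha> \<in> D0 ==> e \<alpha> \<in> Wt 0 \<alpha>"
 using ef(1) by (simp add: Wt_def)

lemma f_Wt: "\<alpha> \<in> D0 ==> f \<alpha> \<in> Wt 0 (- \<alpha>)"
 using ef(2)[of \<alpha>] sh_neg[OF root_Q[OF D0_roots], of \<alpha>] by (simp add: Wt_def)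

lemma e_act: "\<alpha> \<in> D0 ==> x \<in> Wt \<kappa> \<mu> ==> \<mu> \<in> wts ==> br (e \<alpha>) x \<in> Wt \<kappa> (\<mu> + \<alpha>)"
 using Wt_br[OF e_Wt _ root_Q[OF D0_roots] wts_Q, of \<alpha> x \<kappa> \<mu>] by (simp add: add.commute)

lemma f_act: "\<alpha> \<in> D0 ==> x \<in> Wt \<kappa> \<mu> ==> \<mu> \<in> wts ==> br (f \<alpha>) x \<in> Wt \<kappa> (\<mu> - \<alpha>)"
 using Wt_br[OF f_Wt _ gen_subgroup_neg[OF root_Q[OF D0_roots]] wts_Q, of \<alpha> x \<kappa> \<mu>] by simp

lemma neg_D0: "\<alpha> \<in> D0 ==> - \<alpha> \<in> wts" using D0_roots rs.D_neg by blast

lemma e_W0: "\<alpha> \<in> D0 ==> e \<alpha> \<in> W 0" and f_W0: "\<alpha> \<in> D0 ==> f \<alpha> \<in> W 0"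
 using Wt_W e_Wt f_Wt D0_roots neg_D0 by blast+

lemma Wt_one_dim: "x \<in> Wt \<kappa> \<mu> ==> x \<noteq> 0 ==> \<mu> \<in> roots ==> w \<in> Wt \<kappa> \<mu> ==> \<exists>c. w = c *s x"
 unfolding Wt_def using G_one_dim root_hd root_nz by metis

lemma hh_weight: "\<alpha> \<in> D0 ==> \<mu> \<in> roots ==> x \<in> Wt \<kappa> \<mu> ==> br (hh \<alpha>) x = of_int (ai \<mu> \<alpha>) *s x"
 using G_weight[of x \<mu> "\<kappa> + sh \<mu>" \<alpha>] root_hd D0_roots ai by (simp add: Wt_def)

lemma f_inj: "\<alpha> \<in> D0 ==> \<mu> \<in> roots ==> x \<in> Wt \<kappa> \<mu> ==> 0 < R \<mu> \<alpha> ==> br (f \<alpha>) x = 0 ==> x = 0"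
 using sl2_f_inj[OF ef(3) hh_weight] rs.a_pos D0_roots by blast

lemma ef_inj: "\<alpha> \<in> D0 ==> \<mu> \<in> roots ==> x \<in> Wt \<kappa> \<mu> ==> 0 < R \<mu> \<alpha> ==> br (e \<alpha>) (br (f \<alpha>) x) = 0 ==> x = 0"
 using sl2_ef_inj[OF ef(3) hh_weight] rs.a_pos D0_roots by blast

lemma fe_inj: assumes "\<alpha> \<in> D0" "\<mu> \<in> roots" "x \<in> Wt \<kappa> \<mu>" "R \<mu> \<alpha> < 0" "br (f \<alpha>) (br (e \<alpha>) x) = 0" shows "x = 0"
proof (rule sl2_ef_inj[OF sl2_swap[OF ef(3)[OF assms(1)]] _ _ assms(5)])
 show "br (- hh \<alpha>) x = of_int (- ai \<mu> \<alpha>) *s x" using hh_weight[OF assms(1-3)] by (simp add: br_neg_left)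
 have "of_int (ai \<mu> \<alpha>) * R \<alpha> \<alpha> < 0" using a_R'[OF D0_roots assms(2)] assms by simp
 then show "0 < - ai \<mu> \<alpha>" using rs.D_pos[OF D0_roots[OF assms(1)]] by (simp add: mult_less_0_iff)
qed

lemma Pi_D0: "\<alpha> \<in> Pi ==> \<alpha> \<in> D0" using sr.Pi_D0 by blast

lemma supp_Wt0: "\<mu> \<in> roots ==> x \<in> Wt 0 \<mu> ==> x \<noteq> 0 ==> \<mu> \<in> D0"
 using suppI[OF root_hd, of \<mu> x "sh \<mu>"] by (simp add: Wt_def D0_def)

text \<open>Descend from \<open>\<beta>\<close> to \<open>\<beta> - \<alpha>\<close> for a simple
  \<open>\<alpha>\<close> that pairs positively with \<open>\<beta>\<close>. For non-zero
  \<open>x\<close> in \<open>Wt 0 \<beta>\<close> the vector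
  \<open>e \<alpha> (f \<alpha> x)\<close> is non-zero and so spans this line, while
  \<open>f \<alpha> x\<close> lies in \<open>N\<close> by induction. Negative roots are treated
  symmetrically.\<close>

lemma generators:
 assumes N: "subspace N" "\<And>x y. x \<in> N ==> y \<in> N ==> br x y \<in> N"
  and HN: "\<And>h. h \<in> H ==> h \<in> N" and efN: "\<And>\<alpha>. \<alpha> \<in> Pi ==> e \<alpha> \<in> N" "\<And>\<alpha>. \<alpha> \<in> Pi ==> f \<alpha> \<in> N"
 shows "W 0 \<subseteq> N"
proof -
 have pos: "Wt 0 \<beta> \<subseteq> N \<and> Wt 0 (- \<beta>) \<subseteq> N" if "\<beta> \<in> rs.pos" for \<beta>
  using that
 proof (induction \<beta> rule: rs.pos_induct)
  case (step \<beta>)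
  have bR: "\<beta> \<in> roots" "- \<beta> \<in> roots" using rs.pos_D[OF step(1)] rs.D_neg by blast+
  obtain \<alpha> where al: "\<alpha> \<in> Pi" "0 < R \<beta> \<alpha>" using rs.pos_descent[OF step(1)] by blast
  note a0 = Pi_D0[OF al(1)]
  have an: "- \<alpha> \<in> roots" using rs.D_neg[OF D0_roots[OF a0]] .
  show ?case
  proof (cases "\<beta> = \<alpha>")
   case True
   have "x \<in> N" if "x \<in> Wt 0 \<alpha>" for x
    using Wt_one_dim[OF e_Wt[OF a0] ef_nz(1)[OF a0] D0_roots[OF a0] that] efN(1)[OF al(1)] subspace_scale[OF N(1)] by blast
   moreover have "x \<in> N" if "x \<in> Wt 0 (- \<alpha>)" for x
    using Wt_one_dim[OF f_Wt[OF a0] ef_nz(2)[OF a0] an that] efN(2)[OF al(1)] subspace_scale[OF N(1)] by blast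
   ultimately show ?thesis unfolding True by blast
  next
   case False
   have d: "\<beta> - \<alpha> \<in> roots" using string'[OF D0_roots[OF a0] bR(1) al(2)] False by blast
   have dp: "\<beta> - \<alpha> \<in> rs.pos"
   proof (rule ccontr)
    assume "\<beta> - \<alpha> \<notin> rs.pos"
    then have "- (\<beta> - \<alpha>) \<in> rs.pos" using rs.pos_or_neg[OF d] by blast
    then have "\<alpha> - \<beta> \<in> rs.pos" by (simp only: minus_diff_eq)
    moreover have "\<alpha> = (\<alpha> - \<beta>) + \<beta>" by (simp only: diff_add_cancel)
    ultimately show False using al(1) step(1) unfolding rs.base_def by blast
   qed
   have lt: "rs.\<rho> (\<beta> - \<alpha>) < rs.\<rho> \<beta>" using rs.Pi_pos[OF al(1)] by (simp only: rs.rho_lin rs.pos_def) simp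
   have IH: "Wt 0 (\<beta> - \<alpha>) \<subseteq> N" "Wt 0 (- (\<beta> - \<alpha>)) \<subseteq> N" using step(2)[OF dp lt] by blast+
   have "x \<in> N" if x: "x \<in> Wt 0 \<beta>" "x \<noteq> 0" for x
   proof -
    have fx: "br (f \<alpha>) x \<in> Wt 0 (\<beta> - \<alpha>)" by (rule f_act[OF a0 x(1) roots_wts[OF bR(1)]])
    have "br (e \<alpha>) (br (f \<alpha>) x) \<in> Wt 0 (\<beta> - \<alpha> + \<alpha>)" by (rule e_act[OF a0 fx roots_wts[OF d]])
    then have y: "br (e \<alpha>) (br (f \<alpha>) x) \<in> Wt 0 \<beta>" by (simp only: diff_add_cancel)
    have "br (e \<alpha>) (br (f \<alpha>) x) \<noteq> 0" using ef_inj[OF a0 bR(1) x(1) al(2)] x(2) by blast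
    then obtain c where c: "x = c *s br (e \<alpha>) (br (f \<alpha>) x)" using Wt_one_dim[OF y _ bR(1) x(1)] by blast
    have "br (e \<alpha>) (br (f \<alpha>) x) \<in> N" using IH(1) fx efN(1)[OF al(1)] N(2) by blast
    then show ?thesis using c subspace_scale[OF N(1)] by metis
   qed
   moreover have "x \<in> N" if x: "x \<in> Wt 0 (- \<beta>)" "x \<noteq> 0" for x
   proof -
    have "br (e \<alpha>) x \<in> Wt 0 (- \<beta> + \<alpha>)" by (rule e_act[OF a0 x(1) roots_wts[OF bR(2)]])
    then have fx: "br (e \<alpha>) x \<in> Wt 0 (- (\<beta> - \<alpha>))" by (simp only: minus_diff_eq) (simp only: uminus_add_conv_diff)
    have "br (f \<alpha>) (br (e \<alpha>) x) \<in> Wt 0 (- (\<beta> - \<alpha>) - \<alpha>)" by (rule f_act[OF a0 fx roots_wts[OF rs.D_neg[OF d]]])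
    then have y: "br (f \<alpha>) (br (e \<alpha>) x) \<in> Wt 0 (- \<beta>)" by (simp only: minus_diff_eq) simp
    have "R (- \<beta>) \<alpha> < 0" using al(2) rs.R_neg[of \<beta> \<alpha>] by simp
    then have "br (f \<alpha>) (br (e \<alpha>) x) \<noteq> 0" using fe_inj[OF a0 bR(2) x(1)] x(2) by blast
    then obtain c where c: "x = c *s br (f \<alpha>) (br (e \<alpha>) x)" using Wt_one_dim[OF y _ bR(2) x(1)] by blast
    have "br (f \<alpha>) (br (e \<alpha>) x) \<in> N" using IH(2) fx efN(2)[OF al(1)] N(2) by blast
    then show ?thesis using c subspace_scale[OF N(1)] by metis
   qed
   ultimately show ?thesis using subspace_0[OF N(1)] by blast
  qed
 qed
 have "Wt 0 \<mu> \<subseteq> N" if "\<mu> \<in> wts" for \<mu>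
 proof (cases "\<mu> = 0")
  case True then show ?thesis using HN Wt_0_0 by auto
 next
  case False
  then have r: "\<mu> \<in> roots" using that by blast
  from rs.pos_or_neg[OF r] show ?thesis
  proof
   assume "\<mu> \<in> rs.pos" then show ?thesis using pos by blast
  next
   assume "- \<mu> \<in> rs.pos"
   then have "Wt 0 (- (- \<mu>)) \<subseteq> N" using pos by blast
   then show ?thesis by (simp only: minus_minus)
  qed
 qed
 then show ?thesis unfolding W_def by (intro span_minimal N) blast
qed

text \<open>The elements that map \<open>M\<close> into \<open>M'\<close> form a subalgebra because
  \<open>M'\<close> is contained in \<open>M\<close>. A separate target allows
  \<open>M' = {0}\<close> in \<open>UU_trivial\<close>; for \<open>VV_stable\<close> both are
  equal.\<close>

lemma stable_generators:
 assumes M: "subspace M" "\<And>h v. h \<in> H ==> v \<in> M ==> br h v \<in> M'" "subspace M'" "M' \<subseteq> M"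
  "\<And>\<alpha> v. \<alpha> \<in> Pi ==> v \<in> M ==> br (e \<alpha>) v \<in> M'" "\<And>\<alpha> v. \<alpha> \<in> Pi ==> v \<in> M ==> br (f \<alpha>) v \<in> M'"
  and x: "x \<in> W 0" "v \<in> M"
 shows "br x v \<in> M'"
proof -
 let ?N = "{x. \<forall>v\<in>M. br x v \<in> M'}"
 have "W 0 \<subseteq> ?N"
 proof (rule generators)
  show "subspace ?N" using M(3) by (auto intro!: subspaceI simp: br_add_left br_scale_left subspace_0 subspace_add subspace_scale)
  show "br x y \<in> ?N" if "x \<in> ?N" "y \<in> ?N" for x y
   using that M(3,4) by (auto simp: br_br_left intro!: subspace_diff)
 qed (use M in auto)
 then show ?thesis using x by blast
qed

text \<open>The invariants of \<open>W 0\<close> in degree \<open>\<kappa>\<close>, encoded as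
  highest weight vectors of weight zero; \<open>UU_trivial\<close> shows that they are
  invariant.\<close>

definition UU :: "(nat \<Rightarrow> int) \<Rightarrow> 'a set" where
 "UU \<kappa> = {w\<in>G 0 \<kappa>. \<forall>\<alpha>\<in>Pi. br (e \<alpha>) w = 0}"
text \<open>The zero weight space of \<open>VV \<kappa>\<close>.\<close>

definition V0 :: "(nat \<Rightarrow> int) \<Rightarrow> 'a set" where
 "V0 \<kappa> = span {br (f \<alpha>) w | \<alpha> w. \<alpha> \<in> Pi \<and> w \<in> Wt \<kappa> \<alpha>}"
definition VV :: "(nat \<Rightarrow> int) \<Rightarrow> 'a set" where
 "VV \<kappa> = span (V0 \<kappa> \<union> (\<Union>\<mu>\<in>roots. Wt \<kappa> \<mu>))"

lemma subspace_UU: "subspace (UU \<kappa>)"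
 unfolding UU_def using subspace_G[of 0 \<kappa>]
 by (auto intro!: subspaceI simp: br_add_right br_scale_right subspace_0 subspace_add subspace_scale)

lemma G0_H: "w \<in> G 0 \<kappa> ==> h \<in> H ==> br h w = 0"
 by (simp add: G_def rt_iff)

text \<open>A vector of weight zero killed by \<open>e \<alpha>\<close> has highest weight
  \<open>0\<close> for the triple of \<open>\<alpha>\<close>, hence is killed by
  \<open>f \<alpha>\<close> too.\<close>

lemma UU_trivial: assumes x: "x \<in> W 0" "w \<in> UU \<kappa>" shows "br x w = 0"
proof -
 have "br x w \<in> {0}"
 proof (rule stable_generators[OF subspace_UU _ subspace_single_0 _ _ _ x])
  show "br (f \<alpha>) v \<in> {0}" if a: "\<alpha> \<in> Pi" "v \<in> UU \<kappa>" for \<alpha> v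
  proof (cases "v = 0")
   case False
   note a0 = Pi_D0[OF a(1)]
   have v: "v \<in> G 0 \<kappa>" "br (e \<alpha>) v = 0" using a by (auto simp: UU_def)
   have "br (hh \<alpha>) v = 0 *s v" using G0_H[OF v(1) hh_H[OF root_hd[OF D0_roots[OF a0]]]] by simp
   then obtain p where p: "(0::'k) = of_nat p" "br (f \<alpha>) ((br (f \<alpha>) ^^ p) v) = 0"
    using sl2_highest[OF ef(3)[OF a0] _ v(2) False] by blast
   then show ?thesis by simp
  qed simp
 qed (use G0_H subspace_0[OF subspace_UU] in \<open>auto simp: UU_def\<close>)
 then show ?thesis by simp
qed

lemma V0_G: "V0 \<kappa> \<subseteq> G 0 \<kappa>"
 unfolding V0_def
proof (rule span_minimal[OF _ subspace_G], safe)
 fix \<alpha> w assume a: "\<alpha> \<in> Pi" "w \<in> Wt \<kappa> \<alpha>"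
 have "br (f \<alpha>) w \<in> Wt \<kappa> (\<alpha> - \<alpha>)"
  using f_act[OF Pi_D0[OF a(1)] a(2)] D0_roots[OF Pi_D0[OF a(1)]] by blast
 then show "br (f \<alpha>) w \<in> G 0 \<kappa>" by (simp only: diff_self Wt_lambda_0)
qed

lemma V0_VV: "x \<in> V0 \<kappa> ==> x \<in> VV \<kappa>" and Wt_VV: "x \<in> Wt \<kappa> \<mu> ==> \<mu> \<in> roots ==> x \<in> VV \<kappa>"
 unfolding VV_def by (rule span_base, blast)+

lemma subspace_VV: "subspace (VV \<kappa>)" by (simp add: VV_def)

lemma VV_W: "VV \<kappa> \<subseteq> W \<kappa>"
 unfolding VV_def
proof (rule span_minimal[OF _ subspace_W], safe)
 fix x assume "x \<in> V0 \<kappa>"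
 then show "x \<in> W \<kappa>" using V0_G Wt_lambda_0 Wt_W[of x \<kappa> 0] by blast
qed (use Wt_W in blast)

text \<open>The delicate case is \<open>e \<alpha>\<close> on the weight \<open>- \<alpha>\<close>:
  the result must lie in \<open>V0 \<kappa>\<close>, which is defined through the lowering
  elements.\<close>

lemma VV_stable: assumes x: "x \<in> W 0" "v \<in> VV \<kappa>" shows "br x v \<in> VV \<kappa>"
proof (rule stable_generators[OF subspace_VV _ subspace_VV subset_refl _ _ x])
 have st: "br y v \<in> VV \<kappa>" if "v \<in> VV \<kappa>" "\<And>w. w \<in> V0 \<kappa> ==> br y w \<in> VV \<kappa>"
  "\<And>w \<mu>. \<mu> \<in> roots ==> w \<in> Wt \<kappa> \<mu> ==> br y w \<in> VV \<kappa>" for y v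
  by (rule lin_span_image[OF lin_br _ subspace_VV that(1)[unfolded VV_def]]) (use that(2,3) in blast)
 have z: "0 \<in> VV \<kappa>" by (rule subspace_0[OF subspace_VV])
 show "br h v \<in> VV \<kappa>" if h: "h \<in> H" and v: "v \<in> VV \<kappa>" for h v
 proof (rule st[OF v])
  show "br h w \<in> VV \<kappa>" if "w \<in> V0 \<kappa>" for w using that V0_G G0_H[OF _ h] z by force
  show "br h w \<in> VV \<kappa>" if "\<mu> \<in> roots" "w \<in> Wt \<kappa> \<mu>" for w \<mu>
   using Wt_rt[OF that(2)] h Wt_VV[OF that(2,1)] subspace_scale[OF subspace_VV] by (simp add: rt_iff)
 qed
 fix \<alpha> v assume al: "\<alpha> \<in> Pi" and v: "v \<in> VV \<kappa>"
 note a0 = Pi_D0[OF al] and ar = D0_roots[OF Pi_D0[OF al]]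
 have mem: "br y w \<in> VV \<kappa>" if "br y w \<in> Wt \<kappa> \<nu>" "\<nu> \<in> rs.Q" "\<nu> \<noteq> 0" for y w \<nu>
  using that Wt_VV Wt_zero[OF that(1,2)] z by (cases "\<nu> \<in> roots") auto
 show "br (f \<alpha>) v \<in> VV \<kappa>"
 proof (rule st[OF v])
  show "br (f \<alpha>) w \<in> VV \<kappa>" if "w \<in> V0 \<kappa>" for w
  proof -
   have "w \<in> Wt \<kappa> 0" using that V0_G by (auto simp: Wt_lambda_0)
   then have "br (f \<alpha>) w \<in> Wt \<kappa> (0 - \<alpha>)" by (rule f_act[OF a0]) simp
   then show ?thesis by (rule mem) (use gen_diff[OF gen_zero root_Q[OF ar]] root_nz[OF ar] in auto)
  qed
  show "br (f \<alpha>) w \<in> VV \<kappa>" if w: "\<mu> \<in> roots" "w \<in> Wt \<kappa> \<mu>" for w \<mu>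
  proof (cases "\<mu> = \<alpha>")
   case True
   have "br (f \<alpha>) w \<in> V0 \<kappa>" unfolding V0_def using w True al by (intro span_base) blast
   then show ?thesis by (rule V0_VV)
  next
   case False
   have "br (f \<alpha>) w \<in> Wt \<kappa> (\<mu> - \<alpha>)" by (rule f_act[OF a0 w(2)]) (use w in simp)
   then show ?thesis by (rule mem) (use gen_diff[OF root_Q root_Q] ar w False in auto)
  qed
 qed
 show "br (e \<alpha>) v \<in> VV \<kappa>"
 proof (rule st[OF v])
  show "br (e \<alpha>) w \<in> VV \<kappa>" if "w \<in> V0 \<kappa>" for w
  proof -
   have "w \<in> Wt \<kappa> 0" using that V0_G by (auto simp: Wt_lambda_0)
   then have "br (e \<alpha>) w \<in> Wt \<kappa> (0 + \<alpha>)" by (rule e_act[OF a0]) simp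
   then have "br (e \<alpha>) w \<in> Wt \<kappa> \<alpha>" by (simp only: add_0_left)
   then show ?thesis by (rule Wt_VV[OF _ ar])
  qed
  show "br (e \<alpha>) w \<in> VV \<kappa>" if w: "\<mu> \<in> roots" "w \<in> Wt \<kappa> \<mu>" for w \<mu>
  proof (cases "\<mu> + \<alpha> = 0")
   case False
   have "br (e \<alpha>) w \<in> Wt \<kappa> (\<mu> + \<alpha>)" by (rule e_act[OF a0 w(2)]) (use w in simp)
   then show ?thesis by (rule mem[OF _ gen_subgroup_add[OF root_Q[OF w(1)] root_Q[OF ar]] False])
  next
   case True
   then have mu: "\<mu> = - \<alpha>" by (simp only: eq_neg_iff_add_eq_0)
   show ?thesis
   proof (cases "w = 0")
    case True then show ?thesis using z by simp
   next
    case w0: False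
    \<comment> \<open>\<open>w\<close> is a multiple of \<open>f \<alpha> ?u\<close>, because its
      weight space is a line on which \<open>f \<alpha> e \<alpha>\<close> is injective. As
      \<open>?u\<close> has weight zero, \<open>e \<alpha>\<close> and \<open>f \<alpha>\<close>
      commute on it, which brings \<open>e \<alpha> w\<close> into
      \<open>V0 \<kappa>\<close>.\<close>
    let ?u = "br (e \<alpha>) w"
    have "?u \<in> Wt \<kappa> (\<mu> + \<alpha>)" by (rule e_act[OF a0 w(2)]) (use w in simp)
    then have u: "?u \<in> Wt \<kappa> 0" by (simp only: True)
    have fu: "br (f \<alpha>) ?u \<in> Wt \<kappa> (0 - \<alpha>)" by (rule f_act[OF a0 u]) simp
    then have fu: "br (f \<alpha>) ?u \<in> Wt \<kappa> \<mu>" by (simp only: mu diff_0)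
    have "R \<mu> \<alpha> < 0" using rs.D_pos[OF ar] rs.R_neg[of \<alpha> \<alpha>] by (simp add: mu)
    then have "br (f \<alpha>) ?u \<noteq> 0" using fe_inj[OF a0 w(1,2)] w0 by blast
    then obtain c where c: "w = c *s br (f \<alpha>) ?u" using Wt_one_dim[OF fu _ w] by blast
    have hu: "br (hh \<alpha>) ?u = 0" using u G0_H hh_H[OF root_hd[OF ar]] by (simp add: Wt_lambda_0)
    have "br (e \<alpha>) (br (f \<alpha>) ?u) = br (hh \<alpha>) ?u + br (f \<alpha>) (br (e \<alpha>) ?u)"
     using jacobi[of "e \<alpha>" "f \<alpha>" ?u] ef(3)[OF a0] by (simp only: sl2_def)
    then have r: "br (e \<alpha>) (br (f \<alpha>) ?u) = br (f \<alpha>) (br (e \<alpha>) ?u)" using hu by simp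
    have "br (e \<alpha>) ?u \<in> Wt \<kappa> (0 + \<alpha>)" by (rule e_act[OF a0 u]) simp
    then have "br (e \<alpha>) ?u \<in> Wt \<kappa> \<alpha>" by (simp only: add_0_left)
    then have "br (f \<alpha>) (br (e \<alpha>) ?u) \<in> V0 \<kappa>" unfolding V0_def using al by (intro span_base) blast
    then have m: "c *s br (e \<alpha>) (br (f \<alpha>) ?u) \<in> VV \<kappa>" unfolding r by (intro subspace_scale[OF subspace_VV] V0_VV)
    have "br (e \<alpha>) w = br (e \<alpha>) (c *s br (f \<alpha>) ?u)" by (rule arg_cong[OF c])
    then show ?thesis using m by (simp only: br_scale_right)
   qed
  qed
 qed
qed

lemma VV_cases:
 assumes "x \<in> VV \<kappa>"
 obtains u where "\<And>\<mu>. \<mu> \<in> wts ==> u \<mu> \<in> Wt \<kappa> \<mu>" "x = (\<Sum>\<mu>\<in>wts. u \<mu>)" "u 0 \<in> V0 \<kappa>"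
proof -
 have "x \<in> {y. \<exists>u. (\<forall>\<mu>\<in>wts. u \<mu> \<in> Wt \<kappa> \<mu>) \<and> y = (\<Sum>\<mu>\<in>wts. u \<mu>) \<and> u 0 \<in> V0 \<kappa>}" (is "_ \<in> ?S")
  using assms unfolding VV_def
 proof (induction rule: span_induct_alt)
  case base
  show ?case using subspace_0[OF subspace_Wt] by (intro CollectI exI[of _ "\<lambda>_. 0"]) (simp add: V0_def span_zero)
 next
  case (step c x y)
  from step.IH obtain u where u: "\<forall>\<mu>\<in>wts. u \<mu> \<in> Wt \<kappa> \<mu>" "y = (\<Sum>\<mu>\<in>wts. u \<mu>)" "u 0 \<in> V0 \<kappa>" by blast
  obtain \<nu> where nu: "\<nu> \<in> wts" "x \<in> Wt \<kappa> \<nu>" "\<nu> = 0 ==> x \<in> V0 \<kappa>"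
  proof (cases "x \<in> V0 \<kappa>")
   case True then show ?thesis using that[of 0] V0_G by (auto simp: Wt_lambda_0)
  next
   case False
   then obtain \<mu> where m: "\<mu> \<in> roots" "x \<in> Wt \<kappa> \<mu>" using step.hyps by blast
   show ?thesis by (rule that[of \<mu>]) (use m root_nz in auto)
  qed
  define v where "v = (\<lambda>\<mu>. u \<mu> + (if \<mu> = \<nu> then c *s x else 0))"
  have "c *s x + y = (\<Sum>\<mu>\<in>wts. v \<mu>)"
   unfolding v_def sum.distrib using u(2) nu(1) fin_wts by (simp only: sum.delta) simp
  moreover have "\<forall>\<mu>\<in>wts. v \<mu> \<in> Wt \<kappa> \<mu>"
   using u(1) nu subspace_Wt by (auto simp: v_def intro!: subspace_add subspace_scale subspace_0)
  moreover have "v 0 \<in> V0 \<kappa>"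
   using u(3) nu(3) by (auto simp: v_def V0_def intro!: span_add span_scale)
  ultimately show ?case by (intro CollectI exI[of _ v] conjI) (simp only: add.commute)
 qed
 then show ?thesis using that by blast
qed

end

lemma common_denominator:
 fixes q :: "'x \<Rightarrow> rat"
 assumes "finite X" shows "\<exists>N>0. \<exists>z. \<forall>x\<in>X. of_int N * q x = of_int (z x)"
 using assms
proof (induction X rule: finite_induct)
 case empty then show ?case by (intro exI[of _ 1]) simp
next
 case (insert y X)
 then obtain N z where N: "N > 0" "\<forall>x\<in>X. of_int N * q x = of_int (z x)" by blast
 obtain p d where pd: "quotient_of (q y) = (p, d)" by (cases "quotient_of (q y)")
 have d: "d > 0" "q y = of_int p / of_int d" using quotient_of_denom_pos[OF pd] quotient_of_div[OF pd] by auto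
 have "of_int (d * N) * q x = of_int (if x = y then N * p else d * z x)" if x: "x \<in> insert y X" for x
 proof (cases "x = y")
  case True then show ?thesis using d by simp
 next
  case False
  then have "of_int N * q x = of_int (z x)" using x N(2) by blast
  then show ?thesis using False by (simp add: mult.assoc)
 qed
 moreover have "d * N > 0" using d N by simp
 ultimately show ?case
  by (intro exI[of _ "d * N"] conjI exI[of _ "\<lambda>x. if x = y then N * p else d * z x"] ballI)
qed

context mloop begin

subsection \<open>The principal triple\<close>

lemma phi_0: "\<phi> 0 = 0" using phi_rat[of 0] by simp

lemma phi_sum: "\<phi> (sum g X) = (\<Sum>x\<in>X. \<phi> (g x))"
 by (induction X rule: infinite_finite_induct) (simp_all add: phi phi_0)

lemma kil_R: assumes "\<alpha> \<in> roots" "\<beta> \<in> roots" shows "kil (tt \<alpha>) (tt \<beta>) = of_rat (R \<alpha> \<beta>)"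
proof -
 note a = root_hd[OF assms(1)] and b = root_hd[OF assms(2)]
 obtain r where r: "\<beta> (tt \<alpha>) = of_rat r" using root_tt_rational[OF assms] by blast
 have "kil (tt \<beta>) (tt \<alpha>) = of_rat r" using tt[OF b] tt(1)[OF a] r by simp
 then have k: "kil (tt \<alpha>) (tt \<beta>) = of_rat r" by (simp add: kil_sym)
 then have "R \<alpha> \<beta> = r" unfolding R_def tv_tt[OF a] tv_tt[OF b] by (simp only: phi_rat)
 then show ?thesis using k by simp
qed

text \<open>Applying \<open>\<phi>\<close> to the relation divided by \<open>c \<alpha>\<close>
  gives a rational relation. Clearing denominators yields an integral combination of the base that
  is orthogonal to the base, hence zero, against \<open>Pi_independent\<close>.\<close>

lemma tt_Pi_independent:
 assumes z: "(\<Sum>\<alpha>\<in>Pi. c \<alpha> *s tt \<alpha>) = 0" and al: "\<alpha> \<in> Pi" shows "c \<alpha> = 0"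
proof (rule ccontr)
 assume c0: "c \<alpha> \<noteq> 0"
 define q where "q = (\<lambda>\<beta>. \<phi> (c \<beta> / c \<alpha>))"
 have qR: "(\<Sum>\<beta>\<in>Pi. q \<beta> * R \<beta> \<gamma>) = 0" if g: "\<gamma> \<in> Pi" for \<gamma>
 proof -
  have "0 = kil (\<Sum>\<alpha>\<in>Pi. c \<alpha> *s tt \<alpha>) (tt \<gamma>)" using z by simp
  also have "\<dots> = (\<Sum>\<beta>\<in>Pi. c \<beta> * of_rat (R \<beta> \<gamma>))"
   using g by (simp add: kil_sum_left kil_scale_left kil_R rs.Pi_D)
  finally have "(\<Sum>\<beta>\<in>Pi. c \<beta> * of_rat (R \<beta> \<gamma>)) / c \<alpha> = 0" by simp
  then have "(\<Sum>\<beta>\<in>Pi. of_rat (R \<beta> \<gamma>) * (c \<beta> / c \<alpha>)) = 0" by (simp add: sum_divide_distrib mult.commute)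
  then have "\<phi> (\<Sum>\<beta>\<in>Pi. of_rat (R \<beta> \<gamma>) * (c \<beta> / c \<alpha>)) = 0" using phi_0 by simp
  then show ?thesis by (simp only: phi_sum phi(2)) (simp add: q_def mult.commute)
 qed
 obtain N zz where N: "N > 0" "\<forall>\<beta>\<in>Pi. of_int N * q \<beta> = of_int (zz \<beta>)" using common_denominator[OF rs.fin_Pi, of q] by blast
 let ?x = "\<Sum>\<beta>\<in>Pi. of_int (zz \<beta>) * \<beta>"
 have "R ?x \<gamma> = 0" if g: "\<gamma> \<in> Pi" for \<gamma>
 proof -
  have "R ?x \<gamma> = (\<Sum>\<beta>\<in>Pi. of_int (zz \<beta>) * R \<beta> \<gamma>)" by (simp only: rs.R_sum rs.R_of_int)
  also have "\<dots> = (\<Sum>\<beta>\<in>Pi. of_int N * (q \<beta> * R \<beta> \<gamma>))"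
  proof (rule sum.cong[OF refl])
   fix \<beta> assume "\<beta> \<in> Pi"
   then have "of_int N * q \<beta> = of_int (zz \<beta>)" using N(2) by blast
   then show "of_int (zz \<beta>) * R \<beta> \<gamma> = of_int N * (q \<beta> * R \<beta> \<gamma>)" by (metis mult.assoc)
  qed
  also have "\<dots> = 0" using qR[OF g] by (simp flip: sum_distrib_left)
  finally show ?thesis .
 qed
 then have "R ?x ?x = 0" by (subst rs.R_sum2) (simp add: rs.R_of_int2)
 moreover have "?x \<in> rs.Q" by (intro gen_subgroup_sum gen_subgroup_of_int root_Q rs.Pi_D)
 ultimately have "?x = 0" using rs.R_eq0[of ?x] by (simp only: order_refl)
 then have "zz \<alpha> = 0" by (rule rs.Pi_independent[OF _ al])
 moreover have "of_int N * q \<alpha> = of_int (zz \<alpha>)" using N(2) al by blast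
 moreover have "q \<alpha> = 1" using c0 phi(3) by (simp add: q_def)
 ultimately show False using N(1) by simp
qed

lemma tt_Pi_inj: "inj_on tt Pi"
proof (rule inj_onI, rule ccontr)
 fix \<alpha> \<beta> assume ab: "\<alpha> \<in> Pi" "\<beta> \<in> Pi" "tt \<alpha> = tt \<beta>" "\<alpha> \<noteq> \<beta>"
 have "\<alpha> h = \<beta> h" if "h \<in> H" for h
  using tt(2)[OF root_hd[OF rs.Pi_D[OF ab(1)]] that] tt(2)[OF root_hd[OF rs.Pi_D[OF ab(2)]] that] ab(3) by simp
 then show False using hd_eqI[OF root_hd[OF rs.Pi_D[OF ab(1)]] root_hd[OF rs.Pi_D[OF ab(2)]]] ab(4) by blast
qed

lemma roots_vanish: assumes x: "x \<in> H" "\<And>\<alpha>. \<alpha> \<in> Pi ==> \<alpha> x = 0" shows "x = 0"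
proof (rule roots_center[OF x(1)])
 fix \<beta> assume b: "\<beta> \<in> roots"
 have "\<beta> x = (\<Sum>\<alpha>\<in>Pi. of_int (rs.coord \<beta> \<alpha>) * \<alpha>) x" using rs.coord[OF root_Q[OF b]] by simp
 also have "\<dots> = (\<Sum>\<alpha>\<in>Pi. (of_int (rs.coord \<beta> \<alpha>) * \<alpha>) x)"
  using rs.fin_Pi by (induction rule: finite_induct) simp_all
 also have "\<dots> = 0" by (rule sum.neutral) (use x(2) in simp)
 finally show "\<beta> x = 0" .
qed

text \<open>\<open>d\<close> represents, on the span of the \<open>tt \<alpha>\<close>, the
  functional with value \<open>2\<close> on each of them; nondegeneracy of the form there follows
  from \<open>roots_vanish\<close>.\<close>

lemma principal_element: "\<exists>d c. d \<in> H \<and> (\<forall>\<alpha>\<in>Pi. \<alpha> d = 2) \<and> d = (\<Sum>\<alpha>\<in>Pi. c \<alpha> *s hh \<alpha>)"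
proof -
 define B where "B = tt ` Pi"
 have fB: "finite B" using rs.fin_Pi by (simp add: B_def)
 have iB: "independent B"
 proof (rule independent_if_scalars_zero[OF fB])
  fix g x assume g: "(\<Sum>x\<in>B. g x *s x) = 0" "x \<in> B"
  then obtain \<alpha> where a: "\<alpha> \<in> Pi" "x = tt \<alpha>" by (auto simp: B_def)
  have "(\<Sum>\<alpha>\<in>Pi. g (tt \<alpha>) *s tt \<alpha>) = 0" using g(1) by (simp add: B_def sum.reindex[OF tt_Pi_inj])
  then show "g x = 0" using tt_Pi_independent[of "\<lambda>\<alpha>. g (tt \<alpha>)", OF _ a(1)] a(2) by simp
 qed
 have BH: "B \<subseteq> H" using tt(1) root_hd rs.Pi_D by (auto simp: B_def)
 have sH: "span B \<subseteq> H" by (rule span_minimal[OF BH subspace_H])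
 define L where "L = (\<lambda>h. \<Sum>v\<in>B. representation B h v * 2)"
 have "\<exists>d\<in>span B. \<forall>w\<in>span B. kil d w = L w"
 proof (rule kil_functional)
  fix x assume x: "x \<in> span B" "\<And>y. y \<in> span B ==> kil x y = 0"
  show "x = 0"
  proof (rule roots_vanish)
   show "x \<in> H" using x sH by blast
   fix \<alpha> assume a: "\<alpha> \<in> Pi"
   have "kil x (tt \<alpha>) = 0" using x(2) a by (simp add: B_def span_base)
   then show "\<alpha> x = 0" using tt(2)[OF root_hd[OF rs.Pi_D[OF a]], of x] x(1) sH by (simp add: kil_sym subset_iff)
  qed
 qed (use iB in \<open>auto simp: L_def representation_add representation_scale distrib_right sum.distrib sum_distrib_left mult.assoc\<close>)
 then obtain d where d: "d \<in> span B" "\<And>w. w \<in> span B ==> kil d w = L w" by blast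
 have dH: "d \<in> H" using d sH by blast
 have "\<alpha> d = 2" if a: "\<alpha> \<in> Pi" for \<alpha>
 proof -
  have tB: "tt \<alpha> \<in> B" using a by (simp add: B_def)
  have "L (tt \<alpha>) = (\<Sum>w\<in>B. if w = tt \<alpha> then 2 else 0)"
   unfolding L_def by (intro sum.cong refl) (simp add: representation_basis[OF iB tB])
  then have "kil d (tt \<alpha>) = 2" using d(2)[OF span_base[OF tB]] fB tB by simp
  then show ?thesis using tt(2)[OF root_hd[OF rs.Pi_D[OF a]] dH] by (simp add: kil_sym)
 qed
 moreover have "\<exists>c. d = (\<Sum>\<alpha>\<in>Pi. c \<alpha> *s hh \<alpha>)"
 proof -
  let ?r = "representation B d"
  have "d = (\<Sum>v\<in>B. ?r v *s v)" using sum_representation_eq[OF iB d(1) fB subset_refl] by simp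
  also have "\<dots> = (\<Sum>\<alpha>\<in>Pi. ?r (tt \<alpha>) *s tt \<alpha>)" by (simp add: B_def sum.reindex[OF tt_Pi_inj])
  also have "\<dots> = (\<Sum>\<alpha>\<in>Pi. (?r (tt \<alpha>) * (\<alpha> (tt \<alpha>) / 2)) *s hh \<alpha>)"
   using root_norm rs.Pi_D by (intro sum.cong refl) (simp add: hh_def)
  finally have "d = (\<Sum>\<alpha>\<in>Pi. (?r (tt \<alpha>) * (\<alpha> (tt \<alpha>) / 2)) *s hh \<alpha>)" .
  then show ?thesis by (rule exI[of _ "\<lambda>\<alpha>. ?r (tt \<alpha>) * (\<alpha> (tt \<alpha>) / 2)"])
 qed
 ultimately show ?thesis using dH by blast
qed

lemma ef_other: assumes "\<alpha> \<in> Pi" "\<beta> \<in> Pi" "\<alpha> \<noteq> \<beta>" shows "br (e \<alpha>) (f \<beta>) = 0"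
proof -
 note ab = Pi_D0[OF assms(1)] Pi_D0[OF assms(2)]
 have m: "br (e \<alpha>) (f \<beta>) \<in> Wt 0 (- \<beta> + \<alpha>)" by (rule e_act[OF ab(1) f_Wt[OF ab(2)] neg_D0[OF ab(2)]])
 have e1: "- \<beta> + \<alpha> = \<alpha> - \<beta>" by (simp only: uminus_add_conv_diff)
 have "\<alpha> - \<beta> \<notin> wts" using rs.Pi_diff[OF assms(1,2)] assms(3) by simp
 moreover have "\<alpha> - \<beta> \<in> rs.Q" by (intro gen_diff root_Q D0_roots ab)
 ultimately show ?thesis using Wt_zero m unfolding e1 by blast
qed

text \<open>For distinct simple roots \<open>e \<alpha>\<close> and \<open>f \<beta>\<close>
  commute, so the bracket of the two sums reduces to the combination of coroots that equals
  \<open>d\<close>.\<close>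

lemma principal:
 obtains c d where "d \<in> H" "\<And>\<alpha>. \<alpha> \<in> Pi ==> \<alpha> d = 2" "\<And>\<alpha>. \<alpha> \<in> Pi ==> c \<alpha> \<noteq> 0"
  "sl2 (\<Sum>\<alpha>\<in>Pi. c \<alpha> *s e \<alpha>) (\<Sum>\<alpha>\<in>Pi. f \<alpha>) d"
proof -
 obtain d c where d: "d \<in> H" "\<And>\<alpha>. \<alpha> \<in> Pi ==> \<alpha> d = 2" "d = (\<Sum>\<alpha>\<in>Pi. c \<alpha> *s hh \<alpha>)"
  using principal_element by blast
 let ?E = "\<Sum>\<alpha>\<in>Pi. c \<alpha> *s e \<alpha>"
 have we: "br d (e \<alpha>) = 2 *s e \<alpha>" if "\<alpha> \<in> Pi" for \<alpha>
  using Wt_rt[OF e_Wt[OF Pi_D0[OF that]]] d(1,2) that by (simp add: rt_iff)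
 have wf: "br d (f \<alpha>) = (-2) *s f \<alpha>" if "\<alpha> \<in> Pi" for \<alpha>
  using Wt_rt[OF f_Wt[OF Pi_D0[OF that]]] d(1) d(2)[OF that] by (simp add: rt_iff)
 have EF: "br ?E (\<Sum>\<alpha>\<in>X. f \<alpha>) = (\<Sum>\<alpha>\<in>X. c \<alpha> *s hh \<alpha>)" if X: "X \<subseteq> Pi" for X
 proof -
  have "br ?E (f \<beta>) = c \<beta> *s hh \<beta>" if b: "\<beta> \<in> Pi" for \<beta>
  proof -
   have "br ?E (f \<beta>) = (\<Sum>\<alpha>\<in>Pi. if \<alpha> = \<beta> then c \<beta> *s hh \<beta> else 0)"
    unfolding br_sum_left
    by (intro sum.cong refl) (use ef_other b ef(3)[OF Pi_D0[OF b]] in \<open>auto simp: br_scale_left sl2_def\<close>)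
   then show ?thesis using b rs.fin_Pi by simp
  qed
  then show ?thesis using X by (auto simp: br_sum_right intro!: sum.cong)
 qed
 have tri: "sl2 ?E (\<Sum>\<alpha>\<in>X. f \<alpha>) d" if X: "X \<subseteq> Pi" "d = (\<Sum>\<alpha>\<in>X. c \<alpha> *s hh \<alpha>)" for X
  unfolding sl2_def
 proof (intro conjI)
  show "br d ?E = 2 *s ?E" by (simp add: br_sum_right br_scale_right we scale_sum_right mult.commute)
  have "(\<Sum>\<alpha>\<in>X. br d (f \<alpha>)) = (\<Sum>\<alpha>\<in>X. (-2) *s f \<alpha>)" by (rule sum.cong[OF refl]) (use wf X in blast)
  then show "br d (\<Sum>\<alpha>\<in>X. f \<alpha>) = (-2) *s (\<Sum>\<alpha>\<in>X. f \<alpha>)" by (simp only: br_sum_right scale_sum_right)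
  show "br ?E (\<Sum>\<alpha>\<in>X. f \<alpha>) = d" using EF[OF X(1)] X(2) by simp
 qed
 \<comment> \<open>If \<open>c \<alpha> = 0\<close>, dropping \<open>f \<alpha>\<close> leaves a
   triple whose lowering element kills \<open>e \<alpha>\<close>, a non-zero vector of weight
   \<open>2\<close>.\<close>
 have cnz: "c \<alpha> \<noteq> 0" if a: "\<alpha> \<in> Pi" for \<alpha>
 proof
  assume c0: "c \<alpha> = 0"
  have "d = (\<Sum>\<beta>\<in>Pi - {\<alpha>}. c \<beta> *s hh \<beta>)" using d(3) c0 a rs.fin_Pi by (simp add: sum.remove)
  then have s: "sl2 ?E (\<Sum>\<beta>\<in>Pi - {\<alpha>}. f \<beta>) d" by (intro tri) auto
  have "br (f \<beta>) (e \<alpha>) = 0" if "\<beta> \<in> Pi - {\<alpha>}" for \<beta>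
   by (rule br_anti_zero) (use ef_other a that in blast)
  then have "br (\<Sum>\<beta>\<in>Pi - {\<alpha>}. f \<beta>) (e \<alpha>) = 0" by (simp add: br_sum_left)
  moreover have "br d (e \<alpha>) = of_int 2 *s e \<alpha>" using we[OF a] by simp
  ultimately have "e \<alpha> = 0" using sl2_f_inj[OF s, of "e \<alpha>" 2] by simp
  then show False using ef_nz(1)[OF Pi_D0[OF a]] by simp
 qed
 show thesis
 proof (rule that[of d c])
  show "sl2 ?E (sum f Pi) d" by (rule tri[OF subset_refl d(3)])
 qed (fact d(1), erule d(2), erule cnz)
qed

text \<open>The substitute for complete reducibility. With the principal triple \<open>E\<close>,
  \<open>F\<close>, the map \<open>E F\<close> is injective on the sum \<open>W2\<close> of the
  simple weight spaces by \<open>sl2_ef_inj\<close>, hence bijective. So \<open>G 0 \<kappa>\<close>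
  is the direct sum of the kernel of \<open>E\<close> and of \<open>F W2\<close>, which are
  \<open>UU \<kappa>\<close> and \<open>V0 \<kappa>\<close>.\<close>

lemma zero_weight_split:
 shows "UU \<kappa> \<inter> V0 \<kappa> = {0}" "w \<in> G 0 \<kappa> ==> \<exists>u\<in>UU \<kappa>. \<exists>v\<in>V0 \<kappa>. w = u + v"
proof -
 obtain d c where d: "d \<in> H" "\<And>\<alpha>. \<alpha> \<in> Pi ==> \<alpha> d = 2" "\<And>\<alpha>. \<alpha> \<in> Pi ==> c \<alpha> \<noteq> 0"
  "sl2 (\<Sum>\<alpha>\<in>Pi. c \<alpha> *s e \<alpha>) (\<Sum>\<alpha>\<in>Pi. f \<alpha>) d"
  by (rule principal; (rule that; assumption?))
 let ?E = "\<Sum>\<alpha>\<in>Pi. c \<alpha> *s e \<alpha>" and ?F = "\<Sum>\<alpha>\<in>Pi. f \<alpha>"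
 define W2 where "W2 = span (\<Union>\<alpha>\<in>Pi. Wt \<kappa> \<alpha>)"
 have sW2: "subspace W2" by (simp add: W2_def)
 have Pw: "\<alpha> \<in> wts" if "\<alpha> \<in> Pi" for \<alpha> using rs.Pi_D[OF that] by simp
 \<comment> \<open>On a simple weight space only the matching summand of \<open>?F\<close> acts,
   since a difference of distinct simple roots is not a weight. This identifies
   \<open>V0 \<kappa>\<close> with the image of \<open>W2\<close>.\<close>
 have Fv: "br ?F v = br (f \<alpha>) v" if v: "\<alpha> \<in> Pi" "v \<in> Wt \<kappa> \<alpha>" for \<alpha> v
 proof -
  have "br (f \<beta>) v = 0" if b: "\<beta> \<in> Pi" "\<beta> \<noteq> \<alpha>" for \<beta>
  proof -
   have m: "br (f \<beta>) v \<in> Wt \<kappa> (\<alpha> - \<beta>)" by (rule f_act[OF Pi_D0[OF b(1)] v(2) Pw[OF v(1)]])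
   have "\<alpha> - \<beta> \<notin> wts" using rs.Pi_diff[OF v(1) b(1)] b(2) by simp
   moreover have "\<alpha> - \<beta> \<in> rs.Q" by (intro gen_diff root_Q rs.Pi_D v b)
   ultimately show ?thesis using Wt_zero[OF m] by blast
  qed
  then have "br ?F v = (\<Sum>\<beta>\<in>Pi. if \<beta> = \<alpha> then br (f \<alpha>) v else 0)"
   unfolding br_sum_left by (intro sum.cong refl) simp
  then show ?thesis using v(1) rs.fin_Pi by simp
 qed
 have FV0: "br ?F v \<in> V0 \<kappa>" if "v \<in> W2" for v
 proof (rule lin_span_image[OF lin_br _ _ that[unfolded W2_def]])
  show "br ?F x \<in> V0 \<kappa>" if "x \<in> (\<Union>\<alpha>\<in>Pi. Wt \<kappa> \<alpha>)" for x
  proof -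
   obtain \<alpha> where a: "\<alpha> \<in> Pi" "x \<in> Wt \<kappa> \<alpha>" using \<open>x \<in> _\<close> by blast
   show ?thesis unfolding Fv[OF a] V0_def using a by (intro span_base) blast
  qed
 qed (simp add: V0_def)
 have EW2: "br ?E w \<in> W2" if w: "w \<in> G 0 \<kappa>" for w
 proof -
  have "br (e \<alpha>) w \<in> W2" if a: "\<alpha> \<in> Pi" for \<alpha>
  proof -
   have "br (e \<alpha>) w \<in> Wt \<kappa> (0 + \<alpha>)" by (rule e_act[OF Pi_D0[OF a]]) (use w Wt_lambda_0 in auto)
   then have "br (e \<alpha>) w \<in> Wt \<kappa> \<alpha>" by (simp only: add_0_left)
   then show ?thesis unfolding W2_def using a by (intro span_base) blast
  qed
  then show ?thesis unfolding br_sum_left br_scale_left by (intro subspace_sum subspace_scale sW2)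
 qed
 have wt2: "br d v = of_int 2 *s v" if "v \<in> W2" for v
 proof (rule lin_eq_span[OF lin_br lin_smult[OF lin_ident] _ that[unfolded W2_def]])
  fix x assume "x \<in> (\<Union>\<alpha>\<in>Pi. Wt \<kappa> \<alpha>)"
  then obtain \<alpha> where a: "\<alpha> \<in> Pi" "x \<in> Wt \<kappa> \<alpha>" by blast
  show "br d x = of_int 2 *s x" using Wt_rt[OF a(2)] d(1,2) a(1) by (simp add: rt_iff)
 qed
 let ?T = "\<lambda>v. br ?E (br ?F v)"
 have inj0: "v = 0" if "v \<in> W2" "?T v = 0" for v
  by (rule sl2_ef_inj[OF d(4) wt2[OF that(1)] _ that(2)]) simp
 have TW: "?T v \<in> W2" if "v \<in> W2" for v using EW2 FV0[OF that] V0_G by blast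
 have lT: "lin ?T" by (rule lin_br_br)
 have surj: "?T ` W2 = W2"
 proof (rule subspace_dim_equal)
  have "inj_on ?T W2"
  proof (rule inj_onI)
   fix x y assume xy: "x \<in> W2" "y \<in> W2" "?T x = ?T y"
   have "?T (x - y) = 0" using xy(3) lin_diff[OF lT] by simp
   then show "x = y" using inj0[OF subspace_diff[OF sW2 xy(1,2)]] by simp
  qed
  interpret fdp: finite_dimensional_vector_space_pair_1 scale Basis scale ..
  have "dim (?T ` W2) = dim W2"
   using fdp.dim_image_eq[OF lT, of W2] \<open>inj_on ?T W2\<close> sW2 by (simp add: span_eq_iff[THEN iffD2])
  then show "dim W2 \<le> dim (?T ` W2)" by simp
 qed (use TW subspace_lin_image[OF lT sW2] sW2 in auto)
 have V0F: "\<exists>v\<in>W2. x = br ?F v" if "x \<in> V0 \<kappa>" for x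
  using that unfolding V0_def
 proof (induction rule: span_induct_alt)
  case base show ?case using subspace_0[OF sW2] by (intro bexI[of _ 0]) simp_all
 next
  case (step k x y)
  then obtain \<alpha> w v where s: "x = br (f \<alpha>) w" "\<alpha> \<in> Pi" "w \<in> Wt \<kappa> \<alpha>" "v \<in> W2" "y = br ?F v" by blast
  have "w \<in> W2" unfolding W2_def using s by (intro span_base) blast
  then have "k *s w + v \<in> W2" using s sW2 by (intro subspace_add subspace_scale)
  moreover have "k *s x + y = br ?F (k *s w + v)" using s Fv[OF s(2,3)] by (simp add: br_add_right br_scale_right)
  ultimately show ?case by blast
 qed
 have E0: "br ?E u = 0" if "u \<in> UU \<kappa>" for u
  unfolding br_sum_left br_scale_left using that by (intro sum.neutral) (simp add: UU_def)
 have "x = 0" if x: "x \<in> UU \<kappa>" "x \<in> V0 \<kappa>" for x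
 proof -
  obtain v where v: "v \<in> W2" "x = br ?F v" using V0F[OF x(2)] by blast
  have "?T v = 0" using E0[OF x(1)] v(2) by simp
  then have "v = 0" by (rule inj0[OF v(1)])
  then show ?thesis using v(2) by simp
 qed
 then show "UU \<kappa> \<inter> V0 \<kappa> = {0}" using subspace_0[OF subspace_UU] span_zero by (auto simp: V0_def)
 show "\<exists>u\<in>UU \<kappa>. \<exists>v\<in>V0 \<kappa>. w = u + v" if w: "w \<in> G 0 \<kappa>" for w
 proof -
  have "br ?E w \<in> ?T ` W2" using EW2[OF w] surj by simp
  then obtain v where v: "br ?E w = ?T v" "v \<in> W2" by (rule imageE)
  let ?u = "w - br ?F v"
  have uG: "?u \<in> G 0 \<kappa>" using w FV0[OF v(2)] V0_G subspace_diff[OF subspace_G] by blast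
  have z: "(\<Sum>\<alpha>\<in>Pi. c \<alpha> *s br (e \<alpha>) ?u) = 0"
  proof -
   have "br ?E ?u = 0" using v(1) by (simp add: br_diff_right)
   then show ?thesis by (simp only: br_sum_left br_scale_left)
  qed
  have "br (e \<alpha>) ?u = 0" if a: "\<alpha> \<in> Pi" for \<alpha>
  proof -
   \<comment> \<open>The summands of \<open>?E\<close> applied to \<open>?u\<close> have distinct
     weights, so each of them vanishes; as \<open>c \<alpha>\<close> is non-zero, \<open>?u\<close>
     is killed by every simple \<open>e \<alpha>\<close>.\<close>
   have "c \<alpha> *s br (e \<alpha>) ?u \<in> {0}"
   proof (rule rt_independent[OF rs.fin_Pi _ _ subspace_single_0 _ _ a, of "\<lambda>\<alpha>. c \<alpha> *s br (e \<alpha>) ?u"])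
    show "Pi \<subseteq> hd'" using rs.Pi_D root_hd by blast
    fix \<beta> assume b: "\<beta> \<in> Pi"
    have "br (e \<beta>) ?u \<in> Wt \<kappa> (0 + \<beta>)" by (rule e_act[OF Pi_D0[OF b]]) (use uG Wt_lambda_0 in auto)
    then have "br (e \<beta>) ?u \<in> rt \<beta>" by (simp only: add_0_left Wt_rt)
    then show "c \<beta> *s br (e \<beta>) ?u \<in> rt \<beta>" by (rule subspace_scale[OF subspace_rt])
   qed (use z in auto)
   then show ?thesis using d(3)[OF a] by simp
  qed
  then have "?u \<in> UU \<kappa>" using uG by (simp add: UU_def)
  moreover have "w = ?u + br ?F v" by simp
  ultimately show ?thesis using FV0[OF v(2)] by blast
 qed
qed

lemma UU_VV: "UU \<kappa> \<inter> VV \<kappa> = {0}"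
proof -
 have "x = 0" if x: "x \<in> UU \<kappa>" "x \<in> VV \<kappa>" for x
 proof -
  obtain u where u: "\<And>\<mu>. \<mu> \<in> wts ==> u \<mu> \<in> Wt \<kappa> \<mu>" "x = (\<Sum>\<mu>\<in>wts. u \<mu>)" "u 0 \<in> V0 \<kappa>" using VV_cases[OF x(2)] by blast
  have sx: "subspace (rt 0)" by (rule subspace_rt)
  have x0: "x \<in> rt 0" using x(1) by (simp add: UU_def G_def)
  have z: "u \<mu> = 0" if m: "\<mu> \<in> roots" for \<mu>
  proof (rule ccontr)
   assume nz: "u \<mu> \<noteq> 0"
   have "u \<mu> \<in> rt 0"
   proof (rule wt_comp[OF sx])
    show "br h v \<in> rt 0" if "h \<in> H" "v \<in> rt 0" for h v using that subspace_0[OF sx] by (simp add: rt_iff)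
    show "sum u wts \<in> rt 0" using x0 u(2) by simp
   qed (use u(1) Wt_rt m in auto)
   then have "\<mu> = 0" using rt_eq[OF Wt_rt[OF u(1)] _ nz root_hd[OF m] hd_zero] m by simp
   then show False using root_nz[OF m] by simp
  qed
  have "0 \<notin> roots" using root_nz by blast
  then have "x = u 0" unfolding u(2) using finite_roots z by simp
  then show ?thesis using zero_weight_split(1) x(1) u(3) by blast
 qed
 then show ?thesis using subspace_0[OF subspace_UU] subspace_0[OF subspace_VV] by blast
qed

lemma UU_W: "UU \<kappa> \<subseteq> W \<kappa>"
 using Wt_W[of _ \<kappa> 0] by (auto simp: UU_def Wt_lambda_0)

lemma W_split: "{u + v | u v. u \<in> UU \<kappa> \<and> v \<in> VV \<kappa>} = W \<kappa>"
proof
 show "{u + v | u v. u \<in> UU \<kappa> \<and> v \<in> VV \<kappa>} \<subseteq> W \<kappa>"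
  using UU_W VV_W subspace_add[OF subspace_W] by blast
 show "W \<kappa> \<subseteq> {u + v | u v. u \<in> UU \<kappa> \<and> v \<in> VV \<kappa>}"
 proof
  fix x assume "x \<in> W \<kappa>"
  then obtain u where u: "\<And>\<mu>. \<mu> \<in> wts ==> u \<mu> \<in> Wt \<kappa> \<mu>" "x = (\<Sum>\<mu>\<in>wts. u \<mu>)" using W_cases by blast
  have "u 0 \<in> G 0 \<kappa>" using u(1)[of 0] by (simp add: Wt_lambda_0)
  then obtain p q where pq: "p \<in> UU \<kappa>" "q \<in> V0 \<kappa>" "u 0 = p + q" using zero_weight_split(2) by blast
  have "0 \<notin> roots" using root_nz by blast
  then have "x = p + (q + (\<Sum>\<mu>\<in>roots. u \<mu>))" unfolding u(2) using finite_roots pq(3) by (simp add: add.assoc)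
  moreover have "q + (\<Sum>\<mu>\<in>roots. u \<mu>) \<in> VV \<kappa>"
   by (rule subspace_add[OF subspace_VV V0_VV[OF pq(2)] subspace_sum[OF subspace_VV Wt_VV[OF u(1)]]]) simp_all
  ultimately show "x \<in> {u + v | u v. u \<in> UU \<kappa> \<and> v \<in> VV \<kappa>}" using pq(1) by blast
 qed
qed

text \<open>\<open>P\<close> collects the root weights of \<open>M\<close>, \<open>P'\<close> the
  root weights of \<open>VV \<kappa>\<close> that \<open>M\<close> misses. Both are saturated and
  stable under reflections in \<open>D0\<close>, and they are disjoint;
  \<open>saturated_meet\<close> forces one of them to be empty.\<close>

lemma VV_irreducible:
 assumes M: "subspace M" "M \<subseteq> VV \<kappa>" "\<And>x v. x \<in> W 0 ==> v \<in> M ==> br x v \<in> M"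
 shows "M = {0} \<or> M = VV \<kappa>"
proof -
 define P where "P = {\<mu>\<in>roots. \<exists>x\<in>M \<inter> Wt \<kappa> \<mu>. x \<noteq> 0}"
 define P' where "P' = {\<mu>\<in>roots. Wt \<kappa> \<mu> \<noteq> {0}} - P"
 have full: "Wt \<kappa> \<mu> \<subseteq> M" if m: "\<mu> \<in> P" for \<mu>
 proof
  fix w assume w: "w \<in> Wt \<kappa> \<mu>"
  obtain x where x: "x \<in> M" "x \<in> Wt \<kappa> \<mu>" "x \<noteq> 0" "\<mu> \<in> roots" using m by (auto simp: P_def)
  obtain c where "w = c *s x" using Wt_one_dim[OF x(2-4) w] by blast
  then show "w \<in> M" using x(1) M(1) subspace_scale by blast
 qed
 have ef_M: "br (e \<alpha>) v \<in> M" "br (f \<alpha>) v \<in> M" if "\<alpha> \<in> D0" "v \<in> M" for \<alpha> v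
  using that M(3) e_W0 f_W0 by blast+
 have comp: "u \<mu> \<in> M" if "\<And>\<mu>. \<mu> \<in> wts ==> u \<mu> \<in> Wt \<kappa> \<mu>" "(\<Sum>\<mu>\<in>wts. u \<mu>) \<in> M" "\<mu> \<in> wts" for u \<mu>
  by (rule wt_comp[OF M(1) _ _ that(2,3)]) (use M(3) H_W0 that(1) Wt_rt in blast)+
 have refl: "\<exists>y\<in>Wt \<kappa> (\<mu> - of_int (ai \<mu> \<alpha>) * \<alpha>) \<inter> N. y \<noteq> 0"
  if a: "\<alpha> \<in> D0" and m: "\<mu> \<in> roots" and x: "x \<in> Wt \<kappa> \<mu>" "x \<noteq> 0" "x \<in> N"
   and N: "\<And>v. v \<in> N ==> br (e \<alpha>) v \<in> N" "\<And>v. v \<in> N ==> br (f \<alpha>) v \<in> N" for \<alpha> \<mu> x N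
 proof -
  note ar = D0_roots[OF a]
  have "\<exists>y\<in>G (\<mu> - of_int (ai \<mu> \<alpha>) * \<alpha>) ((\<kappa> + sh \<mu>) - of_int (ai \<mu> \<alpha>) * sh \<alpha>) \<inter> N. y \<noteq> 0"
   by (rule G_reflect[OF ef[OF a] root_hd[OF ar] x(1)[unfolded Wt_def] x(2) ai[OF ar m] _ _ x(3)];
    erule N)
  moreover have "(\<kappa> + sh \<mu>) - of_int (ai \<mu> \<alpha>) * sh \<alpha> = \<kappa> + sh (\<mu> - of_int (ai \<mu> \<alpha>) * \<alpha>)"
   by (simp only: sh_diff[OF root_Q[OF m] gen_subgroup_of_int[OF root_Q[OF ar]]] sh_of_int[OF root_Q[OF ar]] add_diff_eq)
  ultimately show ?thesis unfolding Wt_def by (simp only:)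
 qed
 have P_refl: "\<mu> - of_int (ai \<mu> \<alpha>) * \<alpha> \<in> P" if a: "\<alpha> \<in> D0" "\<mu> \<in> P" for \<alpha> \<mu>
 proof -
  obtain x where x: "x \<in> M" "x \<in> Wt \<kappa> \<mu>" "x \<noteq> 0" "\<mu> \<in> roots" using a by (auto simp: P_def)
  have "\<exists>y\<in>Wt \<kappa> (\<mu> - of_int (ai \<mu> \<alpha>) * \<alpha>) \<inter> M. y \<noteq> 0"
   by (rule refl[OF a(1) x(4,2,3,1) ef_M[OF a(1)]])
  then show ?thesis using refl_closed'[OF D0_roots[OF a(1)] x(4)] unfolding P_def by blast
 qed
 have P'_refl: "\<mu> - of_int (ai \<mu> \<alpha>) * \<alpha> \<in> P'" if a: "\<alpha> \<in> D0" "\<mu> \<in> P'" for \<alpha> \<mu>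
 proof -
  have m: "\<mu> \<in> roots" "\<mu> \<notin> P" using a by (auto simp: P'_def)
  obtain x where x: "x \<in> Wt \<kappa> \<mu>" "x \<noteq> 0" using a subspace_0[OF subspace_Wt] by (auto simp: P'_def)
  have "\<exists>y\<in>Wt \<kappa> (\<mu> - of_int (ai \<mu> \<alpha>) * \<alpha>) \<inter> UNIV. y \<noteq> 0"
   by (rule refl[OF a(1) m(1) x UNIV_I]) auto
  then have "Wt \<kappa> (\<mu> - of_int (ai \<mu> \<alpha>) * \<alpha>) \<noteq> {0}" by blast
  moreover have "\<mu> - of_int (ai \<mu> \<alpha>) * \<alpha> \<notin> P"
  proof
   assume "\<mu> - of_int (ai \<mu> \<alpha>) * \<alpha> \<in> P"
   then have "(\<mu> - of_int (ai \<mu> \<alpha>) * \<alpha>) - of_int (ai (\<mu> - of_int (ai \<mu> \<alpha>) * \<alpha>) \<alpha>) * \<alpha> \<in> P" by (rule P_refl[OF a(1)])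
   then show False using m(2) unfolding rs.s_s[OF D0_roots[OF a(1)] m(1)] by blast
  qed
  ultimately show ?thesis using refl_closed'[OF D0_roots[OF a(1)] m(1)] unfolding P'_def by blast
 qed
 have low: "\<mu> = \<alpha> \<or> (\<mu> - \<alpha> \<in> roots \<and> br (f \<alpha>) x \<in> Wt \<kappa> (\<mu> - \<alpha>) \<and> br (f \<alpha>) x \<noteq> 0 \<and>
   br (e \<alpha>) (br (f \<alpha>) x) \<in> Wt \<kappa> \<mu> \<and> br (e \<alpha>) (br (f \<alpha>) x) \<noteq> 0)"
  if a: "\<alpha> \<in> D0" "\<mu> \<in> roots" "0 < R \<mu> \<alpha>" "x \<in> Wt \<kappa> \<mu>" "x \<noteq> 0" for \<alpha> \<mu> x
 proof (cases "\<mu> = \<alpha>")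
  case False
  then have r: "\<mu> - \<alpha> \<in> roots" using string'[OF D0_roots[OF a(1)] a(2,3)] by blast
  have fx: "br (f \<alpha>) x \<in> Wt \<kappa> (\<mu> - \<alpha>)" by (rule f_act[OF a(1,4) roots_wts[OF a(2)]])
  have "br (e \<alpha>) (br (f \<alpha>) x) \<in> Wt \<kappa> (\<mu> - \<alpha> + \<alpha>)" by (rule e_act[OF a(1) fx roots_wts[OF r]])
  then have "br (e \<alpha>) (br (f \<alpha>) x) \<in> Wt \<kappa> \<mu>" by (simp only: diff_add_cancel)
  then show ?thesis using r fx f_inj[OF a(1,2,4,3)] ef_inj[OF a(1,2,4,3)] a(5) by blast
 qed simp
 have P_sat: "\<mu> = \<alpha> \<or> \<mu> - \<alpha> \<in> P" if a: "\<alpha> \<in> D0" "\<mu> \<in> P" "0 < R \<mu> \<alpha>" for \<alpha> \<mu>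
 proof -
  obtain x where x: "x \<in> M" "x \<in> Wt \<kappa> \<mu>" "x \<noteq> 0" "\<mu> \<in> roots" using a by (auto simp: P_def)
  show ?thesis using low[OF a(1) x(4) a(3) x(2,3)] ef_M(2)[OF a(1) x(1)] unfolding P_def by blast
 qed
 have P'_sat: "\<mu> = \<alpha> \<or> \<mu> - \<alpha> \<in> P'" if a: "\<alpha> \<in> D0" "\<mu> \<in> P'" "0 < R \<mu> \<alpha>" for \<alpha> \<mu>
 proof (cases "\<mu> = \<alpha>")
  case False
  have m: "\<mu> \<in> roots" "\<mu> \<notin> P" using a by (auto simp: P'_def)
  obtain x where x: "x \<in> Wt \<kappa> \<mu>" "x \<noteq> 0" using a subspace_0[OF subspace_Wt] by (auto simp: P'_def)
  note lw = low[OF a(1) m(1) a(3) x]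
  \<comment> \<open>Otherwise \<open>f \<alpha> x\<close> lies in \<open>M\<close>, and so does
    \<open>e \<alpha> (f \<alpha> x)\<close>, a non-zero vector of weight
    \<open>\<mu>\<close>.\<close>
  have "\<mu> - \<alpha> \<notin> P"
  proof
   assume "\<mu> - \<alpha> \<in> P"
   then have "br (f \<alpha>) x \<in> M" using full lw False by blast
   then have "br (e \<alpha>) (br (f \<alpha>) x) \<in> M" by (rule ef_M(1)[OF a(1)])
   then have "\<mu> \<in> P" using lw False m(1) unfolding P_def by blast
   then show False using m(2) by blast
  qed
  moreover have "\<mu> - \<alpha> \<in> roots" "Wt \<kappa> (\<mu> - \<alpha>) \<noteq> {0}" using lw False by blast+
  ultimately show ?thesis unfolding P'_def by blast
 qed simp
 have "P = {} \<or> P' = {}"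
 proof (rule ccontr)
  assume ne: "\<not> (P = {} \<or> P' = {})"
  have "P \<inter> P' \<noteq> {}"
  proof (rule sr.saturated_meet)
   show "P \<subseteq> roots" "P' \<subseteq> roots" by (auto simp: P_def P'_def)
  qed (use ne P_refl P'_refl P_sat P'_sat in blast)+
  then show False by (auto simp: P'_def)
 qed
 then show ?thesis
 proof
  \<comment> \<open>Then \<open>M\<close> has no weight but zero, so its vectors are killed by every
    simple \<open>e \<alpha>\<close> and lie in the zero intersection of \<open>UU \<kappa>\<close>
    and \<open>V0 \<kappa>\<close>.\<close>
  assume P0: "P = {}"
  have "x = 0" if x: "x \<in> M" for x
  proof -
   obtain u where u: "\<And>\<mu>. \<mu> \<in> wts ==> u \<mu> \<in> Wt \<kappa> \<mu>" "x = (\<Sum>\<mu>\<in>wts. u \<mu>)" "u 0 \<in> V0 \<kappa>"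
    using VV_cases[of x \<kappa>] x M(2) by blast
   have "(\<Sum>\<mu>\<in>wts. u \<mu>) \<in> M" using u(2) x by (simp only:)
   then have uM: "u \<mu> \<in> M" if "\<mu> \<in> wts" for \<mu> using comp[of u \<mu>] u(1) that by blast
   have z: "u \<mu> = 0" if "\<mu> \<in> roots" for \<mu>
    using uM[of \<mu>] u(1)[of \<mu>] that P0 unfolding P_def by blast
   have "0 \<notin> roots" using root_nz by blast
   then have x0: "x = u 0" unfolding u(2) using finite_roots z by simp
   have "br (e \<alpha>) x = 0" if a: "\<alpha> \<in> Pi" for \<alpha>
   proof -
    have "br (e \<alpha>) x \<in> Wt \<kappa> (0 + \<alpha>)"
     by (rule e_act[OF Pi_D0[OF a]]) (use u(1)[of 0] x0 in auto)
    then have "br (e \<alpha>) x \<in> Wt \<kappa> \<alpha>" by (simp only: add_0_left)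
    moreover have "br (e \<alpha>) x \<in> M" by (rule ef_M(1)[OF Pi_D0[OF a] x])
    ultimately show ?thesis using P0 rs.Pi_D[OF a] unfolding P_def by blast
   qed
   then have "x \<in> UU \<kappa>" using u(1)[of 0] x0 by (simp add: UU_def Wt_lambda_0)
   then show ?thesis using zero_weight_split(1) u(3) x0 by blast
  qed
  then have "M = {0}" using subspace_0[OF M(1)] by blast
  then show ?thesis ..
 next
  assume P0: "P' = {}"
  have Wm: "Wt \<kappa> \<mu> \<subseteq> M" if "\<mu> \<in> roots" for \<mu>
   using full[of \<mu>] P0 that subspace_0[OF M(1)] unfolding P'_def by (cases "\<mu> \<in> P") auto
  have "V0 \<kappa> \<subseteq> M"
   unfolding V0_def
  proof (rule span_minimal[OF _ M(1)], safe)
   fix \<alpha> w assume a: "\<alpha> \<in> Pi" "w \<in> Wt \<kappa> \<alpha>"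
   then show "br (f \<alpha>) w \<in> M" using ef_M(2)[OF Pi_D0[OF a(1)]] Wm[OF rs.Pi_D[OF a(1)]] by blast
  qed
  then have "VV \<kappa> \<subseteq> M" unfolding VV_def using Wm by (intro span_minimal M(1)) blast
  then show ?thesis using M(2) by blast
 qed
qed

text \<open>A non-zero \<open>VV \<kappa>\<close> has a root weight \<open>\<mu>\<close>, which is
  \<open>\<alpha>\<close> or \<open>\<alpha> + \<alpha>\<close> with \<open>\<alpha>\<close> in
  \<open>D0\<close>; reflecting in \<open>\<alpha>\<close> gives the second weight
  \<open>- \<mu>\<close>.\<close>

lemma VV_dim: assumes "VV \<kappa> \<noteq> {0}" shows "1 < dim (VV \<kappa>)"
proof -
 have "\<exists>\<mu>\<in>roots. Wt \<kappa> \<mu> \<noteq> {0}"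
 proof (rule ccontr)
  assume n: "\<not> ?thesis"
  have "V0 \<kappa> \<subseteq> {0}" unfolding V0_def
  proof (rule span_minimal[OF _ subspace_single_0], safe)
   fix \<alpha> w assume a: "\<alpha> \<in> Pi" "w \<in> Wt \<kappa> \<alpha>"
   then have "w = 0" using n rs.Pi_D by blast
   then show "br (f \<alpha>) w = 0" by simp
  qed
  then have "VV \<kappa> \<subseteq> {0}" unfolding VV_def using n by (intro span_minimal subspace_single_0) blast
  then show False using assms subspace_0[OF subspace_VV] by blast
 qed
 then obtain \<mu> where m: "\<mu> \<in> roots" "Wt \<kappa> \<mu> \<noteq> {0}" by blast
 obtain x where x: "x \<in> Wt \<kappa> \<mu>" "x \<noteq> 0" using m subspace_0[OF subspace_Wt] by blast
 obtain \<alpha> where a: "\<alpha> \<in> D0" "\<mu> = \<alpha> \<or> \<mu> = \<alpha> + \<alpha>" using sr.D_cases[OF m(1)] by blast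
 note ar = D0_roots[OF a(1)]
 have neg: "\<mu> - of_int (ai \<mu> \<alpha>) * \<alpha> = - \<mu>"
 proof -
  have 2: "ai \<alpha> \<alpha> = 2" by (rule rs.a_self[OF ar])
  have 4: "ai (\<alpha> + \<alpha>) \<alpha> = 4" if "\<alpha> + \<alpha> \<in> roots"
   by (rule rs.a_eqI[OF ar that]) (simp add: rs.R_add)
  have e2: "\<alpha> - of_int 2 * \<alpha> = - \<alpha>" "\<alpha> + \<alpha> - of_int 4 * \<alpha> = - (\<alpha> + \<alpha>)"
   by (rule ext, simp only: minus_apply uminus_apply plus_fun_apply times_fun_apply of_int_fun_apply, simp)+
  show ?thesis
  proof (cases "\<mu> = \<alpha>")
   case True show ?thesis unfolding True 2 by (rule e2)
  next
   case False
   then have m2: "\<mu> = \<alpha> + \<alpha>" using a(2) by blast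
   show ?thesis unfolding m2 4[OF m(1)[unfolded m2]] by (rule e2)
  qed
 qed
 have "\<exists>y\<in>Wt \<kappa> (\<mu> - of_int (ai \<mu> \<alpha>) * \<alpha>). y \<noteq> 0"
 proof -
  have "\<exists>y\<in>G (\<mu> - of_int (ai \<mu> \<alpha>) * \<alpha>) ((\<kappa> + sh \<mu>) - of_int (ai \<mu> \<alpha>) * sh \<alpha>) \<inter> UNIV. y \<noteq> 0"
   by (rule G_reflect[OF ef[OF a(1)] root_hd[OF ar] x(1)[unfolded Wt_def] x(2) ai[OF ar m(1)]]) simp_all
  moreover have "(\<kappa> + sh \<mu>) - of_int (ai \<mu> \<alpha>) * sh \<alpha> = \<kappa> + sh (\<mu> - of_int (ai \<mu> \<alpha>) * \<alpha>)"
   by (simp only: sh_diff[OF root_Q[OF m(1)] gen_subgroup_of_int[OF root_Q[OF ar]]] sh_of_int[OF root_Q[OF ar]] add_diff_eq)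
  ultimately show ?thesis unfolding Wt_def by (simp only: Int_UNIV_right)
 qed
 then obtain y where y: "y \<in> Wt \<kappa> (- \<mu>)" "y \<noteq> 0" unfolding neg by blast
 have yx: "y \<notin> span {x}"
 proof
  assume "y \<in> span {x}"
  then have "y \<in> Wt \<kappa> \<mu>" using x(1) subspace_scale[OF subspace_Wt] by (auto simp: span_singleton)
  then have "\<mu> = - \<mu>" using rt_eq[OF Wt_rt Wt_rt[OF y(1)] y(2) root_hd[OF m(1)] hd_neg[OF root_hd[OF m(1)]]] by blast
  then have "\<mu> (hh \<mu>) = (- \<mu>) (hh \<mu>)" by (rule fun_cong)
  then show False using root_hh[OF m(1)] by simp
 qed
 then have ind: "independent {y, x}" using x(2) by (intro independent_insertI independent_empty) simp_all
 have "y \<noteq> x" using yx span_base by blast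
 moreover have "{y, x} \<subseteq> VV \<kappa>" using Wt_VV x y m(1) rs.D_neg by blast
 ultimately show ?thesis using independent_card_le_dim[OF _ ind] by fastforce
qed

end

context mloop begin

subsection \<open>The zero component of the twisted grading\<close>

lemma roots_nonempty: assumes "K \<noteq> {0}" shows "roots \<noteq> {}"
proof
 assume r: "roots = {}"
 have H0: "H = {0}" using roots_center r subspace_0[OF subspace_H] by blast
 have "{x\<in>K. \<forall>y\<in>H. br x y \<in> H} = H" using cartan unfolding cartan_subalg_def by blast
 then have "K = {0}" unfolding H0 by (auto simp: subspace_0[OF subspace_K])
 then show False using assms by blast
qed

lemma W_rt: assumes x: "x \<in> W \<kappa>" "x \<in> rt \<alpha>" "\<alpha> \<in> hd'" shows "x \<in> Wt \<kappa> \<alpha>"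
proof (cases "x = 0")
 case True then show ?thesis by (simp add: subspace_0[OF subspace_Wt])
next
 case False
 then have al: "\<alpha> \<in> wts" using rt_zero_or_root[OF x(2,3)] by blast
 obtain u where u: "\<And>\<mu>. \<mu> \<in> wts ==> u \<mu> \<in> Wt \<kappa> \<mu>" "x = (\<Sum>\<mu>\<in>wts. u \<mu>)" using W_cases[OF x(1)] by blast
 have um: "u \<mu> \<in> rt \<alpha>" if "\<mu> \<in> wts" for \<mu>
 proof (rule wt_comp[OF subspace_rt _ _ _ that])
  show "br h v \<in> rt \<alpha>" if "h \<in> H" "v \<in> rt \<alpha>" for h v
   using that subspace_scale[OF subspace_rt] by (simp add: rt_iff[of v] )
  show "sum u wts \<in> rt \<alpha>" using u(2) x(2) by simp
 qed (use u(1) Wt_rt in blast)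
 have "u \<mu> = 0" if "\<mu> \<in> wts - {\<alpha>}" for \<mu>
  using rt_eq[OF Wt_rt[OF u(1)[of \<mu>]] um[of \<mu>] _ wts_hd x(3)] that by blast
 then have "x = u \<alpha>" unfolding u(2) using fin_wts al by (subst sum.remove[of _ \<alpha>]) auto
 then show ?thesis using u(1)[OF al] by simp
qed

lemma W0_cartan: "cartan_subalg scale br (W 0) H"
 unfolding cartan_subalg_def
proof (intro conjI ballI)
 show "H \<subseteq> W 0" using H_W0 by blast
 show "subspace H" by (rule subspace_H)
 show "br x y \<in> H" if "x \<in> H" "y \<in> H" for x y using H_abelian[OF that] subspace_0[OF subspace_H] by simp
 have "foldr br xs y = 0" if "length xs = 1" "set xs \<subseteq> H" "y \<in> H" for xs y
  using that H_abelian by (cases xs) auto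
 then show "nilpotent_subalg br H" unfolding nilpotent_subalg_def by blast
 show "{x \<in> W 0. \<forall>y\<in>H. br x y \<in> H} = H"
 proof
  show "H \<subseteq> {x \<in> W 0. \<forall>y\<in>H. br x y \<in> H}"
   using H_W0 H_abelian subspace_0[OF subspace_H] by auto
  show "{x \<in> W 0. \<forall>y\<in>H. br x y \<in> H} \<subseteq> H"
  proof
   fix x assume "x \<in> {x \<in> W 0. \<forall>y\<in>H. br x y \<in> H}"
   then have x: "x \<in> W 0" "\<And>y. y \<in> H ==> br x y \<in> H" by blast+
   obtain u where u: "\<And>\<mu>. \<mu> \<in> wts ==> u \<mu> \<in> Wt 0 \<mu>" "x = (\<Sum>\<mu>\<in>wts. u \<mu>)" using W_cases[OF x(1)] by blast
   have z: "u \<mu> = 0" if m: "\<mu> \<in> roots" for \<mu>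
   proof (rule ccontr)
    assume nz: "u \<mu> \<noteq> 0"
    have hm: "hh \<mu> \<in> H" by (rule hh_H[OF root_hd[OF m]])
    have "br x (hh \<mu>) \<in> H" by (rule x(2)[OF hm])
    then have "- br x (hh \<mu>) \<in> H" by (rule subspace_neg[OF subspace_H])
    then have "br (hh \<mu>) x \<in> H" by (simp only: br_anti[of "hh \<mu>" x])
    moreover have "br (hh \<mu>) x = (\<Sum>\<nu>\<in>wts. \<nu> (hh \<mu>) *s u \<nu>)"
     unfolding u(2) br_sum_right by (rule sum.cong[OF refl]) (use Wt_rt[OF u(1)] hm in \<open>simp add: rt_iff\<close>)
    ultimately have s: "(\<Sum>\<nu>\<in>wts. \<nu> (hh \<mu>) *s u \<nu>) \<in> H" by simp
    \<comment> \<open>Bracketing with the coroot doubles the component at \<open>\<mu>\<close>. A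
      subspace stable under \<open>H\<close> contains the weight components of its vectors, so
      \<open>u \<mu>\<close> would lie in \<open>H\<close> and have weight zero.\<close>
    have "\<mu> (hh \<mu>) *s u \<mu> \<in> H"
    proof (rule wt_comp[of H "\<lambda>\<nu>. \<nu> (hh \<mu>) *s u \<nu>", OF subspace_H _ _ s])
     show "br h v \<in> H" if "h \<in> H" "v \<in> H" for h v using H_abelian[OF that] subspace_0[OF subspace_H] by simp
     show "\<nu> (hh \<mu>) *s u \<nu> \<in> rt \<nu>" if "\<nu> \<in> wts" for \<nu> using Wt_rt[OF u(1)[OF that]] by (rule subspace_scale[OF subspace_rt])
    qed (use m in simp)
    then have "2 *s u \<mu> \<in> H" by (simp only: root_hh[OF m])
    then have "inverse 2 *s (2 *s u \<mu>) \<in> H" by (rule subspace_scale[OF subspace_H])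
    then have "u \<mu> \<in> H" by simp
    then have "u \<mu> \<in> rt 0" using H_abelian by (simp add: rt_iff)
    then have "\<mu> = 0" using rt_eq[OF Wt_rt[OF u(1)] _ nz root_hd[OF m] hd_zero] m by simp
    then show False using root_nz[OF m] by simp
   qed
   have "0 \<notin> roots" using root_nz by blast
   then have "x = u 0" unfolding u(2) using finite_roots z by simp
   then show "x \<in> H" using u(1)[of 0] Wt_0_0 by simp
  qed
 qed
qed

lemma UU_0: "UU 0 = {0}"
proof -
 have "w = 0" if w: "w \<in> UU 0" for w
 proof (rule roots_vanish)
  show wH: "w \<in> H" using w G_0 by (simp add: UU_def)
  fix \<alpha> assume a: "\<alpha> \<in> Pi"
  have "br (e \<alpha>) w = 0" using w a by (simp add: UU_def)
  then have "br w (e \<alpha>) = 0" by (rule br_anti_zero)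
  then have "\<alpha> w *s e \<alpha> = 0" using Wt_rt[OF e_Wt[OF Pi_D0[OF a]]] wH by (simp add: rt_iff)
  then show "\<alpha> w = 0" using ef_nz(1)[OF Pi_D0[OF a]] by simp
 qed
 then show ?thesis using subspace_0[OF subspace_UU] by blast
qed

lemma W_0_VV: "W 0 = VV 0"
 using W_split[of 0] unfolding UU_0 by auto

lemma W0_simple: assumes "K \<noteq> {0}" shows "simple_subalg scale br (W 0)"
 unfolding simple_subalg_def
proof (intro conjI ballI allI impI)
 show "subspace (W 0)" by (rule subspace_W)
 show "br x y \<in> W 0" if "x \<in> W 0" "y \<in> W 0" for x y using W_br[OF that] by simp
 obtain \<beta> where "\<beta> \<in> roots" using roots_nonempty[OF assms] by blast
 then obtain \<alpha> where a: "\<alpha> \<in> D0" using sr.D_cases by blast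
 have "br (e \<alpha>) (f \<alpha>) = hh \<alpha>" using ef(3)[OF a] by (simp add: sl2_def)
 then have "br (e \<alpha>) (f \<alpha>) \<noteq> 0" using hh_nz[OF D0_roots[OF a]] by simp
 then show "\<exists>x\<in>W 0. \<exists>y\<in>W 0. br x y \<noteq> 0" using e_W0[OF a] f_W0[OF a] by blast
 fix I assume I: "I \<subseteq> W 0 \<and> subspace I \<and> (\<forall>x\<in>W 0. \<forall>y\<in>I. br x y \<in> I)"
 show "I = {0} \<or> I = W 0" unfolding W_0_VV
  by (rule VV_irreducible) (use I W_0_VV in auto)
qed

lemma roots_0: "{\<alpha>\<in>hd'. \<alpha> \<noteq> 0 \<and> rt \<alpha> \<inter> W 0 \<noteq> {0}} = D0"
proof
 show "D0 \<subseteq> {\<alpha>\<in>hd'. \<alpha> \<noteq> 0 \<and> rt \<alpha> \<inter> W 0 \<noteq> {0}}"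
 proof
  fix \<alpha> assume a: "\<alpha> \<in> D0"
  have "e \<alpha> \<in> rt \<alpha> \<inter> W 0" using Wt_rt[OF e_Wt[OF a]] e_W0[OF a] by blast
  then show "\<alpha> \<in> {\<alpha>\<in>hd'. \<alpha> \<noteq> 0 \<and> rt \<alpha> \<inter> W 0 \<noteq> {0}}"
   using ef_nz(1)[OF a] root_hd[OF D0_roots[OF a]] root_nz[OF D0_roots[OF a]] by blast
 qed
 show "{\<alpha>\<in>hd'. \<alpha> \<noteq> 0 \<and> rt \<alpha> \<inter> W 0 \<noteq> {0}} \<subseteq> D0"
 proof
  fix \<alpha> assume "\<alpha> \<in> {\<alpha>\<in>hd'. \<alpha> \<noteq> 0 \<and> rt \<alpha> \<inter> W 0 \<noteq> {0}}"
  then have a: "\<alpha> \<in> hd'" "\<alpha> \<noteq> 0" "rt \<alpha> \<inter> W 0 \<noteq> {0}" by blast+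
  then obtain x where x: "x \<in> rt \<alpha>" "x \<in> W 0" "x \<noteq> 0"
   using subspace_0[OF subspace_rt] subspace_0[OF subspace_W] by blast
  have "\<alpha> \<in> roots" using rt_zero_or_root[OF x(1) a(1)] x a by blast
  then show "\<alpha> \<in> D0" using supp_Wt0 W_rt[OF x(2,1) a(1)] x(3) by blast
 qed
qed

text \<open>A root outside \<open>D0\<close> is the double of a member of \<open>Dbl\<close>; its
  existence forces type B, with that member a short root.\<close>

lemma roots_enlarged: "roots \<subseteq> enlarged_roots D0"
proof
 fix \<beta> assume b: "\<beta> \<in> roots"
 show "\<beta> \<in> enlarged_roots D0"
 proof (cases "\<beta> \<in> D0")
  case True then show ?thesis by (simp add: enlarged_roots_def)
 next
  case False
  then obtain \<alpha> where al: "\<alpha> \<in> D0" "\<beta> = \<alpha> + \<alpha>" using sr.D_cases[OF b] by blast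
  then have "\<alpha> \<in> sr.Dbl" using b unfolding sr.Dbl_def by blast
  from sr.type_B[OF this] obtain l :: nat and \<epsilon> where l: "1 \<le> l" "\<forall>i<l. \<epsilon> i \<in> roots"
   "\<forall>i<l. \<forall>j<l. i \<noteq> j \<longrightarrow> R (\<epsilon> i) (\<epsilon> j) = 0"
   "D0 = {\<epsilon> i | i. i < l} \<union> {- \<epsilon> i | i. i < l} \<union>
    {\<epsilon> i + \<epsilon> j | i j. i < l \<and> j < l \<and> i \<noteq> j} \<union> {\<epsilon> i - \<epsilon> j | i j. i < l \<and> j < l \<and> i \<noteq> j} \<union>
    {- \<epsilon> i - \<epsilon> j | i j. i < l \<and> j < l \<and> i \<noteq> j}"
   "\<exists>i<l. \<alpha> = \<epsilon> i \<or> \<alpha> = - \<epsilon> i"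
   by (elim exE conjE) (rule that, assumption+, rule exI, rule conjI, assumption+)
  have "type_B_coords D0 l \<epsilon>"
   unfolding type_B_coords_def
  proof (intro conjI allI impI)
   fix c :: "nat \<Rightarrow> 'k" and j assume c: "\<forall>x. (\<Sum>i<l. c i * \<epsilon> i x) = 0" and j: "j < l"
   \<comment> \<open>Evaluation at \<open>tt (\<epsilon> j)\<close> isolates the coefficient
     \<open>c j\<close>, because the \<open>\<epsilon> i\<close> are pairwise orthogonal.\<close>
   have v: "\<epsilon> i (tt (\<epsilon> j)) = (if i = j then \<epsilon> j (tt (\<epsilon> j)) else 0)" if i: "i < l" for i
   proof (cases "i = j")
    case False
    have rij: "\<epsilon> i \<in> roots" "\<epsilon> j \<in> roots" using l(2) i j by blast+
    have "R (\<epsilon> i) (\<epsilon> j) = 0" using l(3) i j False by blast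
    then have "kil (tt (\<epsilon> i)) (tt (\<epsilon> j)) = 0" using kil_R[OF rij] by simp
    then show ?thesis using tt(2)[OF root_hd[OF rij(1)] tt(1)[OF root_hd[OF rij(2)]]] False by simp
   qed simp
   have "0 = (\<Sum>i<l. c i * \<epsilon> i (tt (\<epsilon> j)))" using c by simp
   also have "\<dots> = (\<Sum>i<l. if i = j then c j * \<epsilon> j (tt (\<epsilon> j)) else 0)"
   proof (rule sum.cong[OF refl])
    fix i assume "i \<in> {..<l}"
    then show "c i * \<epsilon> i (tt (\<epsilon> j)) = (if i = j then c j * \<epsilon> j (tt (\<epsilon> j)) else 0)"
     using v[of i] by (cases "i = j") simp_all
   qed
   also have "\<dots> = c j * \<epsilon> j (tt (\<epsilon> j))" using j by simp
   finally show "c j = 0" using root_norm[of "\<epsilon> j"] l(2) j by simp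
  qed (rule l(1), rule l(4))
  moreover have "\<exists>i<l. \<beta> = 2 * \<epsilon> i \<or> \<beta> = - (2 * \<epsilon> i)"
  proof -
   obtain i where i: "i < l" "\<alpha> = \<epsilon> i \<or> \<alpha> = - \<epsilon> i" using l(5) by blast
   have "\<beta> = 2 * \<epsilon> i \<or> \<beta> = - (2 * \<epsilon> i)"
    using i(2) unfolding al(2) mult_2 by (elim disjE) (simp_all only: minus_add_distrib simp_thms)
   then show ?thesis using i(1) by blast
  qed
  ultimately show ?thesis unfolding enlarged_roots_def by blast
 qed
qed

lemma W_A2: "\<exists>U V. submodule scale br (W 0) U \<and> submodule scale br (W 0) V \<and>
  U \<inter> V = {0} \<and> {u + v | u v. u \<in> U \<and> v \<in> V} = W \<kappa> \<and>
  (\<forall>x \<in> W 0. \<forall>u\<in>U. br x u = 0) \<and>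
  (V = {0} \<or> (irreducible_submodule scale br (W 0) V \<and> dim V > 1 \<and>
   {\<alpha> \<in> hd'. rt \<alpha> \<inter> V \<noteq> {0}} \<subseteq> enlarged_roots D0 \<union> {0}))"
proof (rule exI[of _ "UU \<kappa>"], rule exI[of _ "VV \<kappa>"], intro conjI)
 show "submodule scale br (W 0) (UU \<kappa>)"
  unfolding submodule_def using subspace_UU[of \<kappa>] UU_trivial subspace_0[OF subspace_UU] by simp
 show V: "submodule scale br (W 0) (VV \<kappa>)" unfolding submodule_def using subspace_VV VV_stable by blast
 show "\<forall>x\<in>W 0. \<forall>u\<in>UU \<kappa>. br x u = 0" using UU_trivial by blast
 show "VV \<kappa> = {0} \<or> (irreducible_submodule scale br (W 0) (VV \<kappa>) \<and> 1 < dim (VV \<kappa>) \<and>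
   {\<alpha> \<in> hd'. rt \<alpha> \<inter> VV \<kappa> \<noteq> {0}} \<subseteq> enlarged_roots D0 \<union> {0})"
 proof (rule disjCI)
  assume ne: "\<not> (irreducible_submodule scale br (W 0) (VV \<kappa>) \<and> 1 < dim (VV \<kappa>) \<and>
   {\<alpha> \<in> hd'. rt \<alpha> \<inter> VV \<kappa> \<noteq> {0}} \<subseteq> enlarged_roots D0 \<union> {0})"
  show "VV \<kappa> = {0}"
  proof (rule ccontr)
   assume V0: "VV \<kappa> \<noteq> {0}"
   have "irreducible_submodule scale br (W 0) (VV \<kappa>)"
    unfolding irreducible_submodule_def
   proof (intro conjI V V0 allI impI)
    fix M assume M: "M \<subseteq> VV \<kappa> \<and> submodule scale br (W 0) M"
    show "M = {0} \<or> M = VV \<kappa>" by (rule VV_irreducible) (use M in \<open>auto simp: submodule_def\<close>)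
   qed
   moreover have "\<alpha> \<in> enlarged_roots D0 \<union> {0}" if a: "\<alpha> \<in> hd'" "rt \<alpha> \<inter> VV \<kappa> \<noteq> {0}" for \<alpha>
   proof -
    obtain x where "x \<in> rt \<alpha>" "x \<noteq> 0" using a(2) subspace_0[OF subspace_rt] subspace_0[OF subspace_VV] by blast
    then show ?thesis using rt_zero_or_root[OF _ a(1)] roots_enlarged by blast
   qed
   ultimately show False using ne VV_dim[OF V0] by blast
  qed
 qed
qed (rule UU_VV W_split)+

subsection \<open>Endomorphisms that are scalar on the joint eigenspaces\<close>

text \<open>One representative for each residue class of degrees, and non-zero spaces only: over all
  integer degrees every space would be repeated infinitely often and the sum would not be
  direct.\<close>

definition box :: "(('a \<Rightarrow> 'k) \<times> (nat \<Rightarrow> int)) set" where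
 "box = {p\<in>hd' \<times> {l\<in>Zn n. \<forall>i<n. 0 \<le> l i \<and> l i < int (m i)}. G (fst p) (snd p) \<noteq> {0}}"

definition red :: "(nat \<Rightarrow> int) \<Rightarrow> nat \<Rightarrow> int" where
 "red l = (\<lambda>i. if i < n then l i mod int (m i) else 0)"

lemma red_cong: "i < n ==> int (m i) dvd l i - red l i"
 by (simp add: red_def minus_mod_eq_mult_div)

lemma G_red: "G \<alpha> (red l) = G \<alpha> l"
 by (rule G_cong[symmetric]) (rule red_cong)

lemma box_red: "\<alpha> \<in> hd' ==> G \<alpha> l \<noteq> {0} ==> (\<alpha>, red l) \<in> box"
 using m_pos by (auto simp: box_def G_red) (auto simp: red_def Zn_def)

lemma box_decomp: "decomp box (\<lambda>p. G (fst p) (snd p))"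
proof -
 let ?J = "hd' \<times> {l\<in>Zn n. \<forall>i<n. 0 \<le> l i \<and> l i < int (m i)}"
 let ?E = "\<lambda>p. G (fst p) (snd p)"
 define T where "T = Inl ` H \<union> Inr ` {..<n}"
 define opr where "opr = case_sum br \<sigma>"
 define c where "c = (\<lambda>p::('a \<Rightarrow> 'k) \<times> (nat \<Rightarrow> int). case_sum (fst p) (\<lambda>i. \<zeta> (m i) powi snd p i))"
 have rb: "red l \<in> {l\<in>Zn n. \<forall>i<n. 0 \<le> l i \<and> l i < int (m i)}" for l
  using m_pos by (auto simp: red_def Zn_def)
 have "decomp {p\<in>?J. ?E p \<noteq> {0}} ?E"
 proof (rule decomp_exists(2))
  show "x \<in> span (\<Union>p\<in>?J. ?E p)" for x
  proof -
   have "(\<Union>p\<in>hd' \<times> Zn n. ?E p) \<subseteq> (\<Union>p\<in>?J. ?E p)"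
   proof
    fix y assume "y \<in> (\<Union>p\<in>hd' \<times> Zn n. ?E p)"
    then obtain \<alpha> l where "\<alpha> \<in> hd'" "y \<in> G \<alpha> l" by auto
    then show "y \<in> (\<Union>p\<in>?J. ?E p)" using rb[of l] by (intro UN_I[of "(\<alpha>, red l)"]) (auto simp: G_red)
   qed
   then show ?thesis using G_span[of x] span_mono by blast
  qed
  fix I u p assume I: "finite I" "I \<subseteq> ?J" "\<And>p. p \<in> I ==> u p \<in> ?E p" "(\<Sum>p\<in>I. u p) = 0" "p \<in> I"
  have "u p \<in> {0}"
  proof (rule jeig_comp[of T opr "{0}" I c u p])
   show "lin (opr t)" if "t \<in> T" for t using that lin_br sig_lin by (auto simp: T_def opr_def)
   show "opr t x \<in> {0}" if "t \<in> T" "x \<in> {0}" for t x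
    using that by (auto simp: T_def opr_def lin_zero sig_lin)
   show "u q \<in> jeig T opr (c q)" if "q \<in> I" for q
    using I(3)[OF that] by (auto simp: jeig_def T_def opr_def c_def G_def rt_iff tw_iff)
   fix q r assume qr: "q \<in> I" "r \<in> I" "q \<noteq> r"
   show "\<exists>t\<in>T. c q t \<noteq> c r t"
   proof (rule ccontr)
    assume "\<not> ?thesis"
    then have eq: "c q t = c r t" if "t \<in> T" for t using that by blast
    have J: "q \<in> ?J" "r \<in> ?J" using qr I(2) by blast+
    have "fst q = fst r"
     by (rule hd_eqI) (use J eq[of "Inl _"] in \<open>auto simp: T_def c_def\<close>)
    moreover have "snd q = snd r"
    proof
     fix i
     show "snd q i = snd r i"
     proof (cases "i < n")
      case False then show ?thesis using J by (auto simp: Zn_def)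
     next
      case True
      have "\<zeta> (m i) powi snd q i = \<zeta> (m i) powi snd r i" using eq[of "Inr i"] True by (simp add: T_def c_def)
      then have "\<zeta> (m i) powi (snd q i - snd r i) = 1" using zeta_nz[OF m_pos[OF True]] by (simp add: power_int_diff)
      then have "int (m i) dvd snd q i - snd r i" using zeta_powi_1[OF m_pos[OF True]] by simp
      moreover have "0 \<le> snd q i \<and> snd q i < int (m i)" "0 \<le> snd r i \<and> snd r i < int (m i)" using J True by auto
      ultimately show ?thesis by (metis mod_eq_dvd_iff mod_pos_pos_trivial)
     qed
    qed
    ultimately show False using qr(3) by (simp add: prod_eq_iff)
   qed
  qed (use I in auto)
  then show "u p = 0" by simp
 qed (rule subspace_G)
 then show ?thesis by (simp add: box_def)
qed

text \<open>Congruent degrees give the same space, so a scalar depending on the degree is well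
  defined exactly when it depends on the residues; this is the hypothesis on
  \<open>c\<close>.\<close>

lemma scalar_exists:
 assumes "\<And>\<alpha> l l'. l \<in> Zn n ==> l' \<in> Zn n ==> (\<And>i. i < n ==> int (m i) dvd l i - l' i) ==> c \<alpha> l = c \<alpha> l'"
 shows "\<exists>\<tau>. lin \<tau> \<and> (\<forall>\<alpha>\<in>hd'. \<forall>l\<in>Zn n. \<forall>x\<in>G \<alpha> l. \<tau> x = c \<alpha> l *s x)"
proof (intro exI conjI ballI allI)
 let ?\<tau> = "gscale box (\<lambda>p. G (fst p) (snd p)) (\<lambda>p. c (fst p) (snd p))"
 show lt: "lin ?\<tau>" by (rule lin_gscale[OF box_decomp])
 fix \<alpha> l x assume x: "\<alpha> \<in> hd'" "x \<in> G \<alpha> l" and l: "l \<in> Zn n"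
 show "?\<tau> x = c \<alpha> l *s x"
 proof (cases "x = 0")
  case True then show ?thesis by (simp add: lin_zero[OF lt])
 next
  case False
  then have "(\<alpha>, red l) \<in> box" using box_red[OF x(1), of l] x(2) by blast
  then have "?\<tau> x = c \<alpha> (red l) *s x" using gscale_on[OF box_decomp, of "(\<alpha>, red l)" x] x(2) by (simp add: G_red)
  also have "c \<alpha> (red l) = c \<alpha> l"
   by (rule assms[symmetric, OF l]) (simp add: red_def Zn_def, rule red_cong)
  finally show ?thesis .
 qed
qed

lemma scalar_comp:
 assumes "\<And>i. i \<in> S ==> lin (\<tau> i) \<and> (\<forall>p\<in>box. \<forall>x\<in>G (fst p) (snd p). \<tau> i x = c i p *s x)"
  and "\<And>i. i \<in> S ==> \<tau> i x = a i *s x"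
 obtains u where "\<And>p. p \<in> box ==> u p \<in> G (fst p) (snd p)" "x = (\<Sum>p\<in>box. u p)"
  "\<And>p i. p \<in> box ==> i \<in> S ==> u p = 0 \<or> c i p = a i"
proof -
 let ?E = "\<lambda>p. G (fst p) (snd p)"
 obtain u where u: "\<forall>p\<in>box. u p \<in> ?E p" "x = (\<Sum>p\<in>box. u p)"
  using box_decomp unfolding decomp_def by blast
 have "c i p = a i" if p: "p \<in> box" and t: "i \<in> S" "u p \<noteq> 0" for p i
 proof -
  have lt: "lin (\<tau> i)" and on: "\<And>p x. p \<in> box ==> x \<in> ?E p ==> \<tau> i x = c i p *s x" using assms(1)[OF t(1)] by blast+
  have "(\<Sum>p\<in>box. c i p *s u p) = \<tau> i x" unfolding u(2) lin_sum[OF lt] by (rule sum.cong[OF refl]) (use on u(1) in simp)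
  also have "\<dots> = (\<Sum>p\<in>box. a i *s u p)" using assms(2)[OF t(1)] u(2) by (simp add: scale_sum_right)
  finally have "c i p *s u p = a i *s u p"
   by (intro decomp_unique[OF box_decomp, of "\<lambda>p. c i p *s u p" "\<lambda>p. a i *s u p"])
    (use u(1) p subspace_scale[OF subspace_G] in auto)
  then show ?thesis using t(2) by simp
 qed
 then show ?thesis using that u by blast
qed

end

subsection \<open>Stacked bases\<close>
lemma lat_zero: "0 \<in> Zn k" and lat_neg: "l \<in> Zn k ==> - l \<in> Zn k" and
 lat_add: "l \<in> Zn k ==> l' \<in> Zn k ==> l + l' \<in> Zn k" and
 lat_diff: "l \<in> Zn k ==> l' \<in> Zn k ==> l - l' \<in> Zn k"
 by (auto simp: Zn_def)

definition lat_hom :: "nat \<Rightarrow> ((nat \<Rightarrow> int) \<Rightarrow> nat \<Rightarrow> int) \<Rightarrow> bool" where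
 "lat_hom k \<theta> \<longleftrightarrow> (\<forall>x\<in>Zn k. \<forall>y\<in>Zn k. \<theta> (x - y) = \<theta> x - \<theta> y)"

lemma lat_hom_diff: "lat_hom k \<theta> ==> x \<in> Zn k ==> y \<in> Zn k ==> \<theta> (x - y) = \<theta> x - \<theta> y"
 by (simp add: lat_hom_def)

lemma lat_hom_0: "lat_hom k \<theta> ==> \<theta> 0 = 0"
 using lat_hom_diff[of k \<theta> 0 0] lat_zero by simp

lemma lat_hom_neg: "lat_hom k \<theta> ==> x \<in> Zn k ==> \<theta> (- x) = - \<theta> x"
 using lat_hom_diff[of k \<theta> 0 x] lat_zero lat_hom_0[of k \<theta>] by simp

lemma lat_hom_add: "lat_hom k \<theta> ==> x \<in> Zn k ==> y \<in> Zn k ==> \<theta> (x + y) = \<theta> x + \<theta> y"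
 using lat_hom_diff[of k \<theta> x "- y"] lat_hom_neg[of k \<theta> y] lat_neg[of y k] by simp

lemma of_nat_lat: "x \<in> Zn k ==> of_nat N * x \<in> Zn k"
 by (induction N) (auto simp: lat_zero distrib_right intro: lat_add)

lemma lat_hom_of_nat: "lat_hom k \<theta> ==> x \<in> Zn k ==> \<theta> (of_nat N * x) = of_nat N * \<theta> x"
proof (induction N)
 case 0 show ?case by (simp only: of_nat_0 mult_zero_left lat_hom_0[OF 0(1)])
next
 case (Suc N)
 show ?case
  by (simp only: of_nat_Suc distrib_right mult_1 lat_hom_add[OF Suc.prems of_nat_lat[OF Suc.prems(2)]] Suc.IH[OF Suc.prems])
qed

definition lat_aut :: "nat \<Rightarrow> ((nat \<Rightarrow> int) \<Rightarrow> nat \<Rightarrow> int) \<Rightarrow> bool" where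
 "lat_aut k \<theta> \<longleftrightarrow> bij_betw \<theta> (Zn k) (Zn k) \<and> lat_hom k \<theta>"

lemma lat_autD: "lat_aut k \<theta> ==> lat_hom k \<theta>" "lat_aut k \<theta> ==> x \<in> Zn k ==> \<theta> x \<in> Zn k"
 by (auto simp: lat_aut_def bij_betw_def)

lemma lat_aut_comp: "lat_aut k \<theta> ==> lat_aut k \<psi> ==> lat_aut k (\<lambda>x. \<theta> (\<psi> x))"
 using bij_betw_trans[of \<psi> "Zn k" "Zn k" \<theta> "Zn k"] lat_autD(2)[of k \<psi>]
 by (auto simp: lat_aut_def lat_hom_def o_def)

text \<open>Shears, swaps with the last coordinate and extensions from one coordinate fewer are the
  moves of the Euclidean algorithm behind \<open>stacked_basis\<close>.\<close>

definition shear :: "nat \<Rightarrow> (nat \<Rightarrow> int) \<Rightarrow> (nat \<Rightarrow> int) \<Rightarrow> nat \<Rightarrow> int" where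
 "shear k c x = (\<lambda>i. if i < k then x i + c i * x k else x i)"

lemma lat_aut_shear: "lat_aut (Suc k) (shear k c)"
 unfolding lat_aut_def
proof
 show "bij_betw (shear k c) (Zn (Suc k)) (Zn (Suc k))"
  by (rule bij_betwI[where g = "shear k (- c)"]) (auto simp: shear_def Zn_def)
 show "lat_hom (Suc k) (shear k c)"
  unfolding lat_hom_def by (auto simp: shear_def algebra_simps fun_eq_iff)
qed

lemma lat_aut_swap: "j \<le> k ==> lat_aut (Suc k) (\<lambda>x. x(j := x k, k := x j))"
 unfolding lat_aut_def
proof
 assume j: "j \<le> k"
 show "bij_betw (\<lambda>x. x(j := x k, k := x j)) (Zn (Suc k)) (Zn (Suc k))"
  by (rule bij_betwI[where g = "\<lambda>x. x(j := x k, k := x j)"]) (use j in \<open>auto simp: Zn_def fun_eq_iff\<close>)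
 show "lat_hom (Suc k) (\<lambda>x. x(j := x k, k := x j))"
  unfolding lat_hom_def by (auto simp: fun_eq_iff)
qed

lemma lat_aut_extend:
 assumes t: "lat_aut k \<theta>" shows "lat_aut (Suc k) (\<lambda>x. (\<theta> (x(k := 0)))(k := x k))"
 unfolding lat_aut_def
proof
 have b: "bij_betw \<theta> (Zn k) (Zn k)" and h: "lat_hom k \<theta>" using t by (auto simp: lat_aut_def)
 have z: "x(k := 0) \<in> Zn k" if "x \<in> Zn (Suc k)" for x using that by (auto simp: Zn_def)
 let ?\<psi> = "inv_into (Zn k) \<theta>"
 have i: "?\<psi> (\<theta> x) = x" "\<theta> (?\<psi> x) = x" "\<theta> x \<in> Zn k" "?\<psi> x \<in> Zn k" if "x \<in> Zn k" for x
  using b that bij_betw_inv_into_left bij_betw_inv_into_right bij_betw_apply bij_betw_inv_into by metis+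
 have r: "y(k := 0) = y" if "y \<in> Zn k" for y using that by (auto simp: Zn_def)
 have e: "y(k := c) \<in> Zn (Suc k)" if "y \<in> Zn k" for y c using that by (auto simp: Zn_def)
 show "bij_betw (\<lambda>x. (\<theta> (x(k := 0)))(k := x k)) (Zn (Suc k)) (Zn (Suc k))"
 proof (rule bij_betwI[where g = "\<lambda>x. (?\<psi> (x(k := 0)))(k := x k)"])
  show "(?\<psi> ((\<theta> (x(k := 0)))(k := x k, k := 0)))(k := ((\<theta> (x(k := 0)))(k := x k)) k) = x"
   if "x \<in> Zn (Suc k)" for x using i[OF z[OF that]] r by simp
  show "(\<theta> ((?\<psi> (x(k := 0)))(k := x k, k := 0)))(k := ((?\<psi> (x(k := 0)))(k := x k)) k) = x"
   if "x \<in> Zn (Suc k)" for x using i[OF z[OF that]] r by simp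
 qed (use i z e in auto)
 show "lat_hom (Suc k) (\<lambda>x. (\<theta> (x(k := 0)))(k := x k))"
  unfolding lat_hom_def
 proof (intro ballI)
  fix x y :: "nat \<Rightarrow> int" assume xy: "x \<in> Zn (Suc k)" "y \<in> Zn (Suc k)"
  have "(x - y)(k := 0) = x(k := 0) - y(k := 0)" by (auto simp: fun_eq_iff)
  then have "\<theta> ((x - y)(k := 0)) = \<theta> (x(k := 0)) - \<theta> (y(k := 0))"
   using lat_hom_diff[OF h z[OF xy(1)] z[OF xy(2)]] by simp
  then show "(\<theta> ((x - y)(k := 0)))(k := (x - y) k) =
    (\<theta> (x(k := 0)))(k := x k) - (\<theta> (y(k := 0)))(k := y k)"
   by (simp add: fun_eq_iff)
 qed
qed

text \<open>The largest invariant factor that can occur is the least positive last coordinate of an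
 element of \<open>\<Gamma>\<close>, over all bases of the lattice.\<close>

lemma stacked_basis:
 assumes "0 \<in> \<Gamma>" "\<And>x y. x \<in> \<Gamma> ==> y \<in> \<Gamma> ==> x - y \<in> \<Gamma>" "0 < (N::nat)" "\<And>x. x \<in> Zn k ==> of_nat N * x \<in> \<Gamma>"
 shows "\<exists>\<theta> d. lat_aut k \<theta> \<and> (\<forall>i<k. 0 < (d i :: nat)) \<and> (\<forall>l\<in>Zn k. \<theta> l \<in> \<Gamma> \<longleftrightarrow> (\<forall>i<k. int (d i) dvd l i))"
 using assms
proof (induction k arbitrary: \<Gamma>)
 case 0
 have "Zn 0 = {0}" by (auto simp: Zn_def)
 then show ?case using 0(1) by (intro exI[of _ id] exI[of _ "\<lambda>_. 1"]) (auto simp: lat_aut_def lat_hom_def)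
next
 case (Suc k)
 note G = Suc.prems
 define unit where "unit = (\<lambda>c::int. (\<lambda>_. 0)(k := c))"
 have uZ: "unit c \<in> Zn (Suc k)" for c by (auto simp: unit_def Zn_def)
 have Zs: "x \<in> Zn (Suc k)" if "x \<in> Zn k" for x using that by (auto simp: Zn_def)
 have Gneg: "- x \<in> \<Gamma>" if "x \<in> \<Gamma>" for x using G(2)[OF G(1) that] by (simp only: diff_0)
 have Gadd: "x + y \<in> \<Gamma>" if "x \<in> \<Gamma>" "y \<in> \<Gamma>" for x y using G(2)[OF that(1) Gneg[OF that(2)]] by (simp only: diff_minus_eq_add)
 define P where "P d \<longleftrightarrow> 0 < d \<and> (\<exists>\<theta> l. lat_aut (Suc k) \<theta> \<and> l \<in> Zn (Suc k) \<and> \<theta> l \<in> \<Gamma> \<and> l k = int d)" for d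
 have idA: "lat_aut (Suc k) id" by (auto simp: lat_aut_def lat_hom_def)
 have "of_nat N * unit 1 \<in> \<Gamma>" by (rule G(4)[OF uZ])
 moreover have "(of_nat N * unit 1) k = int N" by (simp add: unit_def of_nat_fun_apply)
 ultimately have "P N" unfolding P_def using G(3) idA of_nat_lat[OF uZ, of N 1]
  by (intro conjI exI[of _ id] exI[of _ "of_nat N * unit 1"]) simp_all
 define d where "d = (LEAST d. P d)"
 have Pd: "P d" unfolding d_def using \<open>P N\<close> by (rule LeastI)
 have least: "\<not> P r" if "r < d" for r using that unfolding d_def by (rule not_less_Least)
 have d0: "0 < d" using Pd by (simp add: P_def)
 have not_less: False if "lat_aut (Suc k) \<theta>" "l \<in> Zn (Suc k)" "\<theta> l \<in> \<Gamma>" "0 < l k" "l k < int d" for \<theta> l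
 proof -
  have "P (nat (l k))" unfolding P_def using that by auto
  then show False using least[of "nat (l k)"] that by (simp add: nat_less_iff)
 qed
 from Pd obtain \<theta> l where tl: "lat_aut (Suc k) \<theta>" "l \<in> Zn (Suc k)" "\<theta> l \<in> \<Gamma>" "l k = int d"
  unfolding P_def by blast
 have dv: "int d dvd l j" if j: "j < k" for j
 proof (rule ccontr)
  assume nd: "\<not> int d dvd l j"
  \<comment> \<open>Euclidean step: the shear leaves the remainder of \<open>l j\<close> modulo
    \<open>d\<close> at \<open>j\<close>, and the swap makes it the last coordinate, against the
    minimality of \<open>d\<close>.\<close>
  let ?q = "\<lambda>i. if i = j then l j div int d else 0"
  let ?sw = "\<lambda>x::nat\<Rightarrow>int. x(j := x k, k := x j)"
  let ?l = "?sw (shear k (- ?q) l)"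
  have sw: "lat_aut (Suc k) ?sw" using j by (intro lat_aut_swap) simp
  have A: "lat_aut (Suc k) (\<lambda>x. \<theta> (shear k ?q (?sw x)))"
   by (rule lat_aut_comp[OF tl(1) lat_aut_comp[OF lat_aut_shear sw]])
  have "shear k ?q (?sw ?l) = l" using j by (auto simp: shear_def fun_eq_iff)
  then have 1: "\<theta> (shear k ?q (?sw ?l)) \<in> \<Gamma>" using tl(3) by simp
  have 2: "?l \<in> Zn (Suc k)" by (intro lat_autD(2)[OF sw] lat_autD(2)[OF lat_aut_shear] tl)
  have lk: "?l k = l j mod int d" using j tl(4) by (simp add: shear_def minus_div_mult_eq_mod)
  have 3: "0 < l j mod int d" using nd d0 pos_mod_sign[of "int d" "l j"] mod_eq_0_iff_dvd[of "l j" "int d"] by linarith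
  have 4: "l j mod int d < int d" using d0 by simp
  show False
  proof (rule not_less[of "\<lambda>x. \<theta> (shear k ?q (?sw x))" ?l])
   show "0 < ?l k" using 3 by (simp only: lk)
   show "?l k < int d" using 4 by (simp only: lk)
  qed (rule A, rule 2, rule 1)
 qed
 \<comment> \<open>In this basis \<open>l\<close> becomes \<open>d\<close> times the last unit
   vector, so \<open>\<Gamma>\<close> splits into its last coordinate and the part
   \<open>\<Gamma>'\<close> on the first \<open>k\<close> coordinates.\<close>
 define \<phi> where "\<phi> = (\<lambda>x. \<theta> (shear k (\<lambda>i. l i div int d) x))"
 have pA: "lat_aut (Suc k) \<phi>" unfolding \<phi>_def by (rule lat_aut_comp[OF tl(1) lat_aut_shear])
 note pH = lat_autD(1)[OF pA]
 have "shear k (\<lambda>i. l i div int d) (unit (int d)) = l"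
  using dv tl(2,4) by (auto simp: shear_def unit_def Zn_def fun_eq_iff not_less_eq_eq le_Suc_eq not_less)
 then have ug: "\<phi> (unit (int d)) \<in> \<Gamma>" using tl(3) by (simp add: \<phi>_def)
 have mult: "\<phi> (unit (int d * int q)) \<in> \<Gamma>" for q
 proof (induction q)
  case 0
  have "unit 0 = 0" by (rule ext) (simp add: unit_def)
  then show ?case using G(1) by (simp only: lat_hom_0[OF pH] of_nat_0 mult_zero_right)
 next
  case (Suc q)
  have "unit (int d * int (Suc q)) = unit (int d) + unit (int d * int q)"
   by (auto simp: unit_def fun_eq_iff algebra_simps)
  then show ?case using Gadd[OF ug Suc] by (simp only: lat_hom_add[OF pH uZ uZ])
 qed
 have umult: "\<phi> (unit c) \<in> \<Gamma>" if cd: "int d dvd c" for c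
 proof -
  obtain z where z: "c = int d * z" using cd by (elim dvdE)
  show ?thesis
  proof (cases z rule: int_cases2)
   case (nonneg q) then show ?thesis using mult[of q] z by simp
  next
   case (nonpos q)
   have "unit c = - unit (int d * int q)" using z nonpos by (auto simp: unit_def fun_eq_iff)
   then show ?thesis using Gneg[OF mult[of q]] by (simp only: lat_hom_neg[OF pH uZ])
  qed
 qed
 have kdv: "int d dvd x k" if x: "x \<in> Zn (Suc k)" "\<phi> x \<in> \<Gamma>" for x
 proof (rule ccontr)
  assume nd: "\<not> int d dvd x k"
  let ?x = "x - unit (int d * (x k div int d))"
  have "\<phi> ?x \<in> \<Gamma>" unfolding lat_hom_diff[OF pH x(1) uZ] by (rule G(2)[OF x(2) umult]) simp
  moreover have "?x \<in> Zn (Suc k)" by (intro lat_diff x uZ)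
  moreover have "?x k = x k mod int d" by (simp add: unit_def minus_mult_div_eq_mod)
  moreover have "0 < x k mod int d" using nd d0 pos_mod_sign[of "int d" "x k"] mod_eq_0_iff_dvd[of "x k" "int d"] by linarith
  moreover have "x k mod int d < int d" using d0 by simp
  ultimately show False using not_less[OF pA, of ?x] by simp
 qed
 define \<Gamma>' where "\<Gamma>' = {x\<in>Zn k. \<phi> x \<in> \<Gamma>}"
 have "\<exists>\<theta> d. lat_aut k \<theta> \<and> (\<forall>i<k. 0 < (d i :: nat)) \<and> (\<forall>l\<in>Zn k. \<theta> l \<in> \<Gamma>' \<longleftrightarrow> (\<forall>i<k. int (d i) dvd l i))"
 proof (rule Suc.IH)
  show "0 \<in> \<Gamma>'" using G(1) lat_zero unfolding \<Gamma>'_def by (simp only: mem_Collect_eq lat_hom_0[OF pH] simp_thms)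
  show "x - y \<in> \<Gamma>'" if "x \<in> \<Gamma>'" "y \<in> \<Gamma>'" for x y
   using that G(2) lat_diff lat_hom_diff[OF pH Zs Zs, of x y] unfolding \<Gamma>'_def mem_Collect_eq by (metis (no_types))
  show "of_nat N * x \<in> \<Gamma>'" if "x \<in> Zn k" for x
   unfolding \<Gamma>'_def mem_Collect_eq lat_hom_of_nat[OF pH Zs[OF that]]
   by (intro conjI of_nat_lat that G(4) lat_autD(2)[OF pA] Zs)
 qed (rule G(3))
 then obtain \<psi> d' where T: "lat_aut k \<psi> \<and> (\<forall>i<k. 0 < (d' i :: nat)) \<and> (\<forall>l\<in>Zn k. \<psi> l \<in> \<Gamma>' \<longleftrightarrow> (\<forall>i<k. int (d' i) dvd l i))" by (elim exE) (rule that)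
 note psi = conjunct1[OF T] conjunct1[OF conjunct2[OF T], rule_format] conjunct2[OF conjunct2[OF T], rule_format]
 let ?ex = "\<lambda>x. (\<psi> (x(k := 0)))(k := x k)"
 have "\<phi> (?ex l) \<in> \<Gamma> \<longleftrightarrow> (\<forall>i<Suc k. int ((d'(k := d)) i) dvd l i)" if l: "l \<in> Zn (Suc k)" for l
 proof -
  have z: "l(k := 0) \<in> Zn k" using l by (auto simp: Zn_def)
  note pz = lat_autD(2)[OF psi(1) z]
  have "?ex l = \<psi> (l(k := 0)) + unit (l k)" using pz by (auto simp: unit_def fun_eq_iff Zn_def)
  then have e: "\<phi> (?ex l) = \<phi> (\<psi> (l(k := 0))) + \<phi> (unit (l k))" by (simp only: lat_hom_add[OF pH Zs[OF pz] uZ])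
  have exZ: "?ex l \<in> Zn (Suc k)" by (rule lat_autD(2)[OF lat_aut_extend[OF psi(1)] l])
  have "\<phi> (?ex l) \<in> \<Gamma> \<longleftrightarrow> \<phi> (\<psi> (l(k := 0))) \<in> \<Gamma> \<and> int d dvd l k"
  proof
   assume g: "\<phi> (?ex l) \<in> \<Gamma>"
   have dk: "int d dvd l k" using kdv[OF exZ g] by simp
   have "\<phi> (?ex l) - \<phi> (unit (l k)) \<in> \<Gamma>" by (rule G(2)[OF g umult[OF dk]])
   then show "\<phi> (\<psi> (l(k := 0))) \<in> \<Gamma> \<and> int d dvd l k" using dk unfolding e by (simp only: add_diff_cancel_right')
  next
   assume "\<phi> (\<psi> (l(k := 0))) \<in> \<Gamma> \<and> int d dvd l k"
   then show "\<phi> (?ex l) \<in> \<Gamma>" unfolding e using Gadd umult by blast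
  qed
  also have "\<phi> (\<psi> (l(k := 0))) \<in> \<Gamma> \<longleftrightarrow> (\<forall>i<k. int (d' i) dvd l i)"
   using psi(3)[OF z] pz by (simp add: \<Gamma>'_def)
  also have "(\<forall>i<k. int (d' i) dvd l i) \<and> int d dvd l k \<longleftrightarrow> (\<forall>i<Suc k. int ((d'(k := d)) i) dvd l i)"
   by (auto simp: less_Suc_eq)
  finally show ?thesis .
 qed
 moreover have "lat_aut (Suc k) (\<lambda>x. \<phi> (?ex x))" by (rule lat_aut_comp[OF pA lat_aut_extend[OF psi(1)]])
 moreover have "\<forall>i<Suc k. 0 < (d'(k := d)) i" using psi(2) d0 by (auto simp: less_Suc_eq)
 ultimately show ?case by (intro exI[of _ "\<lambda>x. \<phi> (?ex x)"] exI[of _ "d'(k := d)"]) blast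
qed

text \<open>\<open>stacked_basis\<close> is applied twice: the first time it yields a basis of
  \<open>M\<close>, the second time it adapts this basis to \<open>\<Gamma>\<close> inside
  \<open>M\<close>. The \<open>N\<close>-fold multiples bound the index of both lattices.\<close>

lemma lattice_frame:
 assumes M: "0 \<in> M" "\<And>x y. x \<in> M ==> y \<in> M ==> x - y \<in> M" "M \<subseteq> Zn k"
  and \<Gamma>: "0 \<in> \<Gamma>" "\<And>x y. x \<in> \<Gamma> ==> y \<in> \<Gamma> ==> x - y \<in> \<Gamma>" "\<Gamma> \<subseteq> M"
  and N: "0 < (N::nat)" "\<And>x. x \<in> Zn k ==> of_nat N * x \<in> \<Gamma>"
 shows "\<exists>\<theta> d. bij_betw \<theta> (Zn k) M \<and> lat_hom k \<theta> \<and> (\<forall>i<k. 0 < (d i :: nat)) \<and>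
  (\<forall>l\<in>Zn k. \<theta> l \<in> \<Gamma> \<longleftrightarrow> (\<forall>i<k. int (d i) dvd l i))"
proof -
 have "\<exists>\<theta> d. lat_aut k \<theta> \<and> (\<forall>i<k. 0 < (d i :: nat)) \<and> (\<forall>l\<in>Zn k. \<theta> l \<in> M \<longleftrightarrow> (\<forall>i<k. int (d i) dvd l i))"
  by (rule stacked_basis[OF M(1,2) N(1)]) (use N(2) \<Gamma>(3) in blast)+
 then obtain \<theta> d where T: "lat_aut k \<theta> \<and> (\<forall>i<k. 0 < (d i :: nat)) \<and> (\<forall>l\<in>Zn k. \<theta> l \<in> M \<longleftrightarrow> (\<forall>i<k. int (d i) dvd l i))" by (elim exE) (rule that)
 note t = conjunct1[OF T] conjunct1[OF conjunct2[OF T], rule_format] conjunct2[OF conjunct2[OF T], rule_format]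
 define D where "D = (\<lambda>(l::nat \<Rightarrow> int) i. if i < k then int (d i) * l i else 0)"
 have DZ: "D l \<in> Zn k" for l by (auto simp: D_def Zn_def)
 have Dd: "D (x - y) = D x - D y" for x y by (auto simp: D_def fun_eq_iff algebra_simps)
 define \<phi> where "\<phi> = (\<lambda>l. \<theta> (D l))"
 have pH: "lat_hom k \<phi>" unfolding lat_hom_def \<phi>_def
  by (simp add: Dd lat_hom_diff[OF lat_autD(1)[OF t(1)] DZ DZ])
 have tb: "bij_betw \<theta> (Zn k) (Zn k)" using t(1) by (simp add: lat_aut_def)
 have pb: "bij_betw \<phi> (Zn k) M"
 proof (rule bij_betw_imageI)
  show "inj_on \<phi> (Zn k)"
  proof (rule inj_onI)
   fix x y assume xy: "x \<in> Zn k" "y \<in> Zn k" "\<phi> x = \<phi> y"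
   have D: "D x = D y" using tb DZ xy(3) by (auto simp: \<phi>_def bij_betw_def dest: inj_onD)
   show "x = y"
   proof
    fix i show "x i = y i"
     using fun_cong[OF D, of i] t(2)[of i] xy(1,2) by (cases "i < k") (auto simp: D_def Zn_def)
   qed
  qed
  show "\<phi> ` Zn k = M"
  proof
   show "\<phi> ` Zn k \<subseteq> M" using t(3)[OF DZ] by (auto simp: \<phi>_def D_def)
   show "M \<subseteq> \<phi> ` Zn k"
   proof
    fix x assume x: "x \<in> M"
    then obtain l where l: "l \<in> Zn k" "x = \<theta> l" using tb M(3) by (auto simp: bij_betw_def)
    have dv: "\<forall>i<k. int (d i) dvd l i" using t(3)[OF l(1)] x l(2) by simp
    have D: "D (\<lambda>i. if i < k then l i div int (d i) else 0) = l" using dv l(1) by (auto simp: D_def fun_eq_iff Zn_def)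
    show "x \<in> \<phi> ` Zn k"
     by (rule image_eqI[of _ _ "\<lambda>i. if i < k then l i div int (d i) else 0"]) (simp add: \<phi>_def D l(2), simp add: Zn_def)
   qed
  qed
 qed
 have "\<exists>\<psi> d'. lat_aut k \<psi> \<and> (\<forall>i<k. 0 < (d' i :: nat)) \<and>
   (\<forall>l\<in>Zn k. \<psi> l \<in> {x\<in>Zn k. \<phi> x \<in> \<Gamma>} \<longleftrightarrow> (\<forall>i<k. int (d' i) dvd l i))"
 proof (rule stacked_basis[OF _ _ N(1)])
  show "0 \<in> {x\<in>Zn k. \<phi> x \<in> \<Gamma>}" using \<Gamma>(1) lat_zero by (simp only: mem_Collect_eq lat_hom_0[OF pH] simp_thms)
  show "x - y \<in> {x\<in>Zn k. \<phi> x \<in> \<Gamma>}" if "x \<in> {x\<in>Zn k. \<phi> x \<in> \<Gamma>}" "y \<in> {x\<in>Zn k. \<phi> x \<in> \<Gamma>}" for x y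
   using that \<Gamma>(2) lat_diff lat_hom_diff[OF pH, of x y] unfolding mem_Collect_eq by (metis (no_types))
  show "of_nat N * x \<in> {x\<in>Zn k. \<phi> x \<in> \<Gamma>}" if x: "x \<in> Zn k" for x
  proof -
   have "\<phi> x \<in> Zn k" using pb x M(3) by (auto simp: bij_betw_def)
   then show ?thesis unfolding mem_Collect_eq lat_hom_of_nat[OF pH x] by (intro conjI of_nat_lat x N(2))
  qed
 qed
 then obtain \<psi> d' where T: "lat_aut k \<psi> \<and> (\<forall>i<k. 0 < (d' i :: nat)) \<and> (\<forall>l\<in>Zn k. \<psi> l \<in> {x\<in>Zn k. \<phi> x \<in> \<Gamma>} \<longleftrightarrow> (\<forall>i<k. int (d' i) dvd l i))" by (elim exE) (rule that)
 note p = conjunct1[OF T] conjunct1[OF conjunct2[OF T], rule_format] conjunct2[OF conjunct2[OF T], rule_format]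
 have "bij_betw (\<lambda>l. \<phi> (\<psi> l)) (Zn k) M"
  using bij_betw_trans[OF _ pb, of \<psi> "Zn k"] p(1) by (simp add: lat_aut_def o_def)
 moreover have "lat_hom k (\<lambda>l. \<phi> (\<psi> l))"
  using lat_hom_diff[OF pH lat_autD(2)[OF p(1)] lat_autD(2)[OF p(1)]] lat_hom_diff[OF lat_autD(1)[OF p(1)]]
  by (simp add: lat_hom_def)
 moreover have "\<forall>l\<in>Zn k. \<phi> (\<psi> l) \<in> \<Gamma> \<longleftrightarrow> (\<forall>i<k. int (d' i) dvd l i)"
  using p(3) lat_autD(2)[OF p(1)] by simp
 ultimately show ?thesis using p(2) by (intro exI[of _ "\<lambda>l. \<phi> (\<psi> l)"] exI[of _ d']) blast
qed

context mloop begin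

subsection \<open>The multiloop torus\<close>

definition sup0 :: "(nat \<Rightarrow> int) set" where
 "sup0 = {\<kappa>\<in>Zn n. \<exists>\<mu>\<in>wts. Wt \<kappa> \<mu> \<noteq> {0}}"

abbreviation M :: "(nat \<Rightarrow> int) set" where "M \<equiv> gen_subgroup sup0"

abbreviation \<Gamma>0 :: "(nat \<Rightarrow> int) set" where "\<Gamma>0 \<equiv> {l\<in>Zn n. \<forall>i<n. int (m i) dvd l i}"

lemma M_Zn: "\<kappa> \<in> M ==> \<kappa> \<in> Zn n"
 by (induction rule: gen_subgroup.induct) (rule Zn_zero, simp add: sup0_def, rule Zn_diff)

lemma supM: "x \<in> G \<alpha> l ==> x \<noteq> 0 ==> \<alpha> \<in> hd' ==> l \<in> Zn n ==> \<alpha> \<in> wts \<and> l - sh \<alpha> \<in> sup0"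
proof -
 assume a: "x \<in> G \<alpha> l" "x \<noteq> 0" "\<alpha> \<in> hd'" "l \<in> Zn n"
 have "x \<in> rt \<alpha>" using a(1) by (simp add: G_def)
 then have w: "\<alpha> \<in> wts" using rt_zero_or_root[OF _ a(3)] a(2) by blast
 have "Wt (l - sh \<alpha>) \<alpha> = G \<alpha> l" unfolding Wt_def by (simp only: diff_add_cancel)
 then show ?thesis using a w Zn_diff[OF a(4) sh_Zn] unfolding sup0_def by blast
qed

text \<open>A degree divisible by the \<open>m i\<close> carries the same zero weight space as
  degree \<open>0\<close>, namely the non-zero \<open>H\<close>, and \<open>sh 0 = 0\<close>. Hence
  \<open>M\<close> has finite index in \<open>Zn n\<close>.\<close>

lemma \<Gamma>0_M: assumes nz: "K \<noteq> {0}" shows "\<Gamma>0 \<subseteq> M"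
proof
 fix l assume l: "l \<in> \<Gamma>0"
 obtain h where h: "h \<in> H" "h \<noteq> 0"
 proof -
  obtain \<alpha> where a: "\<alpha> \<in> roots" using roots_nonempty[OF nz] by blast
  show ?thesis by (rule that[OF hh_H[OF root_hd[OF a]] hh_nz[OF a]])
 qed
 have "Wt l 0 = G 0 l" by (rule Wt_lambda_0)
 also have "\<dots> = G 0 0" by (rule G_cong) (use l in simp)
 also have "\<dots> = H" by (rule G_0)
 finally have "Wt l 0 \<noteq> {0}" using h by blast
 then have "l \<in> sup0" using l unfolding sup0_def by blast
 then show "l \<in> M" by (rule gen_base)
qed

lemma frame_exists: assumes "K \<noteq> {0}"
 shows "\<exists>\<theta> d. bij_betw \<theta> (Zn n) M \<and> lat_hom n \<theta> \<and> (\<forall>i<n. 0 < (d i :: nat)) \<and>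
  (\<forall>l\<in>Zn n. \<theta> l \<in> \<Gamma>0 \<longleftrightarrow> (\<forall>i<n. int (d i) dvd l i))"
proof (rule lattice_frame)
 show "0 \<in> M" by (rule gen_zero)
 show "x - y \<in> M" if "x \<in> M" "y \<in> M" for x y using that by (rule gen_diff)
 show "M \<subseteq> Zn n" using M_Zn by blast
 show "0 \<in> \<Gamma>0" using Zn_zero by simp
 show "x - y \<in> \<Gamma>0" if "x \<in> \<Gamma>0" "y \<in> \<Gamma>0" for x y using that Zn_diff by simp
 show "\<Gamma>0 \<subseteq> M" by (rule \<Gamma>0_M[OF assms])
 show "0 < (\<Prod>i<n. m i)" using m_pos by (simp add: prod_pos)
 show "of_nat (\<Prod>i<n. m i) * x \<in> \<Gamma>0" if "x \<in> Zn n" for x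
 proof -
  have "int (m i) dvd int (\<Prod>i<n. m i) * x i" if "i < n" for i
   using that by (intro dvd_mult2) (simp only: int_dvd_int_iff, rule dvd_prodI, auto)
  then show ?thesis using of_nat_lat[OF that] by (simp only: mem_Collect_eq times_fun_apply of_nat_fun_apply) simp
 qed
qed

end

text \<open>\<open>\<theta>\<close> is a basis of \<open>M\<close> adapted to
  \<open>\<Gamma>0\<close>: in its coordinates \<open>\<Gamma>0\<close> consists of the vectors with
  entries divisible by the \<open>d i\<close>, which become the orders of the new
  automorphisms.\<close>

locale framed_mloop = mloop scale Basis br \<zeta> n \<sigma> m H
 for scale :: "'k::field_char_0 \<Rightarrow> 'a::ab_group_add \<Rightarrow> 'a" (infixr "*s" 75) and Basis :: "'a set"
  and br :: "'a \<Rightarrow> 'a \<Rightarrow> 'a" and \<zeta> :: "nat \<Rightarrow> 'k" and n :: nat and \<sigma> :: "nat \<Rightarrow> 'a \<Rightarrow> 'a" and m :: "nat \<Rightarrow> nat" and H :: "'a set" +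
 fixes \<theta> :: "(nat \<Rightarrow> int) \<Rightarrow> nat \<Rightarrow> int" and d :: "nat \<Rightarrow> nat"
 assumes nz: "K \<noteq> {0}" and th_bij: "bij_betw \<theta> (Zn n) M" and th_hom: "lat_hom n \<theta>"
  and d_pos: "\<And>i. i < n ==> 0 < d i"
  and th_dvd: "\<And>l. l \<in> Zn n ==> \<theta> l \<in> \<Gamma>0 \<longleftrightarrow> (\<forall>i<n. int (d i) dvd l i)"
begin

definition \<psi> :: "(nat \<Rightarrow> int) \<Rightarrow> nat \<Rightarrow> int" where "\<psi> = inv_into (Zn n) \<theta>"

lemma psi: "\<kappa> \<in> M ==> \<psi> \<kappa> \<in> Zn n" "\<kappa> \<in> M ==> \<theta> (\<psi> \<kappa>) = \<kappa>" "l \<in> Zn n ==> \<psi> (\<theta> l) = l" "l \<in> Zn n ==> \<theta> l \<in> M"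
proof -
 have im: "\<theta> ` Zn n = M" and inj: "inj_on \<theta> (Zn n)" using th_bij by (auto simp: bij_betw_def)
 show "\<kappa> \<in> M ==> \<psi> \<kappa> \<in> Zn n" unfolding \<psi>_def by (rule inv_into_into) (simp only: im)
 show "\<kappa> \<in> M ==> \<theta> (\<psi> \<kappa>) = \<kappa>" unfolding \<psi>_def by (rule f_inv_into_f[of \<kappa> \<theta> "Zn n"]) (simp only: im)
 show "l \<in> Zn n ==> \<psi> (\<theta> l) = l" unfolding \<psi>_def by (rule inv_into_f_f[OF inj])
 show "l \<in> Zn n ==> \<theta> l \<in> M" using im by blast
qed

lemma psi_eqI: "l \<in> Zn n ==> \<theta> l = \<kappa> ==> \<psi> \<kappa> = l"
 using psi(3) by blast

lemma psi_diff: "\<kappa> \<in> M ==> \<kappa>' \<in> M ==> \<psi> (\<kappa> - \<kappa>') = \<psi> \<kappa> - \<psi> \<kappa>'"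
 by (rule psi_eqI) (simp_all only: Zn_diff psi lat_hom_diff[OF th_hom])

lemma psi_add: "\<kappa> \<in> M ==> \<kappa>' \<in> M ==> \<psi> (\<kappa> + \<kappa>') = \<psi> \<kappa> + \<psi> \<kappa>'"
 by (rule psi_eqI) (simp_all only: Zn_add psi lat_hom_add[OF th_hom])

lemma psi_zero: "\<psi> 0 = 0"
 by (rule psi_eqI) (simp_all only: Zn_zero lat_hom_0[OF th_hom])

lemma psi_dvd: "\<kappa> \<in> \<Gamma>0 ==> i < n ==> int (d i) dvd \<psi> \<kappa> i"
 using th_dvd[OF psi(1)[of \<kappa>]] psi(2)[of \<kappa>] \<Gamma>0_M[OF nz] by auto

lemma sup0_M: "\<kappa> \<in> sup0 ==> \<kappa> \<in> M" by (rule gen_base)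

text \<open>The exponents are the coordinates of the new degree \<open>l - sh \<alpha>\<close>. The
  default \<open>1\<close> only concerns zero spaces, by \<open>supM\<close>, and it keeps the
  scalar dependent on residues alone, as \<open>scalar_exists\<close> demands.\<close>

definition sc :: "nat \<Rightarrow> ('a \<Rightarrow> 'k) \<Rightarrow> (nat \<Rightarrow> int) \<Rightarrow> 'k" where
 "sc i \<alpha> l = (if l - sh \<alpha> \<in> M then \<zeta> (d i) powi \<psi> (l - sh \<alpha>) i else 1)"

definition \<tau> :: "nat \<Rightarrow> 'a \<Rightarrow> 'a" where
 "\<tau> i = (SOME \<tau>. lin \<tau> \<and> (\<forall>\<alpha>\<in>hd'. \<forall>l\<in>Zn n. \<forall>x\<in>G \<alpha> l. \<tau> x = sc i \<alpha> l *s x))"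

lemma tau: assumes i: "i < n"
 shows "lin (\<tau> i)" "\<alpha> \<in> hd' ==> l \<in> Zn n ==> x \<in> G \<alpha> l ==> \<tau> i x = sc i \<alpha> l *s x"
proof -
 have "\<exists>\<tau>. lin \<tau> \<and> (\<forall>\<alpha>\<in>hd'. \<forall>l\<in>Zn n. \<forall>x\<in>G \<alpha> l. \<tau> x = sc i \<alpha> l *s x)"
 proof (rule scalar_exists)
  fix \<alpha> l l' assume l: "l \<in> Zn n" "l' \<in> Zn n" and dv: "\<And>i. i < n ==> int (m i) dvd l i - l' i"
  \<comment> \<open>Congruent degrees differ by an element of \<open>\<Gamma>0\<close>. Its
    coordinates are divisible by the \<open>d i\<close>, so the root of unity does not
    change.\<close>
  have g: "l - l' \<in> \<Gamma>0" using Zn_diff[OF l] dv by simp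
  then have gM: "l - l' \<in> M" using \<Gamma>0_M[OF nz] by blast
  have e: "(l' - sh \<alpha>) + (l - l') = l - sh \<alpha>" by simp
  show "sc i \<alpha> l = sc i \<alpha> l'"
  proof (cases "l' - sh \<alpha> \<in> M")
   case True
   then have lM: "l - sh \<alpha> \<in> M" using gen_subgroup_add[OF True gM] by (simp only: e)
   have p: "\<psi> (l - sh \<alpha>) = \<psi> (l' - sh \<alpha>) + \<psi> (l - l')" using psi_add[OF True gM] by (simp only: e)
   have "\<zeta> (d i) powi \<psi> (l - l') i = 1" using zeta_powi_1[OF d_pos[OF i]] psi_dvd[OF g i] by simp
   then show ?thesis using True lM zeta_nz[OF d_pos[OF i]] unfolding sc_def p by (simp add: power_int_add)
  next
   case False
   have "l - sh \<alpha> \<notin> M"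
   proof
    assume "l - sh \<alpha> \<in> M"
    then have "(l - sh \<alpha>) - (l - l') \<in> M" by (rule gen_diff[OF _ gM])
    then show False using False by simp
   qed
   then show ?thesis using False by (simp add: sc_def)
  qed
 qed
 from someI_ex[OF this] show "lin (\<tau> i)" "\<alpha> \<in> hd' ==> l \<in> Zn n ==> x \<in> G \<alpha> l ==> \<tau> i x = sc i \<alpha> l *s x"
  unfolding \<tau>_def[symmetric] by blast+
qed

lemma tau_Wt: assumes "i < n" "\<mu> \<in> wts" "\<kappa> \<in> M" "x \<in> Wt \<kappa> \<mu>"
 shows "\<tau> i x = \<zeta> (d i) powi \<psi> \<kappa> i *s x"
proof -
 have "\<tau> i x = sc i \<mu> (\<kappa> + sh \<mu>) *s x"
  using assms by (intro tau wts_hd Zn_add M_Zn sh_Zn) (auto simp: Wt_def)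
 also have "sc i \<mu> (\<kappa> + sh \<mu>) = \<zeta> (d i) powi \<psi> \<kappa> i" unfolding sc_def using assms(3) by (simp only: add_diff_cancel_right' if_True)
 finally show ?thesis .
qed

lemma Wt_induct:
 assumes "\<And>\<kappa> \<mu> x. \<kappa> \<in> M ==> \<mu> \<in> wts ==> x \<in> Wt \<kappa> \<mu> ==> P x" "\<And>x y. P x ==> P y ==> P (x + y)"
 shows "P x"
proof (rule G_induct[of P])
 fix \<alpha> l x assume a: "\<alpha> \<in> hd'" "l \<in> Zn n" "x \<in> G \<alpha> l"
 show "P x"
 proof (cases "x = 0")
  case True
  have "0 \<in> Wt 0 0" by (rule subspace_0[OF subspace_Wt])
  then show ?thesis using assms(1)[of 0 0 0] gen_zero True by blast
 next
  case False
  have s: "\<alpha> \<in> wts \<and> l - sh \<alpha> \<in> sup0" by (rule supM[OF a(3) False a(1,2)])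
  have "x \<in> Wt (l - sh \<alpha>) \<alpha>" using a(3) unfolding Wt_def by (simp only: diff_add_cancel)
  then show ?thesis using assms(1) s sup0_M by blast
 qed
qed (rule assms(2))

lemma tau_br: assumes i: "i < n" shows "\<tau> i (br x y) = br (\<tau> i x) (\<tau> i y)"
proof (induction x rule: Wt_induct)
 case (1 \<kappa> \<mu> x)
 note x = 1
 show ?case
 proof (induction y rule: Wt_induct)
  case (1 \<kappa>' \<mu>' y)
  have b: "br x y \<in> Wt (\<kappa> + \<kappa>') (\<mu> + \<mu>')" by (rule Wt_br[OF x(3) 1(3) wts_Q[OF x(2)] wts_Q[OF 1(2)]])
  have r: "br (\<tau> i x) (\<tau> i y) = (\<zeta> (d i) powi \<psi> \<kappa> i * \<zeta> (d i) powi \<psi> \<kappa>' i) *s br x y"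
   using tau_Wt[OF i x(2,1,3)] tau_Wt[OF i 1(2,1,3)] by (simp add: br_scale_left br_scale_right)
  show ?case
  proof (cases "br x y = 0")
   case True then show ?thesis using r lin_zero[OF tau(1)[OF i]] by simp
  next
   case False
   have w: "\<mu> + \<mu>' \<in> wts" using Wt_zero[OF b gen_subgroup_add[OF wts_Q[OF x(2)] wts_Q[OF 1(2)]]] False by blast
   have "\<tau> i (br x y) = \<zeta> (d i) powi \<psi> (\<kappa> + \<kappa>') i *s br x y"
    by (rule tau_Wt[OF i w gen_subgroup_add[OF x(1) 1(1)] b])
   then show ?thesis using r zeta_nz[OF d_pos[OF i]] unfolding psi_add[OF x(1) 1(1)] by (simp add: power_int_add)
  qed
 next
  case (2 y y') then show ?case using lin_add[OF tau(1)[OF i]] by (simp add: br_add_right)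
 qed
next
 case (2 x x') then show ?case using lin_add[OF tau(1)[OF i]] by (simp add: br_add_left)
qed

text \<open>The character of \<open>M\<close> with exponent vector \<open>k\<close>, evaluated at
  \<open>\<kappa>\<close>. Products of the \<open>\<tau> i\<close> act on degree
  \<open>\<kappa>\<close> by such values.\<close>

definition ch :: "(nat \<Rightarrow> int) \<Rightarrow> (nat \<Rightarrow> int) \<Rightarrow> 'k" where
 "ch k \<kappa> = (\<Prod>i<n. \<zeta> (d i) powi (k i * \<psi> \<kappa> i))"

definition acts :: "(nat \<Rightarrow> int) \<Rightarrow> ('a \<Rightarrow> 'a) \<Rightarrow> bool" where
 "acts k g \<longleftrightarrow> (\<forall>\<kappa>\<in>M. \<forall>\<mu>\<in>wts. \<forall>x\<in>Wt \<kappa> \<mu>. g x = ch k \<kappa> *s x)"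

lemma acts_eq: assumes "acts k g" "acts k g'" "lin g" "lin g'" shows "g = g'"
proof
 fix x show "g x = g' x"
  by (induction x rule: Wt_induct) (use assms in \<open>auto simp: acts_def lin_add\<close>)
qed

lemma ch_cong: assumes "\<And>i. i < n ==> int (d i) dvd k i - k' i" shows "ch k \<kappa> = ch k' \<kappa>"
 unfolding ch_def
proof (rule prod.cong[OF refl])
 fix i assume "i \<in> {..<n}"
 then have i: "i < n" by simp
 have e: "k i * \<psi> \<kappa> i = k' i * \<psi> \<kappa> i + (k i - k' i) * \<psi> \<kappa> i" by (simp add: algebra_simps)
 have "\<zeta> (d i) powi ((k i - k' i) * \<psi> \<kappa> i) = 1"
  using zeta_powi_1[OF d_pos[OF i]] assms[OF i] by simp
 then show "\<zeta> (d i) powi (k i * \<psi> \<kappa> i) = \<zeta> (d i) powi (k' i * \<psi> \<kappa> i)"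
  unfolding e using zeta_nz[OF d_pos[OF i]] by (simp add: power_int_add)
qed

lemma ch_nz: "ch k \<kappa> \<noteq> 0"
 using zeta_nz d_pos by (simp add: ch_def)

lemma ch_add: "ch (k + k') \<kappa> = ch k \<kappa> * ch k' \<kappa>"
 unfolding ch_def prod.distrib[symmetric]
 by (rule prod.cong) (use zeta_nz d_pos in \<open>auto simp: distrib_right power_int_add\<close>)

lemma ch_0: "ch 0 \<kappa> = 1" by (simp add: ch_def)

lemma acts_comp: assumes "acts k g" "acts k' g'" "lin g" shows "acts (k + k') (g \<circ> g')"
 using assms by (auto simp: acts_def ch_add lin_scale mult.commute)

lemma acts_id: "acts 0 id" by (simp add: acts_def ch_0)

lemma acts_tau: assumes i: "i < n" shows "acts ((\<lambda>_. 0)(i := 1)) (\<tau> i)"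
proof -
 have "ch ((\<lambda>_. 0)(i := 1)) \<kappa> = \<zeta> (d i) powi \<psi> \<kappa> i" for \<kappa>
 proof -
  have "ch ((\<lambda>_. 0)(i := 1)) \<kappa> = (\<Prod>j<n. if j = i then \<zeta> (d i) powi \<psi> \<kappa> i else 1)"
   unfolding ch_def by (rule prod.cong) auto
  then show ?thesis using i by simp
 qed
 then show ?thesis using tau_Wt[OF i] by (simp add: acts_def)
qed

lemma acts_inv: assumes "acts k g" "lin g" "bij g" shows "acts (- k) (inv g)"
 unfolding acts_def
proof (intro ballI)
 fix \<kappa> \<mu> x assume a: "\<kappa> \<in> M" "\<mu> \<in> wts" "x \<in> Wt \<kappa> \<mu>"
 have "ch (- k) \<kappa> * ch k \<kappa> = 1" using ch_add[of "- k" k \<kappa>] ch_0[of \<kappa>] by (simp only: add.left_inverse)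
 moreover have "g x = ch k \<kappa> *s x" using assms(1) a unfolding acts_def by blast
 ultimately have "g (ch (- k) \<kappa> *s x) = x" by (simp only: lin_scale[OF assms(2)] scale_scale scale_one)
 then show "inv g x = ch (- k) \<kappa> *s x" using inv_f_f[OF bij_is_inj[OF assms(3)]] by metis
qed

text \<open>The support generates \<open>M\<close>, so a character trivial on the support is trivial.\<close>

lemma ch_trivial: assumes "\<And>\<kappa>. \<kappa> \<in> sup0 ==> ch k \<kappa> = 1" "i < n" shows "int (d i) dvd k i"
proof -
 have all: "ch k \<kappa> = 1" if "\<kappa> \<in> M" for \<kappa>
  using that
 proof (induction rule: gen_subgroup.induct)
  case gen_zero show ?case unfolding ch_def psi_zero by simp
 next
  case (gen_diff x y)
  have "ch k (x - y) * ch k y = ch k x"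
   unfolding ch_def prod.distrib[symmetric] psi_diff[OF gen_diff(1,2)]
   by (rule prod.cong) (use zeta_nz d_pos in \<open>auto simp: algebra_simps simp flip: power_int_add\<close>)
  then show ?case by (simp only: gen_diff.IH mult_1_right)
 qed (rule assms(1))
 let ?u = "(\<lambda>_. 0)(i := 1) :: nat \<Rightarrow> int"
 have u: "?u \<in> Zn n" using assms(2) by (auto simp: Zn_def)
 have "ch k (\<theta> ?u) = (\<Prod>j<n. if j = i then \<zeta> (d i) powi k i else 1)"
  unfolding ch_def psi(3)[OF u] by (rule prod.cong) auto
 also have "\<dots> = \<zeta> (d i) powi k i" using assms(2) by simp
 finally show ?thesis using all[OF psi(4)[OF u]] zeta_powi_1[OF d_pos[OF assms(2)]] by simp
qed

text \<open>The quotient of the two characters is trivial on the support, because some non-zero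
  vector has each degree in \<open>sup0\<close>; \<open>ch_trivial\<close> then applies.\<close>

lemma acts_unique: assumes "acts k g" "acts k' g" "i < n" shows "int (d i) dvd k i - k' i"
proof -
 have "ch (k - k') \<kappa> = 1" if s: "\<kappa> \<in> sup0" for \<kappa>
 proof -
  obtain \<mu> x where x: "\<mu> \<in> wts" "x \<in> Wt \<kappa> \<mu>" "x \<noteq> 0"
   using s subspace_0[OF subspace_Wt] unfolding sup0_def by blast
  have "ch k \<kappa> *s x = ch k' \<kappa> *s x" using assms(1,2) x(1,2) sup0_M[OF s] unfolding acts_def by metis
  then have "ch k \<kappa> = ch k' \<kappa>" using x(3) by simp
  moreover have "ch (k - k') \<kappa> * ch k' \<kappa> = ch k \<kappa>" using ch_add[of "k - k'" k' \<kappa>] by (simp only: diff_add_cancel)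
  ultimately show ?thesis using ch_nz[of k' \<kappa>] by simp
 qed
 then show ?thesis using ch_trivial[of "k - k'" i] assms(3) by simp
qed

lemma acts_tau_pow: assumes i: "i < n" shows "acts ((\<lambda>_. 0)(i := int q)) (\<tau> i ^^ q)"
proof (induction q)
 case 0
 have "(\<lambda>_. 0)(i := int 0) = 0" by (rule ext) simp
 then show ?case using acts_id by (simp only: funpow.simps)
next
 case (Suc q)
 have e: "(\<lambda>_. 0)(i := 1) + (\<lambda>_. 0)(i := int q) = (\<lambda>_. 0)(i := int (Suc q))" by (rule ext) simp
 have "acts ((\<lambda>_. 0)(i := 1) + (\<lambda>_. 0)(i := int q)) (\<tau> i \<circ> \<tau> i ^^ q)"
  by (rule acts_comp[OF acts_tau[OF i] Suc tau(1)[OF i]])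
 then show ?case unfolding e by (simp only: funpow.simps)
qed

lemma tau_pow_id: assumes i: "i < n" shows "\<tau> i ^^ q = id \<longleftrightarrow> d i dvd q"
proof
 assume e: "\<tau> i ^^ q = id"
 have "int (d i) dvd ((\<lambda>_. 0)(i := int q)) i - (0 :: nat \<Rightarrow> int) i"
  by (rule acts_unique[OF acts_tau_pow[OF i, of q] _ i]) (simp only: e acts_id)
 then show "d i dvd q" by simp
next
 assume q: "d i dvd q"
 have "acts 0 (\<tau> i ^^ q)"
  using acts_tau_pow[OF i, of q] ch_cong[of "(\<lambda>_. 0)(i := int q)" 0] q unfolding acts_def by simp
 then show "\<tau> i ^^ q = id"
  by (rule acts_eq[OF _ acts_id]) (use lin_funpow[OF tau(1)[OF i]] lin_ident in \<open>auto simp: id_def\<close>)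
qed

lemma tau_bij: assumes i: "i < n" shows "bij (\<tau> i)"
proof -
 obtain q where q: "d i = Suc q" using d_pos[OF i] by (cases "d i") auto
 have e: "\<tau> i ^^ Suc q = id" using tau_pow_id[OF i, of "d i"] q by simp
 show ?thesis
  by (rule o_bij[of "\<tau> i ^^ q"]) (use e in \<open>simp_all only: funpow.simps flip: funpow_Suc_right\<close>)
qed

lemma tau_aut: "i < n ==> lie_aut scale br (\<tau> i)"
 unfolding lie_aut_def using tau(1) tau_bij tau_br by blast

lemma tau_comm: assumes "i < n" "j < n" shows "\<tau> i \<circ> \<tau> j = \<tau> j \<circ> \<tau> i"
proof (rule acts_eq)
 let ?e = "\<lambda>i. (\<lambda>_. 0)(i := 1) :: nat \<Rightarrow> int"
 show "acts (?e i + ?e j) (\<tau> i \<circ> \<tau> j)"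
  by (rule acts_comp[OF acts_tau[OF assms(1)] acts_tau[OF assms(2)] tau(1)[OF assms(1)]])
 have "acts (?e j + ?e i) (\<tau> j \<circ> \<tau> i)"
  by (rule acts_comp[OF acts_tau[OF assms(2)] acts_tau[OF assms(1)] tau(1)[OF assms(2)]])
 then show "acts (?e i + ?e j) (\<tau> j \<circ> \<tau> i)" by (simp only: add.commute)
qed (unfold comp_def, rule lin_compose[OF tau(1)[OF assms(1)] tau(1)[OF assms(2)]],
  rule lin_compose[OF tau(1)[OF assms(2)] tau(1)[OF assms(1)]])

lemma tau_order: assumes i: "i < n" shows "aut_order (\<tau> i) = d i"
 unfolding aut_order_def
proof (rule Least_equality)
 show "0 < d i \<and> \<tau> i ^^ d i = id" using d_pos[OF i] tau_pow_id[OF i] by simp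
 show "d i \<le> y" if "0 < y \<and> \<tau> i ^^ y = id" for y using that tau_pow_id[OF i, of y] by (auto intro: dvd_imp_le)
qed

abbreviation gag :: "('a \<Rightarrow> 'a) set" where "gag \<equiv> gen_aut_group n \<tau>"

lemma gag_acts: "g \<in> gag ==> lin g \<and> bij g \<and> (\<exists>k. acts k g)"
proof (induction rule: gen_aut_group.induct)
 case ga_id show ?case by (intro conjI exI[of _ 0] acts_id bij_id) (simp only: id_def lin_ident)
next
 case (ga_gen i) then show ?case using tau(1) tau_bij acts_tau by blast
next
 case (ga_comp f g)
 then obtain k k' where k: "acts k f" "acts k' g" by blast
 have fg: "lin f" "lin g" "bij f" "bij g" using ga_comp.IH by blast+
 have "lin (f \<circ> g)" unfolding comp_def by (rule lin_compose[OF fg(1,2)])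
 then show ?case using acts_comp[OF k fg(1)] bij_comp[OF fg(4,3)] by blast
next
 case (ga_inv f)
 have "lin (inv f)"
 proof (rule linI)
  have b: "surj f" "inj f" using ga_inv by (auto simp: bij_def)
  have l: "lin f" using ga_inv by blast
  show "inv f (x + y) = inv f x + inv f y" for x y
   by (rule inv_f_eq[OF b(2)]) (simp add: lin_add[OF l] surj_f_inv_f[OF b(1)])
  show "inv f (c *s x) = c *s inv f x" for c x
   by (rule inv_f_eq[OF b(2)]) (simp add: lin_scale[OF l] surj_f_inv_f[OF b(1)])
 qed
 moreover obtain k where "acts k f" using ga_inv.IH by blast
 ultimately show ?case using acts_inv[of k f] ga_inv.IH bij_imp_bij_inv by blast
qed

lemma gag_exists: "j \<le> n ==> \<exists>g\<in>gag. acts (\<lambda>i. if i < j then int (k i) else 0) g"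
proof (induction j)
 case 0
 have "(\<lambda>i. if i < 0 then int (k i) else 0) = 0" by (rule ext) simp
 then show ?case using acts_id ga_id[of n \<tau>] by (intro bexI[of _ id]) (simp_all only:)
next
 case (Suc j)
 then obtain g where g: "g \<in> gag" "acts (\<lambda>i. if i < j then int (k i) else 0) g" by auto
 have j: "j < n" using Suc by simp
 have p: "\<tau> j ^^ q \<in> gag" for q
  by (induction q) (use ga_id ga_comp[OF ga_gen[OF j]] in \<open>auto simp only: funpow.simps\<close>)
 have e: "(\<lambda>_. 0)(j := int (k j)) + (\<lambda>i. if i < j then int (k i) else 0) = (\<lambda>i. if i < Suc j then int (k i) else 0)"
  by (rule ext) (simp add: less_Suc_eq)
 have "acts ((\<lambda>_. 0)(j := int (k j)) + (\<lambda>i. if i < j then int (k i) else 0)) (\<tau> j ^^ k j \<circ> g)"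
  by (rule acts_comp[OF acts_tau_pow[OF j] g(2) lin_funpow[OF tau(1)[OF j]]])
 then show ?case using ga_comp[OF p g(1)] unfolding e by blast
qed

text \<open>Exponent vectors modulo the \<open>d i\<close> parametrize the generated group:
  \<open>acts_unique\<close> separates them, and \<open>acts_eq\<close> shows that the exponents
  determine the map.\<close>

lemma gag_card: "card gag = (\<Prod>i<n. d i)"
proof -
 let ?P = "PiE {..<n} (\<lambda>i. {..<d i})"
 let ?k = "\<lambda>(k::nat \<Rightarrow> nat) i. if i < n then int (k i) else 0"
 define F where "F k = (SOME g. g \<in> gag \<and> acts (?k k) g)" for k
 have F: "F k \<in> gag" "acts (?k k) (F k)" for k
  using someI_ex[of "\<lambda>g. g \<in> gag \<and> acts (?k k) g"] gag_exists[OF order_refl, of k] unfolding F_def by blast+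
 have "bij_betw F ?P gag"
 proof (rule bij_betw_imageI)
  show "inj_on F ?P"
  proof (rule inj_onI)
   fix k k' assume k: "k \<in> ?P" "k' \<in> ?P" "F k = F k'"
   show "k = k'"
   proof (rule PiE_ext[OF k(1,2)])
    fix i assume "i \<in> {..<n}"
    then have i: "i < n" by simp
    have "int (d i) dvd ?k k i - ?k k' i" by (rule acts_unique[OF F(2)]) (use F(2)[of k'] k(3) i in auto)
    then have "int (d i) dvd int (k i) - int (k' i)" using i by simp
    then have "int (k i) mod int (d i) = int (k' i) mod int (d i)" by (simp add: mod_eq_dvd_iff)
    moreover have "k i < d i" "k' i < d i" using k(1,2) i by auto
    ultimately show "k i = k' i" by simp
   qed
  qed
  show "F ` ?P = gag"
  proof
   show "F ` ?P \<subseteq> gag" using F(1) by blast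
   show "gag \<subseteq> F ` ?P"
   proof
    fix g assume g: "g \<in> gag"
    then obtain k where k: "lin g" "acts k g" using gag_acts by blast
    define k' where "k' = restrict (\<lambda>i. nat (k i mod int (d i))) {..<n}"
    have kP: "k' \<in> ?P" using d_pos by (auto simp: k'_def nat_less_iff)
    have "ch (?k k') \<kappa> = ch k \<kappa>" for \<kappa>
    proof (rule ch_cong)
     fix i assume i: "i < n"
     have "?k k' i = k i mod int (d i)" using i d_pos[OF i] by (simp add: k'_def)
     then show "int (d i) dvd ?k k' i - k i" by (simp add: mod_eq_dvd_iff[symmetric])
    qed
    then have "acts k (F k')" using F(2)[of k'] by (simp add: acts_def)
    then have "g = F k'" using acts_eq[OF k(2)] k(1) gag_acts[OF F(1)] by blast
    then show "g \<in> F ` ?P" using kP by blast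
   qed
  qed
 qed
 then have "card gag = card ?P" using bij_betw_same_card by metis
 then show ?thesis by (simp add: card_PiE)
qed

text \<open>For the inclusion into \<open>W (\<theta> l)\<close>: a component of new degree
  \<open>\<kappa>\<close> in a joint eigenvector has \<open>\<psi> \<kappa>\<close> congruent to
  \<open>l\<close> modulo the \<open>d i\<close>. Then \<open>\<kappa> - \<theta> l\<close> lies in
  \<open>\<Gamma>0\<close>, and the joint spaces for \<open>\<kappa>\<close> and
  \<open>\<theta> l\<close> coincide.\<close>

lemma twisted_tau: assumes l: "l \<in> Zn n" shows "twisted scale \<zeta> n \<tau> d l = W (\<theta> l)"
proof
 show "W (\<theta> l) \<subseteq> twisted scale \<zeta> n \<tau> d l"
 proof
  fix x assume x: "x \<in> W (\<theta> l)"
  have "\<tau> i x = \<zeta> (d i) powi l i *s x" if i: "i < n" for i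
  proof (rule lin_eq_span[OF tau(1)[OF i] lin_smult[OF lin_ident] _ x[unfolded W_def]])
   fix y assume "y \<in> (\<Union>\<mu>\<in>wts. Wt (\<theta> l) \<mu>)"
   then obtain \<mu> where m: "\<mu> \<in> wts" "y \<in> Wt (\<theta> l) \<mu>" by blast
   show "\<tau> i y = \<zeta> (d i) powi l i *s y" using tau_Wt[OF i m(1) psi(4)[OF l] m(2)] by (simp only: psi(3)[OF l])
  qed
  then show "x \<in> twisted scale \<zeta> n \<tau> d l" by (simp add: twisted_def)
 qed
 show "twisted scale \<zeta> n \<tau> d l \<subseteq> W (\<theta> l)"
 proof
  fix x assume "x \<in> twisted scale \<zeta> n \<tau> d l"
  then have x: "\<tau> i x = \<zeta> (d i) powi l i *s x" if "i \<in> {..<n}" for i using that by (simp add: twisted_def)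
  have t: "lin (\<tau> i) \<and> (\<forall>p\<in>box. \<forall>x\<in>G (fst p) (snd p). \<tau> i x = sc i (fst p) (snd p) *s x)" if "i \<in> {..<n}" for i
   using tau[of i] that by (auto simp: box_def)
  obtain u where u: "\<And>p. p \<in> box ==> u p \<in> G (fst p) (snd p)" "x = (\<Sum>p\<in>box. u p)"
   "\<And>p i. p \<in> box ==> i \<in> {..<n} ==> u p = 0 \<or> sc i (fst p) (snd p) = \<zeta> (d i) powi l i"
   by (rule scalar_comp[OF t x]) (assumption, assumption, rule that, assumption+)
  have "u p \<in> W (\<theta> l)" if p: "p \<in> box" for p
  proof (cases "u p = 0")
   case True then show ?thesis by (simp add: subspace_0[OF subspace_W])
  next
   case False
   obtain \<alpha> k where ak: "p = (\<alpha>, k)" by (cases p)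
   have a: "\<alpha> \<in> hd'" "k \<in> Zn n" using p ak by (auto simp: box_def)
   have uG: "u p \<in> G \<alpha> k" using u(1)[OF p] ak by simp
   have s: "\<alpha> \<in> wts" "k - sh \<alpha> \<in> M" using supM[OF uG False a] sup0_M by blast+
   let ?\<delta> = "(k - sh \<alpha>) - \<theta> l"
   have dM: "?\<delta> \<in> M" by (rule gen_diff[OF s(2) psi(4)[OF l]])
   have p\<delta>: "\<psi> ?\<delta> = \<psi> (k - sh \<alpha>) - l" using psi_diff[OF s(2) psi(4)[OF l]] by (simp only: psi(3)[OF l])
   have "int (d i) dvd \<psi> ?\<delta> i" if i: "i < n" for i
   proof -
    have "\<zeta> (d i) powi \<psi> (k - sh \<alpha>) i = \<zeta> (d i) powi l i" using u(3)[OF p, of i] False i s(2) ak by (simp add: sc_def)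
    then have "\<zeta> (d i) powi (\<psi> (k - sh \<alpha>) i - l i) = 1" using zeta_nz[OF d_pos[OF i]] by (simp add: power_int_diff)
    then show ?thesis unfolding p\<delta> using zeta_powi_1[OF d_pos[OF i]] by simp
   qed
   then have "\<theta> (\<psi> ?\<delta>) \<in> \<Gamma>0" using th_dvd[OF psi(1)[OF dM]] by blast
   then have "?\<delta> \<in> \<Gamma>0" by (simp only: psi(2)[OF dM])
   then have "G \<alpha> k = G \<alpha> (\<theta> l + sh \<alpha>)" by (intro G_cong) (auto simp: algebra_simps)
   then have "u p \<in> Wt (\<theta> l) \<alpha>" using uG by (simp only: Wt_def)
   then show ?thesis by (rule Wt_W[OF _ s(1)])
  qed
  then show "x \<in> W (\<theta> l)" unfolding u(2) by (intro subspace_sum[OF subspace_W])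
 qed
qed

lemma fixed_pts_tau: "fixed_pts scale \<zeta> n \<tau> d = W 0"
 unfolding fixed_pts_def using twisted_tau[OF Zn_zero] lat_hom_0[OF th_hom] by (simp add: zero_fun_def)

lemma fdvs_fin_dim: "fin_dim scale"
 unfolding fin_dim_def using finite_Basis span_Basis by blast

lemma torus: "multiloop_torus \<zeta> n scale br \<tau> d H"
proof -
 have r0: "root_sys0 \<zeta> n scale br \<tau> d H = D0"
  unfolding root_sys0_def fixed_pts_tau by (rule roots_0)
 have W0nz: "W 0 \<noteq> {0}"
 proof -
  have "simple_subalg scale br (W 0)" by (rule W0_simple[OF nz])
  then obtain x y where "x \<in> W 0" "br x y \<noteq> 0" unfolding simple_subalg_def by blast
  then have "x \<noteq> 0" using lin_zero[OF lin_br2] by metis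
  then show ?thesis using \<open>x \<in> W 0\<close> by blast
 qed
 have simple: "simple_subalg scale br UNIV"
  unfolding simple_subalg_def using nonab ideals by auto
 have lie: "lie_algebra scale br"
  unfolding lie_algebra_def using lin_br lin_br2 br_self jacobi0 vector_space_axioms by blast
 have A2: "\<exists>U V. submodule scale br (W 0) U \<and> submodule scale br (W 0) V \<and>
      U \<inter> V = {0} \<and> {u + v | u v. u \<in> U \<and> v \<in> V} = twisted scale \<zeta> n \<tau> d l \<and>
      (\<forall>x \<in> W 0. \<forall>u\<in>U. br x u = 0) \<and>
      (V = {0} \<or> (irreducible_submodule scale br (W 0) V \<and> dim V > 1 \<and>
       {\<alpha> \<in> hd'. rt \<alpha> \<inter> V \<noteq> {0}} \<subseteq> enlarged_roots D0 \<union> {0}))" if "l \<in> Zn n" for l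
  unfolding twisted_tau[OF that] by (rule W_A2)
 have md: "multiloop_datum \<zeta> n scale br \<tau> d H"
  unfolding multiloop_datum_def fixed_pts_tau
  using lie simple fdvs_fin_dim tau_aut d_pos tau_pow_id tau_comm W0nz W0_cartan by simp
 show ?thesis
  unfolding multiloop_torus_def fixed_pts_tau r0
 proof (intro conjI ballI impI allI)
  show "multiloop_datum \<zeta> n scale br \<tau> d H" by (rule md)
  show "d i = aut_order (\<tau> i)" if "i < n" for i using tau_order[OF that] by simp
  show "simple_subalg scale br (W 0)" by (rule W0_simple[OF nz])
  show "card gag = (\<Prod>i<n. aut_order (\<tau> i))" unfolding gag_card by (rule prod.cong) (auto simp: tau_order)
 qed (rule A2)
qed

end

subsection \<open>The support isomorphism\<close>

text \<open>The homogeneous element \<open>x \<otimes> t^l\<close>.\<close>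

definition sgl :: "(nat \<Rightarrow> int) \<Rightarrow> 'a::zero \<Rightarrow> (nat \<Rightarrow> int) \<Rightarrow> 'a" where
 "sgl l x = (\<lambda>\<nu>. if \<nu> = l then x else 0)"

lemma sgl_0: "sgl l 0 = 0" by (rule ext) (simp add: sgl_def)

lemma sgl_image: "{F. F l \<in> S \<and> (\<forall>\<mu>. \<mu> \<noteq> l \<longrightarrow> F \<mu> = 0)} = sgl l ` S"
proof
 show "{F. F l \<in> S \<and> (\<forall>\<mu>. \<mu> \<noteq> l \<longrightarrow> F \<mu> = 0)} \<subseteq> sgl l ` S"
 proof
  fix F assume F: "F \<in> {F. F l \<in> S \<and> (\<forall>\<mu>. \<mu> \<noteq> l \<longrightarrow> F \<mu> = 0)}"
  have "F = sgl l (F l)" by (rule ext) (use F in \<open>simp add: sgl_def\<close>)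
  then show "F \<in> sgl l ` S" using F by blast
 qed
qed (auto simp: sgl_def)

lemma sgl_eq_0: "sgl l x = 0 ==> x = 0"
proof -
 assume "sgl l x = 0"
 then have "sgl l x l = 0 l" by (rule fun_cong)
 then show "x = 0" by (simp add: sgl_def)
qed

lemma sgl_image_nz: assumes "0 \<in> S" shows "sgl l ` S \<noteq> {0} \<longleftrightarrow> (\<exists>x\<in>S. x \<noteq> 0)"
proof
 assume n: "sgl l ` S \<noteq> {0}"
 show "\<exists>x\<in>S. x \<noteq> 0"
 proof (rule ccontr)
  assume "\<not> ?thesis"
  then have "S = {0}" using assms by blast
  then show False using n by (simp only: image_insert image_empty sgl_0)
 qed
next
 assume "\<exists>x\<in>S. x \<noteq> 0"
 then obtain x where x: "x \<in> S" "x \<noteq> 0" by blast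
 have "sgl l x \<in> sgl l ` S" by (rule imageI[OF x(1)])
 then show "sgl l ` S \<noteq> {0}" using sgl_eq_0[of l x] x(2) by blast
qed

lemma finite_supp_sgl: "finite {\<nu>. sgl l x \<nu> \<noteq> 0}"
 by (rule finite_subset[of _ "{l}"]) (auto simp: sgl_def)

lemma gen_subgroup_image:
 assumes h: "\<And>x y. x \<in> gen_subgroup S ==> y \<in> gen_subgroup S ==> h (x - y) = h x - h y"
 shows "h ` gen_subgroup S = gen_subgroup (h ` S)"
proof
 have h0: "h 0 = 0" using h[OF gen_zero gen_zero] by simp
 show "h ` gen_subgroup S \<subseteq> gen_subgroup (h ` S)"
 proof safe
  fix x assume "x \<in> gen_subgroup S"
  then show "h x \<in> gen_subgroup (h ` S)"
  proof (induction rule: gen_subgroup.induct)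
   case gen_zero show ?case unfolding h0 by (rule gen_subgroup.gen_zero)
  next
   case (gen_base x) then show ?case by (intro gen_subgroup.gen_base) blast
  next
   case (gen_diff x y)
   then show ?case by (simp only: h gen_subgroup.gen_diff)
  qed
 qed
 show "gen_subgroup (h ` S) \<subseteq> h ` gen_subgroup S"
 proof
  fix y assume "y \<in> gen_subgroup (h ` S)"
  then show "y \<in> h ` gen_subgroup S"
  proof (induction rule: gen_subgroup.induct)
   case gen_zero show ?case by (rule image_eqI[of _ _ 0]) (simp_all only: h0 gen_subgroup.gen_zero)
  next
   case (gen_base x) then show ?case using gen_subgroup.gen_base by blast
  next
   case (gen_diff x y)
   then obtain u v where uv: "x = h u" "y = h v" "u \<in> gen_subgroup S" "v \<in> gen_subgroup S" by blast
   show ?case by (rule image_eqI[of _ _ "u - v"]) (simp_all only: uv h gen_subgroup.gen_diff)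
  qed
 qed
qed

context vector_space begin

lemma loop_module: "module (loop_scale scale)"
proof
 fix a b F G
 show "loop_scale scale a (F + G) = loop_scale scale a F + loop_scale scale a G"
  by (rule ext) (simp add: loop_scale_def scale_right_distrib)
 show "loop_scale scale (a + b) F = loop_scale scale a F + loop_scale scale b F"
  by (rule ext) (simp add: loop_scale_def scale_left_distrib)
 show "loop_scale scale a (loop_scale scale b F) = loop_scale scale (a * b) F"
  by (rule ext) (simp add: loop_scale_def)
 show "loop_scale scale 1 F = F" by (rule ext) (simp add: loop_scale_def)
qed

end

context flie begin

lemma lb_superset:
 assumes "finite S" "{\<mu>. F \<mu> \<noteq> 0} \<subseteq> S"
 shows "loop_bracket br F G \<nu> = (\<Sum>\<mu>\<in>S. br (F \<mu>) (G (\<nu> - \<mu>)))"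
 unfolding loop_bracket_def
 by (rule sum.mono_neutral_left) (use assms lin_zero[OF lin_br2] in auto)

lemma lb_add_left:
 assumes "finite {\<mu>. F \<mu> \<noteq> 0}" "finite {\<mu>. F' \<mu> \<noteq> 0}"
 shows "loop_bracket br (F + F') G = loop_bracket br F G + loop_bracket br F' G"
proof
 fix \<nu>
 let ?S = "{\<mu>. F \<mu> \<noteq> 0} \<union> {\<mu>. F' \<mu> \<noteq> 0}"
 have f: "finite ?S" using assms by simp
 show "loop_bracket br (F + F') G \<nu> = (loop_bracket br F G + loop_bracket br F' G) \<nu>"
  unfolding plus_fun_apply
  by (subst (1 2 3) lb_superset[OF f]) (auto simp: br_add_left sum.distrib)
qed

lemma lb_add_right: "loop_bracket br F (G + G') = loop_bracket br F G + loop_bracket br F G'"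
 by (rule ext) (simp add: loop_bracket_def br_add_right sum.distrib)

lemma lb_sgl: "loop_bracket br (sgl l x) (sgl l' y) = sgl (l + l') (br x y)"
proof
 fix \<nu>
 have "loop_bracket br (sgl l x) (sgl l' y) \<nu> = br x (sgl l' y (\<nu> - l))"
  by (subst lb_superset[of "{l}"]) (auto simp: sgl_def)
 moreover have "\<nu> - l = l' \<longleftrightarrow> \<nu> = l + l'" by (simp only: diff_eq_eq add.commute)
 ultimately show "loop_bracket br (sgl l x) (sgl l' y) \<nu> = sgl (l + l') (br x y) \<nu>"
  by (simp add: sgl_def lin_zero[OF lin_br])
qed

lemma lb_zero: "loop_bracket br 0 G = 0" "loop_bracket br F 0 = 0"
 by (rule ext, simp add: loop_bracket_def lin_zero[OF lin_br])+

end

context framed_mloop begin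

interpretation lm: module "loop_scale scale" by (rule loop_module)

abbreviation LC where "LC \<equiv> ml_comp \<zeta> n scale br \<sigma> m H"
abbreviation LC' where "LC' \<equiv> ml_comp \<zeta> n scale br \<tau> d H"
abbreviation LA where "LA \<equiv> ml_alg \<zeta> n scale br \<sigma> m H"
abbreviation LA' where "LA' \<equiv> ml_alg \<zeta> n scale br \<tau> d H"

lemma LC_eq: "LC (\<alpha>, l) = (if \<alpha> \<in> rs.Q \<and> l \<in> Zn n then sgl l ` G \<alpha> l else {0})"
 unfolding ml_comp_def fst_conv snd_conv Qh_roots sgl_image G_def ..

lemma Wt_eq: "\<alpha> \<in> rs.Q ==> rt \<alpha> \<inter> W \<kappa> = Wt \<kappa> \<alpha>"
proof
 assume a: "\<alpha> \<in> rs.Q"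
 show "rt \<alpha> \<inter> W \<kappa> \<subseteq> Wt \<kappa> \<alpha>" using W_rt Q_hd[OF a] by blast
 show "Wt \<kappa> \<alpha> \<subseteq> rt \<alpha> \<inter> W \<kappa>"
 proof
  fix x assume x: "x \<in> Wt \<kappa> \<alpha>"
  have "x \<in> W \<kappa>"
  proof (cases "\<alpha> \<in> wts")
   case True then show ?thesis using Wt_W[OF x] by blast
  next
   case False then show ?thesis using Wt_zero[OF x a] subspace_0[OF subspace_W] by blast
  qed
  then show "x \<in> rt \<alpha> \<inter> W \<kappa>" using Wt_rt[OF x] by blast
 qed
qed

lemma LC'_eq: "LC' (\<alpha>, l) = (if \<alpha> \<in> rs.Q \<and> l \<in> Zn n then sgl l ` Wt (\<theta> l) \<alpha> else {0})"
proof (cases "\<alpha> \<in> rs.Q \<and> l \<in> Zn n")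
 case True
 then show ?thesis
  unfolding ml_comp_def fst_conv snd_conv Qh_roots sgl_image using twisted_tau[of l] Wt_eq[of \<alpha> "\<theta> l"] by simp
next
 case False then show ?thesis unfolding ml_comp_def fst_conv snd_conv Qh_roots by (simp only: if_False)
qed

lemma sgl_scale: "loop_scale scale c (sgl l x) = sgl l (c *s x)"
 by (rule ext) (simp add: loop_scale_def sgl_def)

lemma sgl_LA: "\<alpha> \<in> rs.Q ==> l \<in> Zn n ==> x \<in> G \<alpha> l ==> sgl l x \<in> LA"
 unfolding ml_alg_def by (rule lm.span_base, rule UN_I[of "(\<alpha>, l)"]) (auto simp: LC_eq)

lemma sgl_LA': "\<alpha> \<in> rs.Q ==> l \<in> Zn n ==> x \<in> Wt (\<theta> l) \<alpha> ==> sgl l x \<in> LA'"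
 unfolding ml_alg_def by (rule lm.span_base, rule UN_I[of "(\<alpha>, l)"]) (auto simp: LC'_eq)

lemma LA_add: "F \<in> LA ==> E \<in> LA ==> F + E \<in> LA" and LA'_add: "F \<in> LA' ==> E \<in> LA' ==> F + E \<in> LA'"
 unfolding ml_alg_def by (rule lm.span_add, assumption, assumption)+

lemma LA_zero: "0 \<in> LA" and LA'_zero: "0 \<in> LA'"
 unfolding ml_alg_def by (rule lm.span_zero)+

lemma LA_induct:
 assumes "F \<in> LA" and P0: "P 0" and Ps: "\<And>\<alpha> l x. \<alpha> \<in> rs.Q ==> l \<in> Zn n ==> x \<in> G \<alpha> l ==> x \<noteq> 0 ==> P (sgl l x)"
  and Pa: "\<And>F E. F \<in> LA ==> E \<in> LA ==> P F ==> P E ==> P (F + E)"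
 shows "P F"
proof -
 have "F \<in> LA \<and> P F"
  using assms(1)[unfolded ml_alg_def]
 proof (induction rule: lm.span_induct_alt)
  case base show ?case using P0 LA_zero by blast
 next
  case (step c x y)
  then obtain \<alpha> l where x: "x \<in> LC (\<alpha>, l)" by (metis UN_E prod.exhaust)
  have "loop_scale scale c x \<in> LA \<and> P (loop_scale scale c x)"
  proof (cases "x = 0")
   case True
   then show ?thesis using P0 LA_zero by (simp only: lm.scale_zero_right)
  next
   case False
   then have q: "\<alpha> \<in> rs.Q" "l \<in> Zn n" using x by (auto simp only: LC_eq split: if_splits)
   then obtain u where u: "u \<in> G \<alpha> l" "x = sgl l u" using x by (auto simp only: LC_eq split: if_splits)
   have cu: "c *s u \<in> G \<alpha> l" by (rule subspace_scale[OF subspace_G u(1)])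
   have "P (sgl l (c *s u))"
   proof (cases "c *s u = 0")
    case True then show ?thesis using P0 by (simp only: sgl_0)
   qed (rule Ps[OF q cu])
   then show ?thesis using sgl_LA[OF q cu] unfolding u(2) sgl_scale by blast
  qed
  then show ?case using step Pa LA_add by blast
 qed
 then show ?thesis ..
qed

lemma LA'_induct:
 assumes "F \<in> LA'" and P0: "P 0" and Ps: "\<And>\<alpha> l x. \<alpha> \<in> rs.Q ==> l \<in> Zn n ==> x \<in> Wt (\<theta> l) \<alpha> ==> x \<noteq> 0 ==> P (sgl l x)"
  and Pa: "\<And>F E. P F ==> P E ==> P (F + E)"
 shows "P F"
 using assms(1)[unfolded ml_alg_def]
proof (induction rule: lm.span_induct_alt)
 case base show ?case by (rule P0)
next
 case (step c x y)
 then obtain \<alpha> l where x: "x \<in> LC' (\<alpha>, l)" by (metis UN_E prod.exhaust)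
 have "P (loop_scale scale c x)"
 proof (cases "x = 0")
  case True
  then show ?thesis using P0 by (simp only: lm.scale_zero_right)
 next
  case False
  then have q: "\<alpha> \<in> rs.Q" "l \<in> Zn n" using x by (auto simp only: LC'_eq split: if_splits)
  then obtain u where u: "u \<in> Wt (\<theta> l) \<alpha>" "x = sgl l u" using x by (auto simp only: LC'_eq split: if_splits)
  have cu: "c *s u \<in> Wt (\<theta> l) \<alpha>" by (rule subspace_scale[OF subspace_Wt u(1)])
  show ?thesis unfolding u(2) sgl_scale
  proof (cases "c *s u = 0")
   case True then show "P (sgl l (c *s u))" using P0 by (simp only: sgl_0)
  next
   case False then show "P (sgl l (c *s u))" by (rule Ps[OF q cu])
  qed
 qed
 then show ?case using step Pa by blast
qed

lemma finite_supp_add: "finite {\<mu>. F \<mu> \<noteq> 0} ==> finite {\<mu>. F' \<mu> \<noteq> 0} ==> finite {\<mu>. (F + F') \<mu> \<noteq> 0}"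
 for F F' :: "(nat \<Rightarrow> int) \<Rightarrow> 'a"
 by (rule finite_subset[of _ "{\<mu>. F \<mu> \<noteq> 0} \<union> {\<mu>. F' \<mu> \<noteq> 0}"]) auto

text \<open>\<open>loop_bracket\<close> sums over the support of its first argument; additivity in
  that argument, \<open>lb_add_left\<close>, relies on finite supports.\<close>

lemma LA_finite: "F \<in> LA ==> finite {\<mu>. F \<mu> \<noteq> 0}"
 by (erule LA_induct) (simp, rule finite_supp_sgl, rule finite_supp_add)

lemma LA'_finite: "F \<in> LA' ==> finite {\<mu>. F \<mu> \<noteq> 0}"
 by (erule LA'_induct) (simp, rule finite_supp_sgl, rule finite_supp_add)

abbreviation RW where "RW \<equiv> {\<alpha>\<in>hd'. rt \<alpha> \<noteq> {0}}"

text \<open>For \<open>x\<close> of weight \<open>\<alpha>\<close> this sends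
  \<open>x \<otimes> t^l\<close> to \<open>x \<otimes> t^l'\<close> with
  \<open>\<theta> l' = l - sh \<alpha>\<close>. A formula with weight projections on all functions
  makes it linear from the outset.\<close>

definition fwd :: "((nat \<Rightarrow> int) \<Rightarrow> 'a) \<Rightarrow> (nat \<Rightarrow> int) \<Rightarrow> 'a" where
 "fwd F l' = (if l' \<in> Zn n then \<Sum>\<alpha>\<in>RW. pr RW rt \<alpha> (F (\<theta> l' + sh \<alpha>)) else 0)"

definition bwd :: "((nat \<Rightarrow> int) \<Rightarrow> 'a) \<Rightarrow> (nat \<Rightarrow> int) \<Rightarrow> 'a" where
 "bwd F l = (\<Sum>\<alpha>\<in>RW. if l \<in> Zn n \<and> l - sh \<alpha> \<in> M then pr RW rt \<alpha> (F (\<psi> (l - sh \<alpha>))) else 0)"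

lemma fwd_add: "fwd (F + E) = fwd F + fwd E"
 by (rule ext) (simp add: fwd_def lin_add[OF lin_pr[OF rt_decomp(2)]] sum.distrib)

lemma bwd_add: "bwd (F + E) = bwd F + bwd E"
proof
 fix l
 show "bwd (F + E) l = (bwd F + bwd E) l"
  unfolding bwd_def plus_fun_apply sum.distrib[symmetric]
  by (rule sum.cong) (simp_all add: lin_add[OF lin_pr[OF rt_decomp(2)]])
qed

lemma fwd_scale: "fwd (loop_scale scale c F) = loop_scale scale c (fwd F)"
 by (rule ext) (simp add: fwd_def loop_scale_def lin_scale[OF lin_pr[OF rt_decomp(2)]] scale_sum_right)

lemma fwd_0: "fwd 0 = 0" using fwd_add[of 0 0] by (simp only: add_0_left add_cancel_right_right)
lemma bwd_0: "bwd 0 = 0" using bwd_add[of 0 0] by (simp only: add_0_left add_cancel_right_right)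

lemma pr_sgl: assumes "\<alpha> \<in> RW" "\<beta> \<in> RW" "x \<in> rt \<alpha>"
 shows "pr RW rt \<beta> (if P then x else 0) = (if \<beta> = \<alpha> then if P then x else 0 else 0)"
 using pr_same[of RW rt \<alpha> x, OF rt_decomp(2) assms(1,3)] pr_other[of RW rt \<alpha> \<beta> x, OF rt_decomp(2) assms] lin_zero[OF lin_pr[OF rt_decomp(2) assms(2)]]
 by auto

lemma G_RW: assumes "\<alpha> \<in> rs.Q" "x \<in> G \<alpha> l" "x \<noteq> 0" shows "\<alpha> \<in> RW" "x \<in> rt \<alpha>"
 using assms Q_hd by (auto simp: G_def)

lemma fwd_sgl: assumes a: "\<alpha> \<in> rs.Q" "l \<in> Zn n" "x \<in> G \<alpha> l" "x \<noteq> 0"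
 shows "fwd (sgl l x) = sgl (\<psi> (l - sh \<alpha>)) x"
proof
 fix l'
 have kM: "l - sh \<alpha> \<in> M" using supM[OF a(3,4) Q_hd[OF a(1)] a(2)] sup0_M by blast
 note RW = G_RW[OF a(1,3,4)]
 show "fwd (sgl l x) l' = sgl (\<psi> (l - sh \<alpha>)) x l'"
 proof (cases "l' \<in> Zn n")
  case True
  have "fwd (sgl l x) l' = (\<Sum>\<beta>\<in>RW. if \<beta> = \<alpha> then if \<theta> l' + sh \<alpha> = l then x else 0 else 0)"
   unfolding fwd_def sgl_def using True
   by (simp only: if_True) (rule sum.cong[OF refl], simp only: pr_sgl[OF RW(1) _ RW(2)] split: if_splits, auto)
  also have "\<dots> = (if \<theta> l' + sh \<alpha> = l then x else 0)"
   using RW(1) decompD(1)[OF rt_decomp(2)] by (simp only: sum.delta if_True)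
  also have "\<theta> l' + sh \<alpha> = l \<longleftrightarrow> l' = \<psi> (l - sh \<alpha>)"
  proof
   assume "\<theta> l' + sh \<alpha> = l"
   then have "\<theta> l' = l - sh \<alpha>" by (simp only: eq_diff_eq)
   then show "l' = \<psi> (l - sh \<alpha>)" using psi_eqI[OF True] by blast
  next
   assume "l' = \<psi> (l - sh \<alpha>)"
   then show "\<theta> l' + sh \<alpha> = l" by (simp only: psi(2)[OF kM] diff_add_cancel)
  qed
  finally show ?thesis by (simp only: sgl_def)
 next
  case False
  then have "l' \<noteq> \<psi> (l - sh \<alpha>)" using psi(1)[OF kM] by blast
  then show ?thesis using False by (simp only: fwd_def sgl_def if_False)
 qed
qed

lemma bwd_sgl: assumes a: "\<alpha> \<in> rs.Q" "l \<in> Zn n" "x \<in> G \<alpha> l" "x \<noteq> 0"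
 shows "bwd (sgl (\<psi> (l - sh \<alpha>)) x) = sgl l x"
proof
 fix l0
 have kM: "l - sh \<alpha> \<in> M" using supM[OF a(3,4) Q_hd[OF a(1)] a(2)] sup0_M by blast
 note RW = G_RW[OF a(1,3,4)]
 have iff: "(l0 \<in> Zn n \<and> l0 - sh \<alpha> \<in> M) \<and> \<psi> (l0 - sh \<alpha>) = \<psi> (l - sh \<alpha>) \<longleftrightarrow> l0 = l"
 proof
  assume h: "(l0 \<in> Zn n \<and> l0 - sh \<alpha> \<in> M) \<and> \<psi> (l0 - sh \<alpha>) = \<psi> (l - sh \<alpha>)"
  then have "\<theta> (\<psi> (l0 - sh \<alpha>)) = l - sh \<alpha>" using psi(2)[OF kM] by (simp only:)
  moreover have "\<theta> (\<psi> (l0 - sh \<alpha>)) = l0 - sh \<alpha>" using h psi(2) by blast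
  ultimately have "l0 - sh \<alpha> = l - sh \<alpha>" by (simp only:)
  then show "l0 = l" by (simp only: diff_eq_eq diff_add_cancel)
 qed (use kM a(2) in blast)
 have "bwd (sgl (\<psi> (l - sh \<alpha>)) x) l0 =
   (\<Sum>\<beta>\<in>RW. if \<beta> = \<alpha> then if (l0 \<in> Zn n \<and> l0 - sh \<alpha> \<in> M) \<and> \<psi> (l0 - sh \<alpha>) = \<psi> (l - sh \<alpha>) then x else 0 else 0)"
  unfolding bwd_def sgl_def
  by (rule sum.cong[OF refl], simp only: pr_sgl[OF RW(1) _ RW(2)]) (auto split: if_splits)
 also have "\<dots> = (if (l0 \<in> Zn n \<and> l0 - sh \<alpha> \<in> M) \<and> \<psi> (l0 - sh \<alpha>) = \<psi> (l - sh \<alpha>) then x else 0)"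
  using RW(1) decompD(1)[OF rt_decomp(2)] by (simp only: sum.delta if_True)
 finally show "bwd (sgl (\<psi> (l - sh \<alpha>)) x) l0 = sgl l x l0" unfolding iff by (simp only: sgl_def)
qed

lemma bwd_fwd: "F \<in> LA ==> bwd (fwd F) = F"
proof (erule LA_induct)
 show "bwd (fwd 0) = 0" by (simp only: fwd_0 bwd_0)
 fix \<alpha> l x assume a: "\<alpha> \<in> rs.Q" "l \<in> Zn n" "x \<in> G \<alpha> l" "x \<noteq> 0"
 show "bwd (fwd (sgl l x)) = sgl l x" by (simp only: fwd_sgl[OF a] bwd_sgl[OF a])
qed (simp only: fwd_add bwd_add)

lemma sgl_theta: assumes "\<alpha> \<in> rs.Q" "l \<in> Zn n" "x \<in> Wt (\<theta> l) \<alpha>"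
 shows "\<theta> l + sh \<alpha> \<in> Zn n" "x \<in> G \<alpha> (\<theta> l + sh \<alpha>)" "x \<noteq> 0 ==> fwd (sgl (\<theta> l + sh \<alpha>) x) = sgl l x"
proof -
 show Z: "\<theta> l + sh \<alpha> \<in> Zn n" by (intro Zn_add sh_Zn M_Zn psi(4) assms)
 show E: "x \<in> G \<alpha> (\<theta> l + sh \<alpha>)" using assms(3) by (simp only: Wt_def)
 assume "x \<noteq> 0"
 from fwd_sgl[OF assms(1) Z E this] show "fwd (sgl (\<theta> l + sh \<alpha>) x) = sgl l x"
  by (simp only: add_diff_cancel_right' psi(3)[OF assms(2)])
qed

lemma sgl_psi: assumes "\<alpha> \<in> rs.Q" "l \<in> Zn n" "x \<in> G \<alpha> l" "x \<noteq> 0"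
 shows "l - sh \<alpha> \<in> M" "x \<in> Wt (\<theta> (\<psi> (l - sh \<alpha>))) \<alpha>"
proof -
 show kM: "l - sh \<alpha> \<in> M" using supM[OF assms(3,4) Q_hd[OF assms(1)] assms(2)] sup0_M by blast
 show "x \<in> Wt (\<theta> (\<psi> (l - sh \<alpha>))) \<alpha>" using assms(3) by (simp only: psi(2)[OF kM] Wt_def diff_add_cancel)
qed

lemma fwd_LA: "F \<in> LA ==> fwd F \<in> LA'"
proof (erule LA_induct)
 show "fwd 0 \<in> LA'" by (simp only: fwd_0 LA'_zero)
 fix \<alpha> l x assume a: "\<alpha> \<in> rs.Q" "l \<in> Zn n" "x \<in> G \<alpha> l" "x \<noteq> 0"
 show "fwd (sgl l x) \<in> LA'" unfolding fwd_sgl[OF a]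
  by (rule sgl_LA'[OF a(1) psi(1)[OF sgl_psi(1)[OF a]] sgl_psi(2)[OF a]])
qed (simp only: fwd_add LA'_add)

lemma fwd_bij: "bij_betw fwd LA LA'"
proof (rule bij_betw_imageI)
 show "inj_on fwd LA" by (rule inj_on_inverseI[of _ bwd]) (rule bwd_fwd)
 have "F \<in> fwd ` LA" if "F \<in> LA'" for F
  using that
 proof (rule LA'_induct)
  show "0 \<in> fwd ` LA" by (rule image_eqI[of _ _ 0]) (simp_all only: fwd_0 LA_zero)
  fix \<alpha> l x assume a: "\<alpha> \<in> rs.Q" "l \<in> Zn n" "x \<in> Wt (\<theta> l) \<alpha>" "x \<noteq> 0"
  show "sgl l x \<in> fwd ` LA"
   by (rule image_eqI, rule sgl_theta(3)[OF a, symmetric], rule sgl_LA[OF a(1) sgl_theta(1,2)[OF a(1-3)]])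
 next
  fix F E assume "F \<in> fwd ` LA" "E \<in> fwd ` LA"
  then obtain F' E' where FG: "F = fwd F'" "E = fwd E'" "F' \<in> LA" "E' \<in> LA" by blast
  show "F + E \<in> fwd ` LA" by (rule image_eqI[of _ _ "F' + E'"]) (simp_all only: FG fwd_add LA_add)
 qed
 then show "fwd ` LA = LA'" using fwd_LA by blast
qed

text \<open>On homogeneous elements the claim is that \<open>sh\<close> and \<open>\<psi>\<close>
  are additive; the rest is bilinearity.\<close>

lemma fwd_bracket: assumes "F \<in> LA" "E \<in> LA"
 shows "fwd (loop_bracket br F E) = loop_bracket br (fwd F) (fwd E)"
 using assms(1)
proof (rule LA_induct)
 show "fwd (loop_bracket br 0 E) = loop_bracket br (fwd 0) (fwd E)" by (simp only: lb_zero fwd_0)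
next
 fix F F' assume F: "F \<in> LA" "F' \<in> LA" "fwd (loop_bracket br F E) = loop_bracket br (fwd F) (fwd E)"
  "fwd (loop_bracket br F' E) = loop_bracket br (fwd F') (fwd E)"
 note f = lb_add_left[OF LA_finite[OF F(1)] LA_finite[OF F(2)]]
  lb_add_left[OF LA'_finite[OF fwd_LA[OF F(1)]] LA'_finite[OF fwd_LA[OF F(2)]]]
 show "fwd (loop_bracket br (F + F') E) = loop_bracket br (fwd (F + F')) (fwd E)"
  by (simp only: fwd_add f F(3,4))
next
 fix \<alpha> l x assume a: "\<alpha> \<in> rs.Q" "l \<in> Zn n" "x \<in> G \<alpha> l" "x \<noteq> 0"
 show "fwd (loop_bracket br (sgl l x) E) = loop_bracket br (fwd (sgl l x)) (fwd E)"
  using assms(2)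
 proof (rule LA_induct)
  show "fwd (loop_bracket br (sgl l x) 0) = loop_bracket br (fwd (sgl l x)) (fwd 0)" by (simp only: lb_zero fwd_0)
 next
  fix \<beta> k y assume b: "\<beta> \<in> rs.Q" "k \<in> Zn n" "y \<in> G \<beta> k" "y \<noteq> 0"
  have r: "loop_bracket br (fwd (sgl l x)) (fwd (sgl k y)) = sgl (\<psi> (l - sh \<alpha>) + \<psi> (k - sh \<beta>)) (br x y)"
   by (simp only: fwd_sgl[OF a] fwd_sgl[OF b] lb_sgl)
  show "fwd (loop_bracket br (sgl l x) (sgl k y)) = loop_bracket br (fwd (sgl l x)) (fwd (sgl k y))"
  proof (cases "br x y = 0")
   case True then show ?thesis unfolding r by (simp only: lb_sgl sgl_0 fwd_0)
  next
   case False
   have e: "l + k - sh (\<alpha> + \<beta>) = (l - sh \<alpha>) + (k - sh \<beta>)" by (simp only: sh_add[OF a(1) b(1)] add_diff_add)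
   show ?thesis unfolding r lb_sgl fwd_sgl[OF gen_subgroup_add[OF a(1) b(1)] Zn_add[OF a(2) b(2)] G_br[OF a(3) b(3)] False] e
    by (simp only: psi_add[OF sgl_psi(1)[OF a] sgl_psi(1)[OF b]])
  qed
 qed (simp only: fwd_add lb_add_right)
qed

text \<open>The effect of \<open>fwd\<close> on degrees. On the group generated by the support,
  \<open>snd \<gamma> - sh (fst \<gamma>)\<close> stays in \<open>M\<close> by
  \<open>gen_LS\<close>, and there \<open>\<psi>\<close> is additive.\<close>

definition fsu :: "('a \<Rightarrow> 'k) \<times> (nat \<Rightarrow> int) \<Rightarrow> ('a \<Rightarrow> 'k) \<times> (nat \<Rightarrow> int)" where
 "fsu \<gamma> = (fst \<gamma>, \<psi> (snd \<gamma> - sh (fst \<gamma>)))"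

abbreviation LS where "LS \<equiv> ml_supp \<zeta> n scale br \<sigma> m H"
abbreviation LS' where "LS' \<equiv> ml_supp \<zeta> n scale br \<tau> d H"

lemma LS_iff: "(\<alpha>, l) \<in> LS \<longleftrightarrow> \<alpha> \<in> rs.Q \<and> l \<in> Zn n \<and> (\<exists>x\<in>G \<alpha> l. x \<noteq> 0)"
proof (cases "\<alpha> \<in> rs.Q \<and> l \<in> Zn n")
 case True
 have z: "0 \<in> G \<alpha> l" by (rule subspace_0[OF subspace_G])
 have "sgl l ` G \<alpha> l \<noteq> {0} \<longleftrightarrow> (\<exists>x\<in>G \<alpha> l. x \<noteq> 0)" by (rule sgl_image_nz[OF z])
 then show ?thesis using True unfolding ml_supp_def mem_Collect_eq LC_eq by (simp only: if_True simp_thms)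
next
 case False then show ?thesis unfolding ml_supp_def mem_Collect_eq LC_eq by (simp only: if_False) blast
qed

lemma LS'_iff: "(\<alpha>, l) \<in> LS' \<longleftrightarrow> \<alpha> \<in> rs.Q \<and> l \<in> Zn n \<and> (\<exists>x\<in>Wt (\<theta> l) \<alpha>. x \<noteq> 0)"
proof (cases "\<alpha> \<in> rs.Q \<and> l \<in> Zn n")
 case True
 have z: "0 \<in> Wt (\<theta> l) \<alpha>" by (rule subspace_0[OF subspace_Wt])
 have "sgl l ` Wt (\<theta> l) \<alpha> \<noteq> {0} \<longleftrightarrow> (\<exists>x\<in>Wt (\<theta> l) \<alpha>. x \<noteq> 0)" by (rule sgl_image_nz[OF z])
 then show ?thesis using True unfolding ml_supp_def mem_Collect_eq LC'_eq by (simp only: if_True simp_thms)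
next
 case False then show ?thesis unfolding ml_supp_def mem_Collect_eq LC'_eq by (simp only: if_False) blast
qed

lemma gen_LS: "\<gamma> \<in> gen_subgroup LS ==> fst \<gamma> \<in> rs.Q \<and> snd \<gamma> \<in> Zn n \<and> snd \<gamma> - sh (fst \<gamma>) \<in> M"
proof (induction rule: gen_subgroup.induct)
 case gen_zero
 show ?case by (simp only: fst_zero snd_zero sh_zero diff_zero Zn_zero gen_subgroup.gen_zero simp_thms)
next
 case (gen_base \<gamma>)
 obtain \<alpha> l where g: "\<gamma> = (\<alpha>, l)" by (cases \<gamma>)
 obtain x where x: "\<alpha> \<in> rs.Q" "l \<in> Zn n" "x \<in> G \<alpha> l" "x \<noteq> 0" using gen_base unfolding g LS_iff by blast
 show ?case unfolding g fst_conv snd_conv using x(1,2) sgl_psi(1)[OF x] by blast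
next
 case (gen_diff x y)
 have e: "snd x - snd y - (sh (fst x) - sh (fst y)) = (snd x - sh (fst x)) - (snd y - sh (fst y))"
  by (rule ext) simp
 show ?case using gen_diff.IH unfolding fst_diff snd_diff
  by (elim conjE, intro conjI) (erule (1) gen_subgroup.gen_diff, erule (1) Zn_diff, simp only: sh_diff e gen_subgroup.gen_diff)
qed

lemma fsu_diff: "x \<in> gen_subgroup LS ==> y \<in> gen_subgroup LS ==> fsu (x - y) = fsu x - fsu y"
proof -
 assume x: "x \<in> gen_subgroup LS" and y: "y \<in> gen_subgroup LS"
 note gx = gen_LS[OF x] and gy = gen_LS[OF y]
 have e: "snd x - snd y - sh (fst x - fst y) = (snd x - sh (fst x)) - (snd y - sh (fst y))"
  unfolding sh_diff[OF conjunct1[OF gx] conjunct1[OF gy]] by (rule ext) simp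
 show ?thesis unfolding fsu_def fst_diff snd_diff e using gx gy
  by (simp only: psi_diff prod_eq_iff fst_diff snd_diff fst_conv snd_conv simp_thms)
qed

lemma fsu_LS: "fsu ` LS = LS'"
proof
 show "fsu ` LS \<subseteq> LS'"
 proof
  fix \<gamma>' assume "\<gamma>' \<in> fsu ` LS"
  then obtain \<gamma> where h: "\<gamma> \<in> LS" "\<gamma>' = fsu \<gamma>" by blast
  obtain \<alpha> l where g: "\<gamma> = (\<alpha>, l)" by (cases \<gamma>)
  obtain x where x: "\<alpha> \<in> rs.Q" "l \<in> Zn n" "x \<in> G \<alpha> l" "x \<noteq> 0" using h(1) unfolding g LS_iff by blast
  show "\<gamma>' \<in> LS'" unfolding h(2) g fsu_def fst_conv snd_conv LS'_iff
   using x(1,4) psi(1)[OF sgl_psi(1)[OF x]] sgl_psi(2)[OF x] by blast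
 qed
 show "LS' \<subseteq> fsu ` LS"
 proof
  fix \<gamma> assume h: "\<gamma> \<in> LS'"
  obtain \<alpha> l where g: "\<gamma> = (\<alpha>, l)" by (cases \<gamma>)
  obtain x where x: "\<alpha> \<in> rs.Q" "l \<in> Zn n" "x \<in> Wt (\<theta> l) \<alpha>" "x \<noteq> 0" using h unfolding g LS'_iff by blast
  have "(\<alpha>, \<theta> l + sh \<alpha>) \<in> LS" unfolding LS_iff using x(1,4) sgl_theta(1,2)[OF x(1-3)] by blast
  moreover have "\<gamma> = fsu (\<alpha>, \<theta> l + sh \<alpha>)"
   unfolding fsu_def fst_conv snd_conv g by (simp only: add_diff_cancel_right' psi(3)[OF x(2)])
  ultimately show "\<gamma> \<in> fsu ` LS" by (rule rev_image_eqI)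
 qed
qed

lemma fsu_bij: "bij_betw fsu (gen_subgroup LS) (gen_subgroup LS')"
proof (rule bij_betw_imageI)
 show "fsu ` gen_subgroup LS = gen_subgroup LS'" unfolding fsu_LS[symmetric] by (rule gen_subgroup_image[OF fsu_diff])
 show "inj_on fsu (gen_subgroup LS)"
 proof (rule inj_onI)
  fix x y assume xy: "x \<in> gen_subgroup LS" "y \<in> gen_subgroup LS" "fsu x = fsu y"
  note gx = gen_LS[OF xy(1)] and gy = gen_LS[OF xy(2)]
  have fp: "fst x = fst y \<and> \<psi> (snd x - sh (fst x)) = \<psi> (snd y - sh (fst y))"
   using xy(3) unfolding fsu_def prod.inject .
  note f = conjunct1[OF fp] and p = conjunct2[OF fp]
  have "\<theta> (\<psi> (snd x - sh (fst x))) = \<theta> (\<psi> (snd y - sh (fst y)))" by (rule arg_cong[OF p])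
  moreover have "\<theta> (\<psi> (snd x - sh (fst x))) = snd x - sh (fst x)" using gx psi(2) by blast
  moreover have "\<theta> (\<psi> (snd y - sh (fst y))) = snd y - sh (fst y)" using gy psi(2) by blast
  ultimately have "snd x - sh (fst x) = snd y - sh (fst y)" by (simp only:)
  then have "snd x = snd y" unfolding f by (simp only: diff_eq_eq diff_add_cancel)
  then show "x = y" using f by (intro prod_eqI)
 qed
qed

lemma fwd_comp: assumes "\<gamma> \<in> gen_subgroup LS" shows "fwd ` LC \<gamma> = LC' (fsu \<gamma>)"
proof -
 obtain \<alpha> l where g: "\<gamma> = (\<alpha>, l)" by (cases \<gamma>)
 have a: "\<alpha> \<in> rs.Q" "l \<in> Zn n" "l - sh \<alpha> \<in> M" using gen_LS[OF assms] unfolding g fst_conv snd_conv by blast+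
 have pZ: "\<psi> (l - sh \<alpha>) \<in> Zn n" by (rule psi(1)[OF a(3)])
 have Wt: "Wt (\<theta> (\<psi> (l - sh \<alpha>))) \<alpha> = G \<alpha> l" by (simp only: psi(2)[OF a(3)] Wt_def diff_add_cancel)
 have f: "fwd (sgl l x) = sgl (\<psi> (l - sh \<alpha>)) x" if "x \<in> G \<alpha> l" for x
 proof (cases "x = 0")
  case True then show ?thesis by (simp only: sgl_0 fwd_0)
 qed (rule fwd_sgl[OF a(1,2) that])
 have "fwd ` LC \<gamma> = fwd ` sgl l ` G \<alpha> l" using a(1,2) unfolding g LC_eq by (simp only: if_True simp_thms)
 also have "\<dots> = sgl (\<psi> (l - sh \<alpha>)) ` G \<alpha> l" unfolding image_image by (rule image_cong[OF refl f])
 also have "\<dots> = LC' (fsu \<gamma>)"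
  unfolding g fsu_def fst_conv snd_conv LC'_eq using a(1) pZ by (simp only: if_True simp_thms Wt)
 finally show ?thesis .
qed

lemma fsu_add: "x \<in> gen_subgroup LS ==> y \<in> gen_subgroup LS ==> fsu (x + y) = fsu x + fsu y"
proof -
 assume xy: "x \<in> gen_subgroup LS" "y \<in> gen_subgroup LS"
 have "fsu (x + y - y) = fsu (x + y) - fsu y" by (rule fsu_diff[OF gen_subgroup_add[OF xy] xy(2)])
 then show ?thesis by (simp only: add_diff_cancel_right' eq_diff_eq)
qed

lemma support_iso_torus: "support_iso \<zeta> n scale br \<sigma> m H scale br \<tau> d H"
 unfolding support_iso_def
 by (rule exI[of _ fwd], rule exI[of _ fsu], intro conjI ballI allI)
  (rule fwd_bij fwd_add fwd_bracket fwd_scale fsu_bij fsu_add fwd_comp; assumption?)+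

end

section \<open>The two implications\<close>

lemma (in vector_space) finite_basis_exists:
 assumes "fin_dim scale" shows "\<exists>B. finite_dimensional_vector_space scale B"
proof -
 obtain B where B: "finite B" "span B = UNIV" using assms unfolding fin_dim_def by blast
 obtain C where C: "C \<subseteq> B" "independent C" "B \<subseteq> span C" using maximal_independent_subset by blast
 have "span C = UNIV" using span_minimal[OF C(3) subspace_span] B(2) by blast
 then have "finite_dimensional_vector_space scale C"
  by unfold_locales (use finite_subset[OF C(1) B(1)] C(2) in auto)
 then show ?thesis ..
qed

lemma torus_exists:
 fixes \<zeta> :: "nat \<Rightarrow> 'k::field_char_0" and s :: "'k \<Rightarrow> 'a::ab_group_add \<Rightarrow> 'a"
 assumes ac: "alg_closed_field TYPE('k)" and z: "fixed_roots_of_unity \<zeta>"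
  and md: "multiloop_datum \<zeta> n s b \<sigma> m H" and nz: "fixed_pts s \<zeta> n \<sigma> m \<noteq> {0}"
 shows "\<exists>(s' :: 'k \<Rightarrow> 'a \<Rightarrow> 'a) b' \<sigma>' m' H'. multiloop_torus \<zeta> n s' b' \<sigma>' m' H' \<and>
  support_iso \<zeta> n s b \<sigma> m H s' b' \<sigma>' m' H'"
proof -
 have lie: "lie_algebra s b" and fd: "fin_dim s" and simple: "simple_subalg s b UNIV"
  and aut: "\<And>i. i < n ==> lie_aut s b (\<sigma> i) \<and> 0 < m i \<and> \<sigma> i ^^ m i = id"
  and comm: "\<And>i j. i < n ==> j < n ==> \<sigma> i \<circ> \<sigma> j = \<sigma> j \<circ> \<sigma> i"
  and cart: "cartan_subalg s b (fixed_pts s \<zeta> n \<sigma> m) H"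
  using md nz unfolding multiloop_datum_def by auto
 interpret vs: vector_space s using lie by (simp add: lie_algebra_def)
 obtain B where B: "finite_dimensional_vector_space s B" using vs.finite_basis_exists[OF fd] by blast
 interpret fd: finite_dimensional_vector_space s B by (rule B)
 have l: "\<And>x. Vector_Spaces.linear s s (b x)" "\<And>y. Vector_Spaces.linear s s (\<lambda>x. b x y)" "\<And>x. b x x = 0"
  "\<And>x y z. b x (b y z) + b y (b z x) + b z (b x y) = 0"
  using lie by (simp_all add: lie_algebra_def)
 have a: "\<And>i. i < n ==> Vector_Spaces.linear s s (\<sigma> i)" "\<And>i. i < n ==> bij (\<sigma> i)"
  "\<And>i x y. i < n ==> \<sigma> i (b x y) = b (\<sigma> i x) (\<sigma> i y)" "\<And>i. i < n ==> \<sigma> i ^^ m i = id" "\<And>i. i < n ==> 0 < m i"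
  using aut by (simp_all add: lie_aut_def)
 interpret mloop s B b \<zeta> n \<sigma> m H
 proof (intro mloop.intro simple_lie.intro flie.intro fdvs.intro B flie_axioms.intro simple_lie_axioms.intro mloop_axioms.intro)
  show "\<exists>x y. b x y \<noteq> 0" using simple by (auto simp: simple_subalg_def)
  show "I = {0} \<or> I = UNIV" if "vs.subspace I" "\<And>x y. y \<in> I ==> b x y \<in> I" for I
   using simple that unfolding simple_subalg_def by blast
  show "\<sigma> i (\<sigma> j x) = \<sigma> j (\<sigma> i x)" if "i < n" "j < n" for i j x
   using fun_cong[OF comm[OF that], of x] by simp
 qed ((rule ac z l cart | erule a))+
 obtain \<theta> d where T: "bij_betw \<theta> (Zn n) M \<and> lat_hom n \<theta> \<and> (\<forall>i<n. 0 < (d i :: nat)) \<and>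
  (\<forall>l\<in>Zn n. \<theta> l \<in> \<Gamma>0 \<longleftrightarrow> (\<forall>i<n. int (d i) dvd l i))"
  using frame_exists[OF nz] by (elim exE) (rule that)
 interpret framed_mloop s B b \<zeta> n \<sigma> m H \<theta> d
  by unfold_locales (use nz T in blast)+
 show ?thesis using torus support_iso_torus by blast
qed

text \<open>If every non-zero element of \<open>H\<close> had a non-zero bracket with some element
  of \<open>H\<close>, iterated brackets of every length would survive.\<close>

lemma nilpotent_center:
 fixes br :: "'a::zero \<Rightarrow> 'a \<Rightarrow> 'a"
 assumes nil: "nilpotent_subalg br H" and cl: "\<And>x y. x \<in> H ==> y \<in> H ==> br x y \<in> H"
  and z: "z \<in> H" "z \<noteq> 0"
 shows "\<exists>z\<in>H. z \<noteq> 0 \<and> (\<forall>y\<in>H. br y z = 0)"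
proof (rule ccontr)
 assume n: "\<not> ?thesis"
 have "\<exists>xs. length xs = N \<and> set xs \<subseteq> H \<and> foldr br xs z \<noteq> 0 \<and> foldr br xs z \<in> H" for N
 proof (induction N)
  case 0 show ?case using z by simp
 next
  case (Suc N)
  then obtain xs where xs: "length xs = N" "set xs \<subseteq> H" "foldr br xs z \<noteq> 0" "foldr br xs z \<in> H" by blast
  then obtain y where y: "y \<in> H" "br y (foldr br xs z) \<noteq> 0" using n by blast
  show ?case by (rule exI[of _ "y # xs"]) (use xs y cl in auto)
 qed
 then show False using nil z unfolding nilpotent_subalg_def by metis
qed

text \<open>The witness is a non-zero central element of \<open>H\<close> in degree zero.
  \<open>H\<close> itself is non-zero because it is its own normalizer in the fixed points, and
  these are simple.\<close>

lemma torus_component: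
 assumes "multiloop_torus \<zeta> n s b \<sigma> m H"
 shows "\<exists>F\<in>ml_comp \<zeta> n s b \<sigma> m H 0. F \<noteq> 0"
proof -
 let ?K = "fixed_pts s \<zeta> n \<sigma> m"
 have md: "multiloop_datum \<zeta> n s b \<sigma> m H" and simple: "simple_subalg s b ?K"
  using assms unfolding multiloop_torus_def by blast+
 have lie: "lie_algebra s b" using md unfolding multiloop_datum_def by blast
 interpret vs: vector_space s using lie by (simp add: lie_algebra_def)
 have b0: "b 0 y = 0" "b x 0 = 0" for x y
  using lie vs.scale_zero_left[of 0] unfolding lie_algebra_def Vector_Spaces.linear_iff by (metis vs.scale_zero_left)+
 obtain x y where x: "x \<in> ?K" "b x y \<noteq> 0" using simple unfolding simple_subalg_def by blast
 then have x0: "x \<noteq> 0" using b0 by metis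
 have nz: "?K \<noteq> {0}" using x x0 by blast
 then have cart: "cartan_subalg s b ?K H" using md unfolding multiloop_datum_def by simp
 have H: "H \<subseteq> ?K" "0 \<in> H" "\<And>x y. x \<in> H ==> y \<in> H ==> b x y \<in> H" "nilpotent_subalg b H"
  "{x\<in>?K. \<forall>y\<in>H. b x y \<in> H} = H"
  using cart vs.subspace_0 unfolding cartan_subalg_def by blast+
 have "H \<noteq> {0}"
 proof
  assume h: "H = {0}"
  have "x \<in> {x\<in>?K. \<forall>y\<in>H. b x y \<in> H}" using x(1) b0 h by simp
  then show False using H(5) h x0 by blast
 qed
 then obtain z where "z \<in> H" "z \<noteq> 0" using H(2) by blast
 then obtain z where z: "z \<in> H" "z \<noteq> 0" "\<And>y. y \<in> H ==> b y z = 0" using nilpotent_center[OF H(4,3)] by blast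
 have "z \<in> root_space s b H 0" using z(3) by (simp add: root_space_def)
 moreover have "z \<in> twisted s \<zeta> n \<sigma> m 0" using z(1) H(1) by (auto simp: fixed_pts_def zero_fun_def)
 moreover have "ml_comp \<zeta> n s b \<sigma> m H 0 = sgl 0 ` (root_space s b H 0 \<inter> twisted s \<zeta> n \<sigma> m 0)"
 proof -
  have "0 \<in> Qh s b H" unfolding Qh_def by (rule gen_zero)
  then show ?thesis unfolding ml_comp_def fst_zero snd_zero sgl_image using lat_zero by (simp only: if_True simp_thms)
 qed
 ultimately have "sgl 0 z \<in> ml_comp \<zeta> n s b \<sigma> m H 0" by blast
 moreover have "sgl 0 z \<noteq> 0" using sgl_eq_0[of 0 z] z(2) by blast
 ultimately show ?thesis by blast
qed

text \<open>An additive \<open>\<phi>su\<close> sends \<open>0\<close> to \<open>0\<close>, so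
  \<open>\<phi>\<close> matches the components of degree zero. Without fixed points the source
  component is zero, whereas the target is non-zero by \<open>torus_component\<close>.\<close>

lemma torus_fixed_pts:
 fixes s :: "'k::field_char_0 \<Rightarrow> 'a::ab_group_add \<Rightarrow> 'a" and s' :: "'k \<Rightarrow> 'b::ab_group_add \<Rightarrow> 'b"
 assumes md: "multiloop_datum \<zeta> n s b \<sigma> m H"
  and t: "multiloop_torus \<zeta> n s' b' \<sigma>' m' H'" and iso: "support_iso \<zeta> n s b \<sigma> m H s' b' \<sigma>' m' H'"
 shows "fixed_pts s \<zeta> n \<sigma> m \<noteq> {0}"
proof
 assume K0: "fixed_pts s \<zeta> n \<sigma> m = {0}"
 have lie: "lie_algebra s b" using md unfolding multiloop_datum_def by blast
 interpret vs: vector_space s using lie by (simp add: lie_algebra_def)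
 interpret lm: module "loop_scale s" by (rule vs.loop_module)
 let ?A = "ml_alg \<zeta> n s b \<sigma> m H" and ?S = "gen_subgroup (ml_supp \<zeta> n s b \<sigma> m H)"
 from iso show False unfolding support_iso_def
 proof (elim exE conjE)
  fix \<phi> \<phi>su
  assume add: "\<forall>F\<in>?A. \<forall>G\<in>?A. \<phi> (F + G) = \<phi> F + \<phi> G \<and> \<phi> (loop_bracket b F G) = loop_bracket b' (\<phi> F) (\<phi> G)"
   and su: "\<forall>x\<in>?S. \<forall>y\<in>?S. \<phi>su (x + y) = \<phi>su x + \<phi>su y"
   and im: "\<forall>\<gamma>\<in>?S. \<phi> ` ml_comp \<zeta> n s b \<sigma> m H \<gamma> = ml_comp \<zeta> n s' b' \<sigma>' m' H' (\<phi>su \<gamma>)"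
  have A0: "0 \<in> ?A" unfolding ml_alg_def by (rule lm.span_zero)
  have S0: "0 \<in> ?S" by (rule gen_zero)
  have "\<phi> (0 + 0) = \<phi> 0 + \<phi> 0" using add A0 by blast
  then have p0: "\<phi> 0 = 0" by (simp only: add_0_left add_cancel_right_right)
  have "\<phi>su (0 + 0) = \<phi>su 0 + \<phi>su 0" using su S0 by blast
  then have s0: "\<phi>su 0 = 0" by (simp only: add_0_left add_cancel_right_right)
  have tw: "twisted s \<zeta> n \<sigma> m 0 = {0}" using K0 by (simp add: fixed_pts_def zero_fun_def)
  have "ml_comp \<zeta> n s b \<sigma> m H 0 \<subseteq> sgl 0 ` (root_space s b H 0 \<inter> {0}) \<union> {0}"
   unfolding ml_comp_def fst_zero snd_zero sgl_image tw by (simp split: if_split) blast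
  also have "\<dots> \<subseteq> {0}"
  proof (intro Un_least image_subsetI subset_refl)
   fix x assume "x \<in> root_space s b H 0 \<inter> {0}"
   then have "x = 0" by blast
   then show "sgl 0 x \<in> {0}" by (simp only: sgl_0 singletonI)
  qed
  finally have "\<phi> ` ml_comp \<zeta> n s b \<sigma> m H 0 \<subseteq> {\<phi> 0}" by blast
  moreover have "\<phi> ` ml_comp \<zeta> n s b \<sigma> m H 0 = ml_comp \<zeta> n s' b' \<sigma>' m' H' (\<phi>su 0)" by (rule bspec[OF im S0])
  ultimately have "ml_comp \<zeta> n s' b' \<sigma>' m' H' 0 \<subseteq> {0}" by (simp only: s0 p0)
  then show False using torus_component[OF t] by blast
 qed
qed

text \<open>A quantifier over carrier types cannot be expressed, so each implication takes its
  stronger reading: the constructed torus lives on the given type \<open>'a\<close>, while the torus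
  of the converse may live on any type \<open>'b\<close>.\<close>

theorem theorem5p1p4:
  fixes \<zeta> :: "nat \<Rightarrow> 'k::field_char_0"
    and n :: nat
    and s :: "'k \<Rightarrow> 'a::ab_group_add \<Rightarrow> 'a" and b :: "'a \<Rightarrow> 'a \<Rightarrow> 'a"
    and \<sigma> :: "nat \<Rightarrow> 'a \<Rightarrow> 'a" and m :: "nat \<Rightarrow> nat" and H :: "'a set"
  assumes "alg_closed_field TYPE('k)"
    and "fixed_roots_of_unity \<zeta>"
    and "multiloop_datum \<zeta> n s b \<sigma> m H"
  shows "(fixed_pts s \<zeta> n \<sigma> m \<noteq> {0} \<longrightarrow>
            (\<exists>(s' :: 'k \<Rightarrow> 'a \<Rightarrow> 'a) b' \<sigma>' m' H'. multiloop_torus \<zeta> n s' b' \<sigma>' m' H' \<and>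
                 support_iso \<zeta> n s b \<sigma> m H s' b' \<sigma>' m' H'))
       \<and> (\<forall>(s' :: 'k \<Rightarrow> 'b::ab_group_add \<Rightarrow> 'b) b' \<sigma>' m' H'.
            multiloop_torus \<zeta> n s' b' \<sigma>' m' H' \<and> support_iso \<zeta> n s b \<sigma> m H s' b' \<sigma>' m' H'
            \<longrightarrow> fixed_pts s \<zeta> n \<sigma> m \<noteq> {0})"
proof (intro conjI impI allI)
  assume "fixed_pts s \<zeta> n \<sigma> m \<noteq> {0}"
  then show "\<exists>(s' :: 'k \<Rightarrow> 'a \<Rightarrow> 'a) b' \<sigma>' m' H'. multiloop_torus \<zeta> n s' b' \<sigma>' m' H' \<and>
      support_iso \<zeta> n s b \<sigma> m H s' b' \<sigma>' m' H'"
    by (rule torus_exists[OF assms])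
next
  fix s' :: "'k \<Rightarrow> 'b \<Rightarrow> 'b" and b' \<sigma>' m' H'
  assume "multiloop_torus \<zeta> n s' b' \<sigma>' m' H' \<and> support_iso \<zeta> n s b \<sigma> m H s' b' \<sigma>' m' H'"
  then show "fixed_pts s \<zeta> n \<sigma> m \<noteq> {0}" using torus_fixed_pts[OF assms(3)] by blast
qed

end
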